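(* Let $A\Rightarrow M$ be a Lie algebroid with a bundle of ideals $\mathfrak k$ and an infinitesimal multiplicative (IM) connection $(\mathcal C,v)\in\mathcal A(A;\mathfrak k)$. The horizontal exterior covariant derivative $D^{(\mathcal C,v)}=h^*d^\nabla$ of Weil cochains, $W^{p,q}(A;\mathfrak k)\to W^{p,q+1}(A;\mathfrak k)$, is a cochain map: $$\delta D^{(\mathcal C,v)}=D^{(\mathcal C,v)}\delta$$ (for all $p,q\ge0$). In particular, $D^{(\mathcal C,v)}$ maps IM forms to IM forms.
   Context: $A\Rightarrow M$ is a Lie algebroid with anchor $\rho$. A bundle of ideals is a vector subbundle $\mathfrak k\subset A$, $\mathfrak k\subset\ker\rho$, with $[\Gamma(A),\Gamma(\mathfrak k)]\subset\Gamma(\mathfrak k)$; it is a representation of $A$ via $\nabla^A_\alpha\xi=[\alpha,\xi]$. Weil cochains: $W^{p,q}(A;\mathfrak k)$ is the set of sequences $c=(c_0,\dots,c_p)$ of alternating $\mathbb R$-multilinear maps $c_k\colon\Gamma(A)^{p-k}\to\Omega^{q-k}(M;S^k(A^* )\otimes\mathfrak k)$ (zero if $k>q$), written $c_k(\alpha_1,\dots,\alpha_{p-k}|\beta_1,\dots,\beta_k)$, satisfying $c_k(f\alpha_1,\alpha_2,\dots|\cdot)=fc_k(\alpha_1,\alpha_2,\dots|\cdot)+df\wedge c_{k+1}(\alpha_2,\dots,\alpha_{p-k}|\alpha_1,\cdot)$ for $f\in C^\infty(M)$. For $\gamma\in\Omega^m(M;S^n(A^* )\otimes\mathfrak k)$,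 $(\mathcal L^A_\alpha\gamma)(\underline\beta)(\underline X)=\nabla^A_\alpha(\gamma(\underline\beta)(\underline X))-\sum_i\gamma(\dots,[\alpha,\beta_i],\dots)(\underline X)-\sum_j\gamma(\underline\beta)(\dots,[\rho(\alpha),X_j],\dots)$. The simplicial differential $\delta\colon W^{p,q}\to W^{p+1,q}$ is $$\begin{aligned}(-1)^k(\delta c)_k(\alpha_0,\dots,\alpha_{p-k}|\underline\beta)&=\sum_{i}(-1)^i\mathcal L^A_{\alpha_i}\big(c_k(\dots,\widehat{\alpha_i},\dots|\cdot)\big)(\underline\beta)+\sum_{i<j}(-1)^{i+j}c_k([\alpha_i,\alpha_j],\dots,\widehat{\alpha_i},\dots,\widehat{\alpha_j},\dots|\underline\beta)\\&-\sum_{j=1}^k\iota_{\rho(\beta_j)}c_{k-1}(\alpha_0,\dots,\alpha_{p-k}|\beta_1,\dots,\widehat{\beta_j},\dots,\beta_k).\end{aligned}$$ IM forms are the elements of $\ker(\delta\colon W^{1,q}\to W^{2,q})$. An IM connection is an IM 1-form $(\mathcal C,v)\in W^{1,1}(A;\mathfrak k)$, i.e. $\mathcal C\colon\Gamma(A)\to\Omega^1(M;\mathfrak k)$, $v\colon A\to\mathfrak k$, with $v|_{\mathfrak k}=\mathrm{id}_{\mathfrak k}$; the set of these is $\mathcal A(A;\mathfrak k)$. Write $h=\mathrm{id}-v\colon A\to H=\ker v$. The induced linear connection on $\mathfrak k$ is $\nabla_X\xi=\mathcal C(\xi)(X)$. Exterior covariant derivative of Weil cochains: $(-1)^k(d^\nabla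 c)_k(\underline\alpha|\underline\beta)=d^\nabla(c_k(\underline\alpha|\underline\beta))-\sum_{i=1}^kc_{k-1}(\beta_i,\underline\alpha|\beta_1,\dots,\widehat{\beta_i},\dots,\beta_k)$. For $\gamma\in\Omega^m(M;S^\ell(A^* )\otimes\mathfrak k)$ and $\vartheta_1,\dots,\vartheta_\ell\in\Omega^1(M;\mathfrak k)$ put $$\big(\gamma\,\dot\wedge\,(\vartheta_1,\dots,\vartheta_\ell)\big)(X_1,\dots,X_{m+\ell})=\frac1{m!}\sum_{\sigma\in S_{m+\ell}}(\operatorname{sgn}\sigma)\,\gamma\big(\vartheta_1(X_{\sigma(1)}),\dots,\vartheta_\ell(X_{\sigma(\ell)})\big)(X_{\sigma(\ell+1)},\dots,X_{\sigma(\ell+m)}).$$ The horizontal projection $h^*\colon W^{p,q}(A;\mathfrak k)\to W^{p,q}(A;\mathfrak k)$ is $$(h^*c)_k(\alpha_1,\dots,\alpha_{p-k}|\beta_1,\dots,\beta_k)=\sum_{j=k}^p(-1)^{j-k}\sum_{\sigma}(\operatorname{sgn}\sigma)\,c_j(\alpha_{\sigma(j-k+1)},\dots,\alpha_{\sigma(p-k)}|h\beta_1,\dots,h\beta_k,\cdot)\,\dot\wedge\,(\mathcal C\alpha_{\sigma(1)},\dots,\mathcal C\alpha_{\sigma(j-k)}),$$ where $\sigma$ runs over $(j-k,p-j)$-shuffles in $S_{p-k}$. *)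

theory Defs
  imports "HOL-Analysis.Analysis" "HOL-Combinatorics.Permutations"
begin

section \<open>Smooth manifolds\<close>

text \<open>
  \<open>Ck_on n S f\<close> and \<open>smooth_on S f\<close> are used for open \<open>S\<close> in a finite-dimensional normed space only;
  there they say that \<open>f\<close> is of class $C^n$, respectively $C^\infty$, on \<open>S\<close>.
\<close>

fun Ck_on :: "nat \<Rightarrow> 'e::real_normed_vector set \<Rightarrow> ('e \<Rightarrow> 'b::real_normed_vector) \<Rightarrow> bool" where
  "Ck_on 0 S f \<longleftrightarrow> continuous_on S f"
| "Ck_on (Suc n) S f \<longleftrightarrow> (\<forall>x\<in>S. f differentiable (at x)) \<and>
     (\<forall>w. Ck_on n S (\<lambda>x. frechet_derivative f (at x) w))"

definition smooth_on :: "'e::real_normed_vector set \<Rightarrow> ('e \<Rightarrow> 'b::real_normed_vector) \<Rightarrow> bool" where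
  "smooth_on S f \<longleftrightarrow> (\<forall>n. Ck_on n S f)"

type_synonym ('m, 'e) chart = "'m set \<times> ('m \<Rightarrow> 'e)"

text \<open>
  The manifold is the whole type \<open>'m\<close>, which is required to be Hausdorff and second countable.  The
  model space \<open>'e\<close> is a finite-dimensional normed space; the class \<open>euclidean_space\<close> is not used
  because it would exclude manifolds of dimension 0 (and hence Lie algebras over a point).
\<close>

definition smooth_atlas ::
  "('m::{t2_space,second_countable_topology}, 'e::real_normed_vector) chart set \<Rightarrow> bool" where
  "smooth_atlas \<A> \<longleftrightarrow>
     (\<exists>B::'e set. finite B \<and> span B = UNIV) \<and>
     (\<forall>(U, \<phi>) \<in> \<A>. open U \<and> open (\<phi> ` U) \<and> homeomorphism U (\<phi> ` U) \<phi> (inv_into U \<phi>)) \<and>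
     (\<Union>(U, \<phi>) \<in> \<A>. U) = UNIV \<and>
     (\<forall>(U, \<phi>) \<in> \<A>. \<forall>(V, \<psi>) \<in> \<A>. smooth_on (\<phi> ` (U \<inter> V)) (\<psi> \<circ> inv_into U \<phi>))"

definition smooth_fun_on ::
  "('m, 'e::real_normed_vector) chart set \<Rightarrow> 'm set \<Rightarrow> ('m \<Rightarrow> real) \<Rightarrow> bool" where
  "smooth_fun_on \<A> W f \<longleftrightarrow> (\<forall>(U, \<phi>) \<in> \<A>. smooth_on (\<phi> ` (U \<inter> W)) (f \<circ> inv_into U \<phi>))"

definition smooth_funs :: "('m, 'e::real_normed_vector) chart set \<Rightarrow> ('m \<Rightarrow> real) set" where
  "smooth_funs \<A> = {f. smooth_fun_on \<A> UNIV f}"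

text \<open>
  $T_xM$ as the derivations at \<open>x\<close> of the algebra of smooth functions.  The value on non-smooth
  functions is fixed to be 0, so that equality in $T_xM$ is equality in HOL.
\<close>

definition tangent_space ::
  "('m, 'e::real_normed_vector) chart set \<Rightarrow> 'm \<Rightarrow> (('m \<Rightarrow> real) \<Rightarrow> real) set" where
  "tangent_space \<A> x =
     {D. (\<forall>f \<in> smooth_funs \<A>. \<forall>g \<in> smooth_funs \<A>. \<forall>a b.
            D (\<lambda>y. a * f y + b * g y) = a * D f + b * D g) \<and>
         (\<forall>f \<in> smooth_funs \<A>. \<forall>g \<in> smooth_funs \<A>.
            D (\<lambda>y. f y * g y) = f x * D g + g x * D f) \<and>
         (\<forall>f. f \<notin> smooth_funs \<A> \<longrightarrow> D f = 0)}"

type_synonym 'm vfield = "'m \<Rightarrow> ('m \<Rightarrow> real) \<Rightarrow> real"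

definition vector_fields :: "('m, 'e::real_normed_vector) chart set \<Rightarrow> 'm vfield set" where
  "vector_fields \<A> = {X. (\<forall>x. X x \<in> tangent_space \<A> x) \<and>
     (\<forall>f \<in> smooth_funs \<A>. (\<lambda>x. X x f) \<in> smooth_funs \<A>)}"

definition vf_bracket :: "'m vfield \<Rightarrow> 'm vfield \<Rightarrow> 'm vfield" where
  "vf_bracket X Y = (\<lambda>x f. X x (\<lambda>y. Y y f) - Y x (\<lambda>y. X y f))"


section \<open>Vector bundles\<close>

text \<open>
  A vector bundle of rank \<open>r\<close> has as fibres subspaces \<open>E x\<close> of a real vector space \<open>'a\<close>, which has
  no topology and only serves to host the fibres.  The smooth structure is given by local
  trivialisations, written as local frames \<open>(U, e)\<close>; their transition matrices have to be smooth.
\<close>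

type_synonym ('m, 'a) frame = "'m set \<times> (nat \<Rightarrow> 'm \<Rightarrow> 'a)"

definition pointwise_basis_on ::
  "nat \<Rightarrow> ('m \<Rightarrow> 'a::real_vector set) \<Rightarrow> 'm set \<Rightarrow> (nat \<Rightarrow> 'm \<Rightarrow> 'a) \<Rightarrow> bool" where
  "pointwise_basis_on r E U e \<longleftrightarrow>
     (\<forall>x\<in>U. inj_on (\<lambda>i. e i x) {..<r} \<and> independent ((\<lambda>i. e i x) ` {..<r}) \<and>
            span ((\<lambda>i. e i x) ` {..<r}) = E x)"

definition smooth_section_on ::
  "('m, 'e::real_normed_vector) chart set \<Rightarrow> nat \<Rightarrow> ('m, 'a::real_vector) frame set \<Rightarrow>
   'm set \<Rightarrow> ('m \<Rightarrow> 'a) \<Rightarrow> bool" where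
  "smooth_section_on \<A> r F W s \<longleftrightarrow>
     (\<forall>(V, g) \<in> F. \<exists>c. (\<forall>i<r. smooth_fun_on \<A> (W \<inter> V) (c i)) \<and>
        (\<forall>x \<in> W \<inter> V. s x = (\<Sum>i<r. c i x *\<^sub>R g i x)))"

definition vector_bundle ::
  "('m::topological_space, 'e::real_normed_vector) chart set \<Rightarrow> nat \<Rightarrow>
   ('m \<Rightarrow> 'a::real_vector set) \<Rightarrow> ('m, 'a) frame set \<Rightarrow> bool" where
  "vector_bundle \<A> r E F \<longleftrightarrow>
     (\<Union>(U, e) \<in> F. U) = UNIV \<and>
     (\<forall>(U, e) \<in> F. open U \<and> pointwise_basis_on r E U e \<and>
        (\<forall>i<r. smooth_section_on \<A> r F U (e i)))"


section \<open>Lie algebroids and bundles of ideals\<close>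

text \<open>
  The anchor is given fibrewise, \<open>anchor L x\<close> being the map $A_x \to T_xM$.  The bracket is relevant
  only on smooth sections.
\<close>

record ('m, 'e, 'a) algebroid =
  atlas :: "('m, 'e) chart set"
  bundle_rank :: nat
  fibre :: "'m \<Rightarrow> 'a set"
  frames :: "('m, 'a) frame set"
  bracket :: "('m \<Rightarrow> 'a) \<Rightarrow> ('m \<Rightarrow> 'a) \<Rightarrow> ('m \<Rightarrow> 'a)"
  anchor :: "'m \<Rightarrow> 'a \<Rightarrow> ('m \<Rightarrow> real) \<Rightarrow> real"

abbreviation Cinf :: "('m, 'e::real_normed_vector, 'a) algebroid \<Rightarrow> ('m \<Rightarrow> real) set" where
  "Cinf L \<equiv> smooth_funs (atlas L)"

abbreviation vfields :: "('m, 'e::real_normed_vector, 'a) algebroid \<Rightarrow> 'm vfield set" where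
  "vfields L \<equiv> vector_fields (atlas L)"

definition sections ::
  "('m, 'e::real_normed_vector, 'a::real_vector) algebroid \<Rightarrow> ('m \<Rightarrow> 'a) set" where
  "sections L = {s. smooth_section_on (atlas L) (bundle_rank L) (frames L) UNIV s}"

definition rho :: "('m, 'e, 'a) algebroid \<Rightarrow> ('m \<Rightarrow> 'a) \<Rightarrow> 'm vfield" where
  "rho L \<alpha> = (\<lambda>x. anchor L x (\<alpha> x))"

locale lie_algebroid =
  fixes L :: "('m::{t2_space,second_countable_topology}, 'e::real_normed_vector, 'a::real_vector) algebroid"
  assumes manifold: "smooth_atlas (atlas L)"
    and vbundle: "vector_bundle (atlas L) (bundle_rank L) (fibre L) (frames L)"
    and anchor_tangent: "a \<in> fibre L x \<Longrightarrow> anchor L x a \<in> tangent_space (atlas L) x"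
    and anchor_linear: "a \<in> fibre L x \<Longrightarrow> b \<in> fibre L x \<Longrightarrow>
          anchor L x (s *\<^sub>R a + t *\<^sub>R b) = (\<lambda>f. s * anchor L x a f + t * anchor L x b f)"
    and anchor_smooth: "\<alpha> \<in> sections L \<Longrightarrow> rho L \<alpha> \<in> vfields L"
    and bracket_section: "\<alpha> \<in> sections L \<Longrightarrow> \<beta> \<in> sections L \<Longrightarrow> bracket L \<alpha> \<beta> \<in> sections L"
    and bracket_linear: "\<alpha> \<in> sections L \<Longrightarrow> \<beta> \<in> sections L \<Longrightarrow> \<gamma> \<in> sections L \<Longrightarrow>
          bracket L (\<lambda>x. s *\<^sub>R \<alpha> x + t *\<^sub>R \<beta> x) \<gamma> =
            (\<lambda>x. s *\<^sub>R bracket L \<alpha> \<gamma> x + t *\<^sub>R bracket L \<beta> \<gamma> x)"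
    and bracket_skew: "\<alpha> \<in> sections L \<Longrightarrow> \<beta> \<in> sections L \<Longrightarrow>
          bracket L \<alpha> \<beta> = (\<lambda>x. - bracket L \<beta> \<alpha> x)"
    and jacobi: "\<alpha> \<in> sections L \<Longrightarrow> \<beta> \<in> sections L \<Longrightarrow> \<gamma> \<in> sections L \<Longrightarrow>
          bracket L \<alpha> (bracket L \<beta> \<gamma>) =
            (\<lambda>x. bracket L (bracket L \<alpha> \<beta>) \<gamma> x + bracket L \<beta> (bracket L \<alpha> \<gamma>) x)"
    and leibniz: "\<alpha> \<in> sections L \<Longrightarrow> \<beta> \<in> sections L \<Longrightarrow> f \<in> Cinf L \<Longrightarrow>
          bracket L \<alpha> (\<lambda>x. f x *\<^sub>R \<beta> x) =
            (\<lambda>x. f x *\<^sub>R bracket L \<alpha> \<beta> x + rho L \<alpha> x f *\<^sub>R \<beta> x)"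
    and anchor_bracket: "\<alpha> \<in> sections L \<Longrightarrow> \<beta> \<in> sections L \<Longrightarrow>
          rho L (bracket L \<alpha> \<beta>) = vf_bracket (rho L \<alpha>) (rho L \<beta>)"

text \<open>Subbundles are given by adapted local frames.\<close>

definition subbundle ::
  "('m::topological_space, 'e::real_normed_vector, 'a::real_vector) algebroid \<Rightarrow> ('m \<Rightarrow> 'a set) \<Rightarrow> bool" where
  "subbundle L \<kk> \<longleftrightarrow>
     (\<exists>s \<le> bundle_rank L. \<forall>x. \<exists>U e. open U \<and> x \<in> U \<and>
        pointwise_basis_on (bundle_rank L) (fibre L) U e \<and>
        (\<forall>i < bundle_rank L. smooth_section_on (atlas L) (bundle_rank L) (frames L) U (e i)) \<and>
        (\<forall>y\<in>U. \<kk> y = span ((\<lambda>i. e i y) ` {..<s})))"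

definition subsections ::
  "('m, 'e::real_normed_vector, 'a::real_vector) algebroid \<Rightarrow> ('m \<Rightarrow> 'a set) \<Rightarrow> ('m \<Rightarrow> 'a) set" where
  "subsections L \<kk> = {\<xi> \<in> sections L. \<forall>x. \<xi> x \<in> \<kk> x}"

locale bundle_of_ideals = lie_algebroid L
  for L :: "('m::{t2_space,second_countable_topology}, 'e::real_normed_vector, 'a::real_vector) algebroid" +
  fixes \<kk> :: "'m \<Rightarrow> 'a set"
  assumes subbundle: "subbundle L \<kk>"
    and ker_anchor: "a \<in> \<kk> x \<Longrightarrow> anchor L x a = (\<lambda>f. 0)"
    and ideal: "\<alpha> \<in> sections L \<Longrightarrow> \<xi> \<in> subsections L \<kk> \<Longrightarrow> bracket L \<alpha> \<xi> \<in> subsections L \<kk>"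


section \<open>Forms with values in symmetric powers\<close>

definition tuples :: "nat \<Rightarrow> 'b set \<Rightarrow> 'b list set" where
  "tuples n S = {xs. length xs = n \<and> set xs \<subseteq> S}"

definition omit :: "nat \<Rightarrow> 'b list \<Rightarrow> 'b list" where
  "omit i xs = take i xs @ drop (Suc i) xs"

type_synonym ('m, 'a) sform = "('m \<Rightarrow> 'a) list \<Rightarrow> 'm vfield list \<Rightarrow> ('m \<Rightarrow> 'a)"

text \<open>
  \<open>forms L \<kk> n m\<close> is $\Omega^m(M; S^n(A^*) \otimes \mathfrak k)$.  A form is recorded by its values on
  sections and vector fields: $C^\infty(M)$-multilinear maps
  $\Gamma(A)^n \times \mathfrak X(M)^m \to \Gamma(\mathfrak k)$, symmetric in the sections and
  alternating in the vector fields.  Maps are extended by 0 outside their domain.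
\<close>

definition forms ::
  "('m, 'e::real_normed_vector, 'a::real_vector) algebroid \<Rightarrow> ('m \<Rightarrow> 'a set) \<Rightarrow> nat \<Rightarrow> nat \<Rightarrow>
   ('m, 'a) sform set" where
  "forms L \<kk> n m = {\<gamma>.
     (\<forall>\<beta>s Xs. \<not> (\<beta>s \<in> tuples n (sections L) \<and> Xs \<in> tuples m (vfields L)) \<longrightarrow> \<gamma> \<beta>s Xs = (\<lambda>x. 0)) \<and>
     (\<forall>\<beta>s \<in> tuples n (sections L). \<forall>Xs \<in> tuples m (vfields L).
        \<gamma> \<beta>s Xs \<in> subsections L \<kk> \<and>
        (\<forall>i<n. \<forall>\<beta> \<in> sections L. \<forall>\<beta>' \<in> sections L. \<forall>f \<in> Cinf L. \<forall>g \<in> Cinf L.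
           \<gamma> (\<beta>s[i := \<lambda>x. f x *\<^sub>R \<beta> x + g x *\<^sub>R \<beta>' x]) Xs =
             (\<lambda>x. f x *\<^sub>R \<gamma> (\<beta>s[i := \<beta>]) Xs x + g x *\<^sub>R \<gamma> (\<beta>s[i := \<beta>']) Xs x)) \<and>
        (\<forall>j<m. \<forall>X \<in> vfields L. \<forall>Y \<in> vfields L. \<forall>f \<in> Cinf L. \<forall>g \<in> Cinf L.
           \<gamma> \<beta>s (Xs[j := \<lambda>x \<phi>. f x * X x \<phi> + g x * Y x \<phi>]) =
             (\<lambda>x. f x *\<^sub>R \<gamma> \<beta>s (Xs[j := X]) x + g x *\<^sub>R \<gamma> \<beta>s (Xs[j := Y]) x)) \<and>
        (\<forall>\<beta>s'. mset \<beta>s' = mset \<beta>s \<longrightarrow> \<gamma> \<beta>s' Xs = \<gamma> \<beta>s Xs) \<and>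
        (\<not> distinct Xs \<longrightarrow> \<gamma> \<beta>s Xs = (\<lambda>x. 0)))}"

text \<open>
  $df \wedge \omega$, with the convention that the wedge product of forms of degrees $a$ and $b$ is the
  signed sum over $(a,b)$-shuffles.
\<close>

definition dwedge :: "('m \<Rightarrow> real) \<Rightarrow> ('m vfield list \<Rightarrow> ('m \<Rightarrow> 'a::real_vector)) \<Rightarrow>
    'm vfield list \<Rightarrow> ('m \<Rightarrow> 'a)" where
  "dwedge f \<omega> Xs = (\<lambda>x. \<Sum>i<length Xs. (-1) ^ i *\<^sub>R (Xs ! i) x f *\<^sub>R \<omega> (omit i Xs) x)"

definition lie_derivative ::
  "('m, 'e, 'a::real_vector) algebroid \<Rightarrow> ('m \<Rightarrow> 'a) \<Rightarrow> ('m, 'a) sform \<Rightarrow> ('m, 'a) sform" where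
  "lie_derivative L \<alpha> \<gamma> \<beta>s Xs = (\<lambda>x.
     bracket L \<alpha> (\<gamma> \<beta>s Xs) x
     - (\<Sum>i<length \<beta>s. \<gamma> (\<beta>s[i := bracket L \<alpha> (\<beta>s ! i)]) Xs x)
     - (\<Sum>j<length Xs. \<gamma> \<beta>s (Xs[j := vf_bracket (rho L \<alpha>) (Xs ! j)]) x))"


section \<open>Weil cochains\<close>

text \<open>
  The component $c_k(\alpha_1,\dots,\alpha_{p-k}|\beta_1,\dots,\beta_k)(X_1,\dots,X_{q-k})$ of a Weil
  cochain is \<open>c k \<alpha>s \<beta>s Xs\<close>.  Cochains and the results of the operators below are extended by 0
  outside \<open>weil_dom\<close>, so that equality of cochains is equality in HOL.
\<close>

type_synonym ('m, 'a) cochain = "nat \<Rightarrow> ('m \<Rightarrow> 'a) list \<Rightarrow> ('m, 'a) sform"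

definition weil_dom ::
  "('m, 'e::real_normed_vector, 'a::real_vector) algebroid \<Rightarrow> nat \<Rightarrow> nat \<Rightarrow> nat \<Rightarrow>
   ('m \<Rightarrow> 'a) list \<Rightarrow> ('m \<Rightarrow> 'a) list \<Rightarrow> 'm vfield list \<Rightarrow> bool" where
  "weil_dom L p q k \<alpha>s \<beta>s Xs \<longleftrightarrow> k \<le> p \<and> k \<le> q \<and>
     \<alpha>s \<in> tuples (p - k) (sections L) \<and> \<beta>s \<in> tuples k (sections L) \<and> Xs \<in> tuples (q - k) (vfields L)"

definition weil_cochains ::
  "('m, 'e::real_normed_vector, 'a::real_vector) algebroid \<Rightarrow> ('m \<Rightarrow> 'a set) \<Rightarrow> nat \<Rightarrow> nat \<Rightarrow>
   ('m, 'a) cochain set" where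
  "weil_cochains L \<kk> p q = {c.
     (\<forall>k \<alpha>s \<beta>s Xs. \<not> weil_dom L p q k \<alpha>s \<beta>s Xs \<longrightarrow> c k \<alpha>s \<beta>s Xs = (\<lambda>x. 0)) \<and>
     (\<forall>k. k \<le> p \<and> k \<le> q \<longrightarrow> (\<forall>\<alpha>s \<in> tuples (p - k) (sections L).
        c k \<alpha>s \<in> forms L \<kk> k (q - k) \<and>
        (\<forall>i < p - k. \<forall>\<alpha> \<in> sections L. \<forall>\<alpha>' \<in> sections L. \<forall>(a::real) (b::real) \<beta>s Xs.
           c k (\<alpha>s[i := \<lambda>x. a *\<^sub>R \<alpha> x + b *\<^sub>R \<alpha>' x]) \<beta>s Xs =
             (\<lambda>x. a *\<^sub>R c k (\<alpha>s[i := \<alpha>]) \<beta>s Xs x + b *\<^sub>R c k (\<alpha>s[i := \<alpha>']) \<beta>s Xs x)) \<and>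
        (\<not> distinct \<alpha>s \<longrightarrow> (\<forall>\<beta>s Xs. c k \<alpha>s \<beta>s Xs = (\<lambda>x. 0))))) \<and>
     (\<forall>k \<alpha> \<alpha>s \<beta>s Xs. \<forall>f \<in> Cinf L. weil_dom L p q k (\<alpha> # \<alpha>s) \<beta>s Xs \<longrightarrow>
        c k ((\<lambda>x. f x *\<^sub>R \<alpha> x) # \<alpha>s) \<beta>s Xs =
          (\<lambda>x. f x *\<^sub>R c k (\<alpha> # \<alpha>s) \<beta>s Xs x + dwedge f (c (Suc k) \<alpha>s (\<alpha> # \<beta>s)) Xs x))}"

definition weil_delta ::
  "('m, 'e::real_normed_vector, 'a::real_vector) algebroid \<Rightarrow> nat \<Rightarrow> nat \<Rightarrow>
   ('m, 'a) cochain \<Rightarrow> ('m, 'a) cochain" where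
  "weil_delta L p q c k \<alpha>s \<beta>s Xs =
     (if weil_dom L (Suc p) q k \<alpha>s \<beta>s Xs then
        (\<lambda>x. (-1) ^ k *\<^sub>R
          ((\<Sum>i<length \<alpha>s. (-1) ^ i *\<^sub>R lie_derivative L (\<alpha>s ! i) (c k (omit i \<alpha>s)) \<beta>s Xs x)
           + (\<Sum>j<length \<alpha>s. \<Sum>i<j. (-1) ^ (i + j) *\<^sub>R
                c k (bracket L (\<alpha>s ! i) (\<alpha>s ! j) # omit i (omit j \<alpha>s)) \<beta>s Xs x)
           - (\<Sum>j<k. c (k - 1) \<alpha>s (omit j \<beta>s) (rho L (\<beta>s ! j) # Xs) x)))
      else (\<lambda>x. 0))"

definition im_forms ::
  "('m, 'e::real_normed_vector, 'a::real_vector) algebroid \<Rightarrow> ('m \<Rightarrow> 'a set) \<Rightarrow> nat \<Rightarrow>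
   ('m, 'a) cochain set" where
  "im_forms L \<kk> q =
     {c \<in> weil_cochains L \<kk> 1 q. weil_delta L 1 q c = (\<lambda>k \<alpha>s \<beta>s Xs x. 0)}"


section \<open>IM connections and the horizontal exterior covariant derivative\<close>

text \<open>
  The two components of $\theta = (\mathcal C, v) \in W^{1,1}(A;\mathfrak k)$: \<open>symC \<theta> \<alpha> X\<close> is
  $\mathcal C(\alpha)(X)$ and \<open>symv \<theta> \<beta>\<close> is $v(\beta)$.
\<close>

definition symC :: "('m, 'a) cochain \<Rightarrow> ('m \<Rightarrow> 'a) \<Rightarrow> 'm vfield \<Rightarrow> ('m \<Rightarrow> 'a)" where
  "symC \<theta> \<alpha> X = \<theta> 0 [\<alpha>] [] [X]"

definition symv :: "('m, 'a) cochain \<Rightarrow> ('m \<Rightarrow> 'a) \<Rightarrow> ('m \<Rightarrow> 'a)" where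
  "symv \<theta> \<beta> = \<theta> 1 [] [\<beta>] []"

definition im_connections ::
  "('m, 'e::real_normed_vector, 'a::real_vector) algebroid \<Rightarrow> ('m \<Rightarrow> 'a set) \<Rightarrow> ('m, 'a) cochain set" where
  "im_connections L \<kk> = {\<theta> \<in> im_forms L \<kk> 1. \<forall>\<xi> \<in> subsections L \<kk>. symv \<theta> \<xi> = \<xi>}"

definition hor :: "('m, 'a::real_vector) cochain \<Rightarrow> ('m \<Rightarrow> 'a) \<Rightarrow> ('m \<Rightarrow> 'a)" where
  "hor \<theta> \<beta> = (\<lambda>x. \<beta> x - symv \<theta> \<beta> x)"

definition conn :: "('m, 'a) cochain \<Rightarrow> 'm vfield \<Rightarrow> ('m \<Rightarrow> 'a) \<Rightarrow> ('m \<Rightarrow> 'a)" where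
  "conn \<theta> X \<xi> = symC \<theta> \<xi> X"

text \<open>$d^\nabla$ on $\Omega^\bullet(M; \mathfrak k)$, by the Koszul formula.\<close>

definition ext_cov ::
  "('m, 'a::real_vector) cochain \<Rightarrow> ('m vfield list \<Rightarrow> ('m \<Rightarrow> 'a)) \<Rightarrow> 'm vfield list \<Rightarrow> ('m \<Rightarrow> 'a)" where
  "ext_cov \<theta> \<omega> Xs = (\<lambda>x.
     (\<Sum>i<length Xs. (-1) ^ i *\<^sub>R conn \<theta> (Xs ! i) (\<omega> (omit i Xs)) x)
     + (\<Sum>j<length Xs. \<Sum>i<j. (-1) ^ (i + j) *\<^sub>R
          \<omega> (vf_bracket (Xs ! i) (Xs ! j) # omit i (omit j Xs)) x))"

definition weil_dnabla ::
  "('m, 'e::real_normed_vector, 'a::real_vector) algebroid \<Rightarrow> ('m, 'a) cochain \<Rightarrow> nat \<Rightarrow> nat \<Rightarrow>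
   ('m, 'a) cochain \<Rightarrow> ('m, 'a) cochain" where
  "weil_dnabla L \<theta> p q c k \<alpha>s \<beta>s Xs =
     (if weil_dom L p (Suc q) k \<alpha>s \<beta>s Xs then
        (\<lambda>x. (-1) ^ k *\<^sub>R
          (ext_cov \<theta> (c k \<alpha>s \<beta>s) Xs x - (\<Sum>i<k. c (k - 1) (\<beta>s ! i # \<alpha>s) (omit i \<beta>s) Xs x)))
      else (\<lambda>x. 0))"

definition dot_wedge ::
  "('m, 'a::real_vector) sform \<Rightarrow> ('m vfield \<Rightarrow> ('m \<Rightarrow> 'a)) list \<Rightarrow> 'm vfield list \<Rightarrow> ('m \<Rightarrow> 'a)" where
  "dot_wedge \<gamma> \<theta>s Xs =
     (let l = length \<theta>s; n = length Xs in
      (\<lambda>x. (1 / fact (n - l)) *\<^sub>R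
        (\<Sum>\<sigma> | \<sigma> permutes {..<n}. of_int (sign \<sigma>) *\<^sub>R
           \<gamma> (map (\<lambda>i. (\<theta>s ! i) (Xs ! \<sigma> i)) [0..<l]) (map (\<lambda>i. Xs ! \<sigma> i) [l..<n]) x)))"

definition shuffle_perms :: "nat \<Rightarrow> nat \<Rightarrow> (nat \<Rightarrow> nat) set" where
  "shuffle_perms a b =
     {\<sigma>. \<sigma> permutes {..<a + b} \<and> strict_mono_on {..<a} \<sigma> \<and> strict_mono_on {a..<a + b} \<sigma>}"

text \<open>
  The horizontal projection $h^*$ on $W^{p,q}$.  Terms with \<open>j > q\<close> vanish, because then $c_j = 0$.
\<close>

definition hor_proj ::
  "('m, 'e::real_normed_vector, 'a::real_vector) algebroid \<Rightarrow> ('m, 'a) cochain \<Rightarrow> nat \<Rightarrow> nat \<Rightarrow>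
   ('m, 'a) cochain \<Rightarrow> ('m, 'a) cochain" where
  "hor_proj L \<theta> p q c k \<alpha>s \<beta>s Xs =
     (if weil_dom L p q k \<alpha>s \<beta>s Xs then
        (\<lambda>x. \<Sum>j=k..p. (-1) ^ (j - k) *\<^sub>R
          (\<Sum>\<sigma> \<in> shuffle_perms (j - k) (p - j). of_int (sign \<sigma>) *\<^sub>R
             dot_wedge
               (\<lambda>\<gamma>s. c j (map (\<lambda>i. \<alpha>s ! \<sigma> i) [j - k..<p - k]) (map (hor \<theta>) \<beta>s @ \<gamma>s))
               (map (\<lambda>i. symC \<theta> (\<alpha>s ! \<sigma> i)) [0..<j - k]) Xs x))
      else (\<lambda>x. 0))"

definition hor_ext_cov ::
  "('m, 'e::real_normed_vector, 'a::real_vector) algebroid \<Rightarrow> ('m, 'a) cochain \<Rightarrow> nat \<Rightarrow> nat \<Rightarrow>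
   ('m, 'a) cochain \<Rightarrow> ('m, 'a) cochain" where
  "hor_ext_cov L \<theta> p q c = hor_proj L \<theta> p (Suc q) (weil_dnabla L \<theta> p q c)"

end

theory Submission
  imports Defs
begin

text \<open>
  Write \<open>\<delta>\<close> for the simplicial differential, \<open>\<theta> = (C, v)\<close> for the connection and \<open>h\<^sup>*\<close> for the
  horizontal projection, so that the operator in question is \<open>D = h\<^sup>* d\<^sup>\<nabla>\<close>.  Two facts give
  \<open>\<delta> D = D \<delta>\<close>.

  \<^item> \<open>h\<^sup>* \<delta> = \<delta> h\<^sup>*\<close> (lemma \<open>H_Del\<close>).  Let \<open>U\<close> be the operator that takes, with alternating
    signs, one section \<open>\<alpha>\<close> and one vector field \<open>X\<close> out of the arguments of a cochain and inserts
    \<open>C \<alpha> X\<close> as a new symmetric argument.  The sum over shuffles and the product with several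
    one-forms in \<open>h\<^sup>*\<close> amount to \<open>h\<^sup>* = B exp (- U)\<close>, where \<open>B\<close> replaces each remaining symmetric
    argument \<open>\<beta>\<close> by \<open>h \<beta>\<close>.  The condition \<open>\<delta> \<theta> = 0\<close> consists of two structure equations, for
    \<open>C [\<alpha>, \<beta>]\<close> and for \<open>v [\<alpha>, \<beta>]\<close>.  The first one says that \<open>U\<close> commutes with the Lie derivatives
    and brackets in \<open>\<delta>\<close> (\<open>U_Del0\<close>); with the contractions in \<open>\<delta>\<close> it has a commutator \<open>M\<close> that
    inserts \<open>C \<alpha> (\<rho> \<beta>)\<close> for some \<open>\<alpha>\<close> and \<open>\<beta>\<close> (\<open>U_DelR\<close>), and \<open>M\<close> commutes with \<open>U\<close>.  Hence
    \<open>exp (- U) \<delta> = (\<delta> - M) exp (- U)\<close>.  The second structure equation says that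
    \<open>B (\<delta> - M) = \<delta> B\<close> (\<open>Del_B\<close>).

  \<^item> \<open>h\<^sup>* (\<delta> d\<^sup>\<nabla> - d\<^sup>\<nabla> \<delta>) = 0\<close>.  The connection on the bundle of ideals is compatible with its
    structure of a representation of \<open>A\<close> up to the adjoint action of the values of \<open>\<theta>\<close>.  Therefore
    \<open>d\<^sup>\<nabla> \<delta> - \<delta> d\<^sup>\<nabla>\<close> is the product of \<open>\<theta>\<close> with the adjoint action (\<open>Del_Dn\<close>), and \<open>h\<^sup>*\<close> annihilates
    such products because it annihilates \<open>\<theta>\<close> itself (\<open>H_K\<close>).

  Consequently \<open>\<delta> h\<^sup>* d\<^sup>\<nabla> = h\<^sup>* \<delta> d\<^sup>\<nabla> = h\<^sup>* d\<^sup>\<nabla> \<delta>\<close>.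

  The operators \<open>U\<close>, \<open>M\<close> and \<open>B\<close> do not preserve Weil cochains, since the Leibniz rule fails for
  their values.  The computations take place among functions of three lists (of the alternating
  sections, of the symmetric sections and of the vector fields) that are multilinear with the right
  symmetries (predicate \<open>tame\<close>), all bidegrees being treated at once.  All sums over positions, pairs
  of positions, shuffles and permutations are expressed by sums that recurse over a list; these
  satisfy Fubini rules that are proved by induction.  The Leibniz rule is a separate predicate
  \<open>leib\<close>, and it is shown at the end that \<open>d\<^sup>\<nabla>\<close> and \<open>h\<^sup>*\<close> preserve both predicates together.
\<close>

section \<open>Signed sums over the entries of a list\<close>

text \<open>
  Four sums over the entries of a list.  In \<open>asum\<close> and \<open>xsum\<close> each entry in turn is extracted and
  passed to \<open>f\<close> together with the list of the others, with or without the sign of its position;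
  \<open>bsum\<close> extracts two entries at positions \<open>i < j\<close> with the sign \<open>(-1) ^ (i + j)\<close>, as in the bracket
  terms of a Chevalley--Eilenberg differential; \<open>dsum D\<close> applies \<open>D\<close> to each entry in its place.
  The recursive form makes the rules for interchanging such sums provable by induction.
\<close>

primrec asum :: "'b list \<Rightarrow> ('b \<Rightarrow> 'b list \<Rightarrow> 'v::ab_group_add) \<Rightarrow> 'v" where
  "asum [] f = 0"
| "asum (a # as) f = f a as - asum as (\<lambda>b bs. f b (a # bs))"

primrec xsum :: "'b list \<Rightarrow> ('b \<Rightarrow> 'b list \<Rightarrow> 'v::ab_group_add) \<Rightarrow> 'v" where
  "xsum [] f = 0"
| "xsum (a # as) f = f a as + xsum as (\<lambda>b bs. f b (a # bs))"

primrec bsum :: "'b list \<Rightarrow> ('b \<Rightarrow> 'b \<Rightarrow> 'b list \<Rightarrow> 'v::ab_group_add) \<Rightarrow> 'v" where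
  "bsum [] f = 0"
| "bsum (a # as) f = bsum as (\<lambda>b c cs. f b c (a # cs)) - asum as (f a)"

primrec dsum :: "('b \<Rightarrow> 'b) \<Rightarrow> 'b list \<Rightarrow> ('b list \<Rightarrow> 'v::ab_group_add) \<Rightarrow> 'v" where
  "dsum D [] f = 0"
| "dsum D (a # as) f = f (D a # as) + dsum D as (\<lambda>bs. f (a # bs))"

lemma omit_Nil [simp]: "omit i [] = []"
  and omit_Cons_0 [simp]: "omit 0 (a # as) = as"
  and omit_Cons_Suc [simp]: "omit (Suc i) (a # as) = a # omit i as"
  by (simp_all add: omit_def)

lemma length_omit: "i < length xs \<Longrightarrow> Suc (length (omit i xs)) = length xs"
  by (simp add: omit_def)

lemma asum_eq_sum:
  fixes f :: "'b \<Rightarrow> 'b list \<Rightarrow> 'v::real_vector"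
  shows "(\<Sum>i<length xs. (-1) ^ i *\<^sub>R f (xs ! i) (omit i xs)) = asum xs f"
proof (induction xs arbitrary: f)
  case (Cons a xs)
  have "(\<Sum>i<length (a # xs). (-1) ^ i *\<^sub>R f ((a # xs) ! i) (omit i (a # xs))) =
      f a xs - (\<Sum>i<length xs. (-1) ^ i *\<^sub>R f (xs ! i) (a # omit i xs))"
    by (simp add: sum.lessThan_Suc_shift sum_negf del: sum.lessThan_Suc)
  with Cons.IH[of "\<lambda>b bs. f b (a # bs)"] show ?case by simp
qed simp

lemma xsum_eq_sum: "(\<Sum>i<length xs. f (xs ! i) (omit i xs)) = xsum xs f"
proof (induction xs arbitrary: f)
  case (Cons a xs)
  with Cons.IH[of "\<lambda>b bs. f b (a # bs)"] show ?case by (simp add: sum.lessThan_Suc_shift del: sum.lessThan_Suc)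
qed simp

lemma dsum_eq_sum: "(\<Sum>i<length xs. f (xs[i := D (xs ! i)])) = dsum D xs f"
proof (induction xs arbitrary: f)
  case (Cons a xs)
  with Cons.IH[of "\<lambda>bs. f (a # bs)"] show ?case by (simp add: sum.lessThan_Suc_shift del: sum.lessThan_Suc)
qed simp

lemma bsum_eq_sum:
  fixes f :: "'b \<Rightarrow> 'b \<Rightarrow> 'b list \<Rightarrow> 'v::real_vector"
  shows "(\<Sum>j<length xs. \<Sum>i<j. (-1) ^ (i + j) *\<^sub>R f (xs ! i) (xs ! j) (omit i (omit j xs))) = bsum xs f"
proof (induction xs arbitrary: f)
  case (Cons a xs)
  have "(\<Sum>j<length (a # xs). \<Sum>i<j. (-1) ^ (i + j) *\<^sub>R
        f ((a # xs) ! i) ((a # xs) ! j) (omit i (omit j (a # xs)))) =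
      (\<Sum>j<length xs. - ((-1) ^ j *\<^sub>R f a (xs ! j) (omit j xs))
        + (\<Sum>i<j. (-1) ^ (i + j) *\<^sub>R f (xs ! i) (xs ! j) (a # omit i (omit j xs))))"
    by (simp only: list.size add_Suc_right add_0_right sum.lessThan_Suc_shift)
       (simp add: sum.lessThan_Suc_shift del: sum.lessThan_Suc)
  also have "\<dots> = bsum xs (\<lambda>b c cs. f b c (a # cs)) - asum xs (f a)"
    unfolding sum.distrib Cons.IH[of "\<lambda>b c cs. f b c (a # cs)"] sum_negf asum_eq_sum by simp
  finally show ?case by simp
qed simp

lemma asum_cong_mset:
  "(\<And>a bs. mset (a # bs) = mset as \<Longrightarrow> f a bs = g a bs) \<Longrightarrow> asum as f = asum as g"
proof (induction as arbitrary: f g)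
  case (Cons x as)
  have "asum as (\<lambda>b bs. f b (x # bs)) = asum as (\<lambda>b bs. g b (x # bs))"
  proof (rule Cons.IH)
    fix b bs assume "mset (b # bs) = mset as"
    then have "mset (b # x # bs) = mset (x # as)" by (metis add_mset_commute mset.simps(2))
    then show "f b (x # bs) = g b (x # bs)" by (rule Cons.prems)
  qed
  then show ?case using Cons.prems by simp
qed simp

lemma xsum_cong_mset:
  "(\<And>a bs. mset (a # bs) = mset as \<Longrightarrow> f a bs = g a bs) \<Longrightarrow> xsum as f = xsum as g"
proof (induction as arbitrary: f g)
  case (Cons x as)
  have "xsum as (\<lambda>b bs. f b (x # bs)) = xsum as (\<lambda>b bs. g b (x # bs))"
  proof (rule Cons.IH)
    fix b bs assume "mset (b # bs) = mset as"
    then have "mset (b # x # bs) = mset (x # as)" by (metis add_mset_commute mset.simps(2))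
    then show "f b (x # bs) = g b (x # bs)" by (rule Cons.prems)
  qed
  then show ?case using Cons.prems by simp
qed simp

lemma mset_Cons_cases:
  assumes "mset (a # bs) = mset as" and "set as \<subseteq> S"
  shows "a \<in> S" "set bs \<subseteq> S" "Suc (length bs) = length as"
  using assms mset_eq_setD[OF assms(1)] mset_eq_length[OF assms(1)] by auto

lemma asum_cong:
  assumes "set as \<subseteq> S"
    and "\<And>a bs. a \<in> S \<Longrightarrow> set bs \<subseteq> S \<Longrightarrow> Suc (length bs) = length as \<Longrightarrow> f a bs = g a bs"
  shows "asum as f = asum as g"
proof (rule asum_cong_mset)
  fix a bs assume "mset (a # bs) = mset as"
  from mset_Cons_cases[OF this assms(1)] show "f a bs = g a bs" by (rule assms(2))
qed

lemma xsum_cong: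
  assumes "set as \<subseteq> S"
    and "\<And>a bs. a \<in> S \<Longrightarrow> set bs \<subseteq> S \<Longrightarrow> Suc (length bs) = length as \<Longrightarrow> f a bs = g a bs"
  shows "xsum as f = xsum as g"
proof (rule xsum_cong_mset)
  fix a bs assume "mset (a # bs) = mset as"
  from mset_Cons_cases[OF this assms(1)] show "f a bs = g a bs" by (rule assms(2))
qed

lemma bsum_cong:
  assumes "set as \<subseteq> S"
    and "\<And>a b cs. a \<in> S \<Longrightarrow> b \<in> S \<Longrightarrow> set cs \<subseteq> S \<Longrightarrow> Suc (Suc (length cs)) = length as \<Longrightarrow> f a b cs = g a b cs"
  shows "bsum as f = bsum as g"
  using assms
proof (induction as arbitrary: f g)
  case (Cons x as)
  have "bsum as (\<lambda>b c cs. f b c (x # cs)) = bsum as (\<lambda>b c cs. g b c (x # cs))"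
    using Cons.prems by (intro Cons.IH) auto
  moreover have "asum as (f x) = asum as (g x)"
    using Cons.prems by (intro asum_cong[where S = S]) auto
  ultimately show ?case by simp
qed simp

lemma dsum_cong:
  assumes "set as \<subseteq> S" and "\<And>a. a \<in> S \<Longrightarrow> D a \<in> S"
    and "\<And>bs. set bs \<subseteq> S \<Longrightarrow> length bs = length as \<Longrightarrow> f bs = g bs"
  shows "dsum D as f = dsum D as g"
  using assms
proof (induction as arbitrary: f g)
  case (Cons x as)
  have "dsum D as (\<lambda>bs. f (x # bs)) = dsum D as (\<lambda>bs. g (x # bs))"
    using Cons.prems by (intro Cons.IH) auto
  then show ?case using Cons.prems by simp
qed simp

lemma asum_add: "asum as (\<lambda>a bs. f a bs + g a bs) = asum as f + asum as g"
  by (induction as arbitrary: f g) auto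
lemma asum_minus: "asum as (\<lambda>a bs. - f a bs) = - asum as f"
  by (induction as arbitrary: f) auto
lemma asum_diff: "asum as (\<lambda>a bs. f a bs - g a bs) = asum as f - asum as g"
  by (induction as arbitrary: f g) auto
lemma asum_zero [simp]: "asum as (\<lambda>a bs. 0) = 0"
  by (induction as) auto
lemma asum_scaleR:
  "asum as (\<lambda>a bs. r *\<^sub>R f a bs) = r *\<^sub>R (asum as f :: 'v::real_vector)"
  by (induction as arbitrary: f) (auto simp: scaleR_diff_right)

lemma xsum_add: "xsum as (\<lambda>a bs. f a bs + g a bs) = xsum as f + xsum as g"
  by (induction as arbitrary: f g) auto
lemma xsum_minus: "xsum as (\<lambda>a bs. - f a bs) = - xsum as f"
  by (induction as arbitrary: f) auto
lemma xsum_diff: "xsum as (\<lambda>a bs. f a bs - g a bs) = xsum as f - xsum as g"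
  by (induction as arbitrary: f g) auto
lemma xsum_zero [simp]: "xsum as (\<lambda>a bs. 0) = 0"
  by (induction as) auto
lemma xsum_scaleR:
  "xsum as (\<lambda>a bs. r *\<^sub>R f a bs) = r *\<^sub>R (xsum as f :: 'v::real_vector)"
  by (induction as arbitrary: f) (auto simp: scaleR_add_right)

lemma bsum_add: "bsum as (\<lambda>a b bs. f a b bs + g a b bs) = bsum as f + bsum as g"
  by (induction as arbitrary: f g) (auto simp: asum_add)
lemma bsum_minus: "bsum as (\<lambda>a b bs. - f a b bs) = - bsum as f"
  by (induction as arbitrary: f) (auto simp: asum_minus)
lemma bsum_diff: "bsum as (\<lambda>a b bs. f a b bs - g a b bs) = bsum as f - bsum as g"
  by (induction as arbitrary: f g) (auto simp: asum_diff)
lemma bsum_zero [simp]: "bsum as (\<lambda>a b bs. 0) = 0"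
  by (induction as) auto
lemma bsum_scaleR:
  "bsum as (\<lambda>a b bs. r *\<^sub>R f a b bs) = r *\<^sub>R (bsum as f :: 'v::real_vector)"
  by (induction as arbitrary: f) (auto simp: scaleR_diff_right asum_scaleR)

lemma dsum_add: "dsum D as (\<lambda>bs. f bs + g bs) = dsum D as f + dsum D as g"
  by (induction as arbitrary: f g) auto
lemma dsum_minus: "dsum D as (\<lambda>bs. - f bs) = - dsum D as f"
  by (induction as arbitrary: f) auto
lemma dsum_diff: "dsum D as (\<lambda>bs. f bs - g bs) = dsum D as f - dsum D as g"
  by (induction as arbitrary: f g) auto
lemma dsum_scaleR:
  "dsum D as (\<lambda>bs. r *\<^sub>R f bs) = r *\<^sub>R (dsum D as f :: 'v::real_vector)"
  by (induction as arbitrary: f) (auto simp: scaleR_add_right)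

lemma asum_sum: "asum Xs (\<lambda>X Ys. \<Sum>n\<in>A. g n X Ys) = (\<Sum>n\<in>A. asum Xs (g n))"
  by (induction A rule: infinite_finite_induct) (simp_all add: asum_add)

lemma xsum_map: "xsum (map h bs) f = xsum bs (\<lambda>b cs. f (h b) (map h cs))"
  by (induction bs arbitrary: f) simp_all

subsection \<open>Interchange of sums\<close>

lemma asum_asum_swap:
  "asum as (\<lambda>a bs. asum bs (\<lambda>b cs. f a b cs)) = - asum as (\<lambda>a bs. asum bs (\<lambda>b cs. f b a cs))"
proof (induction as arbitrary: f)
  case (Cons x as)
  from Cons.IH[of "\<lambda>a b cs. f a b (x # cs)"] show ?case by (simp add: asum_diff)
qed simp

lemma xsum_xsum_swap:
  "xsum as (\<lambda>a bs. xsum bs (\<lambda>b cs. f a b cs)) = xsum as (\<lambda>a bs. xsum bs (\<lambda>b cs. f b a cs))"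
proof (induction as arbitrary: f)
  case (Cons x as)
  from Cons.IH[of "\<lambda>a b cs. f a b (x # cs)"] show ?case by (simp add: xsum_add)
qed simp

lemma asum_asum_fubini:
  "asum as (\<lambda>a bs. asum Xs (\<lambda>X Ys. f a bs X Ys)) = asum Xs (\<lambda>X Ys. asum as (\<lambda>a bs. f a bs X Ys))"
  by (induction as arbitrary: f) (simp_all add: asum_diff)

lemma asum_xsum_fubini:
  "asum as (\<lambda>a bs. xsum Xs (\<lambda>X Ys. f a bs X Ys)) = xsum Xs (\<lambda>X Ys. asum as (\<lambda>a bs. f a bs X Ys))"
  by (induction as arbitrary: f) (simp_all add: xsum_diff)

lemma asum_bsum_fubini:
  "asum as (\<lambda>a bs. bsum Xs (\<lambda>X Y Ys. f a bs X Y Ys)) = bsum Xs (\<lambda>X Y Ys. asum as (\<lambda>a bs. f a bs X Y Ys))"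
  by (induction as arbitrary: f) (simp_all add: bsum_diff)

lemma xsum_bsum_fubini:
  "xsum as (\<lambda>a bs. bsum Xs (\<lambda>X Y Ys. f a bs X Y Ys)) = bsum Xs (\<lambda>X Y Ys. xsum as (\<lambda>a bs. f a bs X Y Ys))"
  by (induction as arbitrary: f) (simp_all add: bsum_add)

lemma bsum_bsum_fubini:
  "bsum as (\<lambda>a b bs. bsum Xs (\<lambda>X Y Ys. f a b bs X Y Ys)) = bsum Xs (\<lambda>X Y Ys. bsum as (\<lambda>a b bs. f a b bs X Y Ys))"
  by (induction as arbitrary: f) (simp_all add: bsum_diff asum_bsum_fubini)

lemma dsum_asum_fubini:
  "dsum D as (\<lambda>bs. asum Xs (\<lambda>X Ys. f bs X Ys)) = asum Xs (\<lambda>X Ys. dsum D as (\<lambda>bs. f bs X Ys))"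
  by (induction as arbitrary: f) (simp_all add: asum_add)

lemma dsum_bsum_fubini:
  "dsum D as (\<lambda>bs. bsum Xs (\<lambda>X Y Ys. f bs X Y Ys)) = bsum Xs (\<lambda>X Y Ys. dsum D as (\<lambda>bs. f bs X Y Ys))"
  by (induction as arbitrary: f) (simp_all add: bsum_add)

lemma dsum_xsum_fubini:
  "dsum D as (\<lambda>bs. xsum Xs (\<lambda>X Ys. f bs X Ys)) = xsum Xs (\<lambda>X Ys. dsum D as (\<lambda>bs. f bs X Ys))"
  by (induction as arbitrary: f) (simp_all add: xsum_add)

lemma bsum_asum_swap:
  "bsum as (\<lambda>a b cs. asum cs (\<lambda>d ds. f a b d ds)) = asum as (\<lambda>d cs. bsum cs (\<lambda>a b ds. f a b d ds))"
proof (induction as arbitrary: f)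
  case (Cons x as)
  from Cons.IH[of "\<lambda>a b d ds. f a b d (x # ds)"] asum_asum_swap[of as "\<lambda>b d ds. f x b d ds"]
  show ?case by (simp add: asum_diff bsum_diff)
qed simp

text \<open>
  In the double sum on the right each pair of entries is extracted in both orders, with opposite
  signs.
\<close>

lemma bsum_antisym:
  "bsum as (\<lambda>a b cs. g a b cs - g b a cs) = - asum as (\<lambda>a bs. asum bs (\<lambda>b cs. g a b cs))"
proof (induction as arbitrary: g)
  case (Cons x as)
  from Cons.IH[of "\<lambda>a b cs. g a b (x # cs)"] show ?case by (simp add: asum_diff)
qed simp

text \<open>
  A derivation acts on a sum over entries by acting on the extracted entry and on the rest.
\<close>

lemma dsum_asum:
  "dsum D Xs (\<lambda>Ys. asum Ys g) = asum Xs (\<lambda>X Ys. g (D X) Ys + dsum D Ys (\<lambda>Zs. g X Zs))"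
proof (induction Xs arbitrary: g)
  case (Cons x as)
  from Cons.IH[of "\<lambda>b bs. g b (x # bs)"] show ?case
    by (simp add: dsum_diff asum_add)
qed simp

lemma dsum_xsum:
  "dsum D Xs (\<lambda>Ys. xsum Ys g) = xsum Xs (\<lambda>X Ys. g (D X) Ys + dsum D Ys (\<lambda>Zs. g X Zs))"
proof (induction Xs arbitrary: g)
  case (Cons x as)
  from Cons.IH[of "\<lambda>b bs. g b (x # bs)"] show ?case
    by (simp add: dsum_add xsum_add)
qed simp

lemma dsum_bsum:
  "dsum D Xs (\<lambda>Ys. bsum Ys g) = bsum Xs (\<lambda>X Y Ys. g (D X) Y Ys + g X (D Y) Ys + dsum D Ys (\<lambda>Zs. g X Y Zs))"
proof (induction Xs arbitrary: g)
  case (Cons x as)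
  from Cons.IH[of "\<lambda>b c bs. g b c (x # bs)"] dsum_asum[of D as "g x"] show ?case
    by (simp add: dsum_diff bsum_add asum_add)
qed simp

subsection \<open>Alternating and symmetric functions of lists\<close>

text \<open>
  Only lists over \<open>S\<close> matter: \<open>S\<close> will consist of the sections or of the vector fields, and nothing
  is known about the values elsewhere.  Interchanging neighbours suffices, and this form of the
  condition passes through the recursive sums.
\<close>

definition altern :: "'b set \<Rightarrow> ('b list \<Rightarrow> 'v::real_vector) \<Rightarrow> bool" where
  "altern S f \<longleftrightarrow> (\<forall>ps qs. \<forall>a\<in>S. \<forall>b\<in>S. set ps \<subseteq> S \<longrightarrow> set qs \<subseteq> S \<longrightarrow>
     f (ps @ a # b # qs) = - f (ps @ b # a # qs))"

definition symm :: "'b set \<Rightarrow> ('b list \<Rightarrow> 'v::real_vector) \<Rightarrow> bool" where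
  "symm S f \<longleftrightarrow> (\<forall>ps qs. \<forall>a\<in>S. \<forall>b\<in>S. set ps \<subseteq> S \<longrightarrow> set qs \<subseteq> S \<longrightarrow>
     f (ps @ a # b # qs) = f (ps @ b # a # qs))"

lemma alternI:
  assumes "\<And>ps qs a b. a \<in> S \<Longrightarrow> b \<in> S \<Longrightarrow> set ps \<subseteq> S \<Longrightarrow> set qs \<subseteq> S \<Longrightarrow>
    f (ps @ a # b # qs) = - f (ps @ b # a # qs)"
  shows "altern S f"
  unfolding altern_def by (intro allI ballI impI assms)

lemma altern_swap:
  assumes "altern S f" "a \<in> S" "b \<in> S" "set ps \<subseteq> S" "set qs \<subseteq> S"
  shows "f (ps @ a # b # qs) = - f (ps @ b # a # qs)"
  using assms unfolding altern_def by blast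

lemma altern_swap_head:
  assumes "altern S f" "a \<in> S" "b \<in> S" "set qs \<subseteq> S"
  shows "f (a # b # qs) = - f (b # a # qs)"
  using altern_swap[OF assms(1-3), of "[]" qs] assms(4) by simp

lemma symmI:
  assumes "\<And>ps qs a b. a \<in> S \<Longrightarrow> b \<in> S \<Longrightarrow> set ps \<subseteq> S \<Longrightarrow> set qs \<subseteq> S \<Longrightarrow>
    f (ps @ a # b # qs) = f (ps @ b # a # qs)"
  shows "symm S f"
  unfolding symm_def by (intro allI ballI impI assms)

lemma symm_swap:
  assumes "symm S f" "a \<in> S" "b \<in> S" "set ps \<subseteq> S" "set qs \<subseteq> S"
  shows "f (ps @ a # b # qs) = f (ps @ b # a # qs)"
  using assms unfolding symm_def by blast

lemma symm_swap_head:
  assumes "symm S f" "a \<in> S" "b \<in> S" "set qs \<subseteq> S"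
  shows "f (a # b # qs) = f (b # a # qs)"
  using symm_swap[OF assms(1-3), of "[]" qs] assms(4) by simp

lemma altern_Cons:
  assumes "altern S f" "a \<in> S"
  shows "altern S (\<lambda>as. f (a # as))"
  unfolding altern_def
proof (intro allI ballI impI)
  fix ps qs b c
  assume "b \<in> S" "c \<in> S" "set ps \<subseteq> S" "set qs \<subseteq> S"
  then show "f (a # ps @ b # c # qs) = - f (a # ps @ c # b # qs)"
    using assms altern_swap[of S f b c "a # ps" qs] by simp
qed

lemma symm_Cons:
  assumes "symm S f" "a \<in> S"
  shows "symm S (\<lambda>as. f (a # as))"
  unfolding symm_def
proof (intro allI ballI impI)
  fix ps qs b c
  assume "b \<in> S" "c \<in> S" "set ps \<subseteq> S" "set qs \<subseteq> S"
  then show "f (a # ps @ b # c # qs) = f (a # ps @ c # b # qs)"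
    using assms symm_swap[of S f b c "a # ps" qs] by simp
qed

lemma altern_move:
  assumes "altern S f" "a \<in> S" "set ps \<subseteq> S" "set qs \<subseteq> S"
  shows "f (ps @ a # qs) = (-1) ^ length ps *\<^sub>R f (a # ps @ qs)"
  using assms
proof (induction ps arbitrary: f)
  case (Cons p ps)
  have "f (p # ps @ a # qs) = (-1) ^ length ps *\<^sub>R f (p # a # ps @ qs)"
    using Cons.IH[OF altern_Cons[OF Cons.prems(1), of p]] Cons.prems by simp
  also have "f (p # a # ps @ qs) = - f (a # p # ps @ qs)"
    using Cons.prems by (intro altern_swap_head) auto
  finally show ?case by simp
qed simp

lemma symm_move:
  assumes "symm S f" "a \<in> S" "set ps \<subseteq> S" "set qs \<subseteq> S"
  shows "f (ps @ a # qs) = f (a # ps @ qs)"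
  using assms
proof (induction ps arbitrary: f)
  case (Cons p ps)
  have "f (p # ps @ a # qs) = f (p # a # ps @ qs)"
    using Cons.IH[OF symm_Cons[OF Cons.prems(1), of p]] Cons.prems by simp
  also have "f (p # a # ps @ qs) = f (a # p # ps @ qs)"
    using Cons.prems by (intro symm_swap_head) auto
  finally show ?case by simp
qed simp

lemma symm_mset:
  assumes "symm S f" "set xs \<subseteq> S" "mset ys = mset xs"
  shows "f ys = f xs"
  using assms
proof (induction xs arbitrary: f ys)
  case (Cons x xs)
  have "x \<in> set ys" using mset_eq_setD[OF Cons.prems(3)] by simp
  then obtain ps qs where ys: "ys = ps @ x # qs" by (meson split_list)
  have "set ys \<subseteq> S" using mset_eq_setD[OF Cons.prems(3)] Cons.prems(2) by simp
  then have "f ys = f (x # ps @ qs)" unfolding ys using Cons.prems by (intro symm_move) auto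
  also have "\<dots> = f (x # xs)"
    using Cons.IH[OF symm_Cons[OF Cons.prems(1), of x], of "ps @ qs"] Cons.prems(2,3) ys by simp
  finally show ?case .
qed simp

lemma altern_not_distinct:
  assumes "altern S f" "set xs \<subseteq> S" "\<not> distinct xs"
  shows "f xs = 0"
proof -
  obtain ps a qs rs where xs: "xs = ps @ [a] @ qs @ [a] @ rs"
    using not_distinct_decomp[OF assms(3)] by blast
  have "altern S (\<lambda>ys. f (ps @ a # ys))"
    unfolding altern_def
  proof (intro allI ballI impI)
    fix us vs b c assume "b \<in> S" "c \<in> S" "set us \<subseteq> S" "set vs \<subseteq> S"
    then show "f (ps @ a # us @ b # c # vs) = - f (ps @ a # us @ c # b # vs)"
      using altern_swap[OF assms(1), of b c "ps @ a # us" vs] assms(2) unfolding xs by auto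
  qed
  from altern_move[OF this, of a qs rs]
  have "f xs = (-1) ^ length qs *\<^sub>R f (ps @ a # a # qs @ rs)"
    using assms(2) unfolding xs by simp
  moreover have "f (ps @ a # a # qs @ rs) = - f (ps @ a # a # qs @ rs)"
    using assms(2) unfolding xs by (intro altern_swap[OF assms(1)]) auto
  then have "2 *\<^sub>R f (ps @ a # a # qs @ rs) = 0" by (simp add: scaleR_2 eq_neg_iff_add_eq_0)
  then have "f (ps @ a # a # qs @ rs) = 0" by simp
  ultimately show ?thesis by simp
qed

text \<open>
  Polarisation: expand the value at a list that contains \<open>pl a b\<close> twice.  The operation \<open>pl\<close> is
  pointwise addition of sections or of vector fields.
\<close>

lemma altern_of_not_distinct:
  fixes f :: "'b list \<Rightarrow> 'v::real_vector"
  assumes pl: "\<And>a b. a \<in> S \<Longrightarrow> b \<in> S \<Longrightarrow> pl a b \<in> S"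
    and add: "\<And>ps qs a b. set ps \<subseteq> S \<Longrightarrow> set qs \<subseteq> S \<Longrightarrow> a \<in> S \<Longrightarrow> b \<in> S \<Longrightarrow>
      f (ps @ pl a b # qs) = f (ps @ a # qs) + f (ps @ b # qs)"
    and z: "\<And>xs. set xs \<subseteq> S \<Longrightarrow> \<not> distinct xs \<Longrightarrow> f xs = 0"
  shows "altern S f"
proof (rule alternI)
  fix ps qs a b assume *: "a \<in> S" "b \<in> S" "set ps \<subseteq> S" "set qs \<subseteq> S"
  let ?c = "pl a b"
  have c: "?c \<in> S" by (rule pl[OF *(1,2)])
  have in2: "f (ps @ d # ?c # qs) = f (ps @ d # a # qs) + f (ps @ d # b # qs)" if "d \<in> S" for d
    using add[of "ps @ [d]" qs a b] that * by simp
  have "0 = f (ps @ ?c # ?c # qs)" using z[of "ps @ ?c # ?c # qs"] c * by simp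
  also have "\<dots> = f (ps @ a # ?c # qs) + f (ps @ b # ?c # qs)"
    using add[of ps "?c # qs" a b] c * by simp
  also have "\<dots> = (f (ps @ a # a # qs) + f (ps @ a # b # qs)) + (f (ps @ b # a # qs) + f (ps @ b # b # qs))"
    by (simp only: in2[OF *(1)] in2[OF *(2)])
  also have "f (ps @ a # a # qs) = 0" using z[of "ps @ a # a # qs"] * by simp
  also have "f (ps @ b # b # qs) = 0" using z[of "ps @ b # b # qs"] * by simp
  finally show "f (ps @ a # b # qs) = - f (ps @ b # a # qs)" by (simp add: eq_neg_iff_add_eq_0)
qed

lemma altern_cong:
  assumes "\<And>xs. set xs \<subseteq> S \<Longrightarrow> f xs = g xs" "altern S f"
  shows "altern S g"
proof (rule alternI)
  fix ps qs a b assume *: "a \<in> S" "b \<in> S" "set ps \<subseteq> S" "set qs \<subseteq> S"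
  show "g (ps @ a # b # qs) = - g (ps @ b # a # qs)"
    using altern_swap[OF assms(2) *] assms(1)[of "ps @ a # b # qs"] assms(1)[of "ps @ b # a # qs"] * by simp
qed

lemma symm_cong:
  assumes "\<And>xs. set xs \<subseteq> S \<Longrightarrow> f xs = g xs" "symm S f"
  shows "symm S g"
proof (rule symmI)
  fix ps qs a b assume *: "a \<in> S" "b \<in> S" "set ps \<subseteq> S" "set qs \<subseteq> S"
  show "g (ps @ a # b # qs) = g (ps @ b # a # qs)"
    using symm_swap[OF assms(2) *] assms(1)[of "ps @ a # b # qs"] assms(1)[of "ps @ b # a # qs"] * by simp
qed

lemma altern_add:
  assumes "altern S f" "altern S g"
  shows "altern S (\<lambda>xs. f xs + g xs)"
proof (rule alternI)
  fix ps qs a b assume *: "a \<in> S" "b \<in> S" "set ps \<subseteq> S" "set qs \<subseteq> S"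
  show "f (ps @ a # b # qs) + g (ps @ a # b # qs) = - (f (ps @ b # a # qs) + g (ps @ b # a # qs))"
    unfolding altern_swap[OF assms(1) *] altern_swap[OF assms(2) *] by simp
qed

lemma altern_diff:
  assumes "altern S f" "altern S g"
  shows "altern S (\<lambda>xs. f xs - g xs)"
proof (rule alternI)
  fix ps qs a b assume *: "a \<in> S" "b \<in> S" "set ps \<subseteq> S" "set qs \<subseteq> S"
  show "f (ps @ a # b # qs) - g (ps @ a # b # qs) = - (f (ps @ b # a # qs) - g (ps @ b # a # qs))"
    unfolding altern_swap[OF assms(1) *] altern_swap[OF assms(2) *] by simp
qed

lemma altern_scaleR:
  assumes "altern S f"
  shows "altern S (\<lambda>xs. r *\<^sub>R f xs)"
proof (rule alternI)
  fix ps qs a b assume *: "a \<in> S" "b \<in> S" "set ps \<subseteq> S" "set qs \<subseteq> S"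
  show "r *\<^sub>R f (ps @ a # b # qs) = - (r *\<^sub>R f (ps @ b # a # qs))"
    unfolding altern_swap[OF assms *] by simp
qed

lemma altern_minus: "altern S f \<Longrightarrow> altern S (\<lambda>xs. - f xs)"
  using altern_scaleR[of S f "-1"] by simp

lemma altern_zero: "altern S (\<lambda>xs. 0)"
  by (rule alternI) simp

lemma symm_add:
  assumes "symm S f" "symm S g"
  shows "symm S (\<lambda>xs. f xs + g xs)"
proof (rule symmI)
  fix ps qs a b assume *: "a \<in> S" "b \<in> S" "set ps \<subseteq> S" "set qs \<subseteq> S"
  show "f (ps @ a # b # qs) + g (ps @ a # b # qs) = (f (ps @ b # a # qs) + g (ps @ b # a # qs))"
    unfolding symm_swap[OF assms(1) *] symm_swap[OF assms(2) *] by simp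
qed

lemma symm_diff:
  assumes "symm S f" "symm S g"
  shows "symm S (\<lambda>xs. f xs - g xs)"
proof (rule symmI)
  fix ps qs a b assume *: "a \<in> S" "b \<in> S" "set ps \<subseteq> S" "set qs \<subseteq> S"
  show "f (ps @ a # b # qs) - g (ps @ a # b # qs) = (f (ps @ b # a # qs) - g (ps @ b # a # qs))"
    unfolding symm_swap[OF assms(1) *] symm_swap[OF assms(2) *] by simp
qed

lemma symm_scaleR:
  assumes "symm S f"
  shows "symm S (\<lambda>xs. r *\<^sub>R f xs)"
proof (rule symmI)
  fix ps qs a b assume *: "a \<in> S" "b \<in> S" "set ps \<subseteq> S" "set qs \<subseteq> S"
  show "r *\<^sub>R f (ps @ a # b # qs) = (r *\<^sub>R f (ps @ b # a # qs))"
    unfolding symm_swap[OF assms *] by simp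
qed

lemma symm_minus: "symm S f \<Longrightarrow> symm S (\<lambda>xs. - f xs)"
  using symm_scaleR[of S f "-1"] by simp

lemma symm_zero: "symm S (\<lambda>xs. 0)"
  by (rule symmI) simp

lemma symm_sign:
  assumes "symm S f"
  shows "symm S (\<lambda>xs. (-1) ^ length xs *\<^sub>R f xs)"
proof (rule symmI)
  fix ps qs a b assume *: "a \<in> S" "b \<in> S" "set ps \<subseteq> S" "set qs \<subseteq> S"
  show "(-1) ^ length (ps @ a # b # qs) *\<^sub>R f (ps @ a # b # qs) = (-1) ^ length (ps @ b # a # qs) *\<^sub>R f (ps @ b # a # qs)"
    unfolding symm_swap[OF assms *] by simp
qed

lemma symm_map:
  assumes "symm S f" "\<And>b. b \<in> S \<Longrightarrow> h b \<in> S"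
  shows "symm S (\<lambda>bs. f (map h bs))"
proof (rule symmI)
  fix ps qs a b assume "a \<in> S" "b \<in> S" "set ps \<subseteq> S" "set qs \<subseteq> S"
  then show "f (map h (ps @ a # b # qs)) = f (map h (ps @ b # a # qs))"
    using symm_swap[OF assms(1), of "h a" "h b" "map h ps" "map h qs"] assms(2) by auto
qed

lemma symm_fun:
  assumes f: "\<And>x. symm S (\<lambda>xs. f xs x)"
  shows "symm S (\<lambda>xs. T (f xs) x)"
proof (rule symmI)
  fix ps qs a b assume *: "a \<in> S" "b \<in> S" "set ps \<subseteq> S" "set qs \<subseteq> S"
  have "f (ps @ a # b # qs) = f (ps @ b # a # qs)"
    using symm_swap[OF f *] by (simp add: fun_eq_iff)
  then show "T (f (ps @ a # b # qs)) x = T (f (ps @ b # a # qs)) x" by simp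
qed

text \<open>
  Moving the extracted entry back to its place costs exactly the sign with which it was extracted.
\<close>

lemma altern_asum_Cons:
  assumes "altern S f" "set Xs \<subseteq> S"
  shows "asum Xs (\<lambda>X Ys. f (X # Ys)) = real (length Xs) *\<^sub>R f Xs"
  using assms
proof (induction Xs arbitrary: f)
  case (Cons x Xs)
  have "asum Xs (\<lambda>X Ys. f (X # x # Ys)) = asum Xs (\<lambda>X Ys. - f (x # X # Ys))"
    using Cons.prems by (intro asum_cong[where S = S] altern_swap_head[of S]) auto
  also have "\<dots> = - (real (length Xs) *\<^sub>R f (x # Xs))"
    using Cons.IH[OF altern_Cons[OF Cons.prems(1), of x]] Cons.prems(2) by (simp add: asum_minus)
  finally show ?case by (simp add: algebra_simps)
qed simp

lemma altern_dsum:
  assumes "altern S f" "set Xs \<subseteq> S" "\<And>X. X \<in> S \<Longrightarrow> D X \<in> S"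
  shows "dsum D Xs f = asum Xs (\<lambda>X Ys. f (D X # Ys))"
  using assms
proof (induction Xs arbitrary: f)
  case (Cons x Xs)
  have "asum Xs (\<lambda>X Ys. f (D X # x # Ys)) = asum Xs (\<lambda>X Ys. - f (x # D X # Ys))"
    using Cons.prems by (intro asum_cong[where S = S] altern_swap_head[of S]) auto
  moreover have "dsum D Xs (\<lambda>bs. f (x # bs)) = asum Xs (\<lambda>X Ys. f (x # D X # Ys))"
    using Cons.prems by (intro Cons.IH altern_Cons) auto
  ultimately show ?case by (simp add: asum_minus)
qed simp

lemma symm_dsum:
  assumes "symm S f" "set Xs \<subseteq> S" "\<And>X. X \<in> S \<Longrightarrow> D X \<in> S"
  shows "dsum D Xs f = xsum Xs (\<lambda>X Ys. f (D X # Ys))"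
  using assms
proof (induction Xs arbitrary: f)
  case (Cons x Xs)
  have "xsum Xs (\<lambda>X Ys. f (D X # x # Ys)) = xsum Xs (\<lambda>X Ys. f (x # D X # Ys))"
    using Cons.prems by (intro xsum_cong[where S = S] symm_swap_head[of S]) auto
  moreover have "dsum D Xs (\<lambda>bs. f (x # bs)) = xsum Xs (\<lambda>X Ys. f (x # D X # Ys))"
    using Cons.prems by (intro Cons.IH symm_Cons) auto
  ultimately show ?case by simp
qed simp

lemma altern_asum:
  assumes "\<And>X. X \<in> S \<Longrightarrow> altern S (g X)"
  shows "altern S (\<lambda>Xs. asum Xs g)"
proof -
  have "asum (ps @ a # b # qs) g = - asum (ps @ b # a # qs) g"
    if "set ps \<subseteq> S" "a \<in> S" "b \<in> S" "set qs \<subseteq> S" "\<And>X. X \<in> S \<Longrightarrow> altern S (g X)" for ps a b qs g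
    using that
  proof (induction ps arbitrary: g)
    case Nil
    have "asum qs (\<lambda>c cs. g c (a # b # cs)) = asum qs (\<lambda>c cs. - g c (b # a # cs))"
      using Nil by (intro asum_cong[where S = S] altern_swap_head[of S]) auto
    then show ?case by (simp add: asum_minus)
  next
    case (Cons p ps)
    have "asum (ps @ a # b # qs) (\<lambda>c cs. g c (p # cs)) = - asum (ps @ b # a # qs) (\<lambda>c cs. g c (p # cs))"
      using Cons.prems by (intro Cons.IH altern_Cons) auto
    moreover have "g p (ps @ a # b # qs) = - g p (ps @ b # a # qs)"
      using Cons.prems by (intro altern_swap[of S]) auto
    ultimately show ?case by simp
  qed
  with assms show ?thesis by (intro alternI) blast
qed

lemma symm_xsum:
  assumes "\<And>X. X \<in> S \<Longrightarrow> symm S (g X)"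
  shows "symm S (\<lambda>Xs. xsum Xs g)"
proof -
  have "xsum (ps @ a # b # qs) g = xsum (ps @ b # a # qs) g"
    if "set ps \<subseteq> S" "a \<in> S" "b \<in> S" "set qs \<subseteq> S" "\<And>X. X \<in> S \<Longrightarrow> symm S (g X)" for ps a b qs g
    using that
  proof (induction ps arbitrary: g)
    case Nil
    have "xsum qs (\<lambda>c cs. g c (a # b # cs)) = xsum qs (\<lambda>c cs. g c (b # a # cs))"
      using Nil by (intro xsum_cong[where S = S] symm_swap_head[of S]) auto
    then show ?case by simp
  next
    case (Cons p ps)
    have "xsum (ps @ a # b # qs) (\<lambda>c cs. g c (p # cs)) = xsum (ps @ b # a # qs) (\<lambda>c cs. g c (p # cs))"
      using Cons.prems by (intro Cons.IH symm_Cons) auto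
    moreover have "g p (ps @ a # b # qs) = g p (ps @ b # a # qs)"
      using Cons.prems by (intro symm_swap[of S]) auto
    ultimately show ?case by simp
  qed
  with assms show ?thesis by (intro symmI) blast
qed

text \<open>
  This reduces the symmetries of \<open>bsum\<close> to those of a double \<open>asum\<close>, where no order of the two
  extracted positions is prescribed.
\<close>

lemma bsum_eq_half_asum:
  fixes g :: "'b \<Rightarrow> 'b \<Rightarrow> 'b list \<Rightarrow> 'v::real_vector"
  assumes "set as \<subseteq> S" "\<And>a b cs. a \<in> S \<Longrightarrow> b \<in> S \<Longrightarrow> set cs \<subseteq> S \<Longrightarrow> g a b cs = - g b a cs"
  shows "bsum as g = (-1/2) *\<^sub>R asum as (\<lambda>a bs. asum bs (\<lambda>b cs. g a b cs))"
proof -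
  have "g a b cs = (1/2) *\<^sub>R g a b cs - (1/2) *\<^sub>R g b a cs"
    if "a \<in> S" "b \<in> S" "set cs \<subseteq> S" for a b cs
    using assms(2)[OF that(2,1,3)] by (simp flip: scaleR_add_left)
  then have "bsum as g = bsum as (\<lambda>a b cs. (1/2) *\<^sub>R g a b cs - (1/2) *\<^sub>R g b a cs)"
    using assms(1) by (intro bsum_cong[where S = S]) auto
  also have "\<dots> = - asum as (\<lambda>a bs. asum bs (\<lambda>b cs. (1/2) *\<^sub>R g a b cs))"
    by (rule bsum_antisym)
  finally show ?thesis by (simp add: asum_scaleR)
qed

lemma altern_bsum:
  assumes "\<And>X Y. X \<in> S \<Longrightarrow> Y \<in> S \<Longrightarrow> altern S (g X Y)"
    and "\<And>a b cs. a \<in> S \<Longrightarrow> b \<in> S \<Longrightarrow> set cs \<subseteq> S \<Longrightarrow> g a b cs = - g b a cs"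
  shows "altern S (\<lambda>Xs. bsum Xs g)"
proof (rule altern_cong)
  show "altern S (\<lambda>as. (-1/2) *\<^sub>R asum as (\<lambda>a bs. asum bs (\<lambda>b cs. g a b cs)))"
    by (intro altern_scaleR altern_asum assms(1))
  show "(-1/2) *\<^sub>R asum as (\<lambda>a bs. asum bs (\<lambda>b cs. g a b cs)) = bsum as g" if "set as \<subseteq> S" for as
    using bsum_eq_half_asum[OF that assms(2)] by simp
qed

lemma symm_dsum_self:
  assumes "symm S f" "\<And>a. a \<in> S \<Longrightarrow> D a \<in> S"
  shows "symm S (\<lambda>as. dsum D as f)"
proof (rule symm_cong)
  show "xsum as (\<lambda>a bs. f (D a # bs)) = dsum D as f" if "set as \<subseteq> S" for as
    by (rule symm_dsum[OF assms(1) that assms(2), symmetric])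
  show "symm S (\<lambda>as. xsum as (\<lambda>a bs. f (D a # bs)))"
    by (rule symm_xsum) (rule symm_Cons[OF assms(1) assms(2)])
qed

lemma altern_dsum_self:
  assumes "altern S f" "\<And>a. a \<in> S \<Longrightarrow> D a \<in> S"
  shows "altern S (\<lambda>as. dsum D as f)"
proof (rule altern_cong)
  show "asum as (\<lambda>a bs. f (D a # bs)) = dsum D as f" if "set as \<subseteq> S" for as
    by (rule altern_dsum[OF assms(1) that assms(2), symmetric])
  show "altern S (\<lambda>as. asum as (\<lambda>a bs. f (D a # bs)))"
    by (rule altern_asum) (rule altern_Cons[OF assms(1) assms(2)])
qed

lemma symm_asum_param:
  assumes "set as \<subseteq> S" "\<And>a bs. a \<in> S \<Longrightarrow> set bs \<subseteq> S \<Longrightarrow> symm T (\<lambda>ys. g a bs ys)"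
  shows "symm T (\<lambda>ys. asum as (\<lambda>a bs. g a bs ys))"
  by (rule symmI, rule asum_cong[OF assms(1)]) (rule symm_swap[OF assms(2)])

lemma altern_asum_param:
  assumes "set as \<subseteq> S" "\<And>a bs. a \<in> S \<Longrightarrow> set bs \<subseteq> S \<Longrightarrow> altern T (\<lambda>ys. g a bs ys)"
  shows "altern T (\<lambda>ys. asum as (\<lambda>a bs. g a bs ys))"
  by (rule alternI, subst asum_minus[symmetric], rule asum_cong[OF assms(1)]) (rule altern_swap[OF assms(2)])

lemma altern_xsum_param:
  assumes "set as \<subseteq> S" "\<And>a bs. a \<in> S \<Longrightarrow> set bs \<subseteq> S \<Longrightarrow> altern T (\<lambda>ys. g a bs ys)"
  shows "altern T (\<lambda>ys. xsum as (\<lambda>a bs. g a bs ys))"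
  by (rule alternI, subst xsum_minus[symmetric], rule xsum_cong[OF assms(1)]) (rule altern_swap[OF assms(2)])

lemma symm_bsum_param:
  assumes "set as \<subseteq> S" "\<And>a b cs. a \<in> S \<Longrightarrow> b \<in> S \<Longrightarrow> set cs \<subseteq> S \<Longrightarrow> symm T (\<lambda>ys. g a b cs ys)"
  shows "symm T (\<lambda>ys. bsum as (\<lambda>a b cs. g a b cs ys))"
  by (rule symmI, rule bsum_cong[OF assms(1)]) (rule symm_swap[OF assms(2)])

lemma altern_bsum_param:
  assumes "set as \<subseteq> S" "\<And>a b cs. a \<in> S \<Longrightarrow> b \<in> S \<Longrightarrow> set cs \<subseteq> S \<Longrightarrow> altern T (\<lambda>ys. g a b cs ys)"
  shows "altern T (\<lambda>ys. bsum as (\<lambda>a b cs. g a b cs ys))"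
  by (rule alternI, subst bsum_minus[symmetric], rule bsum_cong[OF assms(1)]) (rule altern_swap[OF assms(2)])

lemma symm_dsum_param:
  assumes "set as \<subseteq> S" "\<And>a. a \<in> S \<Longrightarrow> D a \<in> S" "\<And>bs. set bs \<subseteq> S \<Longrightarrow> symm T (\<lambda>ys. g bs ys)"
  shows "symm T (\<lambda>ys. dsum D as (\<lambda>bs. g bs ys))"
  by (rule symmI, rule dsum_cong[OF assms(1,2)], assumption) (rule symm_swap[OF assms(3)])

lemma altern_dsum_param:
  assumes "set as \<subseteq> S" "\<And>a. a \<in> S \<Longrightarrow> D a \<in> S" "\<And>bs. set bs \<subseteq> S \<Longrightarrow> altern T (\<lambda>ys. g bs ys)"
  shows "altern T (\<lambda>ys. dsum D as (\<lambda>bs. g bs ys))"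
  by (rule alternI, subst dsum_minus[symmetric], rule dsum_cong[OF assms(1,2)], assumption) (rule altern_swap[OF assms(3)])

subsection \<open>Linear maps applied to sums of functions\<close>

text \<open>
  Sections form a linear subspace of a function space but not a type of their own; linearity is
  therefore relative to a set \<open>P\<close> of functions.
\<close>

definition subsp :: "('x \<Rightarrow> 'v::real_vector) set \<Rightarrow> bool" where
  "subsp P \<longleftrightarrow> (\<lambda>x. 0) \<in> P \<and> (\<forall>s\<in>P. \<forall>t\<in>P. \<forall>r q. (\<lambda>x. r *\<^sub>R s x + q *\<^sub>R t x) \<in> P)"

definition linon :: "('x \<Rightarrow> 'v::real_vector) set \<Rightarrow> (('x \<Rightarrow> 'v) \<Rightarrow> ('y \<Rightarrow> 'w::real_vector)) \<Rightarrow> bool" where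
  "linon P T \<longleftrightarrow> (\<forall>s\<in>P. \<forall>t\<in>P. \<forall>r q.
     T (\<lambda>x. r *\<^sub>R s x + q *\<^sub>R t x) = (\<lambda>x. r *\<^sub>R T s x + q *\<^sub>R T t x))"

lemma subsp_zero: "subsp P \<Longrightarrow> (\<lambda>x. 0) \<in> P"
  by (simp add: subsp_def)
lemma subsp_add: "subsp P \<Longrightarrow> s \<in> P \<Longrightarrow> t \<in> P \<Longrightarrow> (\<lambda>x. s x + t x) \<in> P"
  unfolding subsp_def by (drule conjunct2, drule (1) bspec, drule (1) bspec,
    drule spec[of _ 1], drule spec[of _ 1]) simp
lemma subsp_diff: "subsp P \<Longrightarrow> s \<in> P \<Longrightarrow> t \<in> P \<Longrightarrow> (\<lambda>x. s x - t x) \<in> P"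
  unfolding subsp_def by (drule conjunct2, drule (1) bspec, drule (1) bspec,
    drule spec[of _ 1], drule spec[of _ "-1"]) simp
lemma subsp_scaleR: "subsp P \<Longrightarrow> s \<in> P \<Longrightarrow> (\<lambda>x. r *\<^sub>R s x) \<in> P"
  unfolding subsp_def by (drule conjunct2, drule (1) bspec, drule (1) bspec,
    drule spec[of _ r], drule spec[of _ "0"]) simp
lemma subsp_minus: "subsp P \<Longrightarrow> s \<in> P \<Longrightarrow> (\<lambda>x. - s x) \<in> P"
  using subsp_scaleR[of P s "-1"] by simp

lemma linon_add: "linon P T \<Longrightarrow> s \<in> P \<Longrightarrow> t \<in> P \<Longrightarrow> T (\<lambda>x. s x + t x) = (\<lambda>x. T s x + T t x)"
  unfolding linon_def by (drule (1) bspec, drule (1) bspec,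
    drule spec[of _ 1], drule spec[of _ "1"]) simp
lemma linon_diff: "linon P T \<Longrightarrow> s \<in> P \<Longrightarrow> t \<in> P \<Longrightarrow> T (\<lambda>x. s x - t x) = (\<lambda>x. T s x - T t x)"
  unfolding linon_def by (drule (1) bspec, drule (1) bspec,
    drule spec[of _ 1], drule spec[of _ "-1"]) simp
lemma linon_scaleR: "linon P T \<Longrightarrow> s \<in> P \<Longrightarrow> T (\<lambda>x. r *\<^sub>R s x) = (\<lambda>x. r *\<^sub>R T s x)"
  unfolding linon_def by (drule (1) bspec, drule (1) bspec,
    drule spec[of _ r], drule spec[of _ "0"]) simp
lemma linon_zero: "linon P T \<Longrightarrow> subsp P \<Longrightarrow> T (\<lambda>x. 0) = (\<lambda>x. 0)"
  using linon_scaleR[of P T "\<lambda>x. 0" 0] subsp_zero[of P] by simp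
lemma linon_minus: "linon P T \<Longrightarrow> s \<in> P \<Longrightarrow> T (\<lambda>x. - s x) = (\<lambda>x. - T s x)"
  using linon_scaleR[of P T s "-1"] by simp

lemma altern_lin:
  assumes T: "linon P T" and f: "\<And>x. altern S (\<lambda>xs. f xs x)"
    and v: "\<And>xs. set xs \<subseteq> S \<Longrightarrow> f xs \<in> P"
  shows "altern S (\<lambda>xs. T (f xs) x)"
proof (rule alternI)
  fix ps qs a b assume *: "a \<in> S" "b \<in> S" "set ps \<subseteq> S" "set qs \<subseteq> S"
  have "f (ps @ a # b # qs) = (\<lambda>x. - f (ps @ b # a # qs) x)"
    using altern_swap[OF f *] by (simp add: fun_eq_iff)
  then show "T (f (ps @ a # b # qs)) x = - T (f (ps @ b # a # qs)) x"
    using linon_minus[OF T v[of "ps @ b # a # qs"]] * by simp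
qed

lemma subsp_asum:
  assumes "subsp P" "set Xs \<subseteq> S"
    and "\<And>X Ys. X \<in> S \<Longrightarrow> set Ys \<subseteq> S \<Longrightarrow> Suc (length Ys) = length Xs \<Longrightarrow> g X Ys \<in> P"
  shows "(\<lambda>x. asum Xs (\<lambda>X Ys. g X Ys x)) \<in> P"
  using assms(2,3)
proof (induction Xs arbitrary: g)
  case (Cons X Xs)
  show ?case unfolding asum.simps using Cons.prems by (intro subsp_diff[OF assms(1)] Cons.IH) auto
qed (simp add: subsp_zero[OF assms(1)])

lemma subsp_xsum:
  assumes "subsp P" "set Xs \<subseteq> S"
    and "\<And>X Ys. X \<in> S \<Longrightarrow> set Ys \<subseteq> S \<Longrightarrow> Suc (length Ys) = length Xs \<Longrightarrow> g X Ys \<in> P"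
  shows "(\<lambda>x. xsum Xs (\<lambda>X Ys. g X Ys x)) \<in> P"
  using assms(2,3)
proof (induction Xs arbitrary: g)
  case (Cons X Xs)
  show ?case unfolding xsum.simps using Cons.prems by (intro subsp_add[OF assms(1)] Cons.IH) auto
qed (simp add: subsp_zero[OF assms(1)])

lemma subsp_bsum:
  assumes "subsp P" "set Xs \<subseteq> S"
    and "\<And>X Y Ys. X \<in> S \<Longrightarrow> Y \<in> S \<Longrightarrow> set Ys \<subseteq> S \<Longrightarrow> g X Y Ys \<in> P"
  shows "(\<lambda>x. bsum Xs (\<lambda>X Y Ys. g X Y Ys x)) \<in> P"
  using assms(2,3)
proof (induction Xs arbitrary: g)
  case (Cons X Xs)
  show ?case unfolding bsum.simps
    using Cons.prems by (intro subsp_diff[OF assms(1)] Cons.IH subsp_asum[OF assms(1), where S = S]) auto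
qed (simp add: subsp_zero[OF assms(1)])

lemma subsp_dsum:
  assumes "subsp P" "set Xs \<subseteq> S" "\<And>X. X \<in> S \<Longrightarrow> D X \<in> S"
    and "\<And>Ys. set Ys \<subseteq> S \<Longrightarrow> g Ys \<in> P"
  shows "(\<lambda>x. dsum D Xs (\<lambda>Ys. g Ys x)) \<in> P"
  using assms(2,4)
proof (induction Xs arbitrary: g)
  case (Cons X Xs)
  show ?case unfolding dsum.simps using Cons.prems assms(3) by (intro subsp_add[OF assms(1)] Cons.IH) auto
qed (simp add: subsp_zero[OF assms(1)])

lemma linon_asum:
  assumes "linon P T" "subsp P" "set Xs \<subseteq> S"
    and "\<And>X Ys. X \<in> S \<Longrightarrow> set Ys \<subseteq> S \<Longrightarrow> Suc (length Ys) = length Xs \<Longrightarrow> g X Ys \<in> P"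
  shows "T (\<lambda>x. asum Xs (\<lambda>X Ys. g X Ys x)) y = asum Xs (\<lambda>X Ys. T (g X Ys) y)"
  using assms(3,4)
proof (induction Xs arbitrary: g)
  case (Cons X Xs)
  have a: "T (\<lambda>x. asum Xs (\<lambda>Y Ys. g Y (X # Ys) x)) y = asum Xs (\<lambda>Y Ys. T (g Y (X # Ys)) y)"
    using Cons.prems by (intro Cons.IH) auto
  have "T (\<lambda>x. g X Xs x - asum Xs (\<lambda>Y Ys. g Y (X # Ys) x)) y =
      T (g X Xs) y - T (\<lambda>x. asum Xs (\<lambda>Y Ys. g Y (X # Ys) x)) y"
    using Cons.prems
    by (subst linon_diff[OF assms(1)]) (auto intro!: subsp_asum[OF assms(2), where S = S])
  then show ?case unfolding asum.simps a .
qed (simp add: linon_zero[OF assms(1,2)])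

lemma linon_xsum:
  assumes "linon P T" "subsp P" "set Xs \<subseteq> S"
    and "\<And>X Ys. X \<in> S \<Longrightarrow> set Ys \<subseteq> S \<Longrightarrow> Suc (length Ys) = length Xs \<Longrightarrow> g X Ys \<in> P"
  shows "T (\<lambda>x. xsum Xs (\<lambda>X Ys. g X Ys x)) y = xsum Xs (\<lambda>X Ys. T (g X Ys) y)"
  using assms(3,4)
proof (induction Xs arbitrary: g)
  case (Cons X Xs)
  have a: "T (\<lambda>x. xsum Xs (\<lambda>Y Ys. g Y (X # Ys) x)) y = xsum Xs (\<lambda>Y Ys. T (g Y (X # Ys)) y)"
    using Cons.prems by (intro Cons.IH) auto
  have "T (\<lambda>x. g X Xs x + xsum Xs (\<lambda>Y Ys. g Y (X # Ys) x)) y =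
      T (g X Xs) y + T (\<lambda>x. xsum Xs (\<lambda>Y Ys. g Y (X # Ys) x)) y"
    using Cons.prems
    by (subst linon_add[OF assms(1)]) (auto intro!: subsp_xsum[OF assms(2), where S = S])
  then show ?case unfolding xsum.simps a .
qed (simp add: linon_zero[OF assms(1,2)])

lemma linon_bsum:
  assumes "linon P T" "subsp P" "set Xs \<subseteq> S"
    and "\<And>X Y Ys. X \<in> S \<Longrightarrow> Y \<in> S \<Longrightarrow> set Ys \<subseteq> S \<Longrightarrow> g X Y Ys \<in> P"
  shows "T (\<lambda>x. bsum Xs (\<lambda>X Y Ys. g X Y Ys x)) y = bsum Xs (\<lambda>X Y Ys. T (g X Y Ys) y)"
  using assms(3,4)
proof (induction Xs arbitrary: g)
  case (Cons X Xs)
  have a: "T (\<lambda>x. bsum Xs (\<lambda>Y Z Ys. g Y Z (X # Ys) x)) y = bsum Xs (\<lambda>Y Z Ys. T (g Y Z (X # Ys)) y)"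
    using Cons.prems by (intro Cons.IH) auto
  have b: "T (\<lambda>x. asum Xs (\<lambda>Y Ys. g X Y Ys x)) y = asum Xs (\<lambda>Y Ys. T (g X Y Ys) y)"
    using Cons.prems by (intro linon_asum[OF assms(1,2), where S = S]) auto
  have "T (\<lambda>x. bsum Xs (\<lambda>Y Z Ys. g Y Z (X # Ys) x) - asum Xs (\<lambda>Y Ys. g X Y Ys x)) y =
      T (\<lambda>x. bsum Xs (\<lambda>Y Z Ys. g Y Z (X # Ys) x)) y - T (\<lambda>x. asum Xs (\<lambda>Y Ys. g X Y Ys x)) y"
    using Cons.prems
    by (subst linon_diff[OF assms(1)]) (auto intro!: subsp_bsum[OF assms(2), where S = S] subsp_asum[OF assms(2), where S = S])
  then show ?case unfolding bsum.simps a b .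
qed (simp add: linon_zero[OF assms(1,2)])

lemma linon_dsum:
  assumes "linon P T" "subsp P" "set Xs \<subseteq> S" "\<And>X. X \<in> S \<Longrightarrow> D X \<in> S"
    and "\<And>Ys. set Ys \<subseteq> S \<Longrightarrow> g Ys \<in> P"
  shows "T (\<lambda>x. dsum D Xs (\<lambda>Ys. g Ys x)) y = dsum D Xs (\<lambda>Ys. T (g Ys) y)"
  using assms(3,5)
proof (induction Xs arbitrary: g)
  case (Cons X Xs)
  have a: "T (\<lambda>x. dsum D Xs (\<lambda>Ys. g (X # Ys) x)) y = dsum D Xs (\<lambda>Ys. T (g (X # Ys)) y)"
    using Cons.prems by (intro Cons.IH) auto
  have "T (\<lambda>x. g (D X # Xs) x + dsum D Xs (\<lambda>Ys. g (X # Ys) x)) y = T (g (D X # Xs)) y + T (\<lambda>x. dsum D Xs (\<lambda>Ys. g (X # Ys) x)) y"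
    using Cons.prems assms(4)
    by (subst linon_add[OF assms(1)]) (auto intro!: subsp_dsum[OF assms(2), where S = S])
  then show ?case unfolding dsum.simps a .
qed (simp add: linon_zero[OF assms(1,2)])

section \<open>Sums over permutations and shuffles\<close>

text \<open>
  The cycle that sends \<open>a\<close> to \<open>a + b\<close> and lowers the numbers in between by one.
\<close>

primrec rot :: "nat \<Rightarrow> nat \<Rightarrow> nat \<Rightarrow> nat" where
  "rot a 0 = id"
| "rot a (Suc b) = Transposition.transpose (a + b) (Suc (a + b)) \<circ> rot a b"

lemma rot_apply: "rot a b i = (if i = a then a + b else if a < i \<and> i \<le> a + b then i - 1 else i)"
  by (induction b) (auto simp: Transposition.transpose_def)

lemma rot_permutes: "rot a b permutes {a..a + b}"
proof (induction b)
  case 0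
  show ?case unfolding rot.simps by (rule permutes_id)
next
  case (Suc b)
  have "rot a b permutes {a..a + Suc b}" by (rule permutes_subset[OF Suc]) auto
  moreover have "Transposition.transpose (a + b) (Suc (a + b)) permutes {a..a + Suc b}"
    by (rule permutes_swap_id) auto
  ultimately show ?case unfolding rot.simps by (rule permutes_compose)
qed

lemma rot_permutes': "a + b < n \<Longrightarrow> rot a b permutes {..<n}"
  by (rule permutes_subset[OF rot_permutes]) auto

lemma bij_rot: "bij (rot a b)"
  by (rule permutes_bij[OF rot_permutes])

lemma sign_rot: "sign (rot a b) = (-1) ^ b"
proof (induction b)
  case (Suc b)
  have "permutation (rot a b)" using rot_permutes permutation_permutes by blast
  then show ?case using Suc unfolding rot.simps
    by (subst sign_compose) (auto simp: permutation_swap_id sign_swap_id)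
qed (simp add: sign_id)

lemma inv_rot_rot [simp]: "inv (rot a b) (rot a b i) = i" "rot a b (inv (rot a b) i) = i"
  using bij_rot[of a b] by (simp_all add: bij_def surj_f_inv_f)

lemma inv_rot_apply:
  "inv (rot a b) i = (if i = a + b then a else if a \<le> i \<and> i < a + b then Suc i else i)"
proof -
  have "rot a b (if i = a + b then a else if a \<le> i \<and> i < a + b then Suc i else i) = i"
    by (auto simp: rot_apply)
  from arg_cong[OF this, of "inv (rot a b)"] show ?thesis unfolding inv_rot_rot by (rule sym)
qed

declare rot.simps [simp del]

definition psum :: "'b list \<Rightarrow> ('b list \<Rightarrow> 'v::real_vector) \<Rightarrow> 'v" where
  "psum Xs f = (\<Sum>\<sigma> | \<sigma> permutes {..<length Xs}. of_int (sign \<sigma>) *\<^sub>R f (map (\<lambda>i. Xs ! \<sigma> i) [0..<length Xs]))"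

lemma nth_omit: "i < length xs \<Longrightarrow> j < length xs \<Longrightarrow> omit j xs ! i = (if i < j then xs ! i else xs ! Suc i)"
  by (auto simp: omit_def nth_append min_def)

lemma minus_one_pow_diff: "j \<le> n \<Longrightarrow> (-1) ^ (n - j) * (-1) ^ n = (-1 :: 'r::comm_ring_1) ^ j"
  by (simp add: minus_one_power_iff)

lemma psum_Nil: "psum [] f = f []"
  by (simp add: psum_def sign_id)

lemma sign_permutes_comp:
  "p permutes S \<Longrightarrow> q permutes T \<Longrightarrow> finite S \<Longrightarrow> finite T \<Longrightarrow> sign (p \<circ> q) = sign p * sign q"
  by (meson permutation_permutes sign_compose)

text \<open>
  A permutation is determined by the image \<open>j\<close> of the first position and by the permutation that it
  induces between the remaining positions and the remaining values.  Composing with two cycles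
  turns the latter into a permutation of an initial segment; the two cycles contribute
  the sign \<open>(-1) ^ j\<close>.
\<close>

lemma psum_Cons:
  assumes "Xs \<noteq> []"
  shows "psum Xs f = asum Xs (\<lambda>X Ys. psum Ys (\<lambda>Zs. f (X # Zs)))"
proof -
  obtain n where n: "length Xs = Suc n" using assms by (cases Xs) auto
  define F where "F \<sigma> = of_int (sign \<sigma>) *\<^sub>R f (map (\<lambda>i. Xs ! \<sigma> i) [0..<Suc n])" for \<sigma>
  \<comment> \<open>\<open>\<Phi> (j, \<tau>)\<close> has the first value \<open>j\<close> and acts by \<open>\<tau>\<close> on the rest; \<open>\<Psi>\<close> is its inverse.\<close>
  define \<Phi> where "\<Phi> = (\<lambda>(j, \<tau>). inv (rot j (n - j)) \<circ> \<tau> \<circ> rot 0 n)"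
  define \<Psi> where "\<Psi> \<sigma> = (\<sigma> 0, rot (\<sigma> 0) (n - \<sigma> 0) \<circ> \<sigma> \<circ> inv (rot 0 n))" for \<sigma> :: "nat \<Rightarrow> nat"
  have perm\<Phi>: "\<Phi> (j, \<tau>) permutes {..<Suc n}" if "j < Suc n" "\<tau> permutes {..<n}" for j \<tau>
    unfolding \<Phi>_def prod.case using that
    by (intro permutes_compose rot_permutes' permutes_inv permutes_subset[OF that(2)]) auto
  have \<Phi>0: "\<Phi> (j, \<tau>) 0 = j" if "j < Suc n" "\<tau> permutes {..<n}" for j \<tau>
    using that permutes_not_in[OF that(2), of n] by (simp add: \<Phi>_def rot_apply inv_rot_apply)
  have "sum F {\<sigma>. \<sigma> permutes {..<Suc n}} = sum (F \<circ> \<Phi>) ({..<Suc n} \<times> {\<tau>. \<tau> permutes {..<n}})"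
  proof (rule sum.reindex_bij_witness[where i = \<Phi> and j = \<Psi>])
    fix \<sigma> assume "\<sigma> \<in> {\<sigma>. \<sigma> permutes {..<Suc n}}"
    then have \<sigma>: "\<sigma> permutes {..<Suc n}" by simp
    have s0: "\<sigma> 0 < Suc n" using permutes_in_image[OF \<sigma>, of 0] by simp
    show *: "\<Phi> (\<Psi> \<sigma>) = \<sigma>" by (auto simp: \<Phi>_def \<Psi>_def fun_eq_iff)
    have "rot (\<sigma> 0) (n - \<sigma> 0) \<circ> \<sigma> \<circ> inv (rot 0 n) permutes {..<n}"
    proof (rule permutes_superset)
      show "rot (\<sigma> 0) (n - \<sigma> 0) \<circ> \<sigma> \<circ> inv (rot 0 n) permutes {..<Suc n}"
        using s0 by (intro permutes_compose rot_permutes' permutes_inv \<sigma>) auto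
      fix x assume "x \<in> {..<Suc n} - {..<n}"
      then have "x = n" by auto
      then show "(rot (\<sigma> 0) (n - \<sigma> 0) \<circ> \<sigma> \<circ> inv (rot 0 n)) x = x"
        using s0 by (simp add: inv_rot_apply rot_apply)
    qed
    then show "\<Psi> \<sigma> \<in> {..<Suc n} \<times> {\<tau>. \<tau> permutes {..<n}}" using s0 by (simp add: \<Psi>_def)
    show "(F \<circ> \<Phi>) (\<Psi> \<sigma>) = F \<sigma>" using * by simp
  next
    fix p assume "p \<in> {..<Suc n} \<times> {\<tau>. \<tau> permutes {..<n}}"
    then obtain j \<tau> where p: "p = (j, \<tau>)" and j: "j < Suc n" and \<tau>: "\<tau> permutes {..<n}" by auto
    show "\<Psi> (\<Phi> p) = p" using \<Phi>0[OF j \<tau>] by (simp add: \<Psi>_def p) (simp add: \<Phi>_def fun_eq_iff)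
    show "\<Phi> p \<in> {\<sigma>. \<sigma> permutes {..<Suc n}}" using perm\<Phi>[OF j \<tau>] p by simp
  qed
  also have "\<dots> = (\<Sum>j<Suc n. \<Sum>\<tau> | \<tau> permutes {..<n}. F (\<Phi> (j, \<tau>)))"
    by (simp add: sum.cartesian_product' )
  also have "\<dots> = (\<Sum>j<Suc n. (-1) ^ j *\<^sub>R psum (omit j Xs) (\<lambda>Zs. f (Xs ! j # Zs)))"
  proof (rule sum.cong[OF refl])
    fix j assume "j \<in> {..<Suc n}"
    then have j: "j < Suc n" by simp
    have len: "length (omit j Xs) = n" using length_omit[of j Xs] j n by simp
    have "F (\<Phi> (j, \<tau>)) = (-1) ^ j *\<^sub>R of_int (sign \<tau>) *\<^sub>R f (Xs ! j # map (\<lambda>i. omit j Xs ! \<tau> i) [0..<n])"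
      if \<tau>: "\<tau> permutes {..<n}" for \<tau>
    proof -
      have "sign (\<Phi> (j, \<tau>)) = (-1) ^ (n - j) * sign \<tau> * (-1) ^ n"
      proof -
        have a: "inv (rot j (n - j)) permutes {..<Suc n}" "\<tau> permutes {..<Suc n}" "rot 0 n permutes {..<Suc n}"
          using j by (intro permutes_inv rot_permutes' permutes_subset[OF \<tau>]; auto)+
        have "permutation (rot j (n - j))" using permutation_permutes rot_permutes by blast
        then show ?thesis unfolding \<Phi>_def prod.case
          using a by (simp add: sign_permutes_comp[OF permutes_compose[OF a(2,1)] a(3)]
            sign_permutes_comp[OF a(1,2)] sign_inverse sign_rot)
      qed
      also have "\<dots> = (-1) ^ j * sign \<tau>"
      proof -
        have "(-1::int) ^ (n - j) * (-1) ^ n = (-1) ^ j"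
          using j minus_one_pow_diff[of j n] by simp
        then show ?thesis by (simp add: ac_simps)
      qed
      finally have sg: "sign (\<Phi> (j, \<tau>)) = (-1) ^ j * sign \<tau>" .
      have "Xs ! \<Phi> (j, \<tau>) (Suc i) = omit j Xs ! \<tau> i" if "i < n" for i
      proof -
        have "\<tau> i < n" using permutes_in_image[OF \<tau>, of i] that by simp
        then show ?thesis using j that n nth_omit[of "\<tau> i" Xs j]
          by (auto simp: \<Phi>_def rot_apply inv_rot_apply)
      qed
      then have "map (\<lambda>i. Xs ! \<Phi> (j, \<tau>) i) [0..<Suc n] = Xs ! j # map (\<lambda>i. omit j Xs ! \<tau> i) [0..<n]"
        unfolding map_upt_Suc by (simp add: \<Phi>0[OF j \<tau>])
      then show ?thesis unfolding F_def sg by simp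
    qed
    then have "(\<Sum>\<tau> | \<tau> permutes {..<n}. F (\<Phi> (j, \<tau>))) =
        (\<Sum>\<tau> | \<tau> permutes {..<n}. (-1) ^ j *\<^sub>R of_int (sign \<tau>) *\<^sub>R
          f (Xs ! j # map (\<lambda>i. omit j Xs ! \<tau> i) [0..<n]))"
      by (intro sum.cong) auto
    then show "(\<Sum>\<tau> | \<tau> permutes {..<n}. F (\<Phi> (j, \<tau>))) = (-1) ^ j *\<^sub>R psum (omit j Xs) (\<lambda>Zs. f (Xs ! j # Zs))"
      unfolding psum_def len scaleR_sum_right by simp
  qed
  also have "\<dots> = asum Xs (\<lambda>X Ys. psum Ys (\<lambda>Zs. f (X # Zs)))"
    using asum_eq_sum[of "\<lambda>X Ys. psum Ys (\<lambda>Zs. f (X # Zs))" Xs] n by simp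
  finally show ?thesis unfolding psum_def n F_def .
qed

lemma psum_altern:
  assumes "altern S f" "set Xs \<subseteq> S"
  shows "psum Xs f = fact (length Xs) *\<^sub>R f Xs"
  using assms
proof (induction "length Xs" arbitrary: Xs f)
  case 0
  then show ?case by (simp add: psum_Nil)
next
  case (Suc n)
  have "psum Xs f = asum Xs (\<lambda>X Ys. psum Ys (\<lambda>Zs. f (X # Zs)))"
    using Suc by (intro psum_Cons) auto
  also have "\<dots> = asum Xs (\<lambda>X Ys. fact n *\<^sub>R f (X # Ys))"
  proof (rule asum_cong[OF Suc.prems(2)])
    fix X Ys assume "X \<in> S" "set Ys \<subseteq> S" "Suc (length Ys) = length Xs"
    moreover from this have "length Ys = n" using Suc.hyps(2) by simp
    ultimately show "psum Ys (\<lambda>Zs. f (X # Zs)) = fact n *\<^sub>R f (X # Ys)"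
      using Suc.hyps(1)[of Ys "\<lambda>Zs. f (X # Zs)"] Suc.hyps(2) altern_Cons[OF Suc.prems(1)] by simp
  qed
  also have "\<dots> = fact n *\<^sub>R real (length Xs) *\<^sub>R f Xs"
    by (simp add: asum_scaleR altern_asum_Cons[OF Suc.prems])
  finally show ?case unfolding Suc.hyps(2)[symmetric] by (simp add: algebra_simps)
qed

subsection \<open>Iterated extraction\<close>

text \<open>
  Extraction of \<open>l\<close> entries one after the other: a set of \<open>l\<close> positions contributes once for each of
  its \<open>fact l\<close> orderings.
\<close>

primrec asumn :: "nat \<Rightarrow> 'b list \<Rightarrow> ('b list \<Rightarrow> 'b list \<Rightarrow> 'v::ab_group_add) \<Rightarrow> 'v" where
  "asumn 0 as f = f [] as"
| "asumn (Suc l) as f = asum as (\<lambda>a bs. asumn l bs (\<lambda>cs ds. f (a # cs) ds))"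

lemma asumn_cong:
  assumes "set as \<subseteq> S"
    and "\<And>xs ys. set xs \<subseteq> S \<Longrightarrow> set ys \<subseteq> S \<Longrightarrow> length xs = l \<Longrightarrow> length ys + l = length as \<Longrightarrow> f xs ys = g xs ys"
  shows "asumn l as f = asumn l as g"
  using assms
proof (induction l arbitrary: as f g)
  case (Suc l)
  show ?case unfolding asumn.simps
    by (rule asum_cong[OF Suc.prems(1)], rule Suc.IH) (auto intro!: Suc.prems(2))
qed simp

lemma asumn_scaleR: "asumn l as (\<lambda>xs ys. r *\<^sub>R f xs ys) = r *\<^sub>R (asumn l as f :: 'v::real_vector)"
  by (induction l arbitrary: as f) (simp_all add: asum_scaleR)

lemma asumn_asum_fubini:
  "asum Xs (\<lambda>X Ys. asumn l as (\<lambda>bs cs. g X Ys bs cs)) = asumn l as (\<lambda>bs cs. asum Xs (\<lambda>X Ys. g X Ys bs cs))"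
proof (induction l arbitrary: as g)
  case (Suc l)
  show ?case unfolding asumn.simps Suc[symmetric] by (rule asum_asum_fubini)
qed simp

lemma asum_snoc:
  fixes f :: "'b \<Rightarrow> 'b list \<Rightarrow> 'v::real_vector"
  shows "asum (as @ [a]) f = asum as (\<lambda>b bs. f b (bs @ [a])) + (-1) ^ length as *\<^sub>R f a as"
  by (induction as arbitrary: f) simp_all

text \<open>
  The last entry of the list either remains or is extracted.  In the second case it can be moved to
  the end of the extracted entries, and the \<open>Suc l\<close> turns in which it may have been extracted
  contribute equally.
\<close>

lemma asumn_snoc:
  fixes g :: "'b list \<Rightarrow> 'b list \<Rightarrow> 'v::real_vector"
  assumes "\<And>ys. set ys \<subseteq> S \<Longrightarrow> altern S (\<lambda>xs. g xs ys)" "set as \<subseteq> S" "a \<in> S" "l \<le> length as"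
  shows "asumn (Suc l) (as @ [a]) g = asumn (Suc l) as (\<lambda>xs ys. g xs (ys @ [a]))
    + (real (Suc l) * (-1) ^ (length as - l)) *\<^sub>R asumn l as (\<lambda>xs ys. g (xs @ [a]) ys)"
  using assms
proof (induction l arbitrary: as g)
  case 0
  then show ?case by (simp add: asum_snoc)
next
  case (Suc l)
  let ?r = "real (Suc l) * (-1) ^ (length as - Suc l) :: real"
  have "asumn (Suc (Suc l)) (as @ [a]) g = asum (as @ [a]) (\<lambda>b bs. asumn (Suc l) bs (\<lambda>cs ds. g (b # cs) ds))"
    by simp
  also have "\<dots> = asum as (\<lambda>b bs. asumn (Suc l) (bs @ [a]) (\<lambda>cs ds. g (b # cs) ds))
      + (-1) ^ length as *\<^sub>R asumn (Suc l) as (\<lambda>cs ds. g (a # cs) ds)"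
    by (rule asum_snoc)
  also have "asum as (\<lambda>b bs. asumn (Suc l) (bs @ [a]) (\<lambda>cs ds. g (b # cs) ds)) =
      asum as (\<lambda>b bs. asumn (Suc l) bs (\<lambda>cs ds. g (b # cs) (ds @ [a])) + ?r *\<^sub>R asumn l bs (\<lambda>cs ds. g (b # cs @ [a]) ds))"
  proof (rule asum_cong[OF Suc.prems(2)])
    fix b bs assume b: "b \<in> S" "set bs \<subseteq> S" "Suc (length bs) = length as"
    have "asumn (Suc l) (bs @ [a]) (\<lambda>cs ds. g (b # cs) ds) =
        asumn (Suc l) bs (\<lambda>cs ds. g (b # cs) (ds @ [a]))
        + (real (Suc l) * (-1) ^ (length bs - l)) *\<^sub>R asumn l bs (\<lambda>cs ds. g (b # cs @ [a]) ds)"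
    proof (rule Suc.IH[of "\<lambda>cs. g (b # cs)" bs, unfolded append_Cons])
      show "altern S (\<lambda>xs. g (b # xs) ys)" if "set ys \<subseteq> S" for ys
        using altern_Cons[OF Suc.prems(1)[OF that] b(1)] .
    qed (use Suc.prems b in auto)
    moreover have "length as - Suc l = length bs - l" using b by simp
    ultimately show "asumn (Suc l) (bs @ [a]) (\<lambda>cs ds. g (b # cs) ds) =
      asumn (Suc l) bs (\<lambda>cs ds. g (b # cs) (ds @ [a])) + ?r *\<^sub>R asumn l bs (\<lambda>cs ds. g (b # cs @ [a]) ds)"
      by simp
  qed
  also have "\<dots> = asumn (Suc (Suc l)) as (\<lambda>xs ys. g xs (ys @ [a])) + ?r *\<^sub>R asumn (Suc l) as (\<lambda>xs ys. g (xs @ [a]) ys)"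
    by (simp add: asum_add asum_scaleR)
  also have "asumn (Suc l) as (\<lambda>cs ds. g (a # cs) ds) = asumn (Suc l) as (\<lambda>cs ds. (-1) ^ Suc l *\<^sub>R g (cs @ [a]) ds)"
  proof (rule asumn_cong[OF Suc.prems(2)])
    fix xs ys assume *: "set xs \<subseteq> S" "set ys \<subseteq> S" "length xs = Suc l"
    then have "g (xs @ [a]) ys = (-1) ^ Suc l *\<^sub>R g (a # xs) ys"
      using altern_move[OF Suc.prems(1)[OF *(2)] Suc.prems(3) *(1), of "[]"] by simp
    then show "g (a # xs) ys = (-1) ^ Suc l *\<^sub>R g (xs @ [a]) ys"
      by (simp add: minus_one_power_iff)
  qed
  also have "\<dots> = (-1) ^ Suc l *\<^sub>R asumn (Suc l) as (\<lambda>cs ds. g (cs @ [a]) ds)"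
    by (rule asumn_scaleR)
  also have "(-1) ^ length as *\<^sub>R (-1) ^ Suc l *\<^sub>R asumn (Suc l) as (\<lambda>cs ds. g (cs @ [a]) ds) =
      (-1) ^ (length as - Suc l) *\<^sub>R asumn (Suc l) as (\<lambda>cs ds. g (cs @ [a]) ds)"
  proof -
    have "(-1::real) ^ length as * (-1) ^ Suc l = (-1) ^ (length as - Suc l)"
      using Suc.prems(4) by (auto simp: minus_one_power_iff)
    then show ?thesis by (simp only: scaleR_scaleR)
  qed
  finally have "asumn (Suc (Suc l)) (as @ [a]) g =
      asumn (Suc (Suc l)) as (\<lambda>xs ys. g xs (ys @ [a]))
      + (?r + (-1) ^ (length as - Suc l)) *\<^sub>R asumn (Suc l) as (\<lambda>xs ys. g (xs @ [a]) ys)"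
    by (simp only: scaleR_add_left add.assoc)
  moreover have "?r + (-1) ^ (length as - Suc l) = real (Suc (Suc l)) * (-1) ^ (length as - Suc l)"
    by (simp add: algebra_simps)
  ultimately show ?case by (simp only:)
qed

lemma asumn_full:
  assumes "altern S (\<lambda>xs. g xs [])" "set as \<subseteq> S"
  shows "asumn (length as) as g = fact (length as) *\<^sub>R (g as [] :: 'v::real_vector)"
  using assms
proof (induction "length as" arbitrary: as g)
  case (Suc n)
  have "asumn (length as) as g = asum as (\<lambda>a bs. asumn n bs (\<lambda>cs ds. g (a # cs) ds))"
    unfolding Suc.hyps(2)[symmetric] by simp
  also have "\<dots> = asum as (\<lambda>a bs. fact n *\<^sub>R g (a # bs) [])"
  proof (rule asum_cong[OF Suc.prems(2)])
    fix a bs assume "a \<in> S" "set bs \<subseteq> S" "Suc (length bs) = length as"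
    moreover from this have "length bs = n" using Suc.hyps(2) by simp
    ultimately show "asumn n bs (\<lambda>cs ds. g (a # cs) ds) = fact n *\<^sub>R g (a # bs) []"
      using Suc.hyps(1)[of bs "\<lambda>xs. g (a # xs)"] Suc.hyps(2) altern_Cons[OF Suc.prems(1)] by simp
  qed
  also have "\<dots> = fact n *\<^sub>R real (length as) *\<^sub>R g as []"
    using altern_asum_Cons[OF Suc.prems] by (simp add: asum_scaleR)
  finally show ?case unfolding Suc.hyps(2)[symmetric] by (simp add: algebra_simps)
qed simp

definition ssum :: "nat \<Rightarrow> nat \<Rightarrow> 'b list \<Rightarrow> ('b list \<Rightarrow> 'b list \<Rightarrow> 'v::real_vector) \<Rightarrow> 'v" where
  "ssum l b as G = (\<Sum>\<sigma> \<in> shuffle_perms l b. of_int (sign \<sigma>) *\<^sub>R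
      G (map (\<lambda>i. as ! \<sigma> i) [0..<l]) (map (\<lambda>i. as ! \<sigma> i) [l..<l + b]))"

lemma permutes_strict_mono_id:
  assumes "\<sigma> permutes {..<n}" "strict_mono_on {..<n} \<sigma>"
  shows "\<sigma> = (id :: nat \<Rightarrow> nat)"
proof (rule permutes_natset_ge[OF assms(1)])
  have "i < n \<Longrightarrow> i \<le> \<sigma> i" for i
  proof (induction i)
    case (Suc i)
    then have "\<sigma> i < \<sigma> (Suc i)" using assms(2) by (auto simp: strict_mono_on_def)
    then show ?case using Suc by simp
  qed simp
  then show "\<forall>i\<in>{..<n}. i \<le> \<sigma> i" by simp
qed

lemma shuffle_perms_0: "shuffle_perms 0 b = {id}" "shuffle_perms l 0 = {id}"
proof -
  show "shuffle_perms 0 b = {id}"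
    using permutes_strict_mono_id[of _ b]
    by (auto simp: shuffle_perms_def permutes_id strict_mono_on_def lessThan_atLeast0)
  show "shuffle_perms l 0 = {id}"
    using permutes_strict_mono_id[of _ l]
    by (auto simp: shuffle_perms_def permutes_id strict_mono_on_def)
qed

lemma ssum_0: "length as = b \<Longrightarrow> ssum 0 b as G = G [] as"
  and ssum_full: "length as = l \<Longrightarrow> ssum l 0 as G = G as []"
  unfolding ssum_def shuffle_perms_0 by (auto simp: sign_id map_nth)

lemma strict_mono_onD': "strict_mono_on A f \<Longrightarrow> x \<in> A \<Longrightarrow> y \<in> A \<Longrightarrow> x < y \<Longrightarrow> f x < (f y :: nat)"
  for x y :: nat
  by (auto simp: strict_mono_on_def)

text \<open>
  The largest value of a shuffle sits at the end of one of the two blocks.  If it ends the first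
  block, a cycle moves it to the last position and leaves a shuffle with a shorter first block.
\<close>

lemma shuffle_perms_Suc:
  fixes l b :: nat
  defines "N \<equiv> Suc (l + b)"
  shows "shuffle_perms (Suc l) (Suc b) =
      shuffle_perms (Suc l) b \<union> (\<lambda>\<sigma>. \<sigma> \<circ> rot l (Suc b)) ` shuffle_perms l (Suc b)" (is "?L = ?A \<union> ?B")
    and "shuffle_perms (Suc l) b \<inter> (\<lambda>\<sigma>. \<sigma> \<circ> rot l (Suc b)) ` shuffle_perms l (Suc b) = {}"
proof -
  have A: "\<sigma> \<in> ?L" if "\<sigma> \<in> ?A" for \<sigma>
  proof -
    have p: "\<sigma> permutes {..<Suc l + b}" "strict_mono_on {..<Suc l} \<sigma>" "strict_mono_on {Suc l..<Suc l + b} \<sigma>"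
      using that by (auto simp: shuffle_perms_def)
    have N: "\<sigma> N = N" using permutes_not_in[OF p(1), of N] by (simp add: N_def)
    have lt: "\<sigma> i < N" if "i < N" for i using permutes_in_image[OF p(1), of i] that by (simp add: N_def)
    have "strict_mono_on {Suc l..<Suc l + Suc b} \<sigma>"
    proof (rule strict_mono_onI)
      fix r s assume rs: "r \<in> {Suc l..<Suc l + Suc b}" "s \<in> {Suc l..<Suc l + Suc b}" "r < s"
      show "\<sigma> r < \<sigma> s"
      proof (cases "s = N")
        case True
        then show ?thesis using N lt rs by simp
      next
        case False
        then show ?thesis using rs by (intro strict_mono_onD'[OF p(3)]) (auto simp: N_def)
      qed
    qed
    moreover have "\<sigma> permutes {..<Suc l + Suc b}" by (rule permutes_subset[OF p(1)]) auto
    ultimately show ?thesis using p(2) by (simp add: shuffle_perms_def)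
  qed
  have B: "\<sigma> \<circ> rot l (Suc b) \<in> ?L" if "\<sigma> \<in> shuffle_perms l (Suc b)" for \<sigma>
  proof -
    have p: "\<sigma> permutes {..<N}" "strict_mono_on {..<l} \<sigma>" "strict_mono_on {l..<l + Suc b} \<sigma>"
      using that by (auto simp: shuffle_perms_def N_def)
    have N: "\<sigma> N = N" using permutes_not_in[OF p(1), of N] by simp
    have lt: "\<sigma> i < N" if "i < N" for i using permutes_in_image[OF p(1), of i] that by simp
    have "\<sigma> \<circ> rot l (Suc b) permutes {..<Suc l + Suc b}"
      by (intro permutes_compose rot_permutes' permutes_subset[OF p(1)]) (auto simp: N_def)
    moreover have "strict_mono_on {..<Suc l} (\<sigma> \<circ> rot l (Suc b))"
    proof (rule strict_mono_onI)
      fix r s assume rs: "r \<in> {..<Suc l}" "s \<in> {..<Suc l}" "r < s"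
      show "(\<sigma> \<circ> rot l (Suc b)) r < (\<sigma> \<circ> rot l (Suc b)) s"
      proof (cases "s = l")
        case True
        then show ?thesis using N lt[of r] rs by (simp add: rot_apply N_def)
      next
        case False
        then show ?thesis using rs by (auto simp: rot_apply intro!: strict_mono_onD'[OF p(2)])
      qed
    qed
    moreover have "strict_mono_on {Suc l..<Suc l + Suc b} (\<sigma> \<circ> rot l (Suc b))"
    proof (rule strict_mono_onI)
      fix r s assume rs: "r \<in> {Suc l..<Suc l + Suc b}" "s \<in> {Suc l..<Suc l + Suc b}" "r < s"
      then show "(\<sigma> \<circ> rot l (Suc b)) r < (\<sigma> \<circ> rot l (Suc b)) s"
        by (auto simp: rot_apply intro!: strict_mono_onD'[OF p(3)])
    qed
    ultimately show ?thesis by (simp add: shuffle_perms_def)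
  qed
  have C: "\<sigma> \<in> ?A \<union> ?B" if "\<sigma> \<in> ?L" for \<sigma>
  proof -
    have p: "\<sigma> permutes {..<Suc N}" "strict_mono_on {..<Suc l} \<sigma>" "strict_mono_on {Suc l..<Suc l + Suc b} \<sigma>"
      using that by (auto simp: shuffle_perms_def N_def)
    obtain i where i: "i < Suc N" "\<sigma> i = N"
      using permutes_surj[OF p(1)] permutes_in_image[OF p(1)] by (metis lessI lessThan_iff surj_def)
    have le: "\<sigma> r \<le> N" if "r < Suc N" for r using permutes_in_image[OF p(1), of r] that by simp
    \<comment> \<open>Elsewhere the largest value would be followed by a larger one in the same block.\<close>
    have "i = l \<or> i = N"
    proof (rule ccontr)
      assume ni: "\<not> (i = l \<or> i = N)"
      have "\<sigma> i < \<sigma> (Suc i)"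
      proof (cases "i < l")
        case True
        then show ?thesis by (intro strict_mono_onD'[OF p(2)]) auto
      next
        case False
        then show ?thesis using ni i(1) by (intro strict_mono_onD'[OF p(3)]) (auto simp: N_def)
      qed
      moreover have "Suc i < Suc N" using i ni by auto
      ultimately show False using le[of "Suc i"] i by simp
    qed
    then show ?thesis
    proof
      assume "i = N"
      then have "\<sigma> N = N" using i by simp
      then have "\<sigma> permutes {..<N}" using p(1) by (intro permutes_superset[OF p(1)]) (auto simp: less_Suc_eq)
      moreover have "strict_mono_on {Suc l..<Suc l + b} \<sigma>" using p(3) by (rule monotone_on_subset) auto
      ultimately show ?thesis using p(2) by (simp add: shuffle_perms_def N_def)
    next
      assume "i = l"
      then have sl: "\<sigma> l = N" using i by simp
      define \<tau> where "\<tau> = \<sigma> \<circ> inv (rot l (Suc b))"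
      have "\<tau> permutes {..<N}"
      proof (rule permutes_superset)
        show "\<tau> permutes {..<Suc N}" unfolding \<tau>_def
          by (intro permutes_compose permutes_inv rot_permutes' p(1)) (simp add: N_def)
        show "\<tau> x = x" if "x \<in> {..<Suc N} - {..<N}" for x
          using that sl by (auto simp: \<tau>_def inv_rot_apply N_def)
      qed
      moreover have "strict_mono_on {..<l} \<tau>"
        by (rule strict_mono_onI) (auto simp: \<tau>_def inv_rot_apply intro!: strict_mono_onD'[OF p(2)])
      moreover have "strict_mono_on {l..<l + Suc b} \<tau>"
        by (rule strict_mono_onI) (auto simp: \<tau>_def inv_rot_apply intro!: strict_mono_onD'[OF p(3)])
      ultimately have "\<tau> \<in> shuffle_perms l (Suc b)" by (simp add: shuffle_perms_def N_def)
      moreover have "\<sigma> = \<tau> \<circ> rot l (Suc b)" by (simp add: \<tau>_def fun_eq_iff)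
      ultimately show ?thesis by blast
    qed
  qed
  show "?L = ?A \<union> ?B" using A B C by blast
  show "?A \<inter> ?B = {}"
  proof (rule ccontr)
    assume "?A \<inter> ?B \<noteq> {}"
    then obtain \<tau> where \<tau>: "\<tau> \<in> shuffle_perms l (Suc b)" "\<tau> \<circ> rot l (Suc b) \<in> ?A" by blast
    have "\<tau> \<circ> rot l (Suc b) permutes {..<Suc l + b}" using \<tau>(2) unfolding shuffle_perms_def by blast
    from permutes_not_in[OF this, of N] have "(\<tau> \<circ> rot l (Suc b)) N = N" by (simp add: N_def)
    moreover have "\<tau> N = N"
      using \<tau>(1) by (intro permutes_not_in[where S = "{..<l + Suc b}"]) (auto simp: shuffle_perms_def N_def)
    moreover have "inj \<tau>" using \<tau>(1) by (auto simp: shuffle_perms_def dest: permutes_inj)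
    ultimately have "rot l (Suc b) N = N" by (metis comp_apply injD)
    then show False by (simp add: rot_apply N_def split: if_splits)
  qed
qed

lemma finite_shuffle_perms: "finite (shuffle_perms l b)"
  unfolding shuffle_perms_def by (rule finite_subset[OF _ finite_permutations[of "{..<l + b}"]]) auto

lemma ssum_snoc:
  assumes len: "length as = Suc (l + b)"
  shows "ssum (Suc l) (Suc b) (as @ [a]) G = ssum (Suc l) b as (\<lambda>xs ys. G xs (ys @ [a]))
    + (-1) ^ Suc b *\<^sub>R ssum l (Suc b) as (\<lambda>xs ys. G (xs @ [a]) ys)"
proof -
  define F where "F \<sigma> = of_int (sign \<sigma>) *\<^sub>R
      G (map (\<lambda>i. (as @ [a]) ! \<sigma> i) [0..<Suc l]) (map (\<lambda>i. (as @ [a]) ! \<sigma> i) [Suc l..<Suc l + Suc b])" for \<sigma>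
  let ?N = "Suc (l + b)"
  have "ssum (Suc l) (Suc b) (as @ [a]) G = sum F (shuffle_perms (Suc l) b)
      + sum F ((\<lambda>\<sigma>. \<sigma> \<circ> rot l (Suc b)) ` shuffle_perms l (Suc b))"
    unfolding ssum_def F_def[symmetric] shuffle_perms_Suc(1)
    by (rule sum.union_disjoint) (auto simp: finite_shuffle_perms shuffle_perms_Suc(2))
  also have "sum F (shuffle_perms (Suc l) b) = ssum (Suc l) b as (\<lambda>xs ys. G xs (ys @ [a]))"
    unfolding ssum_def
  proof (rule sum.cong[OF refl])
    fix \<sigma> assume "\<sigma> \<in> shuffle_perms (Suc l) b"
    then have p: "\<sigma> permutes {..<?N}" by (auto simp: shuffle_perms_def)
    have lt: "\<sigma> i < ?N" if "i < ?N" for i using permutes_in_image[OF p, of i] that by simp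
    have N: "\<sigma> ?N = ?N" using permutes_not_in[OF p, of ?N] by simp
    have nth: "(as @ [a]) ! \<sigma> i = as ! \<sigma> i" if "i < ?N" for i using lt[OF that] len by (simp add: nth_append)
    have 1: "map (\<lambda>i. (as @ [a]) ! \<sigma> i) [0..<Suc l] = map (\<lambda>i. as ! \<sigma> i) [0..<Suc l]"
      by (rule map_cong[OF refl], rule nth) auto
    have 2: "map (\<lambda>i. (as @ [a]) ! \<sigma> i) [Suc l..<Suc l + b] = map (\<lambda>i. as ! \<sigma> i) [Suc l..<Suc l + b]"
      by (rule map_cong[OF refl], rule nth) auto
    have 3: "map (\<lambda>i. (as @ [a]) ! \<sigma> i) [Suc l..<Suc l + Suc b] = map (\<lambda>i. as ! \<sigma> i) [Suc l..<Suc l + b] @ [a]"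
      using 2 N len by (simp add: nth_append)
    show "F \<sigma> = of_int (sign \<sigma>) *\<^sub>R G (map (\<lambda>i. as ! \<sigma> i) [0..<Suc l]) (map (\<lambda>i. as ! \<sigma> i) [Suc l..<Suc l + b] @ [a])"
      unfolding F_def 1 3 ..
  qed
  also have "sum F ((\<lambda>\<sigma>. \<sigma> \<circ> rot l (Suc b)) ` shuffle_perms l (Suc b)) =
      sum (\<lambda>\<sigma>. F (\<sigma> \<circ> rot l (Suc b))) (shuffle_perms l (Suc b))"
  proof -
    have inj: "inj_on (\<lambda>\<sigma>. \<sigma> \<circ> rot l (Suc b)) (shuffle_perms l (Suc b))"
    proof (rule inj_onI)
      fix \<sigma> \<tau> :: "nat \<Rightarrow> nat" assume "\<sigma> \<circ> rot l (Suc b) = \<tau> \<circ> rot l (Suc b)"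
      then have "(\<sigma> \<circ> rot l (Suc b)) (inv (rot l (Suc b)) x) = (\<tau> \<circ> rot l (Suc b)) (inv (rot l (Suc b)) x)" for x
        by (rule fun_cong)
      then show "\<sigma> = \<tau>" unfolding comp_apply inv_rot_rot by (rule ext)
    qed
    show ?thesis unfolding sum.reindex[OF inj] by (rule sum.cong[OF refl]) (simp only: comp_apply)
  qed
  also have "\<dots> = (-1) ^ Suc b *\<^sub>R ssum l (Suc b) as (\<lambda>xs ys. G (xs @ [a]) ys)"
    unfolding ssum_def scaleR_sum_right
  proof (rule sum.cong[OF refl])
    fix \<sigma> assume "\<sigma> \<in> shuffle_perms l (Suc b)"
    then have p: "\<sigma> permutes {..<?N}" by (auto simp: shuffle_perms_def)
    have lt: "\<sigma> i < ?N" if "i < ?N" for i using permutes_in_image[OF p, of i] that by simp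
    have N: "\<sigma> ?N = ?N" using permutes_not_in[OF p, of ?N] by simp
    have sg: "sign (\<sigma> \<circ> rot l (Suc b)) = sign \<sigma> * (-1) ^ Suc b"
      by (subst sign_permutes_comp[OF p rot_permutes]) (auto simp: sign_rot)
    have nth: "(as @ [a]) ! \<sigma> i = as ! \<sigma> i" if "i < ?N" for i using lt[OF that] len by (simp add: nth_append)
    have 0: "map (\<lambda>i. (as @ [a]) ! (\<sigma> \<circ> rot l (Suc b)) i) [0..<l] = map (\<lambda>i. as ! \<sigma> i) [0..<l]"
      by (rule map_cong[OF refl]) (auto simp: rot_apply nth)
    have 1: "map (\<lambda>i. (as @ [a]) ! (\<sigma> \<circ> rot l (Suc b)) i) [0..<Suc l] = map (\<lambda>i. as ! \<sigma> i) [0..<l] @ [a]"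
      using 0 N len by (simp add: rot_apply nth_append)
    have 2: "map (\<lambda>i. (as @ [a]) ! (\<sigma> \<circ> rot l (Suc b)) i) [Suc l..<Suc l + Suc b] =
        map (\<lambda>i. as ! \<sigma> i) [l..<l + Suc b]"
    proof -
      have "[Suc l..<Suc l + Suc b] = map Suc [l..<l + Suc b]" by (simp only: map_Suc_upt add_Suc)
      then have "map (\<lambda>i. (as @ [a]) ! (\<sigma> \<circ> rot l (Suc b)) i) [Suc l..<Suc l + Suc b] =
          map (\<lambda>i. (as @ [a]) ! (\<sigma> \<circ> rot l (Suc b)) (Suc i)) [l..<l + Suc b]" by (simp only: map_map o_def)
      also have "\<dots> = map (\<lambda>i. as ! \<sigma> i) [l..<l + Suc b]"
        by (rule map_cong[OF refl]) (auto simp: rot_apply nth)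
      finally show ?thesis .
    qed
    show "F (\<sigma> \<circ> rot l (Suc b)) = (-1) ^ Suc b *\<^sub>R of_int (sign \<sigma>) *\<^sub>R
        G (map (\<lambda>i. as ! \<sigma> i) [0..<l] @ [a]) (map (\<lambda>i. as ! \<sigma> i) [l..<l + Suc b])"
      unfolding F_def 1 2 sg by simp
  qed
  finally show ?thesis .
qed

text \<open>
  Both sides obey the same recursion on the last entry of the list (\<open>ssum_snoc\<close> and
  \<open>asumn_snoc\<close>); the factor \<open>Suc l\<close> on the right is the quotient of the two factorials.
\<close>

lemma ssum_eq_asumn:
  fixes G :: "'b list \<Rightarrow> 'b list \<Rightarrow> 'v::real_vector"
  assumes "\<And>ys. set ys \<subseteq> S \<Longrightarrow> altern S (\<lambda>xs. G xs ys)" "set as \<subseteq> S" "length as = l + b"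
  shows "ssum l b as G = (1 / fact l) *\<^sub>R asumn l as G"
  using assms
proof (induction as arbitrary: l b G rule: rev_induct)
  case Nil
  then show ?case by (simp add: ssum_0)
next
  case (snoc a as)
  show ?case
  proof (cases l)
    case 0
    then show ?thesis using snoc.prems ssum_0[of "as @ [a]" b G] by simp
  next
    case l: (Suc l')
    show ?thesis
    proof (cases b)
      case 0
      then have len: "length (as @ [a]) = l" using snoc.prems by simp
      have "asumn l (as @ [a]) G = fact l *\<^sub>R G (as @ [a]) []"
        unfolding len[symmetric] by (rule asumn_full) (use snoc.prems(1)[of "[]"] snoc.prems(2) in auto)
      then show ?thesis using 0 ssum_full[OF len, of G] by simp
    next
      case b: (Suc b')
      have len: "length as = Suc (l' + b')" using snoc.prems l b by simp
      have S: "set as \<subseteq> S" "a \<in> S" using snoc.prems by auto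
      have alt: "altern S (\<lambda>xs. G (xs @ [a]) ys)" if "set ys \<subseteq> S" for ys
      proof (rule alternI)
        fix ps qs c d assume "c \<in> S" "d \<in> S" "set ps \<subseteq> S" "set qs \<subseteq> S"
        then show "G ((ps @ c # d # qs) @ [a]) ys = - G ((ps @ d # c # qs) @ [a]) ys"
          using altern_swap[OF snoc.prems(1)[OF that], of c d ps "qs @ [a]"] S by simp
      qed
      have "ssum l b (as @ [a]) G = ssum l b' as (\<lambda>xs ys. G xs (ys @ [a]))
          + (-1) ^ b *\<^sub>R ssum l' b as (\<lambda>xs ys. G (xs @ [a]) ys)"
        unfolding l b by (rule ssum_snoc[OF len])
      also have "ssum l b' as (\<lambda>xs ys. G xs (ys @ [a])) = (1 / fact l) *\<^sub>R asumn l as (\<lambda>xs ys. G xs (ys @ [a]))"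
        using snoc.prems(1) S len l by (intro snoc.IH) auto
      also have "ssum l' b as (\<lambda>xs ys. G (xs @ [a]) ys) = (1 / fact l') *\<^sub>R asumn l' as (\<lambda>xs ys. G (xs @ [a]) ys)"
        using alt S len b by (intro snoc.IH) auto
      finally have *: "ssum l b (as @ [a]) G = (1 / fact l) *\<^sub>R asumn l as (\<lambda>xs ys. G xs (ys @ [a]))
          + (-1) ^ b *\<^sub>R (1 / fact l') *\<^sub>R asumn l' as (\<lambda>xs ys. G (xs @ [a]) ys)" .
      have "length as - l' = b" using len b by simp
      then have c: "1 / fact l * (real (Suc l') * (-1) ^ (length as - l')) = (-1) ^ b * (1 / fact l' :: real)"
        unfolding l fact_Suc by (simp del: of_nat_Suc)
      have "asumn l (as @ [a]) G = asumn l as (\<lambda>xs ys. G xs (ys @ [a]))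
          + (real (Suc l') * (-1) ^ (length as - l')) *\<^sub>R asumn l' as (\<lambda>xs ys. G (xs @ [a]) ys)"
        unfolding l by (rule asumn_snoc[OF snoc.prems(1) S]) (use len in auto)
      then show ?thesis unfolding * by (simp only: scaleR_add_right scaleR_scaleR c)
    qed
  qed
qed

subsection \<open>Insertion of one-forms\<close>

text \<open>
  The product of \<open>F\<close> with the one-forms \<open>C a\<close>, for \<open>a\<close> in the given list, evaluated by extracting one
  vector field for each of them instead of by permuting all vector fields.
\<close>

primrec ins :: "('b \<Rightarrow> 'x \<Rightarrow> 'c) \<Rightarrow> 'b list \<Rightarrow> ('c list \<Rightarrow> 'x list \<Rightarrow> 'v::ab_group_add) \<Rightarrow> 'c list \<Rightarrow> 'x list \<Rightarrow> 'v" where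
  "ins C [] F bs Xs = F bs Xs"
| "ins C (a # as) F bs Xs = asum Xs (\<lambda>X Ys. ins C as F (C a X # bs) Ys)"

lemma ins_vanish: "length Xs < length as \<Longrightarrow> ins C as F bs Xs = 0"
proof (induction as arbitrary: bs Xs)
  case (Cons a as)
  have "asum Xs (\<lambda>X Ys. ins C as F (C a X # bs) Ys) = asum Xs (\<lambda>X Ys. 0)"
    by (rule asum_cong[OF subset_UNIV], rule Cons.IH) (use Cons.prems in simp)
  then show ?case by simp
qed simp

lemma symm_ins:
  assumes "\<And>Xs. set Xs \<subseteq> SX \<Longrightarrow> symm SB (\<lambda>bs. F bs Xs)" "set Xs \<subseteq> SX"
    and "\<And>a X. a \<in> SA \<Longrightarrow> X \<in> SX \<Longrightarrow> C a X \<in> SB" "set as \<subseteq> SA"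
  shows "symm SB (\<lambda>bs. ins C as F bs Xs)"
  using assms(2,4)
proof (induction as arbitrary: Xs)
  case (Cons a as)
  show ?case
  proof (rule symmI)
    fix ps qs b c assume *: "b \<in> SB" "c \<in> SB" "set ps \<subseteq> SB" "set qs \<subseteq> SB"
    have "ins C as F (C a X # ps @ b # c # qs) Ys = ins C as F (C a X # ps @ c # b # qs) Ys"
      if "X \<in> SX" "set Ys \<subseteq> SX" for X Ys
      using symm_swap[OF Cons.IH[OF that(2)], of b c "C a X # ps" qs] Cons.prems * that assms(3) by simp
    then show "ins C (a # as) F (ps @ b # c # qs) Xs = ins C (a # as) F (ps @ c # b # qs) Xs"
      unfolding ins.simps by (intro asum_cong[OF Cons.prems(1)]) auto
  qed
qed (use assms(1) in simp)

lemma altern_ins: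
  fixes F :: "'c list \<Rightarrow> 'x list \<Rightarrow> 'v::real_vector"
  assumes "\<And>Xs. set Xs \<subseteq> SX \<Longrightarrow> symm SB (\<lambda>bs. F bs Xs)" "set Xs \<subseteq> SX" "set bs \<subseteq> SB"
    and "\<And>a X. a \<in> SA \<Longrightarrow> X \<in> SX \<Longrightarrow> C a X \<in> SB"
  shows "altern SA (\<lambda>as. ins C as F bs Xs)"
proof (rule alternI)
  fix ps qs a b assume *: "a \<in> SA" "b \<in> SA" "set ps \<subseteq> SA" "set qs \<subseteq> SA"
  show "ins C (ps @ a # b # qs) F bs Xs = - ins C (ps @ b # a # qs) F bs Xs"
    using *(3) assms(2,3)
  proof (induction ps arbitrary: bs Xs)
    case Nil
    have "ins C qs F (C a Y # C b X # bs) Zs = ins C qs F (C b X # C a Y # bs) Zs"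
      if "X \<in> SX" "Y \<in> SX" "set Zs \<subseteq> SX" for X Y Zs
      using * assms(4) that Nil
      by (intro symm_swap_head[OF symm_ins[where SX = SX and SA = SA and SB = SB]] assms(1)) auto
    then have "asum Xs (\<lambda>X Ys. asum Ys (\<lambda>Y Zs. ins C qs F (C a Y # C b X # bs) Zs)) =
        asum Xs (\<lambda>X Ys. asum Ys (\<lambda>Y Zs. ins C qs F (C b X # C a Y # bs) Zs))"
      using Nil by (intro asum_cong[where S = SX]) auto
    with asum_asum_swap[of Xs "\<lambda>X Y Zs. ins C qs F (C a Y # C b X # bs) Zs"]
    show ?case by (simp add: asum_asum_swap[of Xs "\<lambda>X Y Zs. ins C qs F (C b Y # C a X # bs) Zs"])
  next
    case (Cons p ps)
    have "asum Xs (\<lambda>X Ys. ins C (ps @ a # b # qs) F (C p X # bs) Ys) =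
        asum Xs (\<lambda>X Ys. - ins C (ps @ b # a # qs) F (C p X # bs) Ys)"
      using Cons.prems assms(4) by (intro asum_cong[where S = SX] Cons.IH) auto
    then show ?case by (simp add: asum_minus)
  qed
qed

text \<open>
  Each one-form takes the first entry of the permuted list, so \<open>psum_Cons\<close> turns it into an
  extraction.  The remaining permutations act on an alternating function and account for the
  factorial.
\<close>

lemma psum_eq_ins:
  fixes F :: "'c list \<Rightarrow> 'x list \<Rightarrow> 'v::real_vector"
  assumes "\<And>Xs. set Xs \<subseteq> SX \<Longrightarrow> symm SB (\<lambda>bs. F bs Xs)" "\<And>bs. set bs \<subseteq> SB \<Longrightarrow> altern SX (\<lambda>Xs. F bs Xs)"
    and "\<And>a X. a \<in> SA \<Longrightarrow> X \<in> SX \<Longrightarrow> C a X \<in> SB"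
    and "set Xs \<subseteq> SX" "set bs \<subseteq> SB" "set as \<subseteq> SA" "length as \<le> length Xs"
  shows "psum Xs (\<lambda>Zs. F (bs @ map2 C as Zs) (drop (length as) Zs)) = fact (length Xs - length as) *\<^sub>R ins C as F bs Xs"
  using assms(4-)
proof (induction as arbitrary: bs Xs)
  case Nil
  then show ?case using psum_altern[OF assms(2), of bs Xs] by simp
next
  case (Cons a as)
  have sub: "set (map2 C as Zs) \<subseteq> SB" if "set Zs \<subseteq> SX" for Zs
  proof
    fix c assume "c \<in> set (map2 C as Zs)"
    then obtain a' X where "(a', X) \<in> set (zip as Zs)" "c = C a' X" by auto
    then show "c \<in> SB"
      using set_zip_leftD[of a' X as Zs] set_zip_rightD[of a' X as Zs] Cons.prems(3) that assms(3)
      by (auto simp: subset_iff)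
  qed
  have "psum Xs (\<lambda>Zs. F (bs @ map2 C (a # as) Zs) (drop (length (a # as)) Zs)) =
      asum Xs (\<lambda>X Ys. psum Ys (\<lambda>Zs. F (bs @ C a X # map2 C as Zs) (drop (length as) Zs)))"
    using Cons.prems by (subst psum_Cons) auto
  also have "\<dots> = asum Xs (\<lambda>X Ys. fact (length Xs - length (a # as)) *\<^sub>R ins C as F (C a X # bs) Ys)"
  proof (rule asum_cong[OF Cons.prems(1)])
    fix X Ys assume X: "X \<in> SX" "set Ys \<subseteq> SX" "Suc (length Ys) = length Xs"
    have "psum Ys (\<lambda>Zs. F (bs @ C a X # map2 C as Zs) (drop (length as) Zs)) =
        psum Ys (\<lambda>Zs. F ((C a X # bs) @ map2 C as Zs) (drop (length as) Zs))"
      unfolding psum_def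
    proof (rule sum.cong[OF refl])
      fix \<sigma> assume "\<sigma> \<in> {\<sigma>. \<sigma> permutes {..<length Ys}}"
      then have \<sigma>: "\<sigma> permutes {..<length Ys}" by simp
      let ?Zs = "map (\<lambda>i. Ys ! \<sigma> i) [0..<length Ys]"
      have Z: "set ?Zs \<subseteq> SX" using permutes_in_image[OF \<sigma>] X(2) by (auto simp: subset_iff)
      then have "set (drop (length as) ?Zs) \<subseteq> SX" using set_drop_subset by (rule order_trans[rotated])
      then have "F (bs @ C a X # map2 C as ?Zs) (drop (length as) ?Zs) =
          F ((C a X # bs) @ map2 C as ?Zs) (drop (length as) ?Zs)"
        using Cons.prems assms(3) X sub[OF Z]
        by (simp only: append_Cons) (intro symm_move[OF assms(1)], auto)
      then show "of_int (sign \<sigma>) *\<^sub>R F (bs @ C a X # map2 C as ?Zs) (drop (length as) ?Zs) =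
          of_int (sign \<sigma>) *\<^sub>R F ((C a X # bs) @ map2 C as ?Zs) (drop (length as) ?Zs)" by simp
    qed
    also have "\<dots> = fact (length Ys - length as) *\<^sub>R ins C as F (C a X # bs) Ys"
      using Cons.prems X assms(3) by (intro Cons.IH) auto
    also have "length Ys - length as = length Xs - length (a # as)" using X by simp
    finally show "psum Ys (\<lambda>Zs. F (bs @ C a X # map2 C as Zs) (drop (length as) Zs)) =
        fact (length Xs - length (a # as)) *\<^sub>R ins C as F (C a X # bs) Ys" .
  qed
  also have "\<dots> = fact (length Xs - length (a # as)) *\<^sub>R ins C (a # as) F bs Xs"
    by (simp add: asum_scaleR)
  finally show ?case .
qed

section \<open>Smooth functions and sections\<close>

lemma Ck_on_subset: "Ck_on n S f \<Longrightarrow> T \<subseteq> S \<Longrightarrow> Ck_on n T f"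
  by (induction n arbitrary: f) (auto intro: continuous_on_subset)

lemma frechet_derivative_cong_open:
  assumes "open S" "x \<in> S" "\<And>y. y \<in> S \<Longrightarrow> f y = g y" "f differentiable (at x)"
  shows "frechet_derivative g (at x) = frechet_derivative f (at x)" "g differentiable (at x)"
proof -
  have "(f has_derivative frechet_derivative f (at x)) (at x)"
    using assms(4) frechet_derivative_works by blast
  then have g: "(g has_derivative frechet_derivative f (at x)) (at x)"
    by (rule has_derivative_transform_within_open[OF _ assms(1,2)]) (rule assms(3))
  show "frechet_derivative g (at x) = frechet_derivative f (at x)"
    using frechet_derivative_at[OF g] by simp
  show "g differentiable (at x)" using g by (rule differentiableI)
qed

lemma Ck_on_cong:
  assumes "open S" "\<And>y. y \<in> S \<Longrightarrow> f y = g y" "Ck_on n S f"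
  shows "Ck_on n S g"
  using assms(2,3)
proof (induction n arbitrary: f g)
  case 0
  then show ?case using continuous_on_eq[of S f g] unfolding Ck_on.simps by blast
next
  case (Suc n)
  have "f differentiable (at x)" if "x \<in> S" for x using Suc.prems(2) that by simp
  note d = frechet_derivative_cong_open[OF assms(1) _ Suc.prems(1) this]
  have "Ck_on n S (\<lambda>x. frechet_derivative g (at x) w)" for w
  proof (rule Suc.IH)
    show "Ck_on n S (\<lambda>x. frechet_derivative f (at x) w)" using Suc.prems(2) by simp
  qed (simp only: d(1))
  then show ?case unfolding Ck_on.simps using d(2) by blast
qed

lemma Ck_on_Suc_D: "Ck_on (Suc n) S f \<Longrightarrow> Ck_on n S f"
proof (induction n arbitrary: f)
  case 0
  then show ?case
    by (auto intro!: continuous_at_imp_continuous_on differentiable_imp_continuous_within)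
next
  case (Suc n)
  have "Ck_on n S (\<lambda>x. frechet_derivative f (at x) w)" for w
    using Suc.prems by (intro Suc.IH) simp
  then show ?case using Suc.prems by simp
qed

lemma Ck_on_const: "Ck_on n S (\<lambda>x. c)"
  by (induction n arbitrary: c) (simp_all add: frechet_derivative_const)

lemma Ck_on_add:
  assumes "open S" "Ck_on n S f" "Ck_on n S g"
  shows "Ck_on n S (\<lambda>x. f x + g x)"
  using assms(2,3)
proof (induction n arbitrary: f g)
  case 0
  then show ?case by (simp add: continuous_on_add)
next
  case (Suc n)
  have d: "frechet_derivative (\<lambda>x. f x + g x) (at x) = (\<lambda>w. frechet_derivative f (at x) w + frechet_derivative g (at x) w)"
    if "x \<in> S" for x
  proof -
    have "f differentiable (at x)" "g differentiable (at x)" using Suc.prems that by auto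
    then show ?thesis
      by (intro frechet_derivative_at[symmetric] has_derivative_add) (simp_all add: frechet_derivative_works[symmetric])
  qed
  have "Ck_on n S (\<lambda>x. frechet_derivative (\<lambda>x. f x + g x) (at x) w)" for w
  proof (rule Ck_on_cong[OF assms(1)])
    show "Ck_on n S (\<lambda>x. frechet_derivative f (at x) w + frechet_derivative g (at x) w)"
      using Suc.prems by (intro Suc.IH) auto
  qed (simp add: d)
  then show ?case using Suc.prems by (simp add: differentiable_add)
qed

lemma Ck_on_mult:
  fixes f g :: "'e::real_normed_vector \<Rightarrow> real"
  assumes "open S" "Ck_on n S f" "Ck_on n S g"
  shows "Ck_on n S (\<lambda>x. f x * g x)"
  using assms(2,3)
proof (induction n arbitrary: f g)
  case 0
  then show ?case by (simp add: continuous_on_mult)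
next
  case (Suc n)
  have d: "frechet_derivative (\<lambda>x. f x * g x) (at x) =
      (\<lambda>w. f x * frechet_derivative g (at x) w + frechet_derivative f (at x) w * g x)"
    if "x \<in> S" for x
  proof -
    have "f differentiable (at x)" "g differentiable (at x)" using Suc.prems that by auto
    then show ?thesis
      by (intro frechet_derivative_at[symmetric] has_derivative_mult) (simp_all add: frechet_derivative_works[symmetric])
  qed
  have "Ck_on n S (\<lambda>x. frechet_derivative (\<lambda>x. f x * g x) (at x) w)" for w
  proof (rule Ck_on_cong[OF assms(1)])
    show "Ck_on n S (\<lambda>x. f x * frechet_derivative g (at x) w + frechet_derivative f (at x) w * g x)"
      using Suc.prems Ck_on_Suc_D[OF Suc.prems(1)] Ck_on_Suc_D[OF Suc.prems(2)]
      by (intro Ck_on_add[OF assms(1)] Suc.IH) auto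
  qed (simp add: d)
  then show ?case using Suc.prems by (simp add: differentiable_mult)
qed

lemma smooth_on_const: "smooth_on S (\<lambda>x. c)"
  by (simp add: smooth_on_def Ck_on_const)

lemma smooth_on_subset: "smooth_on S f \<Longrightarrow> T \<subseteq> S \<Longrightarrow> smooth_on T f"
  unfolding smooth_on_def using Ck_on_subset by blast

lemma smooth_on_add: "open S \<Longrightarrow> smooth_on S f \<Longrightarrow> smooth_on S g \<Longrightarrow> smooth_on S (\<lambda>x. f x + g x)"
  unfolding smooth_on_def using Ck_on_add by blast

lemma smooth_on_mult:
  fixes f g :: "'e::real_normed_vector \<Rightarrow> real"
  shows "open S \<Longrightarrow> smooth_on S f \<Longrightarrow> smooth_on S g \<Longrightarrow> smooth_on S (\<lambda>x. f x * g x)"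
  unfolding smooth_on_def using Ck_on_mult by blast

lemma open_chart_image:
  assumes "smooth_atlas \<A>" "(U, \<phi>) \<in> \<A>" "open W"
  shows "open (\<phi> ` (U \<inter> W))"
proof -
  have o: "open U" "open (\<phi> ` U)" and h: "homeomorphism U (\<phi> ` U) \<phi> (inv_into U \<phi>)"
    using bspec[OF conjunct1[OF conjunct2[OF assms(1)[unfolded smooth_atlas_def]]] assms(2)] by simp_all
  have "openin (top_of_set (\<phi> ` U)) (\<phi> ` (U \<inter> W))"
    by (rule homeomorphism_imp_open_map[OF h]) (rule openin_open_Int[OF assms(3)])
  then show ?thesis using o(2) by (rule openin_open_trans)
qed

lemma smooth_fun_on_const: "smooth_fun_on \<A> W (\<lambda>x. c)"
  by (auto simp: smooth_fun_on_def o_def smooth_on_const)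

lemma smooth_fun_on_subset:
  assumes "smooth_fun_on \<A> W f" "V \<subseteq> W"
  shows "smooth_fun_on \<A> V f"
  unfolding smooth_fun_on_def
proof safe
  fix U \<phi> assume "(U, \<phi>) \<in> \<A>"
  then have "smooth_on (\<phi> ` (U \<inter> W)) (f \<circ> inv_into U \<phi>)" using assms(1) by (auto simp: smooth_fun_on_def)
  then show "smooth_on (\<phi> ` (U \<inter> V)) (f \<circ> inv_into U \<phi>)" by (rule smooth_on_subset) (use assms(2) in auto)
qed

lemma smooth_fun_on_add:
  assumes "smooth_atlas \<A>" "open W" "smooth_fun_on \<A> W f" "smooth_fun_on \<A> W g"
  shows "smooth_fun_on \<A> W (\<lambda>x. f x + g x)"
  unfolding smooth_fun_on_def
proof safe
  fix U \<phi> assume U: "(U, \<phi>) \<in> \<A>"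
  then have "smooth_on (\<phi> ` (U \<inter> W)) (f \<circ> inv_into U \<phi>)" "smooth_on (\<phi> ` (U \<inter> W)) (g \<circ> inv_into U \<phi>)"
    using assms(3,4) by (auto simp: smooth_fun_on_def)
  then show "smooth_on (\<phi> ` (U \<inter> W)) ((\<lambda>x. f x + g x) \<circ> inv_into U \<phi>)"
    using smooth_on_add[OF open_chart_image[OF assms(1) U assms(2)]] by (simp only: o_def)
qed

lemma smooth_fun_on_mult:
  assumes "smooth_atlas \<A>" "open W" "smooth_fun_on \<A> W f" "smooth_fun_on \<A> W g"
  shows "smooth_fun_on \<A> W (\<lambda>x. f x * g x)"
  unfolding smooth_fun_on_def
proof safe
  fix U \<phi> assume U: "(U, \<phi>) \<in> \<A>"
  then have "smooth_on (\<phi> ` (U \<inter> W)) (f \<circ> inv_into U \<phi>)" "smooth_on (\<phi> ` (U \<inter> W)) (g \<circ> inv_into U \<phi>)"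
    using assms(3,4) by (auto simp: smooth_fun_on_def)
  then show "smooth_on (\<phi> ` (U \<inter> W)) ((\<lambda>x. f x * g x) \<circ> inv_into U \<phi>)"
    using smooth_on_mult[OF open_chart_image[OF assms(1) U assms(2)]] by (simp only: o_def)
qed

context lie_algebroid
begin

abbreviation "SA \<equiv> sections L"
abbreviation "SX \<equiv> vfields L"

lemma Cf_const: "(\<lambda>x. c) \<in> Cinf L"
  by (simp add: smooth_funs_def smooth_fun_on_const)

lemma Cf_add: "f \<in> Cinf L \<Longrightarrow> g \<in> Cinf L \<Longrightarrow> (\<lambda>x. f x + g x) \<in> Cinf L"
  by (simp add: smooth_funs_def smooth_fun_on_add[OF manifold])

lemma Cf_mult: "f \<in> Cinf L \<Longrightarrow> g \<in> Cinf L \<Longrightarrow> (\<lambda>x. f x * g x) \<in> Cinf L"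
  by (simp add: smooth_funs_def smooth_fun_on_mult[OF manifold])

lemma Cf_lin: "f \<in> Cinf L \<Longrightarrow> g \<in> Cinf L \<Longrightarrow> (\<lambda>x. a * f x + b * g x) \<in> Cinf L"
  by (intro Cf_add Cf_mult Cf_const)

lemma Cf_diff: "f \<in> Cinf L \<Longrightarrow> g \<in> Cinf L \<Longrightarrow> (\<lambda>x. f x - g x) \<in> Cinf L"
  using Cf_lin[of f g 1 "-1"] by simp

lemma section_coeffs:
  assumes "s \<in> SA" "(V, e) \<in> frames L"
  shows "\<exists>c. (\<forall>i<bundle_rank L. smooth_fun_on (atlas L) V (c i)) \<and>
    (\<forall>x\<in>V. s x = (\<Sum>i<bundle_rank L. c i x *\<^sub>R e i x))"
proof -
  have "\<forall>(V, g) \<in> frames L. \<exists>c. (\<forall>i<bundle_rank L. smooth_fun_on (atlas L) (UNIV \<inter> V) (c i)) \<and>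
        (\<forall>x \<in> UNIV \<inter> V. s x = (\<Sum>i<bundle_rank L. c i x *\<^sub>R g i x))"
    using assms(1) by (simp only: sections_def smooth_section_on_def mem_Collect_eq)
  from bspec[OF this assms(2)] show ?thesis by simp
qed

lemma SA_lin:
  assumes "s \<in> SA" "t \<in> SA" "f \<in> Cinf L" "g \<in> Cinf L"
  shows "(\<lambda>x. f x *\<^sub>R s x + g x *\<^sub>R t x) \<in> SA"
  unfolding sections_def smooth_section_on_def
proof (clarsimp, goal_cases)
  case (1 V e)
  have "open V" using vbundle 1 by (auto simp: vector_bundle_def)
  obtain c where c: "\<And>i. i < bundle_rank L \<Longrightarrow> smooth_fun_on (atlas L) V (c i)"
    "\<And>x. x \<in> V \<Longrightarrow> s x = (\<Sum>i<bundle_rank L. c i x *\<^sub>R e i x)"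
    using section_coeffs[OF assms(1) 1] by blast
  obtain d where d: "\<And>i. i < bundle_rank L \<Longrightarrow> smooth_fun_on (atlas L) V (d i)"
    "\<And>x. x \<in> V \<Longrightarrow> t x = (\<Sum>i<bundle_rank L. d i x *\<^sub>R e i x)"
    using section_coeffs[OF assms(2) 1] by blast
  have fg: "smooth_fun_on (atlas L) V f" "smooth_fun_on (atlas L) V g"
    using assms(3,4) by (auto simp: smooth_funs_def intro: smooth_fun_on_subset)
  show ?case
  proof (intro exI[of _ "\<lambda>i x. f x * c i x + g x * d i x"] conjI allI impI ballI)
    fix i assume i: "i < bundle_rank L"
    show "smooth_fun_on (atlas L) V (\<lambda>x. f x * c i x + g x * d i x)"
      by (intro smooth_fun_on_add[OF manifold \<open>open V\<close>] smooth_fun_on_mult[OF manifold \<open>open V\<close>] fg c(1)[OF i] d(1)[OF i])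
  next
    fix x assume "x \<in> V"
    then show "f x *\<^sub>R s x + g x *\<^sub>R t x = (\<Sum>i<bundle_rank L. (f x * c i x + g x * d i x) *\<^sub>R e i x)"
      by (simp add: c(2) d(2) scaleR_sum_right scaleR_add_left sum.distrib)
  qed
qed

lemma SA_zero: "(\<lambda>x. 0) \<in> SA"
  unfolding sections_def smooth_section_on_def
  by (auto intro!: exI[of _ "\<lambda>i x. 0"] simp: smooth_fun_on_const)

lemma subsp_SA: "subsp SA"
  unfolding subsp_def using SA_zero SA_lin Cf_const by blast

lemma SA_scale: "s \<in> SA \<Longrightarrow> f \<in> Cinf L \<Longrightarrow> (\<lambda>x. f x *\<^sub>R s x) \<in> SA"
  using SA_lin[of s "\<lambda>x. 0" f "\<lambda>x. 0"] SA_zero Cf_const[of 0] by simp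

lemma SA_fibre: "s \<in> SA \<Longrightarrow> s x \<in> fibre L x"
proof -
  assume s: "s \<in> SA"
  have "(\<Union>(U, e) \<in> frames L. U) = UNIV" using vbundle unfolding vector_bundle_def by (rule conjunct1)
  then have "x \<in> (\<Union>(U, e) \<in> frames L. U)" by simp
  then obtain V e where V: "(V, e) \<in> frames L" "x \<in> V" by auto
  have "pointwise_basis_on (bundle_rank L) (fibre L) V e"
    using bspec[OF conjunct2[OF vbundle[unfolded vector_bundle_def]] V(1)] by simp
  then have "span ((\<lambda>i. e i x) ` {..<bundle_rank L}) = fibre L x"
    using V(2) unfolding pointwise_basis_on_def by simp
  moreover have "s x \<in> span ((\<lambda>i. e i x) ` {..<bundle_rank L})"
  proof -
    obtain c where "\<And>i. i < bundle_rank L \<Longrightarrow> smooth_fun_on (atlas L) V (c i)"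
      and c: "\<And>x. x \<in> V \<Longrightarrow> s x = (\<Sum>i<bundle_rank L. c i x *\<^sub>R e i x)"
      using section_coeffs[OF s V(1)] by blast
    from c[OF V(2)] show ?thesis
      by (simp only:) (rule span_sum, rule span_scale, rule span_base, rule imageI)
  qed
  ultimately show ?thesis by simp
qed

lemma bracket_lin2:
  assumes "\<alpha> \<in> SA" "\<beta> \<in> SA" "\<gamma> \<in> SA"
  shows "bracket L \<gamma> (\<lambda>x. s *\<^sub>R \<alpha> x + t *\<^sub>R \<beta> x) = (\<lambda>x. s *\<^sub>R bracket L \<gamma> \<alpha> x + t *\<^sub>R bracket L \<gamma> \<beta> x)"
proof -
  have "(\<lambda>x. s *\<^sub>R \<alpha> x + t *\<^sub>R \<beta> x) \<in> SA"
    using SA_lin[OF assms(1,2) Cf_const Cf_const] .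
  then have "bracket L \<gamma> (\<lambda>x. s *\<^sub>R \<alpha> x + t *\<^sub>R \<beta> x) = (\<lambda>x. - bracket L (\<lambda>x. s *\<^sub>R \<alpha> x + t *\<^sub>R \<beta> x) \<gamma> x)"
    using bracket_skew assms(3) by blast
  then show ?thesis
    unfolding bracket_linear[OF assms] by (simp add: bracket_skew[OF assms(3,1)] bracket_skew[OF assms(3,2)])
qed

lemma linon_bracket: "\<gamma> \<in> SA \<Longrightarrow> linon SA (bracket L \<gamma>)"
  unfolding linon_def using bracket_lin2 by blast

lemma linon_bracket1: "\<gamma> \<in> SA \<Longrightarrow> linon SA (\<lambda>\<alpha>. bracket L \<alpha> \<gamma>)"
  unfolding linon_def using bracket_linear by blast

subsection \<open>Vector fields\<close>

lemma SX_Cf: "X \<in> SX \<Longrightarrow> f \<in> Cinf L \<Longrightarrow> (\<lambda>x. X x f) \<in> Cinf L"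
  by (simp only: vector_fields_def mem_Collect_eq)

lemma SX_tangent:
  assumes "X \<in> SX"
  shows "(\<forall>f \<in> Cinf L. \<forall>g \<in> Cinf L. \<forall>a b. X x (\<lambda>y. a * f y + b * g y) = a * X x f + b * X x g)"
    and "(\<forall>f \<in> Cinf L. \<forall>g \<in> Cinf L. X x (\<lambda>y. f y * g y) = f x * X x g + g x * X x f)"
    and "(\<forall>f. f \<notin> Cinf L \<longrightarrow> X x f = 0)"
proof -
  note A = spec[OF conjunct1[OF assms[unfolded vector_fields_def mem_Collect_eq]], of x,
      unfolded tangent_space_def mem_Collect_eq]
  show "(\<forall>f \<in> Cinf L. \<forall>g \<in> Cinf L. \<forall>a b. X x (\<lambda>y. a * f y + b * g y) = a * X x f + b * X x g)"
    by (rule conjunct1[OF A])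
  show "(\<forall>f \<in> Cinf L. \<forall>g \<in> Cinf L. X x (\<lambda>y. f y * g y) = f x * X x g + g x * X x f)"
    by (rule conjunct1[OF conjunct2[OF A]])
  show "(\<forall>f. f \<notin> Cinf L \<longrightarrow> X x f = 0)"
    by (rule conjunct2[OF conjunct2[OF A]])
qed

lemma SX_off: "X \<in> SX \<Longrightarrow> f \<notin> Cinf L \<Longrightarrow> X x f = 0"
  by (rule SX_tangent(3)[rule_format])

lemma SX_lin_fun: "X \<in> SX \<Longrightarrow> f \<in> Cinf L \<Longrightarrow> g \<in> Cinf L \<Longrightarrow> X x (\<lambda>y. a * f y + b * g y) = a * X x f + b * X x g"
  by (rule SX_tangent(1)[rule_format])

lemma SX_mult_fun: "X \<in> SX \<Longrightarrow> f \<in> Cinf L \<Longrightarrow> g \<in> Cinf L \<Longrightarrow> X x (\<lambda>y. f y * g y) = f x * X x g + g x * X x f"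
  by (rule SX_tangent(2)[rule_format])

lemma SX_I:
  assumes "\<And>x f g a b. f \<in> Cinf L \<Longrightarrow> g \<in> Cinf L \<Longrightarrow> X x (\<lambda>y. a * f y + b * g y) = a * X x f + b * X x g"
    and "\<And>x f g. f \<in> Cinf L \<Longrightarrow> g \<in> Cinf L \<Longrightarrow> X x (\<lambda>y. f y * g y) = f x * X x g + g x * X x f"
    and "\<And>x f. f \<notin> Cinf L \<Longrightarrow> X x f = 0"
    and "\<And>f. f \<in> Cinf L \<Longrightarrow> (\<lambda>x. X x f) \<in> Cinf L"
  shows "X \<in> SX"
  unfolding vector_fields_def tangent_space_def mem_Collect_eq
  by (intro conjI allI ballI impI assms)

lemma SX_diff_fun: "X \<in> SX \<Longrightarrow> f \<in> Cinf L \<Longrightarrow> g \<in> Cinf L \<Longrightarrow> X x (\<lambda>y. f y - g y) = X x f - X x g"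
  using SX_lin_fun[of X f g x 1 "-1"] by simp

lemma SX_zero_fun: "X \<in> SX \<Longrightarrow> X x (\<lambda>y. 0) = 0"
  using SX_lin_fun[of X "\<lambda>y. 0" "\<lambda>y. 0" x 0 0] Cf_const[of 0] by simp

lemma SX_add_fun: "X \<in> SX \<Longrightarrow> f \<in> Cinf L \<Longrightarrow> g \<in> Cinf L \<Longrightarrow> X x (\<lambda>y. f y + g y) = X x f + X x g"
  using SX_lin_fun[of X f g x 1 1] by simp

lemma SX_lin:
  assumes "X \<in> SX" "Y \<in> SX" "f \<in> Cinf L" "g \<in> Cinf L"
  shows "(\<lambda>x \<phi>. f x * X x \<phi> + g x * Y x \<phi>) \<in> SX"
proof (rule SX_I, goal_cases)
  case (1 x \<phi> \<psi> a b)
  show ?case unfolding SX_lin_fun[OF assms(1) 1] SX_lin_fun[OF assms(2) 1] by (simp add: algebra_simps)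
next
  case (2 x \<phi> \<psi>)
  show ?case unfolding SX_mult_fun[OF assms(1) 2] SX_mult_fun[OF assms(2) 2] by (simp add: algebra_simps)
next
  case (3 x \<phi>)
  then show ?case by (simp add: SX_off[OF assms(1)] SX_off[OF assms(2)])
next
  case (4 \<phi>)
  show ?case
    by (rule Cf_add[OF Cf_mult[OF assms(3) SX_Cf[OF assms(1) 4]] Cf_mult[OF assms(4) SX_Cf[OF assms(2) 4]]])
qed

lemma SX_zero: "(\<lambda>x \<phi>. 0) \<in> SX"
  by (rule SX_I) (simp_all add: Cf_const)

lemma SX_bracket:
  assumes "X \<in> SX" "Y \<in> SX"
  shows "vf_bracket X Y \<in> SX"
proof (rule SX_I, goal_cases)
  case (1 x f g a b)
  note S = 1[THEN SX_Cf[OF assms(1)]] 1[THEN SX_Cf[OF assms(2)]]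
  show ?case
    unfolding vf_bracket_def SX_lin_fun[OF assms(1) 1] SX_lin_fun[OF assms(2) 1]
      SX_lin_fun[OF assms(1) S(3,4)] SX_lin_fun[OF assms(2) S(1,2)]
    by (simp add: algebra_simps)
next
  case (2 x f g)
  note S = 2[THEN SX_Cf[OF assms(1)]] 2[THEN SX_Cf[OF assms(2)]]
  have a: "X x (\<lambda>y. f y * Y y g + g y * Y y f) = (f x * X x (\<lambda>y. Y y g) + Y x g * X x f) + (g x * X x (\<lambda>y. Y y f) + Y x f * X x g)"
    by (simp only: SX_add_fun[OF assms(1) Cf_mult[OF 2(1) S(4)] Cf_mult[OF 2(2) S(3)]]
      SX_mult_fun[OF assms(1) 2(1) S(4)] SX_mult_fun[OF assms(1) 2(2) S(3)])
  have b: "Y x (\<lambda>y. f y * X y g + g y * X y f) = (f x * Y x (\<lambda>y. X y g) + X x g * Y x f) + (g x * Y x (\<lambda>y. X y f) + X x f * Y x g)"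
    by (simp only: SX_add_fun[OF assms(2) Cf_mult[OF 2(1) S(2)] Cf_mult[OF 2(2) S(1)]]
      SX_mult_fun[OF assms(2) 2(1) S(2)] SX_mult_fun[OF assms(2) 2(2) S(1)])
  show ?case
    unfolding vf_bracket_def SX_mult_fun[OF assms(1) 2] SX_mult_fun[OF assms(2) 2] a b
    by (simp add: algebra_simps)
next
  case (3 x f)
  then show ?case by (simp add: vf_bracket_def SX_off[OF assms(1)] SX_off[OF assms(2)] SX_zero_fun[OF assms(1)] SX_zero_fun[OF assms(2)])
next
  case (4 f)
  show ?case unfolding vf_bracket_def
    by (rule Cf_diff[OF SX_Cf[OF assms(1) SX_Cf[OF assms(2) 4]] SX_Cf[OF assms(2) SX_Cf[OF assms(1) 4]]])
qed

lemma vf_bracket_skew: "vf_bracket X Y = (\<lambda>x \<phi>. - vf_bracket Y X x \<phi>)"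
  by (simp add: vf_bracket_def fun_eq_iff)

text \<open>
  Vector fields are only derivations of smooth functions and vanish on all others by convention,
  so that identities between iterated brackets need a case distinction.
\<close>

lemma vf_jacobi:
  assumes "X \<in> SX" "Y \<in> SX" "Z \<in> SX"
  shows "vf_bracket X (vf_bracket Y Z) =
    (\<lambda>x \<phi>. vf_bracket (vf_bracket X Y) Z x \<phi> + vf_bracket Y (vf_bracket X Z) x \<phi>)"
proof (intro ext)
  fix x \<phi>
  show "vf_bracket X (vf_bracket Y Z) x \<phi> = vf_bracket (vf_bracket X Y) Z x \<phi> + vf_bracket Y (vf_bracket X Z) x \<phi>"
  proof (cases "\<phi> \<in> Cinf L")
    case True
    have "V x (\<lambda>y. vf_bracket U W y \<phi>) = V x (\<lambda>y. U y (\<lambda>z. W z \<phi>)) - V x (\<lambda>y. W y (\<lambda>z. U z \<phi>))"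
      if "U \<in> SX" "V \<in> SX" "W \<in> SX" for U V W
      unfolding vf_bracket_def
      by (rule SX_diff_fun[OF that(2) SX_Cf[OF that(1) SX_Cf[OF that(3) True]] SX_Cf[OF that(3) SX_Cf[OF that(1) True]]])
    note * = this[OF assms(2,1,3)] this[OF assms(1,2,3)] this[OF assms(1,3,2)]
    show ?thesis
      unfolding vf_bracket_def[of X "vf_bracket Y Z"] vf_bracket_def[of "vf_bracket X Y" Z]
        vf_bracket_def[of Y "vf_bracket X Z"] * by (simp add: vf_bracket_def)
  next
    case False
    note off = SX_off[OF _ False, of _ x]
    show ?thesis
      unfolding off[OF SX_bracket[OF assms(1) SX_bracket[OF assms(2,3)]]]
        off[OF SX_bracket[OF SX_bracket[OF assms(1,2)] assms(3)]]
        off[OF SX_bracket[OF assms(2) SX_bracket[OF assms(1,3)]]] by simp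
  qed
qed

lemma vf_bracket_scale:
  assumes "X \<in> SX" "Y \<in> SX" "Z \<in> SX" "f \<in> Cinf L" "g \<in> Cinf L"
  shows "vf_bracket (\<lambda>x \<phi>. f x * X x \<phi> + g x * Y x \<phi>) Z =
    (\<lambda>x \<phi>. f x * vf_bracket X Z x \<phi> + g x * vf_bracket Y Z x \<phi> - Z x f * X x \<phi> - Z x g * Y x \<phi>)"
proof (intro ext)
  fix x \<phi>
  show "vf_bracket (\<lambda>x \<phi>. f x * X x \<phi> + g x * Y x \<phi>) Z x \<phi> =
      f x * vf_bracket X Z x \<phi> + g x * vf_bracket Y Z x \<phi> - Z x f * X x \<phi> - Z x g * Y x \<phi>"
  proof (cases "\<phi> \<in> Cinf L")
    case True
    note S = SX_Cf[OF assms(1) True] SX_Cf[OF assms(2) True]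
    have "Z x (\<lambda>y. f y * X y \<phi> + g y * Y y \<phi>) =
        (f x * Z x (\<lambda>y. X y \<phi>) + X x \<phi> * Z x f) + (g x * Z x (\<lambda>y. Y y \<phi>) + Y x \<phi> * Z x g)"
      by (simp only: SX_add_fun[OF assms(3) Cf_mult[OF assms(4) S(1)] Cf_mult[OF assms(5) S(2)]]
        SX_mult_fun[OF assms(3,4) S(1)] SX_mult_fun[OF assms(3,5) S(2)])
    then show ?thesis by (simp add: vf_bracket_def algebra_simps)
  next
    case False
    note off = SX_off[OF _ False, of _ x]
    show ?thesis
      unfolding off[OF SX_bracket[OF SX_lin[OF assms(1,2,4,5)] assms(3)]] off[OF SX_bracket[OF assms(1,3)]]
        off[OF SX_bracket[OF assms(2,3)]] off[OF assms(1)] off[OF assms(2)] by simp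
  qed
qed

end

section \<open>The structure equations of an IM connection\<close>

context bundle_of_ideals
begin

abbreviation "SK \<equiv> subsections L \<kk>"

lemma SK_SA: "s \<in> SK \<Longrightarrow> s \<in> SA"
  by (simp add: subsections_def)

lemma subspace_ideal: "subspace (\<kk> x)"
proof -
  obtain s where "\<forall>x. \<exists>U e. open U \<and> x \<in> U \<and>
        pointwise_basis_on (bundle_rank L) (fibre L) U e \<and>
        (\<forall>i < bundle_rank L. smooth_section_on (atlas L) (bundle_rank L) (frames L) U (e i)) \<and>
        (\<forall>y\<in>U. \<kk> y = span ((\<lambda>i. e i y) ` {..<s}))"
    using subbundle unfolding subbundle_def by (elim exE conjE)
  then obtain U e where "x \<in> U" "\<forall>y\<in>U. \<kk> y = span ((\<lambda>i. e i y) ` {..<s :: nat})"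
    by (elim allE[of _ x] exE conjE)
  then have "\<kk> x = span ((\<lambda>i. e i x) ` {..<s})" by simp
  then show ?thesis by (simp only: subspace_span)
qed

lemma SK_I: "s \<in> SA \<Longrightarrow> (\<And>x. s x \<in> \<kk> x) \<Longrightarrow> s \<in> SK"
  by (simp add: subsections_def)

lemma SK_D: "s \<in> SK \<Longrightarrow> s x \<in> \<kk> x"
  by (simp add: subsections_def)

lemma SK_lin:
  assumes "s \<in> SK" "t \<in> SK" "f \<in> Cinf L" "g \<in> Cinf L"
  shows "(\<lambda>x. f x *\<^sub>R s x + g x *\<^sub>R t x) \<in> SK"
proof (rule SK_I)
  show "(\<lambda>x. f x *\<^sub>R s x + g x *\<^sub>R t x) \<in> SA"
    by (rule SA_lin[OF SK_SA[OF assms(1)] SK_SA[OF assms(2)] assms(3,4)])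
  show "f x *\<^sub>R s x + g x *\<^sub>R t x \<in> \<kk> x" for x
    by (rule subspace_add[OF subspace_ideal subspace_scale[OF subspace_ideal SK_D[OF assms(1)]]
      subspace_scale[OF subspace_ideal SK_D[OF assms(2)]]])
qed

lemma SK_zero: "(\<lambda>x. 0) \<in> SK"
  by (rule SK_I[OF SA_zero subspace_0[OF subspace_ideal]])

lemma subsp_SK: "subsp SK"
  unfolding subsp_def using SK_zero SK_lin Cf_const by blast

lemma SK_scale: "s \<in> SK \<Longrightarrow> f \<in> Cinf L \<Longrightarrow> (\<lambda>x. f x *\<^sub>R s x) \<in> SK"
  using SK_lin[of s "\<lambda>x. 0" f "\<lambda>x. 0"] SK_zero Cf_const[of 0] by simp

lemma rho_SK: "\<xi> \<in> SK \<Longrightarrow> rho L \<xi> = (\<lambda>x \<phi>. 0)"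
  by (auto simp: rho_def subsections_def ker_anchor)

lemma linon_bracket_SK: "\<gamma> \<in> SA \<Longrightarrow> linon SK (bracket L \<gamma>)"
  using linon_bracket SK_SA unfolding linon_def by blast

lemma rho_diff_SK: "\<beta> \<in> SA \<Longrightarrow> \<xi> \<in> SK \<Longrightarrow> rho L (\<lambda>x. \<beta> x - \<xi> x) = rho L \<beta>"
proof -
  assume a: "\<beta> \<in> SA" "\<xi> \<in> SK"
  have "anchor L x (\<beta> x - \<xi> x) = anchor L x (\<beta> x)" for x
    using anchor_linear[of "\<beta> x" x "\<xi> x" 1 "-1"] SA_fibre[OF a(1)] SA_fibre[OF SK_SA[OF a(2)]]
      rho_SK[OF a(2)] by (simp add: rho_def fun_eq_iff)
  then show ?thesis by (simp add: rho_def)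
qed

lemma tuples_0 [simp]: "tuples 0 S = {[]}"
  by (auto simp: tuples_def)

lemma tuples_1 [simp]: "tuples (Suc 0) S = {[s] |s. s \<in> S}"
  by (auto simp: tuples_def length_Suc_conv)

lemma formsD:
  assumes "\<gamma> \<in> forms L \<kk> n m" "\<beta>s \<in> tuples n SA" "Xs \<in> tuples m SX"
  shows "\<gamma> \<beta>s Xs \<in> SK"
    and "i < n \<Longrightarrow> \<beta> \<in> SA \<Longrightarrow> \<beta>' \<in> SA \<Longrightarrow> f \<in> Cinf L \<Longrightarrow> g \<in> Cinf L \<Longrightarrow>
      \<gamma> (\<beta>s[i := \<lambda>x. f x *\<^sub>R \<beta> x + g x *\<^sub>R \<beta>' x]) Xs =
             (\<lambda>x. f x *\<^sub>R \<gamma> (\<beta>s[i := \<beta>]) Xs x + g x *\<^sub>R \<gamma> (\<beta>s[i := \<beta>']) Xs x)"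
    and "j < m \<Longrightarrow> X \<in> SX \<Longrightarrow> Y \<in> SX \<Longrightarrow> f \<in> Cinf L \<Longrightarrow> g \<in> Cinf L \<Longrightarrow>
      \<gamma> \<beta>s (Xs[j := \<lambda>x \<phi>. f x * X x \<phi> + g x * Y x \<phi>]) =
             (\<lambda>x. f x *\<^sub>R \<gamma> \<beta>s (Xs[j := X]) x + g x *\<^sub>R \<gamma> \<beta>s (Xs[j := Y]) x)"
    and "mset \<beta>s' = mset \<beta>s \<Longrightarrow> \<gamma> \<beta>s' Xs = \<gamma> \<beta>s Xs"
    and "\<not> distinct Xs \<Longrightarrow> \<gamma> \<beta>s Xs = (\<lambda>x. 0)"
proof -
  note A = bspec[OF bspec[OF conjunct2[OF assms(1)[unfolded forms_def mem_Collect_eq]] assms(2)] assms(3)]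
  note A1 = conjunct2[OF A] note A2 = conjunct2[OF A1] note A3 = conjunct2[OF A2] note A4 = conjunct2[OF A3]
  show "\<gamma> \<beta>s Xs \<in> SK" by (rule conjunct1[OF A])
  show "i < n \<Longrightarrow> \<beta> \<in> SA \<Longrightarrow> \<beta>' \<in> SA \<Longrightarrow> f \<in> Cinf L \<Longrightarrow> g \<in> Cinf L \<Longrightarrow>
      \<gamma> (\<beta>s[i := \<lambda>x. f x *\<^sub>R \<beta> x + g x *\<^sub>R \<beta>' x]) Xs =
             (\<lambda>x. f x *\<^sub>R \<gamma> (\<beta>s[i := \<beta>]) Xs x + g x *\<^sub>R \<gamma> (\<beta>s[i := \<beta>']) Xs x)"
    by (rule conjunct1[OF A1, rule_format])
  show "j < m \<Longrightarrow> X \<in> SX \<Longrightarrow> Y \<in> SX \<Longrightarrow> f \<in> Cinf L \<Longrightarrow> g \<in> Cinf L \<Longrightarrow>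
      \<gamma> \<beta>s (Xs[j := \<lambda>x \<phi>. f x * X x \<phi> + g x * Y x \<phi>]) =
             (\<lambda>x. f x *\<^sub>R \<gamma> \<beta>s (Xs[j := X]) x + g x *\<^sub>R \<gamma> \<beta>s (Xs[j := Y]) x)"
    by (rule conjunct1[OF A2, rule_format])
  show "mset \<beta>s' = mset \<beta>s \<Longrightarrow> \<gamma> \<beta>s' Xs = \<gamma> \<beta>s Xs" by (rule conjunct1[OF A3, rule_format])
  show "\<not> distinct Xs \<Longrightarrow> \<gamma> \<beta>s Xs = (\<lambda>x. 0)" by (rule A4[rule_format])
qed

lemma weilD:
  assumes "c \<in> weil_cochains L \<kk> p q"
  shows "\<not> weil_dom L p q k \<alpha>s \<beta>s Xs \<Longrightarrow> c k \<alpha>s \<beta>s Xs = (\<lambda>x. 0)"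
    and "k \<le> p \<Longrightarrow> k \<le> q \<Longrightarrow> \<alpha>s \<in> tuples (p - k) SA \<Longrightarrow> c k \<alpha>s \<in> forms L \<kk> k (q - k)"
    and "k \<le> p \<Longrightarrow> k \<le> q \<Longrightarrow> \<alpha>s \<in> tuples (p - k) SA \<Longrightarrow> i < p - k \<Longrightarrow> \<alpha> \<in> SA \<Longrightarrow> \<alpha>' \<in> SA \<Longrightarrow>
      c k (\<alpha>s[i := \<lambda>x. a *\<^sub>R \<alpha> x + b *\<^sub>R \<alpha>' x]) \<beta>s Xs =
             (\<lambda>x. a *\<^sub>R c k (\<alpha>s[i := \<alpha>]) \<beta>s Xs x + b *\<^sub>R c k (\<alpha>s[i := \<alpha>']) \<beta>s Xs x)"
    and "k \<le> p \<Longrightarrow> k \<le> q \<Longrightarrow> \<alpha>s \<in> tuples (p - k) SA \<Longrightarrow> \<not> distinct \<alpha>s \<Longrightarrow> c k \<alpha>s \<beta>s Xs = (\<lambda>x. 0)"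
    and "f \<in> Cinf L \<Longrightarrow> weil_dom L p q k (\<alpha> # \<alpha>s) \<beta>s Xs \<Longrightarrow>
        c k ((\<lambda>x. f x *\<^sub>R \<alpha> x) # \<alpha>s) \<beta>s Xs =
          (\<lambda>x. f x *\<^sub>R c k (\<alpha> # \<alpha>s) \<beta>s Xs x + dwedge f (c (Suc k) \<alpha>s (\<alpha> # \<beta>s)) Xs x)"
proof -
  note A = assms[unfolded weil_cochains_def mem_Collect_eq]
  note A1 = conjunct1[OF conjunct2[OF A], rule_format]
  show "\<not> weil_dom L p q k \<alpha>s \<beta>s Xs \<Longrightarrow> c k \<alpha>s \<beta>s Xs = (\<lambda>x. 0)" by (rule conjunct1[OF A, rule_format])
  { assume *: "k \<le> p" "k \<le> q" "\<alpha>s \<in> tuples (p - k) SA"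
    note B = A1[OF conjI[OF *(1,2)] *(3)]
    show "c k \<alpha>s \<in> forms L \<kk> k (q - k)" by (rule conjunct1[OF B])
    show "i < p - k \<Longrightarrow> \<alpha> \<in> SA \<Longrightarrow> \<alpha>' \<in> SA \<Longrightarrow>
      c k (\<alpha>s[i := \<lambda>x. a *\<^sub>R \<alpha> x + b *\<^sub>R \<alpha>' x]) \<beta>s Xs =
             (\<lambda>x. a *\<^sub>R c k (\<alpha>s[i := \<alpha>]) \<beta>s Xs x + b *\<^sub>R c k (\<alpha>s[i := \<alpha>']) \<beta>s Xs x)"
      by (rule conjunct1[OF conjunct2[OF B], rule_format])
    show "\<not> distinct \<alpha>s \<Longrightarrow> c k \<alpha>s \<beta>s Xs = (\<lambda>x. 0)"
      by (rule conjunct2[OF conjunct2[OF B], rule_format])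
  }
  show "f \<in> Cinf L \<Longrightarrow> weil_dom L p q k (\<alpha> # \<alpha>s) \<beta>s Xs \<Longrightarrow>
        c k ((\<lambda>x. f x *\<^sub>R \<alpha> x) # \<alpha>s) \<beta>s Xs =
          (\<lambda>x. f x *\<^sub>R c k (\<alpha> # \<alpha>s) \<beta>s Xs x + dwedge f (c (Suc k) \<alpha>s (\<alpha> # \<beta>s)) Xs x)"
    by (rule conjunct2[OF conjunct2[OF A], rule_format])
qed

end

text \<open>
  The arguments of a Weil cochain of unspecified bidegree; the component \<open>c\<^sub>k\<close> is the restriction to
  lists of length \<open>k\<close> in the second place.
\<close>

type_synonym ('m, 'a) cfun = "('m \<Rightarrow> 'a) list \<Rightarrow> ('m \<Rightarrow> 'a) list \<Rightarrow> 'm vfield list \<Rightarrow> 'm \<Rightarrow> 'a"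

locale im_connection = bundle_of_ideals L \<kk>
  for L :: "('m::{t2_space,second_countable_topology}, 'e::real_normed_vector, 'a::real_vector) algebroid"
    and \<kk> +
  fixes \<theta> :: "('m, 'a) cochain"
  assumes \<theta>: "\<theta> \<in> im_connections L \<kk>"
begin

abbreviation "br \<equiv> bracket L"
abbreviation "ro \<equiv> rho L"
abbreviation "C \<equiv> symC \<theta>"
abbreviation "v \<equiv> symv \<theta>"
abbreviation "h \<equiv> hor \<theta>"

lemma \<theta>W: "\<theta> \<in> weil_cochains L \<kk> 1 1"
  and \<theta>\<delta>: "weil_delta L 1 1 \<theta> = (\<lambda>k \<alpha>s \<beta>s Xs x. 0)"
  and v_SK: "\<xi> \<in> SK \<Longrightarrow> v \<xi> = \<xi>"
  using \<theta> unfolding im_connections_def im_forms_def by simp_all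

lemma \<theta>_forms: "k \<le> 1 \<Longrightarrow> \<alpha>s \<in> tuples (1 - k) SA \<Longrightarrow> \<theta> k \<alpha>s \<in> forms L \<kk> k (1 - k)"
  by (rule weilD(2)[OF \<theta>W]) simp_all

lemma C_SK: "\<alpha> \<in> SA \<Longrightarrow> X \<in> SX \<Longrightarrow> C \<alpha> X \<in> SK"
  unfolding symC_def by (rule formsD(1)[OF \<theta>_forms[of 0 "[\<alpha>]"]]) simp_all

lemma v_in_SK: "\<beta> \<in> SA \<Longrightarrow> v \<beta> \<in> SK"
  unfolding symv_def by (rule formsD(1)[OF \<theta>_forms[of 1 "[]"]]) simp_all

lemma C_linX:
  assumes "\<alpha> \<in> SA" "X \<in> SX" "Y \<in> SX" "f \<in> Cinf L" "g \<in> Cinf L"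
  shows "C \<alpha> (\<lambda>x \<phi>. f x * X x \<phi> + g x * Y x \<phi>) = (\<lambda>x. f x *\<^sub>R C \<alpha> X x + g x *\<^sub>R C \<alpha> Y x)"
  using formsD(3)[OF \<theta>_forms[of 0 "[\<alpha>]"], of "[]" "[X]" 0 X Y f g] assms by (simp add: symC_def)

lemma v_lin:
  assumes "\<alpha> \<in> SA" "\<beta> \<in> SA" "f \<in> Cinf L" "g \<in> Cinf L"
  shows "v (\<lambda>x. f x *\<^sub>R \<alpha> x + g x *\<^sub>R \<beta> x) = (\<lambda>x. f x *\<^sub>R v \<alpha> x + g x *\<^sub>R v \<beta> x)"
  using formsD(2)[OF \<theta>_forms[of 1 "[]"], of "[\<alpha>]" "[]" 0 \<alpha> \<beta> f g] assms by (simp add: symv_def)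

lemma C_lin:
  assumes "\<alpha> \<in> SA" "\<beta> \<in> SA"
  shows "C (\<lambda>x. r *\<^sub>R \<alpha> x + q *\<^sub>R \<beta> x) X = (\<lambda>x. r *\<^sub>R C \<alpha> X x + q *\<^sub>R C \<beta> X x)"
  using weilD(3)[OF \<theta>W, of 0 "[\<alpha>]" 0 \<alpha> \<beta> r q "[]" "[X]"] assms by (simp add: symC_def)

lemma C_leibniz:
  assumes "\<alpha> \<in> SA" "X \<in> SX" "f \<in> Cinf L"
  shows "C (\<lambda>x. f x *\<^sub>R \<alpha> x) X = (\<lambda>x. f x *\<^sub>R C \<alpha> X x + X x f *\<^sub>R v \<alpha> x)"
  using weilD(5)[OF \<theta>W assms(3), of 0 \<alpha> "[]" "[]" "[X]"] assms
  by (simp add: symC_def symv_def dwedge_def weil_dom_def)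

lemma SK_br: "\<alpha> \<in> SA \<Longrightarrow> \<xi> \<in> SK \<Longrightarrow> br \<alpha> \<xi> \<in> SK"
  by (rule ideal)

lemma linon_C: "linon SA (\<lambda>\<alpha>. C \<alpha> X)"
  unfolding linon_def using C_lin by blast

lemma linon_C_SK: "linon SK (\<lambda>\<alpha>. C \<alpha> X)"
  unfolding linon_def using C_lin SK_SA by blast

lemma C_zero: "\<alpha> \<in> SA \<Longrightarrow> C \<alpha> (\<lambda>x \<phi>. 0) = (\<lambda>x. 0)"
  using C_linX[of \<alpha> "\<lambda>x \<phi>. 0" "\<lambda>x \<phi>. 0" "\<lambda>x. 0" "\<lambda>x. 0"] SX_zero Cf_const[of 0] by simp

lemma linon_v: "linon SA v"
  unfolding linon_def using v_lin Cf_const by blast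

lemma v_v: "\<beta> \<in> SA \<Longrightarrow> v (v \<beta>) = v \<beta>"
  by (rule v_SK[OF v_in_SK])

lemma h_SA: "\<beta> \<in> SA \<Longrightarrow> h \<beta> \<in> SA"
  unfolding hor_def by (rule subsp_diff[OF subsp_SA _ SK_SA[OF v_in_SK]])

lemma h_lin:
  assumes "\<alpha> \<in> SA" "\<beta> \<in> SA" "f \<in> Cinf L" "g \<in> Cinf L"
  shows "h (\<lambda>x. f x *\<^sub>R \<alpha> x + g x *\<^sub>R \<beta> x) = (\<lambda>x. f x *\<^sub>R h \<alpha> x + g x *\<^sub>R h \<beta> x)"
  by (simp add: hor_def v_lin[OF assms] fun_eq_iff algebra_simps)

lemma v_h: "\<beta> \<in> SA \<Longrightarrow> v (h \<beta>) = (\<lambda>x. 0)"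
  unfolding hor_def using linon_diff[OF linon_v, of \<beta> "v \<beta>"] SK_SA[OF v_in_SK] by (simp add: v_v)

lemma ro_h: "\<beta> \<in> SA \<Longrightarrow> ro (h \<beta>) = ro \<beta>"
  unfolding hor_def by (rule rho_diff_SK[OF _ v_in_SK])

lemma ro_SX: "\<alpha> \<in> SA \<Longrightarrow> ro \<alpha> \<in> SX"
  by (rule anchor_smooth)

lemma C_SA: "\<alpha> \<in> SA \<Longrightarrow> X \<in> SX \<Longrightarrow> C \<alpha> X \<in> SA"
  by (rule SK_SA[OF C_SK])

lemma v_SA: "b \<in> SA \<Longrightarrow> v b \<in> SA"
  by (rule SK_SA[OF v_in_SK])

lemma h_set: "set \<beta>s \<subseteq> SA \<Longrightarrow> set (map h \<beta>s) \<subseteq> SA"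
  using h_SA by auto

text \<open>
  The structure equations: the two components of \<open>\<delta> \<theta> = 0\<close> on two alternating sections, and on one
  alternating and one symmetric section.
\<close>

lemma C_bracket:
  assumes "\<alpha> \<in> SA" "\<beta> \<in> SA" "X \<in> SX"
  shows "C (br \<alpha> \<beta>) X = (\<lambda>x. (br \<alpha> (C \<beta> X) x - C \<beta> (vf_bracket (ro \<alpha>) X) x)
    - (br \<beta> (C \<alpha> X) x - C \<alpha> (vf_bracket (ro \<beta>) X) x))"
proof -
  have "weil_delta L 1 1 \<theta> 0 [\<alpha>, \<beta>] [] [X] x = 0" for x by (simp only: \<theta>\<delta>)
  moreover have "weil_dom L (Suc 1) 1 0 [\<alpha>, \<beta>] [] [X]" using assms by (simp add: weil_dom_def tuples_def)
  ultimately show ?thesis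
    by (simp add: weil_delta_def lie_derivative_def symC_def fun_eq_iff omit_def algebra_simps)
qed

lemma v_bracket:
  assumes "\<alpha> \<in> SA" "\<beta> \<in> SA"
  shows "v (br \<alpha> \<beta>) = (\<lambda>x. br \<alpha> (v \<beta>) x - C \<alpha> (ro \<beta>) x)"
proof -
  have "weil_delta L 1 1 \<theta> 1 [\<alpha>] [\<beta>] [] x = 0" for x by (simp only: \<theta>\<delta>)
  moreover have "weil_dom L (Suc 1) 1 1 [\<alpha>] [\<beta>] []" using assms by (simp add: weil_dom_def tuples_def)
  ultimately show ?thesis
    by (simp add: weil_delta_def lie_derivative_def symC_def symv_def fun_eq_iff omit_def algebra_simps)
qed

lemma h_bracket:
  assumes "\<alpha> \<in> SA" "\<beta> \<in> SA"
  shows "br \<alpha> (h \<beta>) = (\<lambda>x. h (br \<alpha> \<beta>) x - C \<alpha> (ro \<beta>) x)"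
  using linon_diff[OF linon_bracket[OF assms(1)] assms(2) SK_SA[OF v_in_SK[OF assms(2)]]]
  by (simp add: hor_def v_bracket[OF assms] fun_eq_iff)

text \<open>
  The anchor vanishes on a section of the bundle of ideals, so the structure equations lose a term
  there.  What remains is the compatibility of the induced connection with the action of \<open>A\<close>:
  invariance, and agreement along the anchor, both up to the adjoint action of a value of \<open>\<theta>\<close>.
\<close>

lemma C_bracket_SK:
  assumes "\<alpha> \<in> SA" "\<xi> \<in> SK" "X \<in> SX"
  shows "br \<alpha> (C \<xi> X) x - C (br \<alpha> \<xi>) X x - C \<xi> (vf_bracket (ro \<alpha>) X) x = - br (C \<alpha> X) \<xi> x"
proof -
  have "vf_bracket (ro \<xi>) X = (\<lambda>x \<phi>. 0)"
    unfolding rho_SK[OF assms(2)] using SX_zero_fun[OF assms(3)] by (simp add: vf_bracket_def)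
  then show ?thesis
    using C_bracket[OF assms(1) SK_SA[OF assms(2)] assms(3)] C_zero[OF assms(1)]
      bracket_skew[OF SK_SA[OF C_SK[OF assms(1,3)]] SK_SA[OF assms(2)]]
    by simp
qed

lemma C_ro_SK:
  assumes "\<beta> \<in> SA" "\<xi> \<in> SK"
  shows "C \<xi> (ro \<beta>) x - br \<beta> \<xi> x = - br (v \<beta>) \<xi> x"
proof -
  have "v (br \<xi> \<beta>) = br \<xi> \<beta>"
    using bracket_skew[OF SK_SA[OF assms(2)] assms(1)] subsp_minus[OF subsp_SK SK_br[OF assms]]
    by (intro v_SK) simp
  then show ?thesis
    using v_bracket[OF SK_SA[OF assms(2)] assms(1)]
      fun_cong[OF bracket_skew[OF SK_SA[OF assms(2)] assms(1)], of x]
      fun_cong[OF bracket_skew[OF SK_SA[OF assms(2)] SK_SA[OF v_in_SK[OF assms(1)]]], of x]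
    by (simp add: fun_eq_iff algebra_simps)
qed

section \<open>Cochains as functions of lists\<close>

text \<open>
  The defining properties of Weil cochains without the Leibniz rule: in the sections of the first
  list only linearity over the reals is required.  By the symmetries it is enough to require linearity in the
  head of each list.
\<close>

definition tame :: "('m, 'a) cfun \<Rightarrow> bool" where
  "tame F \<longleftrightarrow> (\<forall>\<alpha>s \<beta>s Xs. set \<alpha>s \<subseteq> SA \<longrightarrow> set \<beta>s \<subseteq> SA \<longrightarrow> set Xs \<subseteq> SX \<longrightarrow>
     F \<alpha>s \<beta>s Xs \<in> SK \<and>
     (\<forall>x. symm SA (\<lambda>\<beta>s. F \<alpha>s \<beta>s Xs x)) \<and>
     (\<forall>x. altern SX (\<lambda>Xs. F \<alpha>s \<beta>s Xs x)) \<and>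
     (\<forall>x. altern SA (\<lambda>\<alpha>s. F \<alpha>s \<beta>s Xs x)) \<and>
     (\<forall>\<beta>\<in>SA. \<forall>\<beta>'\<in>SA. \<forall>f\<in>Cinf L. \<forall>g\<in>Cinf L. \<forall>x.
        F \<alpha>s ((\<lambda>x. f x *\<^sub>R \<beta> x + g x *\<^sub>R \<beta>' x) # \<beta>s) Xs x =
          f x *\<^sub>R F \<alpha>s (\<beta> # \<beta>s) Xs x + g x *\<^sub>R F \<alpha>s (\<beta>' # \<beta>s) Xs x) \<and>
     (\<forall>X\<in>SX. \<forall>Y\<in>SX. \<forall>f\<in>Cinf L. \<forall>g\<in>Cinf L. \<forall>x.
        F \<alpha>s \<beta>s ((\<lambda>x \<phi>. f x * X x \<phi> + g x * Y x \<phi>) # Xs) x =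
          f x *\<^sub>R F \<alpha>s \<beta>s (X # Xs) x + g x *\<^sub>R F \<alpha>s \<beta>s (Y # Xs) x) \<and>
     (\<forall>\<alpha>\<in>SA. \<forall>\<alpha>'\<in>SA. \<forall>r q x.
        F ((\<lambda>x. r *\<^sub>R \<alpha> x + q *\<^sub>R \<alpha>' x) # \<alpha>s) \<beta>s Xs x =
          r *\<^sub>R F (\<alpha> # \<alpha>s) \<beta>s Xs x + q *\<^sub>R F (\<alpha>' # \<alpha>s) \<beta>s Xs x))"

lemma tameI:
  assumes "\<And>\<alpha>s \<beta>s Xs. set \<alpha>s \<subseteq> SA \<Longrightarrow> set \<beta>s \<subseteq> SA \<Longrightarrow> set Xs \<subseteq> SX \<Longrightarrow> F \<alpha>s \<beta>s Xs \<in> SK"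
    and "\<And>\<alpha>s Xs x. set \<alpha>s \<subseteq> SA \<Longrightarrow> set Xs \<subseteq> SX \<Longrightarrow> symm SA (\<lambda>\<beta>s. F \<alpha>s \<beta>s Xs x)"
    and "\<And>\<alpha>s \<beta>s x. set \<alpha>s \<subseteq> SA \<Longrightarrow> set \<beta>s \<subseteq> SA \<Longrightarrow> altern SX (\<lambda>Xs. F \<alpha>s \<beta>s Xs x)"
    and "\<And>\<beta>s Xs x. set \<beta>s \<subseteq> SA \<Longrightarrow> set Xs \<subseteq> SX \<Longrightarrow> altern SA (\<lambda>\<alpha>s. F \<alpha>s \<beta>s Xs x)"
    and "\<And>\<alpha>s \<beta>s Xs \<beta> \<beta>' f g x. set \<alpha>s \<subseteq> SA \<Longrightarrow> set \<beta>s \<subseteq> SA \<Longrightarrow> set Xs \<subseteq> SX \<Longrightarrow> \<beta> \<in> SA \<Longrightarrow> \<beta>' \<in> SA \<Longrightarrow>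
       f \<in> Cinf L \<Longrightarrow> g \<in> Cinf L \<Longrightarrow> F \<alpha>s ((\<lambda>x. f x *\<^sub>R \<beta> x + g x *\<^sub>R \<beta>' x) # \<beta>s) Xs x =
          f x *\<^sub>R F \<alpha>s (\<beta> # \<beta>s) Xs x + g x *\<^sub>R F \<alpha>s (\<beta>' # \<beta>s) Xs x"
    and "\<And>\<alpha>s \<beta>s Xs X Y f g x. set \<alpha>s \<subseteq> SA \<Longrightarrow> set \<beta>s \<subseteq> SA \<Longrightarrow> set Xs \<subseteq> SX \<Longrightarrow> X \<in> SX \<Longrightarrow> Y \<in> SX \<Longrightarrow>
       f \<in> Cinf L \<Longrightarrow> g \<in> Cinf L \<Longrightarrow> F \<alpha>s \<beta>s ((\<lambda>x \<phi>. f x * X x \<phi> + g x * Y x \<phi>) # Xs) x =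
          f x *\<^sub>R F \<alpha>s \<beta>s (X # Xs) x + g x *\<^sub>R F \<alpha>s \<beta>s (Y # Xs) x"
    and "\<And>\<alpha>s \<beta>s Xs \<alpha> \<alpha>' r q x. set \<alpha>s \<subseteq> SA \<Longrightarrow> set \<beta>s \<subseteq> SA \<Longrightarrow> set Xs \<subseteq> SX \<Longrightarrow> \<alpha> \<in> SA \<Longrightarrow> \<alpha>' \<in> SA \<Longrightarrow>
       F ((\<lambda>x. r *\<^sub>R \<alpha> x + q *\<^sub>R \<alpha>' x) # \<alpha>s) \<beta>s Xs x =
          r *\<^sub>R F (\<alpha> # \<alpha>s) \<beta>s Xs x + q *\<^sub>R F (\<alpha>' # \<alpha>s) \<beta>s Xs x"
  shows "tame F"
  unfolding tame_def by (intro allI impI conjI ballI assms)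

lemma tameD:
  assumes "tame F" "set \<alpha>s \<subseteq> SA" "set \<beta>s \<subseteq> SA" "set Xs \<subseteq> SX"
  shows "F \<alpha>s \<beta>s Xs \<in> SK"
    and "\<beta> \<in> SA \<Longrightarrow> \<beta>' \<in> SA \<Longrightarrow> f \<in> Cinf L \<Longrightarrow> g \<in> Cinf L \<Longrightarrow>
       F \<alpha>s ((\<lambda>x. f x *\<^sub>R \<beta> x + g x *\<^sub>R \<beta>' x) # \<beta>s) Xs x =
          f x *\<^sub>R F \<alpha>s (\<beta> # \<beta>s) Xs x + g x *\<^sub>R F \<alpha>s (\<beta>' # \<beta>s) Xs x"
    and "X \<in> SX \<Longrightarrow> Y \<in> SX \<Longrightarrow> f \<in> Cinf L \<Longrightarrow> g \<in> Cinf L \<Longrightarrow>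
       F \<alpha>s \<beta>s ((\<lambda>x \<phi>. f x * X x \<phi> + g x * Y x \<phi>) # Xs) x =
          f x *\<^sub>R F \<alpha>s \<beta>s (X # Xs) x + g x *\<^sub>R F \<alpha>s \<beta>s (Y # Xs) x"
    and "\<alpha> \<in> SA \<Longrightarrow> \<alpha>' \<in> SA \<Longrightarrow> F ((\<lambda>x. r *\<^sub>R \<alpha> x + q *\<^sub>R \<alpha>' x) # \<alpha>s) \<beta>s Xs x =
          r *\<^sub>R F (\<alpha> # \<alpha>s) \<beta>s Xs x + q *\<^sub>R F (\<alpha>' # \<alpha>s) \<beta>s Xs x"
proof -
  note A = assms(1)[unfolded tame_def, THEN spec, THEN spec, THEN spec, THEN mp, THEN mp, THEN mp, OF assms(2-4)]
  note A4 = conjunct2[OF conjunct2[OF conjunct2[OF conjunct2[OF A]]]]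
  show "F \<alpha>s \<beta>s Xs \<in> SK" by (rule conjunct1[OF A])
  show "\<beta> \<in> SA \<Longrightarrow> \<beta>' \<in> SA \<Longrightarrow> f \<in> Cinf L \<Longrightarrow> g \<in> Cinf L \<Longrightarrow>
       F \<alpha>s ((\<lambda>x. f x *\<^sub>R \<beta> x + g x *\<^sub>R \<beta>' x) # \<beta>s) Xs x =
          f x *\<^sub>R F \<alpha>s (\<beta> # \<beta>s) Xs x + g x *\<^sub>R F \<alpha>s (\<beta>' # \<beta>s) Xs x"
    by (rule conjunct1[OF A4, rule_format])
  show "X \<in> SX \<Longrightarrow> Y \<in> SX \<Longrightarrow> f \<in> Cinf L \<Longrightarrow> g \<in> Cinf L \<Longrightarrow>
       F \<alpha>s \<beta>s ((\<lambda>x \<phi>. f x * X x \<phi> + g x * Y x \<phi>) # Xs) x =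
          f x *\<^sub>R F \<alpha>s \<beta>s (X # Xs) x + g x *\<^sub>R F \<alpha>s \<beta>s (Y # Xs) x"
    by (rule conjunct1[OF conjunct2[OF A4], rule_format])
  show "\<alpha> \<in> SA \<Longrightarrow> \<alpha>' \<in> SA \<Longrightarrow> F ((\<lambda>x. r *\<^sub>R \<alpha> x + q *\<^sub>R \<alpha>' x) # \<alpha>s) \<beta>s Xs x =
          r *\<^sub>R F (\<alpha> # \<alpha>s) \<beta>s Xs x + q *\<^sub>R F (\<alpha>' # \<alpha>s) \<beta>s Xs x"
    by (rule conjunct2[OF conjunct2[OF A4], rule_format])
qed

lemma tame_symB: "tame F \<Longrightarrow> set \<alpha>s \<subseteq> SA \<Longrightarrow> set Xs \<subseteq> SX \<Longrightarrow> symm SA (\<lambda>\<beta>s. F \<alpha>s \<beta>s Xs x)"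
  unfolding tame_def by (drule spec[of _ \<alpha>s], drule spec[of _ "[]"], drule spec[of _ Xs]) simp

lemma tame_altX: "tame F \<Longrightarrow> set \<alpha>s \<subseteq> SA \<Longrightarrow> set \<beta>s \<subseteq> SA \<Longrightarrow> altern SX (\<lambda>Xs. F \<alpha>s \<beta>s Xs x)"
  unfolding tame_def by (drule spec[of _ \<alpha>s], drule spec[of _ \<beta>s], drule spec[of _ "[]"]) simp

lemma tame_altA: "tame F \<Longrightarrow> set \<beta>s \<subseteq> SA \<Longrightarrow> set Xs \<subseteq> SX \<Longrightarrow> altern SA (\<lambda>\<alpha>s. F \<alpha>s \<beta>s Xs x)"
  unfolding tame_def by (drule spec[of _ "[]"], drule spec[of _ \<beta>s], drule spec[of _ Xs]) simp

lemma tame_linonB: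
  assumes "tame F" "set \<alpha>s \<subseteq> SA" "set \<beta>s \<subseteq> SA" "set Xs \<subseteq> SX"
  shows "linon SA (\<lambda>\<beta>. F \<alpha>s (\<beta> # \<beta>s) Xs)"
  unfolding linon_def using tameD(2)[OF assms _ _ Cf_const Cf_const] by blast

lemma tame_diffB:
  assumes "tame F" "set \<alpha>s \<subseteq> SA" "set \<beta>s \<subseteq> SA" "set Xs \<subseteq> SX" "\<beta> \<in> SA" "\<beta>' \<in> SA"
  shows "F \<alpha>s ((\<lambda>x. \<beta> x - \<beta>' x) # \<beta>s) Xs x = F \<alpha>s (\<beta> # \<beta>s) Xs x - F \<alpha>s (\<beta>' # \<beta>s) Xs x"
  by (rule fun_cong[OF linon_diff[OF tame_linonB[OF assms(1-4)] assms(5,6)]])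

lemma tame_zeroB:
  assumes "tame F" "set \<alpha>s \<subseteq> SA" "set \<beta>s \<subseteq> SA" "set Xs \<subseteq> SX"
  shows "F \<alpha>s ((\<lambda>x. 0) # \<beta>s) Xs x = 0"
  by (rule fun_cong[OF linon_zero[OF tame_linonB[OF assms] subsp_SA]])

lemma tame_zeroX:
  assumes "tame F" "set \<alpha>s \<subseteq> SA" "set \<beta>s \<subseteq> SA" "set Xs \<subseteq> SX"
  shows "F \<alpha>s \<beta>s ((\<lambda>x \<phi>. 0) # Xs) x = 0"
  using tameD(3)[OF assms SX_zero SX_zero Cf_const[of 0] Cf_const[of 0]] by simp

lemma tame_addX:
  assumes "tame F" "set \<alpha>s \<subseteq> SA" "set \<beta>s \<subseteq> SA" "set Xs \<subseteq> SX" "X \<in> SX" "Y \<in> SX"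
  shows "F \<alpha>s \<beta>s ((\<lambda>x \<phi>. X x \<phi> + Y x \<phi>) # Xs) x = F \<alpha>s \<beta>s (X # Xs) x + F \<alpha>s \<beta>s (Y # Xs) x"
  using tameD(3)[OF assms(1-6) Cf_const[of 1] Cf_const[of 1]] by simp

lemma tame_minusX:
  assumes "tame F" "set \<alpha>s \<subseteq> SA" "set \<beta>s \<subseteq> SA" "set Xs \<subseteq> SX" "X \<in> SX"
  shows "F \<alpha>s \<beta>s ((\<lambda>x \<phi>. - X x \<phi>) # Xs) x = - F \<alpha>s \<beta>s (X # Xs) x"
  using tameD(3)[OF assms(1-5) SX_zero Cf_const[of "-1"] Cf_const[of 0]] by simp

lemma tame_minusA:
  assumes "tame F" "set \<alpha>s \<subseteq> SA" "set \<beta>s \<subseteq> SA" "set Xs \<subseteq> SX" "\<alpha> \<in> SA"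
  shows "F ((\<lambda>x. - \<alpha> x) # \<alpha>s) \<beta>s Xs x = - F (\<alpha> # \<alpha>s) \<beta>s Xs x"
  using tameD(4)[OF assms(1-5,5), of "-1" 0 x] by simp

lemma tame_add:
  assumes F: "tame F" and G: "tame G"
  shows "tame (\<lambda>\<alpha>s \<beta>s Xs x. F \<alpha>s \<beta>s Xs x + r *\<^sub>R G \<alpha>s \<beta>s Xs x)"
proof (rule tameI, goal_cases)
  case (1 \<alpha>s \<beta>s Xs)
  show ?case by (rule subsp_add[OF subsp_SK tameD(1)[OF F 1] subsp_scaleR[OF subsp_SK tameD(1)[OF G 1]]])
next
  case (2 \<alpha>s Xs x)
  show ?case by (rule symm_add[OF tame_symB[OF F 2] symm_scaleR[OF tame_symB[OF G 2]]])
next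
  case (3 \<alpha>s \<beta>s x)
  show ?case by (rule altern_add[OF tame_altX[OF F 3] altern_scaleR[OF tame_altX[OF G 3]]])
next
  case (4 \<beta>s Xs x)
  show ?case by (rule altern_add[OF tame_altA[OF F 4] altern_scaleR[OF tame_altA[OF G 4]]])
next
  case (5 \<alpha>s \<beta>s Xs \<beta> \<beta>' f g x)
  show ?case unfolding tameD(2)[OF F 5] tameD(2)[OF G 5] by (simp add: algebra_simps)
next
  case (6 \<alpha>s \<beta>s Xs X Y f g x)
  show ?case unfolding tameD(3)[OF F 6] tameD(3)[OF G 6] by (simp add: algebra_simps)
next
  case (7 \<alpha>s \<beta>s Xs \<alpha> \<alpha>' r' q x)
  show ?case unfolding tameD(4)[OF F 7] tameD(4)[OF G 7] by (simp add: algebra_simps)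
qed

lemma tame_0: "tame (\<lambda>\<alpha>s \<beta>s Xs x. 0)"
  by (rule tameI) (simp_all add: SK_zero symm_zero altern_zero)

lemma tame_sum:
  fixes N :: nat
  assumes G: "\<And>n. tame (G n)"
  shows "tame (\<lambda>\<alpha>s \<beta>s Xs x. \<Sum>n<N. c n *\<^sub>R G n \<alpha>s \<beta>s Xs x)"
proof (induction N)
  case 0
  then show ?case by (simp add: tame_0)
next
  case (Suc N)
  show ?case unfolding sum.lessThan_Suc by (rule tame_add[OF Suc.IH G])
qed

subsection \<open>Insertion of the connection\<close>

text \<open>
  The summand of \<open>h\<^sup>*\<close> with \<open>l\<close> one-forms is \<open>(-1) ^ l / fact l\<close> times the \<open>l\<close>-th power of \<open>U\<close>, followed
  by \<open>h\<close> in the other symmetric arguments.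
\<close>

definition U :: "('m, 'a) cfun \<Rightarrow> ('m, 'a) cfun" where
  "U F \<alpha>s \<beta>s Xs x = asum \<alpha>s (\<lambda>a as. asum Xs (\<lambda>X Ys. F as (C a X # \<beta>s) Ys x))"

lemma tame_U:
  assumes F: "tame F"
  shows "tame (U F)"
proof (rule tameI, goal_cases)
  case (1 \<alpha>s \<beta>s Xs)
  have "(\<lambda>x. asum \<alpha>s (\<lambda>a as. asum Xs (\<lambda>X Ys. F as (C a X # \<beta>s) Ys x))) \<in> SK"
    using 1 by (intro subsp_asum[OF subsp_SK 1(1)] subsp_asum[OF subsp_SK 1(3)] tameD(1)[OF F]) (auto intro: C_SA)
  then show ?case unfolding U_def .
next
  case (2 \<alpha>s Xs x)
  show ?case unfolding U_def
    by (intro symm_asum_param[OF 2(1)] symm_asum_param[OF 2(2)]) (rule symm_Cons[OF tame_symB[OF F]]; simp add: C_SA)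
next
  case (3 \<alpha>s \<beta>s x)
  show ?case unfolding U_def
    by (intro altern_asum_param[OF 3(1)] altern_asum) (rule tame_altX[OF F]; use 3 in \<open>simp add: C_SA\<close>)
next
  case (4 \<beta>s Xs x)
  show ?case unfolding U_def
    by (intro altern_asum altern_asum_param[OF 4(2)]) (rule tame_altA[OF F]; use 4 in \<open>simp add: C_SA\<close>)
next
  case (5 \<alpha>s \<beta>s Xs \<beta> \<beta>' f g x)
  have sw: "F as (C a X # b # \<beta>s) Ys x = F as (b # C a X # \<beta>s) Ys x"
    if "a \<in> SA" "set as \<subseteq> SA" "X \<in> SX" "set Ys \<subseteq> SX" "b \<in> SA" for a as X Ys b
    by (rule symm_swap_head[OF tame_symB[OF F]]) (use that 5 in \<open>simp_all add: C_SA\<close>)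
  have "F as (C a X # (\<lambda>x. f x *\<^sub>R \<beta> x + g x *\<^sub>R \<beta>' x) # \<beta>s) Ys x =
      f x *\<^sub>R F as (C a X # \<beta> # \<beta>s) Ys x + g x *\<^sub>R F as (C a X # \<beta>' # \<beta>s) Ys x"
    if "a \<in> SA" "set as \<subseteq> SA" "X \<in> SX" "set Ys \<subseteq> SX" for a as X Ys
    unfolding sw[OF that SA_lin[OF 5(4-7)]] sw[OF that 5(4)] sw[OF that 5(5)]
    by (rule tameD(2)[OF F]) (use that 5 in \<open>simp_all add: C_SA\<close>)
  then have "U F \<alpha>s ((\<lambda>x. f x *\<^sub>R \<beta> x + g x *\<^sub>R \<beta>' x) # \<beta>s) Xs x =
      asum \<alpha>s (\<lambda>a as. asum Xs (\<lambda>X Ys. f x *\<^sub>R F as (C a X # \<beta> # \<beta>s) Ys x + g x *\<^sub>R F as (C a X # \<beta>' # \<beta>s) Ys x))"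
    unfolding U_def by (intro asum_cong[OF 5(1)] asum_cong[OF 5(3)]) auto
  then show ?case unfolding U_def by (simp add: asum_add asum_scaleR)
next
  case (6 \<alpha>s \<beta>s Xs X Y f g x)
  let ?Z = "\<lambda>x \<phi>. f x * X x \<phi> + g x * Y x \<phi>"
  have 1: "F as (C a ?Z # \<beta>s) Xs x = f x *\<^sub>R F as (C a X # \<beta>s) Xs x + g x *\<^sub>R F as (C a Y # \<beta>s) Xs x"
    if "a \<in> SA" "set as \<subseteq> SA" for a as
    unfolding C_linX[OF that(1) 6(4-7)]
    by (rule tameD(2)[OF F]) (use that 6 in \<open>simp_all add: C_SA\<close>)
  have 2: "F as (C a W # \<beta>s) (?Z # Ys) x = f x *\<^sub>R F as (C a W # \<beta>s) (X # Ys) x + g x *\<^sub>R F as (C a W # \<beta>s) (Y # Ys) x"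
    if "a \<in> SA" "set as \<subseteq> SA" "W \<in> SX" "set Ys \<subseteq> SX" for a as W Ys
    by (rule tameD(3)[OF F]) (use that 6 in \<open>simp_all add: C_SA\<close>)
  have "U F \<alpha>s \<beta>s (?Z # Xs) x = asum \<alpha>s (\<lambda>a as.
      (f x *\<^sub>R F as (C a X # \<beta>s) Xs x + g x *\<^sub>R F as (C a Y # \<beta>s) Xs x) -
      asum Xs (\<lambda>W Ys. f x *\<^sub>R F as (C a W # \<beta>s) (X # Ys) x + g x *\<^sub>R F as (C a W # \<beta>s) (Y # Ys) x))"
    unfolding U_def asum.simps
    by (intro asum_cong[OF 6(1)] arg_cong2[of _ _ _ _ minus] 1 asum_cong[OF 6(3)] 2)
  then show ?case unfolding U_def by (simp add: asum_add asum_scaleR asum_diff algebra_simps)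
next
  case (7 \<alpha>s \<beta>s Xs \<alpha> \<alpha>' r q x)
  let ?Z = "\<lambda>x. r *\<^sub>R \<alpha> x + q *\<^sub>R \<alpha>' x"
  have 1: "F \<alpha>s (C ?Z X # \<beta>s) Ys x = r *\<^sub>R F \<alpha>s (C \<alpha> X # \<beta>s) Ys x + q *\<^sub>R F \<alpha>s (C \<alpha>' X # \<beta>s) Ys x"
    if "X \<in> SX" "set Ys \<subseteq> SX" for X Ys
    unfolding C_lin[OF 7(4,5)]
    by (rule tameD(2)[OF F _ _ _ _ _ Cf_const Cf_const]) (use that 7 in \<open>simp_all add: C_SA\<close>)
  have 2: "F (?Z # as) (C a X # \<beta>s) Ys x = r *\<^sub>R F (\<alpha> # as) (C a X # \<beta>s) Ys x + q *\<^sub>R F (\<alpha>' # as) (C a X # \<beta>s) Ys x"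
    if "a \<in> SA" "set as \<subseteq> SA" "X \<in> SX" "set Ys \<subseteq> SX" for a as X Ys
    by (rule tameD(4)[OF F]) (use that 7 in \<open>simp_all add: C_SA\<close>)
  have "U F (?Z # \<alpha>s) \<beta>s Xs x =
      asum Xs (\<lambda>X Ys. r *\<^sub>R F \<alpha>s (C \<alpha> X # \<beta>s) Ys x + q *\<^sub>R F \<alpha>s (C \<alpha>' X # \<beta>s) Ys x) -
      asum \<alpha>s (\<lambda>a as. asum Xs (\<lambda>X Ys. r *\<^sub>R F (\<alpha> # as) (C a X # \<beta>s) Ys x + q *\<^sub>R F (\<alpha>' # as) (C a X # \<beta>s) Ys x))"
    unfolding U_def asum.simps
    by (intro arg_cong2[of _ _ _ _ minus] asum_cong[OF 7(1)] asum_cong[OF 7(3)] 1 2)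
  then show ?case unfolding U_def by (simp add: asum_add asum_scaleR algebra_simps)
qed

lemma tame_Upow: "tame F \<Longrightarrow> tame ((U ^^ n) F)"
  by (induction n) (simp_all add: tame_U)

lemma Upow_add:
  "(U ^^ n) (\<lambda>\<alpha>s \<beta>s Xs x. F \<alpha>s \<beta>s Xs x + G \<alpha>s \<beta>s Xs x) =
    (\<lambda>\<alpha>s \<beta>s Xs x. (U ^^ n) F \<alpha>s \<beta>s Xs x + (U ^^ n) G \<alpha>s \<beta>s Xs x)"
  by (induction n) (simp_all add: U_def asum_add fun_eq_iff)

text \<open>
  Each insertion uses up one section of the first list.
\<close>

lemma Upow_vanish: "length \<alpha>s < n \<Longrightarrow> (U ^^ n) F \<alpha>s \<beta>s Xs x = 0"
proof (induction n arbitrary: \<alpha>s \<beta>s Xs)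
  case (Suc n)
  have "U ((U ^^ n) F) \<alpha>s \<beta>s Xs x = asum \<alpha>s (\<lambda>a as. asum Xs (\<lambda>X Ys. 0))"
    unfolding U_def[of "(U ^^ n) F"]
    by (rule asum_cong[OF subset_UNIV], rule asum_cong[OF subset_UNIV], rule Suc.IH) (use Suc.prems in simp)
  then show ?case by simp
qed simp

lemma br_U:
  assumes F: "tame F" and dom: "e \<in> SA" "set as \<subseteq> SA" "set \<beta>s \<subseteq> SA" "set Xs \<subseteq> SX"
  shows "br e (U F as \<beta>s Xs) x = asum as (\<lambda>c cs. asum Xs (\<lambda>X Ys. br e (F cs (C c X # \<beta>s) Ys) x))"
proof -
  have v: "F cs (C c X # \<beta>s) Ys \<in> SK" if "c \<in> SA" "set cs \<subseteq> SA" "X \<in> SX" "set Ys \<subseteq> SX" for c cs X Ys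
    by (rule tameD(1)[OF F]) (use that dom in \<open>simp_all add: C_SA\<close>)
  have "br e (U F as \<beta>s Xs) x = br e (\<lambda>x. asum as (\<lambda>c cs. asum Xs (\<lambda>X Ys. F cs (C c X # \<beta>s) Ys x))) x"
    unfolding U_def ..
  also have "\<dots> = asum as (\<lambda>c cs. br e (\<lambda>x. asum Xs (\<lambda>X Ys. F cs (C c X # \<beta>s) Ys x)) x)"
    by (rule linon_asum[OF linon_bracket_SK[OF dom(1)] subsp_SK dom(2)])
      (rule subsp_asum[OF subsp_SK dom(4)], rule v)
  also have "\<dots> = asum as (\<lambda>c cs. asum Xs (\<lambda>X Ys. br e (F cs (C c X # \<beta>s) Ys) x))"
    by (rule asum_cong[OF dom(2)], rule linon_asum[OF linon_bracket_SK[OF dom(1)] subsp_SK dom(4)], rule v)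
  finally show ?thesis .
qed

subsection \<open>The simplicial differential and insertion\<close>

definition lie :: "('m \<Rightarrow> 'a) \<Rightarrow> ('m, 'a) cfun \<Rightarrow> ('m, 'a) cfun" where
  "lie a F \<alpha>s \<beta>s Xs x = br a (F \<alpha>s \<beta>s Xs) x - dsum (br a) \<beta>s (\<lambda>bs. F \<alpha>s bs Xs x)
     - dsum (vf_bracket (ro a)) Xs (\<lambda>Ys. F \<alpha>s \<beta>s Ys x)"

text \<open>
  The simplicial differential \<open>Del\<close> is split into the part \<open>Del0\<close> with Lie derivatives and brackets
  and the part \<open>DelR\<close> with contractions, because \<open>U\<close> commutes only with the former.
\<close>

definition Del0 :: "('m, 'a) cfun \<Rightarrow> ('m, 'a) cfun" where
  "Del0 F \<alpha>s \<beta>s Xs x = (-1) ^ length \<beta>s *\<^sub>R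
     (asum \<alpha>s (\<lambda>a as. lie a F as \<beta>s Xs x) + bsum \<alpha>s (\<lambda>a b cs. F (br a b # cs) \<beta>s Xs x))"

definition DelR :: "('m, 'a) cfun \<Rightarrow> ('m, 'a) cfun" where
  "DelR F \<alpha>s \<beta>s Xs x = - ((-1) ^ length \<beta>s *\<^sub>R xsum \<beta>s (\<lambda>b bs. F \<alpha>s bs (ro b # Xs) x))"

definition Del :: "('m, 'a) cfun \<Rightarrow> ('m, 'a) cfun" where
  "Del F \<alpha>s \<beta>s Xs x = Del0 F \<alpha>s \<beta>s Xs x + DelR F \<alpha>s \<beta>s Xs x"

text \<open>
  The commutator of \<open>U\<close> with \<open>Del\<close>.
\<close>

definition M :: "('m, 'a) cfun \<Rightarrow> ('m, 'a) cfun" where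
  "M F \<alpha>s \<beta>s Xs x = (-1) ^ length \<beta>s *\<^sub>R
     xsum \<beta>s (\<lambda>b bs. asum \<alpha>s (\<lambda>a as. F as (C a (ro b) # bs) Xs x))"

text \<open>
  The Lie derivative of the one-form \<open>C c\<close> along \<open>a\<close>.
\<close>

definition twist :: "('m \<Rightarrow> 'a) \<Rightarrow> ('m \<Rightarrow> 'a) \<Rightarrow> 'm vfield \<Rightarrow> 'm \<Rightarrow> 'a" where
  "twist a c X = (\<lambda>y. br a (C c X) y - C c (vf_bracket (ro a) X) y)"

lemma twist_SA: "a \<in> SA \<Longrightarrow> c \<in> SA \<Longrightarrow> X \<in> SX \<Longrightarrow> twist a c X \<in> SA"
  unfolding twist_def by (rule subsp_diff[OF subsp_SA bracket_section[OF _ C_SA] C_SA[OF _ SX_bracket[OF ro_SX]]])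

lemma C_bracket_twist: "a \<in> SA \<Longrightarrow> b \<in> SA \<Longrightarrow> X \<in> SX \<Longrightarrow> C (br a b) X = (\<lambda>y. twist a b X y - twist b a X y)"
  using C_bracket[of a b X] by (simp add: twist_def)

lemma lie_U:
  assumes F: "tame F" and dom: "a \<in> SA" "set as \<subseteq> SA" "set \<beta>s \<subseteq> SA" "set Xs \<subseteq> SX"
  shows "lie a (U F) as \<beta>s Xs x = asum as (\<lambda>c cs. asum Xs (\<lambda>X Ys.
    lie a F cs (C c X # \<beta>s) Ys x + F cs (twist a c X # \<beta>s) Ys x))"
proof -
  let ?D = "vf_bracket (ro a)"
  have D: "?D X \<in> SX" if "X \<in> SX" for X by (rule SX_bracket[OF ro_SX[OF dom(1)] that])
  note 1 = br_U[OF F dom]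
  have 2: "dsum (br a) \<beta>s (\<lambda>bs. U F as bs Xs x) =
      asum as (\<lambda>c cs. asum Xs (\<lambda>X Ys. dsum (br a) \<beta>s (\<lambda>bs. F cs (C c X # bs) Ys x)))"
    unfolding U_def dsum_asum_fubini ..
  have 3: "dsum ?D Xs (\<lambda>Ys. U F as \<beta>s Ys x) =
      asum as (\<lambda>c cs. asum Xs (\<lambda>X Ys. F cs (C c (?D X) # \<beta>s) Ys x + dsum ?D Ys (\<lambda>Zs. F cs (C c X # \<beta>s) Zs x)))"
    unfolding U_def dsum_asum_fubini dsum_asum ..
  have "br a (F cs (C c X # \<beta>s) Ys) x - dsum (br a) \<beta>s (\<lambda>bs. F cs (C c X # bs) Ys x)
      - (F cs (C c (?D X) # \<beta>s) Ys x + dsum ?D Ys (\<lambda>Zs. F cs (C c X # \<beta>s) Zs x)) =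
      lie a F cs (C c X # \<beta>s) Ys x + F cs (twist a c X # \<beta>s) Ys x"
    if "c \<in> SA" "set cs \<subseteq> SA" "X \<in> SX" "set Ys \<subseteq> SX" for c cs X Ys
  proof -
    have "F cs (twist a c X # \<beta>s) Ys x = F cs (br a (C c X) # \<beta>s) Ys x - F cs (C c (?D X) # \<beta>s) Ys x"
      unfolding twist_def
      by (rule tame_diffB[OF F]) (use that dom in \<open>simp_all add: C_SA D bracket_section\<close>)
    then show ?thesis by (simp add: lie_def)
  qed
  then show ?thesis
    unfolding lie_def[of a "U F"] 1 2 3 asum_diff[symmetric]
    by (intro asum_cong[OF dom(2)] asum_cong[OF dom(4)])
qed

text \<open>
  By \<open>lie_U\<close>, Lie derivatives of inserted forms appear for every ordered pair of sections.
  Antisymmetrised over the pair they give \<open>C\<close> of the bracket, by the first structure equation,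
  and this cancels the insertions of brackets.
\<close>

lemma U_Del0:
  assumes F: "tame F" and dom: "set \<alpha>s \<subseteq> SA" "set \<beta>s \<subseteq> SA" "set Xs \<subseteq> SX"
  shows "U (Del0 F) \<alpha>s \<beta>s Xs x = Del0 (U F) \<alpha>s \<beta>s Xs x"
proof -
  define T where "T c a cs = asum Xs (\<lambda>X Ys. lie a F cs (C c X # \<beta>s) Ys x)" for c a cs
  define W where "W a b cs = asum Xs (\<lambda>X Ys. F cs (twist a b X # \<beta>s) Ys x)" for a b cs
  define G where "G c a b ds = asum Xs (\<lambda>X Ys. F (br a b # ds) (C c X # \<beta>s) Ys x)" for c a b ds
  have "asum Xs (\<lambda>X Ys. Del0 F cs (C c X # \<beta>s) Ys x) =
      - ((-1) ^ length \<beta>s *\<^sub>R (asum cs (T c) + bsum cs (G c)))" for c cs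
    unfolding Del0_def T_def G_def asum_asum_fubini[of cs Xs] asum_bsum_fubini[of Xs cs, symmetric]
    by (simp add: asum_add asum_scaleR asum_minus)
  then have "U (Del0 F) \<alpha>s \<beta>s Xs x =
      asum \<alpha>s (\<lambda>c cs. - ((-1) ^ length \<beta>s *\<^sub>R (asum cs (T c) + bsum cs (G c))))"
    unfolding U_def by simp
  also have "\<dots> = - ((-1) ^ length \<beta>s *\<^sub>R (asum \<alpha>s (\<lambda>c cs. asum cs (\<lambda>a ds. T c a ds))
      + asum \<alpha>s (\<lambda>c cs. bsum cs (\<lambda>a b ds. G c a b ds))))"
    unfolding asum_minus asum_scaleR asum_add ..
  also have "\<dots> = (-1) ^ length \<beta>s *\<^sub>R (asum \<alpha>s (\<lambda>a cs. asum cs (\<lambda>c ds. T c a ds))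
      - asum \<alpha>s (\<lambda>c cs. bsum cs (\<lambda>a b ds. G c a b ds)))"
    unfolding asum_asum_swap[of \<alpha>s "\<lambda>c a ds. T c a ds"] by (simp add: scaleR_diff_right)
  finally have L: "U (Del0 F) \<alpha>s \<beta>s Xs x = (-1) ^ length \<beta>s *\<^sub>R (asum \<alpha>s (\<lambda>a cs. asum cs (\<lambda>c ds. T c a ds))
      - asum \<alpha>s (\<lambda>c cs. bsum cs (\<lambda>a b ds. G c a b ds)))" .
  have 1: "asum \<alpha>s (\<lambda>a as. lie a (U F) as \<beta>s Xs x) =
      asum \<alpha>s (\<lambda>a as. asum as (\<lambda>c cs. T c a cs)) + asum \<alpha>s (\<lambda>a as. asum as (\<lambda>c cs. W a c cs))"
    unfolding T_def W_def asum_add[symmetric]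
    by (rule asum_cong[OF dom(1)]) (rule lie_U[OF F _ _ dom(2,3)])
  have 2: "bsum \<alpha>s (\<lambda>a b cs. U F (br a b # cs) \<beta>s Xs x) =
      bsum \<alpha>s (\<lambda>a b cs. (W a b cs - W b a cs) - asum cs (\<lambda>d ds. G d a b ds))"
  proof (rule bsum_cong[OF dom(1)])
    fix a b cs assume ab: "a \<in> SA" "b \<in> SA" "set cs \<subseteq> SA"
    have "F cs (C (br a b) X # \<beta>s) Ys x = F cs (twist a b X # \<beta>s) Ys x - F cs (twist b a X # \<beta>s) Ys x"
      if "X \<in> SX" "set Ys \<subseteq> SX" for X Ys
      unfolding C_bracket_twist[OF ab(1,2) that(1)]
      by (rule tame_diffB[OF F]) (use ab that dom in \<open>simp_all add: twist_SA\<close>)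
    then have "asum Xs (\<lambda>X Ys. F cs (C (br a b) X # \<beta>s) Ys x) =
        asum Xs (\<lambda>X Ys. F cs (twist a b X # \<beta>s) Ys x - F cs (twist b a X # \<beta>s) Ys x)"
      by (intro asum_cong[OF dom(3)])
    then show "U F (br a b # cs) \<beta>s Xs x = (W a b cs - W b a cs) - asum cs (\<lambda>d ds. G d a b ds)"
      unfolding U_def asum.simps W_def G_def asum_diff by simp
  qed
  also have "\<dots> = - asum \<alpha>s (\<lambda>a as. asum as (\<lambda>c cs. W a c cs)) - asum \<alpha>s (\<lambda>d cs. bsum cs (\<lambda>a b ds. G d a b ds))"
    unfolding bsum_diff[of \<alpha>s "\<lambda>a b cs. W a b cs - W b a cs"] bsum_antisym bsum_asum_swap ..
  finally show ?thesis unfolding L Del0_def 1 by simp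
qed

text \<open>
  The contraction vanishes on an inserted value, since the anchor kills the bundle of ideals.  In
  the other order the contracted vector field \<open>ro b\<close> can itself be extracted, which produces \<open>M\<close>.
\<close>

lemma U_DelR:
  assumes F: "tame F" and dom: "set \<alpha>s \<subseteq> SA" "set \<beta>s \<subseteq> SA" "set Xs \<subseteq> SX"
  shows "U (DelR F) \<alpha>s \<beta>s Xs x = DelR (U F) \<alpha>s \<beta>s Xs x + M F \<alpha>s \<beta>s Xs x"
proof -
  define T where "T b bs = asum \<alpha>s (\<lambda>a as. asum Xs (\<lambda>X Ys. F as (C a X # bs) (ro b # Ys) x))" for b bs
  have 0: "F as \<beta>s (ro (C a X) # Ys) x = 0" if "a \<in> SA" "set as \<subseteq> SA" "X \<in> SX" "set Ys \<subseteq> SX" for a as X Ys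
    unfolding rho_SK[OF C_SK[OF that(1,3)]] by (rule tame_zeroX[OF F that(2) dom(2) that(4)])
  have "U (DelR F) \<alpha>s \<beta>s Xs x = asum \<alpha>s (\<lambda>a as. asum Xs (\<lambda>X Ys.
      (-1) ^ length \<beta>s *\<^sub>R xsum \<beta>s (\<lambda>b bs. F as (C a X # bs) (ro b # Ys) x)))"
    unfolding U_def DelR_def
    by (intro asum_cong[OF dom(1)] asum_cong[OF dom(3)]) (simp add: 0)
  also have "\<dots> = (-1) ^ length \<beta>s *\<^sub>R xsum \<beta>s T"
    unfolding T_def by (simp add: asum_scaleR asum_xsum_fubini)
  finally have L: "U (DelR F) \<alpha>s \<beta>s Xs x = (-1) ^ length \<beta>s *\<^sub>R xsum \<beta>s T" .
  have "DelR (U F) \<alpha>s \<beta>s Xs x = - ((-1) ^ length \<beta>s *\<^sub>R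
      (xsum \<beta>s (\<lambda>b bs. asum \<alpha>s (\<lambda>a as. F as (C a (ro b) # bs) Xs x)) - xsum \<beta>s T))"
    unfolding DelR_def U_def T_def asum.simps asum_diff xsum_diff ..
  then show ?thesis unfolding L M_def by (simp add: scaleR_diff_right)
qed

lemma U_M:
  assumes F: "tame F" and dom: "set \<alpha>s \<subseteq> SA" "set \<beta>s \<subseteq> SA" "set Xs \<subseteq> SX"
  shows "U (M F) \<alpha>s \<beta>s Xs x = M (U F) \<alpha>s \<beta>s Xs x"
proof -
  define T where "T b bs a c cs = asum Xs (\<lambda>X Ys. F cs (C c (ro b) # C a X # bs) Ys x)" for b bs a c cs
  have 0: "F cs (C c (ro (C a X)) # bs) Ys x = 0"
    if "a \<in> SA" "c \<in> SA" "set cs \<subseteq> SA" "X \<in> SX" "set bs \<subseteq> SA" "set Ys \<subseteq> SX" for a c cs X bs Ys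
    unfolding rho_SK[OF C_SK[OF that(1,4)]] C_zero[OF that(2)] by (rule tame_zeroB[OF F that(3,5,6)])
  have "U (M F) \<alpha>s \<beta>s Xs x = asum \<alpha>s (\<lambda>a as. asum Xs (\<lambda>X Ys.
      - ((-1) ^ length \<beta>s *\<^sub>R xsum \<beta>s (\<lambda>b bs. asum as (\<lambda>c cs. F cs (C c (ro b) # C a X # bs) Ys x)))))"
    unfolding U_def
  proof (intro asum_cong[OF dom(1)] asum_cong[OF dom(3)])
    fix a as X Ys assume *: "a \<in> SA" "set as \<subseteq> SA" "X \<in> SX" "set Ys \<subseteq> SX"
    have "asum as (\<lambda>c cs. F cs (C c (ro (C a X)) # \<beta>s) Ys x) = asum as (\<lambda>c cs. 0)"
      by (rule asum_cong[OF *(2)], rule 0) (use * dom in auto)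
    then show "M F as (C a X # \<beta>s) Ys x = - ((-1) ^ length \<beta>s *\<^sub>R
        xsum \<beta>s (\<lambda>b bs. asum as (\<lambda>c cs. F cs (C c (ro b) # C a X # bs) Ys x)))"
      unfolding M_def xsum.simps by simp
  qed
  also have "\<dots> = - ((-1) ^ length \<beta>s *\<^sub>R xsum \<beta>s (\<lambda>b bs. asum \<alpha>s (\<lambda>a as. asum as (\<lambda>c cs. T b bs a c cs))))"
    unfolding T_def by (simp add: asum_minus asum_scaleR asum_xsum_fubini asum_asum_fubini[of _ Xs])
  also have "\<dots> = (-1) ^ length \<beta>s *\<^sub>R xsum \<beta>s (\<lambda>b bs. asum \<alpha>s (\<lambda>c as. asum as (\<lambda>a cs. T b bs a c cs)))"
    by (subst asum_asum_swap) (simp add: xsum_minus)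
  also have "\<dots> = M (U F) \<alpha>s \<beta>s Xs x"
    unfolding M_def U_def T_def
  proof (intro arg_cong[of _ _ "scaleR _"] xsum_cong[OF dom(2)] asum_cong[OF dom(1)])
    fix b bs c as assume *: "b \<in> SA" "set bs \<subseteq> SA" "c \<in> SA" "set as \<subseteq> SA"
    show "asum as (\<lambda>a cs. asum Xs (\<lambda>X Ys. F cs (C c (ro b) # C a X # bs) Ys x)) =
        asum as (\<lambda>a cs. asum Xs (\<lambda>X Ys. F cs (C a X # C c (ro b) # bs) Ys x))"
      by (intro asum_cong[OF *(4)] asum_cong[OF dom(3)] symm_swap_head[OF tame_symB[OF F]])
        (use * in \<open>simp_all add: C_SA ro_SX\<close>)
  qed
  finally show ?thesis .
qed

text \<open>
  \<open>Del F\<close> at lists of given lengths only involves \<open>F\<close> in the preceding degree.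
\<close>

lemma Del_cong:
  assumes dom: "set \<alpha>s \<subseteq> SA" "set \<beta>s \<subseteq> SA" "set Xs \<subseteq> SX"
    and eq: "\<And>as bs Ys. set as \<subseteq> SA \<Longrightarrow> set bs \<subseteq> SA \<Longrightarrow> set Ys \<subseteq> SX \<Longrightarrow> length as \<le> length \<alpha>s \<Longrightarrow>
      Suc (length as + length bs) = length \<alpha>s + length \<beta>s \<Longrightarrow>
      length bs + length Ys = length \<beta>s + length Xs \<Longrightarrow> F as bs Ys = G as bs Ys"
  shows "Del F \<alpha>s \<beta>s Xs x = Del G \<alpha>s \<beta>s Xs x"
proof -
  have "lie a F as \<beta>s Xs x = lie a G as \<beta>s Xs x" if a: "a \<in> SA" "set as \<subseteq> SA" "Suc (length as) = length \<alpha>s" for a as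
  proof -
    have e: "F as bs Ys = G as bs Ys"
      if "set bs \<subseteq> SA" "set Ys \<subseteq> SX" "length bs = length \<beta>s" "length Ys = length Xs" for bs Ys
      by (rule eq[OF a(2) that(1,2)]) (use a(3) that in simp_all)
    have "dsum (br a) \<beta>s (\<lambda>bs. F as bs Xs x) = dsum (br a) \<beta>s (\<lambda>bs. G as bs Xs x)"
      by (rule dsum_cong[OF dom(2) bracket_section[OF a(1)]], assumption)
        (rule fun_cong[OF e[OF _ dom(3)]], simp_all)
    moreover have "dsum (vf_bracket (ro a)) Xs (\<lambda>Ys. F as \<beta>s Ys x) = dsum (vf_bracket (ro a)) Xs (\<lambda>Ys. G as \<beta>s Ys x)"
      by (rule dsum_cong[OF dom(3) SX_bracket[OF ro_SX[OF a(1)]]], assumption)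
        (rule fun_cong[OF e[OF dom(2)]], simp_all)
    ultimately show ?thesis unfolding lie_def e[OF dom(2,3) refl refl] by simp
  qed
  then have "asum \<alpha>s (\<lambda>a as. lie a F as \<beta>s Xs x) = asum \<alpha>s (\<lambda>a as. lie a G as \<beta>s Xs x)"
    by (rule asum_cong[OF dom(1)])
  moreover have "bsum \<alpha>s (\<lambda>a b cs. F (br a b # cs) \<beta>s Xs x) = bsum \<alpha>s (\<lambda>a b cs. G (br a b # cs) \<beta>s Xs x)"
    by (rule bsum_cong[OF dom(1)], rule fun_cong[OF eq[OF _ dom(2,3)]]) (simp_all add: bracket_section)
  moreover have "xsum \<beta>s (\<lambda>b bs. F \<alpha>s bs (ro b # Xs) x) = xsum \<beta>s (\<lambda>b bs. G \<alpha>s bs (ro b # Xs) x)"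
    by (rule xsum_cong[OF dom(2)], rule fun_cong[OF eq[OF dom(1)]]) (use dom in \<open>simp_all add: ro_SX\<close>)
  ultimately show ?thesis unfolding Del_def Del0_def DelR_def by simp
qed

section \<open>The horizontal projection commutes with the simplicial differential\<close>

definition B :: "('m, 'a) cfun \<Rightarrow> ('m, 'a) cfun" where
  "B F \<alpha>s \<beta>s Xs x = F \<alpha>s (map h \<beta>s) Xs x"

lemma lie_B:
  assumes F: "tame F" and dom: "a \<in> SA" "set as \<subseteq> SA" "set \<beta>s \<subseteq> SA" "set Xs \<subseteq> SX"
  shows "lie a (B F) as \<beta>s Xs x = lie a F as (map h \<beta>s) Xs x
    - xsum \<beta>s (\<lambda>b bs. F as (C a (ro b) # map h bs) Xs x)"
proof -
  note sym = tame_symB[OF F dom(2,4), of x]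
  have "dsum (br a) (map h \<beta>s) (\<lambda>bs. F as bs Xs x) = xsum \<beta>s (\<lambda>b bs. F as (br a (h b) # map h bs) Xs x)"
    using symm_dsum[OF sym h_set[OF dom(3)] bracket_section[OF dom(1)]] unfolding xsum_map .
  moreover have "dsum (br a) \<beta>s (\<lambda>bs. F as (map h bs) Xs x) = xsum \<beta>s (\<lambda>b bs. F as (h (br a b) # map h bs) Xs x)"
    using symm_dsum[OF symm_map[OF sym h_SA] dom(3) bracket_section[OF dom(1)]] by simp
  moreover have "xsum \<beta>s (\<lambda>b bs. F as (br a (h b) # map h bs) Xs x) =
      xsum \<beta>s (\<lambda>b bs. F as (h (br a b) # map h bs) Xs x - F as (C a (ro b) # map h bs) Xs x)"
  proof (rule xsum_cong[OF dom(3)])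
    fix b bs assume b: "b \<in> SA" "set bs \<subseteq> SA"
    show "F as (br a (h b) # map h bs) Xs x = F as (h (br a b) # map h bs) Xs x - F as (C a (ro b) # map h bs) Xs x"
      unfolding h_bracket[OF dom(1) b(1)]
      by (rule tame_diffB[OF F dom(2) h_set[OF b(2)] dom(4)]) (simp_all add: h_SA C_SA ro_SX bracket_section dom b)
  qed
  moreover have "B F as \<beta>s Xs = F as (map h \<beta>s) Xs" by (simp add: B_def fun_eq_iff)
  ultimately show ?thesis unfolding lie_def by (simp add: B_def xsum_diff)
qed

text \<open>
  By \<open>h_bracket\<close>, which is the second structure equation, bracketing with \<open>a\<close> before or after applying
  \<open>h\<close> to \<open>b\<close> differs by \<open>C a (ro b)\<close>.  The contractions are unaffected since \<open>\<rho> \<circ> h = \<rho>\<close>.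
\<close>

lemma Del_B:
  assumes F: "tame F" and dom: "set \<alpha>s \<subseteq> SA" "set \<beta>s \<subseteq> SA" "set Xs \<subseteq> SX"
  shows "Del (B F) \<alpha>s \<beta>s Xs x = B (Del F) \<alpha>s \<beta>s Xs x - B (M F) \<alpha>s \<beta>s Xs x"
proof -
  have 1: "asum \<alpha>s (\<lambda>a as. lie a (B F) as \<beta>s Xs x) = asum \<alpha>s (\<lambda>a as. lie a F as (map h \<beta>s) Xs x)
      - xsum \<beta>s (\<lambda>b bs. asum \<alpha>s (\<lambda>a as. F as (C a (ro b) # map h bs) Xs x))"
    unfolding asum_xsum_fubini[symmetric] asum_diff[symmetric]
    by (rule asum_cong[OF dom(1)]) (rule lie_B[OF F _ _ dom(2,3)])
  have 2: "B (M F) \<alpha>s \<beta>s Xs x = (-1) ^ length \<beta>s *\<^sub>R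
      xsum \<beta>s (\<lambda>b bs. asum \<alpha>s (\<lambda>a as. F as (C a (ro b) # map h bs) Xs x))"
    unfolding B_def M_def xsum_map length_map
    by (intro arg_cong[of _ _ "scaleR _"] xsum_cong[OF dom(2)]) (simp add: ro_h)
  have 3: "DelR (B F) \<alpha>s \<beta>s Xs x = DelR F \<alpha>s (map h \<beta>s) Xs x"
    unfolding B_def DelR_def xsum_map length_map
    by (intro arg_cong[of _ _ uminus] arg_cong[of _ _ "scaleR _"] xsum_cong[OF dom(2)]) (simp add: ro_h)
  have 4: "Del0 (B F) \<alpha>s \<beta>s Xs x = Del0 F \<alpha>s (map h \<beta>s) Xs x - B (M F) \<alpha>s \<beta>s Xs x"
    unfolding Del0_def 1 2 by (simp add: B_def algebra_simps)
  show ?thesis unfolding Del_def 3 4 by (simp add: B_def Del_def)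
qed

text \<open>
  Additivity in the form needed to move an operator past the finite sum in \<open>expU\<close>.
\<close>

definition linop :: "(('m, 'a) cfun \<Rightarrow> ('m, 'a) cfun) \<Rightarrow> bool" where
  "linop T \<longleftrightarrow> (\<forall>F G r \<alpha>s \<beta>s Xs x. tame F \<longrightarrow> tame G \<longrightarrow> set \<alpha>s \<subseteq> SA \<longrightarrow> set \<beta>s \<subseteq> SA \<longrightarrow> set Xs \<subseteq> SX \<longrightarrow>
     T (\<lambda>\<alpha>s \<beta>s Xs x. F \<alpha>s \<beta>s Xs x + r *\<^sub>R G \<alpha>s \<beta>s Xs x) \<alpha>s \<beta>s Xs x =
       T F \<alpha>s \<beta>s Xs x + r *\<^sub>R T G \<alpha>s \<beta>s Xs x)"

lemma linopD: "linop T \<Longrightarrow> tame F \<Longrightarrow> tame G \<Longrightarrow> set \<alpha>s \<subseteq> SA \<Longrightarrow> set \<beta>s \<subseteq> SA \<Longrightarrow> set Xs \<subseteq> SX \<Longrightarrow>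
     T (\<lambda>\<alpha>s \<beta>s Xs x. F \<alpha>s \<beta>s Xs x + r *\<^sub>R G \<alpha>s \<beta>s Xs x) \<alpha>s \<beta>s Xs x =
       T F \<alpha>s \<beta>s Xs x + r *\<^sub>R T G \<alpha>s \<beta>s Xs x"
  unfolding linop_def by blast

lemma linop_sum:
  fixes N :: nat
  assumes T: "linop T" and G: "\<And>n. tame (G n)" and dom: "set \<alpha>s \<subseteq> SA" "set \<beta>s \<subseteq> SA" "set Xs \<subseteq> SX"
  shows "T (\<lambda>\<alpha>s \<beta>s Xs x. \<Sum>n<N. c n *\<^sub>R G n \<alpha>s \<beta>s Xs x) \<alpha>s \<beta>s Xs x = (\<Sum>n<N. c n *\<^sub>R T (G n) \<alpha>s \<beta>s Xs x)"
proof (induction N)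
  case 0
  show ?case using linopD[OF T tame_0 tame_0 dom, of "-1" x] by simp
next
  case (Suc N)
  show ?case unfolding sum.lessThan_Suc linopD[OF T tame_sum[OF G] G dom] Suc.IH ..
qed

text \<open>
  The exponential of \<open>- U\<close>.  By \<open>Upow_vanish\<close> the terms beyond the length of the first list are zero,
  so the order \<open>N\<close> of truncation is immaterial once it exceeds that length.
\<close>

definition expU :: "nat \<Rightarrow> ('m, 'a) cfun \<Rightarrow> ('m, 'a) cfun" where
  "expU N F = (\<lambda>\<alpha>s \<beta>s Xs x. \<Sum>n<N. ((-1) ^ n / fact n) *\<^sub>R (U ^^ n) F \<alpha>s \<beta>s Xs x)"

lemma tame_expU: "tame F \<Longrightarrow> tame (expU N F)"
  unfolding expU_def by (rule tame_sum[OF tame_Upow])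

lemma linop_expU:
  assumes T: "linop T" and F: "tame F" and dom: "set \<alpha>s \<subseteq> SA" "set \<beta>s \<subseteq> SA" "set Xs \<subseteq> SX"
  shows "T (expU N F) \<alpha>s \<beta>s Xs x = (\<Sum>n<N. ((-1) ^ n / fact n) *\<^sub>R T ((U ^^ n) F) \<alpha>s \<beta>s Xs x)"
  unfolding expU_def by (rule linop_sum[OF T tame_Upow[OF F] dom])

text \<open>
  The differentiated exponential series: the factor \<open>n\<close> cancels against the factorial.
\<close>

lemma exp_series_shift:
  fixes g :: "nat \<Rightarrow> 'v::real_vector"
  shows "(\<Sum>n<Suc N. ((-1) ^ n / fact n) *\<^sub>R (real n *\<^sub>R g (n - 1))) = - (\<Sum>n<N. ((-1) ^ n / fact n) *\<^sub>R g n)"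
proof -
  have "((-1) ^ Suc n / fact (Suc n)) * real (Suc n) = - ((-1) ^ n / fact n)" for n
    unfolding fact_Suc by (simp del: of_nat_Suc)
  then have e: "((-1) ^ Suc n / fact (Suc n)) *\<^sub>R (real (Suc n) *\<^sub>R g n) = - (((-1) ^ n / fact n) *\<^sub>R g n)" for n
    by (simp only: scaleR_scaleR scaleR_minus_left)
  show ?thesis unfolding sum.lessThan_Suc_shift diff_Suc_1 e sum_negf by simp
qed

lemma expU_eq:
  assumes "length \<alpha>s < N" "length \<alpha>s < N'"
  shows "expU N F \<alpha>s \<beta>s Xs x = expU N' F \<alpha>s \<beta>s Xs x"
proof -
  have "expU n F \<alpha>s \<beta>s Xs x = expU (Suc (length \<alpha>s)) F \<alpha>s \<beta>s Xs x" if "length \<alpha>s < n" for n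
    unfolding expU_def
    by (rule sum.mono_neutral_right) (use that Upow_vanish in auto)
  from this[OF assms(1)] this[OF assms(2)] show ?thesis by simp
qed

definition H :: "('m, 'a) cfun \<Rightarrow> ('m, 'a) cfun" where
  "H F \<alpha>s \<beta>s Xs x = expU (Suc (length \<alpha>s)) F \<alpha>s (map h \<beta>s) Xs x"

lemma linop_M: "linop M"
  unfolding linop_def M_def
  by (simp add: asum_add asum_scaleR xsum_add xsum_scaleR algebra_simps)

lemma lie_add:
  assumes F: "tame F" and G: "tame G" and dom: "a \<in> SA" "set \<alpha>s \<subseteq> SA" "set \<beta>s \<subseteq> SA" "set Xs \<subseteq> SX"
  shows "lie a (\<lambda>\<alpha>s \<beta>s Xs x. F \<alpha>s \<beta>s Xs x + r *\<^sub>R G \<alpha>s \<beta>s Xs x) \<alpha>s \<beta>s Xs x =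
    lie a F \<alpha>s \<beta>s Xs x + r *\<^sub>R lie a G \<alpha>s \<beta>s Xs x"
proof -
  note l = linon_bracket_SK[OF dom(1)]
  have "br a (\<lambda>x. F \<alpha>s \<beta>s Xs x + r *\<^sub>R G \<alpha>s \<beta>s Xs x) = (\<lambda>x. br a (F \<alpha>s \<beta>s Xs) x + r *\<^sub>R br a (G \<alpha>s \<beta>s Xs) x)"
    using linon_add[OF l tameD(1)[OF F dom(2-)] subsp_scaleR[OF subsp_SK tameD(1)[OF G dom(2-)]]]
      linon_scaleR[OF l tameD(1)[OF G dom(2-)]] by simp
  then show ?thesis unfolding lie_def by (simp add: dsum_add dsum_scaleR algebra_simps)
qed

lemma linop_Del: "linop Del"
  unfolding linop_def
proof (intro allI impI)
  fix F G :: "('m, 'a) cfun" and r \<alpha>s \<beta>s Xs x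
  assume F: "tame F" and G: "tame G" and dom: "set \<alpha>s \<subseteq> SA" "set \<beta>s \<subseteq> SA" "set Xs \<subseteq> SX"
  have "asum \<alpha>s (\<lambda>a as. lie a (\<lambda>\<alpha>s \<beta>s Xs x. F \<alpha>s \<beta>s Xs x + r *\<^sub>R G \<alpha>s \<beta>s Xs x) as \<beta>s Xs x) =
      asum \<alpha>s (\<lambda>a as. lie a F as \<beta>s Xs x + r *\<^sub>R lie a G as \<beta>s Xs x)"
    by (rule asum_cong[OF dom(1)], rule lie_add[OF F G _ _ dom(2,3)])
  then show "Del (\<lambda>\<alpha>s \<beta>s Xs x. F \<alpha>s \<beta>s Xs x + r *\<^sub>R G \<alpha>s \<beta>s Xs x) \<alpha>s \<beta>s Xs x =
      Del F \<alpha>s \<beta>s Xs x + r *\<^sub>R Del G \<alpha>s \<beta>s Xs x"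
    unfolding Del_def Del0_def DelR_def
    by (simp add: asum_add asum_scaleR bsum_add bsum_scaleR xsum_add xsum_scaleR algebra_simps)
qed

lemma U_Del:
  assumes F: "tame F" and dom: "set \<alpha>s \<subseteq> SA" "set \<beta>s \<subseteq> SA" "set Xs \<subseteq> SX"
  shows "U (Del F) \<alpha>s \<beta>s Xs x = Del (U F) \<alpha>s \<beta>s Xs x + M F \<alpha>s \<beta>s Xs x"
proof -
  have "U (Del F) \<alpha>s \<beta>s Xs x = U (Del0 F) \<alpha>s \<beta>s Xs x + U (DelR F) \<alpha>s \<beta>s Xs x"
    unfolding U_def[of "Del F"] Del_def asum_add by (simp add: U_def)
  then show ?thesis unfolding U_Del0[OF F dom] U_DelR[OF F dom] Del_def by simp
qed

text \<open>
  If the commutator \<open>S\<close> of \<open>U\<close> and \<open>T\<close> commutes with \<open>U\<close>, then \<open>U\<close> differentiates: passing \<open>n\<close> factors \<open>U\<close>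
  over \<open>T\<close> produces \<open>S\<close> once for each factor.
\<close>

lemma Upow_commutator:
  assumes T: "\<And>F \<alpha>s \<beta>s Xs x. tame F \<Longrightarrow> set \<alpha>s \<subseteq> SA \<Longrightarrow> set \<beta>s \<subseteq> SA \<Longrightarrow> set Xs \<subseteq> SX \<Longrightarrow>
      U (T F) \<alpha>s \<beta>s Xs x = T (U F) \<alpha>s \<beta>s Xs x + S F \<alpha>s \<beta>s Xs x"
    and S: "\<And>F \<alpha>s \<beta>s Xs x. tame F \<Longrightarrow> set \<alpha>s \<subseteq> SA \<Longrightarrow> set \<beta>s \<subseteq> SA \<Longrightarrow> set Xs \<subseteq> SX \<Longrightarrow>
      U (S F) \<alpha>s \<beta>s Xs x = S (U F) \<alpha>s \<beta>s Xs x"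
    and F: "tame F" and dom: "set \<alpha>s \<subseteq> SA" "set \<beta>s \<subseteq> SA" "set Xs \<subseteq> SX"
  shows "(U ^^ n) (T F) \<alpha>s \<beta>s Xs x = T ((U ^^ n) F) \<alpha>s \<beta>s Xs x + real n *\<^sub>R S ((U ^^ (n - 1)) F) \<alpha>s \<beta>s Xs x"
  using dom
proof (induction n arbitrary: \<alpha>s \<beta>s Xs)
  case (Suc n)
  have "U ((U ^^ n) (T F)) \<alpha>s \<beta>s Xs x =
      U (\<lambda>\<alpha>s \<beta>s Xs x. T ((U ^^ n) F) \<alpha>s \<beta>s Xs x + real n *\<^sub>R S ((U ^^ (n - 1)) F) \<alpha>s \<beta>s Xs x) \<alpha>s \<beta>s Xs x"
    unfolding U_def[of "(U ^^ n) (T F)"] U_def[of "\<lambda>\<alpha>s \<beta>s Xs x. T ((U ^^ n) F) \<alpha>s \<beta>s Xs x + real n *\<^sub>R S ((U ^^ (n - 1)) F) \<alpha>s \<beta>s Xs x"]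
    by (intro asum_cong[OF Suc.prems(1)] asum_cong[OF Suc.prems(3)] Suc.IH) (use Suc.prems in \<open>simp_all add: C_SA\<close>)
  also have "\<dots> = U (T ((U ^^ n) F)) \<alpha>s \<beta>s Xs x + real n *\<^sub>R U (S ((U ^^ (n - 1)) F)) \<alpha>s \<beta>s Xs x"
    unfolding U_def[of "\<lambda>\<alpha>s \<beta>s Xs x. T ((U ^^ n) F) \<alpha>s \<beta>s Xs x + real n *\<^sub>R S ((U ^^ (n - 1)) F) \<alpha>s \<beta>s Xs x"]
      U_def[of "T ((U ^^ n) F)"] U_def[of "S ((U ^^ (n - 1)) F)"]
    by (simp only: asum_add asum_scaleR)
  also have "\<dots> = T ((U ^^ Suc n) F) \<alpha>s \<beta>s Xs x + S ((U ^^ n) F) \<alpha>s \<beta>s Xs x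
      + real n *\<^sub>R S (U ((U ^^ (n - 1)) F)) \<alpha>s \<beta>s Xs x"
    unfolding T[OF tame_Upow[OF F] Suc.prems] S[OF tame_Upow[OF F] Suc.prems] by simp
  also have "real n *\<^sub>R S (U ((U ^^ (n - 1)) F)) \<alpha>s \<beta>s Xs x = real n *\<^sub>R S ((U ^^ n) F) \<alpha>s \<beta>s Xs x"
    by (cases n) simp_all
  finally show ?case by (simp add: algebra_simps)
qed simp

text \<open>
  Summed up, \<open>exp (- U) T = (T - S) exp (- U)\<close>.  The shifted series for \<open>S\<close> has one term less; the
  assumption on \<open>(U ^^ N) F\<close> supplies it.
\<close>

lemma expU_commutator:
  assumes T: "\<And>F \<alpha>s \<beta>s Xs x. tame F \<Longrightarrow> set \<alpha>s \<subseteq> SA \<Longrightarrow> set \<beta>s \<subseteq> SA \<Longrightarrow> set Xs \<subseteq> SX \<Longrightarrow>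
      U (T F) \<alpha>s \<beta>s Xs x = T (U F) \<alpha>s \<beta>s Xs x + S F \<alpha>s \<beta>s Xs x"
    and S: "\<And>F \<alpha>s \<beta>s Xs x. tame F \<Longrightarrow> set \<alpha>s \<subseteq> SA \<Longrightarrow> set \<beta>s \<subseteq> SA \<Longrightarrow> set Xs \<subseteq> SX \<Longrightarrow>
      U (S F) \<alpha>s \<beta>s Xs x = S (U F) \<alpha>s \<beta>s Xs x"
    and lin: "linop T" "linop S"
    and van: "S ((U ^^ N) F) \<alpha>s \<beta>s Xs x = 0"
    and F: "tame F" and dom: "set \<alpha>s \<subseteq> SA" "set \<beta>s \<subseteq> SA" "set Xs \<subseteq> SX"
  shows "expU (Suc N) (T F) \<alpha>s \<beta>s Xs x = T (expU (Suc N) F) \<alpha>s \<beta>s Xs x - S (expU (Suc N) F) \<alpha>s \<beta>s Xs x"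
proof -
  have e: "(U ^^ n) (T F) \<alpha>s \<beta>s Xs x =
      T ((U ^^ n) F) \<alpha>s \<beta>s Xs x + real n *\<^sub>R S ((U ^^ (n - 1)) F) \<alpha>s \<beta>s Xs x" for n
    by (rule Upow_commutator[of T S, OF T S F dom])
  have "expU (Suc N) (T F) \<alpha>s \<beta>s Xs x = (\<Sum>n<Suc N. ((-1) ^ n / fact n) *\<^sub>R
      (T ((U ^^ n) F) \<alpha>s \<beta>s Xs x + real n *\<^sub>R S ((U ^^ (n - 1)) F) \<alpha>s \<beta>s Xs x))"
    unfolding expU_def[of _ "T F"] e ..
  also have "\<dots> = T (expU (Suc N) F) \<alpha>s \<beta>s Xs x
      + (\<Sum>n<Suc N. ((-1) ^ n / fact n) *\<^sub>R (real n *\<^sub>R S ((U ^^ (n - 1)) F) \<alpha>s \<beta>s Xs x))"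
    unfolding scaleR_add_right sum.distrib linop_expU[OF lin(1) F dom] ..
  also have "\<dots> = T (expU (Suc N) F) \<alpha>s \<beta>s Xs x - S (expU (Suc N) F) \<alpha>s \<beta>s Xs x"
    unfolding linop_expU[OF lin(2) F dom] exp_series_shift[where N = N and g = "\<lambda>n. S ((U ^^ n) F) \<alpha>s \<beta>s Xs x"]
    by (simp add: van)
  finally show ?thesis .
qed

lemma M_vanish: "M ((U ^^ length \<alpha>s) F) \<alpha>s \<beta>s Xs x = 0"
proof -
  have "asum \<alpha>s (\<lambda>a as. (U ^^ length \<alpha>s) F as (C a (ro b) # bs) Xs x) = asum \<alpha>s (\<lambda>a as. 0)" for b bs
    by (rule asum_cong[OF subset_UNIV], rule Upow_vanish) simp
  then show ?thesis by (simp add: M_def)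
qed

text \<open>
  Combines \<open>exp (- U) \<delta> = (\<delta> - M) exp (- U)\<close> with \<open>B (\<delta> - M) = \<delta> B\<close>.
\<close>

lemma H_Del:
  assumes F: "tame F" and dom: "set \<alpha>s \<subseteq> SA" "set \<beta>s \<subseteq> SA" "set Xs \<subseteq> SX"
  shows "H (Del F) \<alpha>s \<beta>s Xs x = Del (H F) \<alpha>s \<beta>s Xs x"
proof -
  let ?N = "length \<alpha>s"
  have "H (Del F) \<alpha>s \<beta>s Xs x = B (Del (expU (Suc ?N) F)) \<alpha>s \<beta>s Xs x - B (M (expU (Suc ?N) F)) \<alpha>s \<beta>s Xs x"
    unfolding H_def B_def
    by (rule expU_commutator[of Del M, OF U_Del U_M linop_Del linop_M M_vanish F dom(1) h_set[OF dom(2)] dom(3)])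
  also have "\<dots> = Del (B (expU (Suc ?N) F)) \<alpha>s \<beta>s Xs x"
    by (rule Del_B[OF tame_expU[OF F] dom, symmetric])
  also have "\<dots> = Del (H F) \<alpha>s \<beta>s Xs x"
  proof (rule Del_cong[OF dom])
    fix as bs :: "('m \<Rightarrow> 'a) list" and Ys :: "'m vfield list" assume "length as \<le> ?N"
    then show "B (expU (Suc ?N) F) as bs Ys = H F as bs Ys"
      unfolding H_def B_def by (auto intro!: ext expU_eq)
  qed
  finally show ?thesis .
qed

subsection \<open>Products of the connection with the adjoint action\<close>

text \<open>
  \<open>Kv\<close> and \<open>Kc\<close> pair the two components of \<open>\<theta>\<close> with the values of \<open>F\<close> by the bracket of the bundle of
  ideals.
\<close>

definition Kv :: "('m, 'a) cfun \<Rightarrow> ('m, 'a) cfun" where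
  "Kv F \<alpha>s \<beta>s Xs x = xsum \<beta>s (\<lambda>b bs. br (v b) (F \<alpha>s bs Xs) x)"

definition Kc :: "('m, 'a) cfun \<Rightarrow> ('m, 'a) cfun" where
  "Kc F \<alpha>s \<beta>s Xs x = asum \<alpha>s (\<lambda>a as. asum Xs (\<lambda>X Ys. br (C a X) (F as \<beta>s Ys) x))"

lemma U_Kv:
  assumes F: "tame F" and dom: "set \<alpha>s \<subseteq> SA" "set \<beta>s \<subseteq> SA" "set Xs \<subseteq> SX"
  shows "U (Kv F) \<alpha>s \<beta>s Xs x = Kv (U F) \<alpha>s \<beta>s Xs x + Kc F \<alpha>s \<beta>s Xs x"
proof -
  have "U (Kv F) \<alpha>s \<beta>s Xs x = asum \<alpha>s (\<lambda>a as. asum Xs (\<lambda>X Ys.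
      xsum \<beta>s (\<lambda>b bs. br (v b) (F as (C a X # bs) Ys) x) + br (C a X) (F as \<beta>s Ys) x))"
    unfolding U_def Kv_def xsum.simps
    by (intro asum_cong[OF dom(1)] asum_cong[OF dom(3)]) (simp add: v_SK[OF C_SK])
  also have "\<dots> = xsum \<beta>s (\<lambda>b bs. asum \<alpha>s (\<lambda>a as. asum Xs (\<lambda>X Ys. br (v b) (F as (C a X # bs) Ys) x)))
      + Kc F \<alpha>s \<beta>s Xs x"
    unfolding asum_add Kc_def by (simp add: asum_xsum_fubini)
  also have "xsum \<beta>s (\<lambda>b bs. asum \<alpha>s (\<lambda>a as. asum Xs (\<lambda>X Ys. br (v b) (F as (C a X # bs) Ys) x))) =
      Kv (U F) \<alpha>s \<beta>s Xs x"
    unfolding Kv_def by (rule xsum_cong[OF dom(2)], rule br_U[OF F _ dom(1) _ dom(3), symmetric]) (simp_all add: v_SA)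
  finally show ?thesis .
qed

lemma U_Kc:
  assumes F: "tame F" and dom: "set \<alpha>s \<subseteq> SA" "set \<beta>s \<subseteq> SA" "set Xs \<subseteq> SX"
  shows "U (Kc F) \<alpha>s \<beta>s Xs x = Kc (U F) \<alpha>s \<beta>s Xs x"
proof -
  define T where "T a c cs X Y Zs = br (C c Y) (F cs (C a X # \<beta>s) Zs) x" for a c cs X Y Zs
  have "U (Kc F) \<alpha>s \<beta>s Xs x = asum \<alpha>s (\<lambda>a as. asum as (\<lambda>c cs. asum Xs (\<lambda>X Ys. asum Ys (\<lambda>Y Zs. T a c cs X Y Zs))))"
    unfolding U_def Kc_def T_def by (simp add: asum_asum_fubini[of _ Xs])
  also have "\<dots> = asum \<alpha>s (\<lambda>a as. asum as (\<lambda>c cs. asum Xs (\<lambda>X Ys. asum Ys (\<lambda>Y Zs. T c a cs Y X Zs))))"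
    unfolding asum_asum_swap[of \<alpha>s "\<lambda>a c cs. asum Xs (\<lambda>X Ys. asum Ys (\<lambda>Y Zs. T a c cs X Y Zs))"]
    by (subst asum_asum_swap[of Xs]) (simp add: asum_minus)
  also have "\<dots> = asum \<alpha>s (\<lambda>a as. asum Xs (\<lambda>X Ys. asum as (\<lambda>c cs. asum Ys (\<lambda>Y Zs. T c a cs Y X Zs))))"
    by (simp add: asum_asum_fubini[of _ Xs])
  also have "\<dots> = Kc (U F) \<alpha>s \<beta>s Xs x"
    unfolding Kc_def T_def
    by (intro asum_cong[OF dom(1)] asum_cong[OF dom(3)] br_U[OF F _ _ dom(2), symmetric] C_SA)
  finally show ?thesis .
qed

lemma linop_Kv: "linop Kv"
  unfolding linop_def
proof (intro allI impI)
  fix F G :: "('m, 'a) cfun" and r \<alpha>s \<beta>s Xs x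
  assume F: "tame F" and G: "tame G" and dom: "set \<alpha>s \<subseteq> SA" "set \<beta>s \<subseteq> SA" "set Xs \<subseteq> SX"
  show "Kv (\<lambda>\<alpha>s \<beta>s Xs x. F \<alpha>s \<beta>s Xs x + r *\<^sub>R G \<alpha>s \<beta>s Xs x) \<alpha>s \<beta>s Xs x =
      Kv F \<alpha>s \<beta>s Xs x + r *\<^sub>R Kv G \<alpha>s \<beta>s Xs x"
    unfolding Kv_def xsum_scaleR[symmetric] xsum_add[symmetric]
  proof (rule xsum_cong[OF dom(2)])
    fix b bs assume b: "b \<in> SA" "set bs \<subseteq> SA"
    note l = linon_bracket_SK[OF v_SA[OF b(1)]]
    show "br (v b) (\<lambda>x. F \<alpha>s bs Xs x + r *\<^sub>R G \<alpha>s bs Xs x) x = br (v b) (F \<alpha>s bs Xs) x + r *\<^sub>R br (v b) (G \<alpha>s bs Xs) x"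
      using linon_add[OF l tameD(1)[OF F dom(1) b(2) dom(3)] subsp_scaleR[OF subsp_SK tameD(1)[OF G dom(1) b(2) dom(3)]]]
        linon_scaleR[OF l tameD(1)[OF G dom(1) b(2) dom(3)]] by simp
  qed
qed

lemma linop_Kc: "linop Kc"
  unfolding linop_def
proof (intro allI impI)
  fix F G :: "('m, 'a) cfun" and r \<alpha>s \<beta>s Xs x
  assume F: "tame F" and G: "tame G" and dom: "set \<alpha>s \<subseteq> SA" "set \<beta>s \<subseteq> SA" "set Xs \<subseteq> SX"
  show "Kc (\<lambda>\<alpha>s \<beta>s Xs x. F \<alpha>s \<beta>s Xs x + r *\<^sub>R G \<alpha>s \<beta>s Xs x) \<alpha>s \<beta>s Xs x =
      Kc F \<alpha>s \<beta>s Xs x + r *\<^sub>R Kc G \<alpha>s \<beta>s Xs x"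
    unfolding Kc_def asum_scaleR[symmetric] asum_add[symmetric]
  proof (intro asum_cong[OF dom(1)] asum_cong[OF dom(3)])
    fix a as X Ys assume b: "a \<in> SA" "set as \<subseteq> SA" "X \<in> SX" "set Ys \<subseteq> SX"
    note l = linon_bracket_SK[OF C_SA[OF b(1,3)]]
    show "br (C a X) (\<lambda>x. F as \<beta>s Ys x + r *\<^sub>R G as \<beta>s Ys x) x = br (C a X) (F as \<beta>s Ys) x + r *\<^sub>R br (C a X) (G as \<beta>s Ys) x"
      using linon_add[OF l tameD(1)[OF F b(2) dom(2) b(4)] subsp_scaleR[OF subsp_SK tameD(1)[OF G b(2) dom(2) b(4)]]]
        linon_scaleR[OF l tameD(1)[OF G b(2) dom(2) b(4)]] by simp
  qed
qed

text \<open>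
  Since \<open>Kc\<close> is the commutator of \<open>U\<close> and \<open>Kv\<close> and commutes with \<open>U\<close>, the two contributions of \<open>Kc\<close> to
  \<open>exp (- U) (Kv + Kc)\<close> cancel and \<open>Kv exp (- U)\<close> remains.  It vanishes on horizontal symmetric
  arguments because \<open>v \<circ> h = 0\<close>.
\<close>

lemma H_K:
  assumes F: "tame F" and dom: "set \<alpha>s \<subseteq> SA" "set \<beta>s \<subseteq> SA" "set Xs \<subseteq> SX"
  shows "H (\<lambda>\<alpha>s \<beta>s Xs x. Kv F \<alpha>s \<beta>s Xs x + Kc F \<alpha>s \<beta>s Xs x) \<alpha>s \<beta>s Xs x = 0"
proof -
  let ?N = "length \<alpha>s"
  note dom' = dom(1) h_set[OF dom(2)] dom(3)
  have van: "Kc ((U ^^ ?N) F) \<alpha>s (map h \<beta>s) Xs x = 0"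
  proof -
    have "asum \<alpha>s (\<lambda>a as. asum Xs (\<lambda>X Ys. br (C a X) ((U ^^ ?N) F as (map h \<beta>s) Ys) x)) = asum \<alpha>s (\<lambda>a as. asum Xs (\<lambda>X Ys. 0))"
    proof (intro asum_cong[OF dom(1)] asum_cong[OF dom(3)])
      fix a as X Ys assume *: "a \<in> SA" "Suc (length as) = length \<alpha>s" "X \<in> SX" "set as \<subseteq> SA" "set Ys \<subseteq> SX"
      have "(U ^^ ?N) F as (map h \<beta>s) Ys = (\<lambda>x. 0)" by (rule ext, rule Upow_vanish) (use * in simp)
      then show "br (C a X) ((U ^^ ?N) F as (map h \<beta>s) Ys) x = 0"
        using linon_zero[OF linon_bracket_SK[OF C_SA[OF *(1,3)]] subsp_SK] by simp
    qed
    then show ?thesis by (simp add: Kc_def)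
  qed
  have "H (\<lambda>\<alpha>s \<beta>s Xs x. Kv F \<alpha>s \<beta>s Xs x + Kc F \<alpha>s \<beta>s Xs x) \<alpha>s \<beta>s Xs x =
      expU (Suc ?N) (Kv F) \<alpha>s (map h \<beta>s) Xs x + expU (Suc ?N) (Kc F) \<alpha>s (map h \<beta>s) Xs x"
    unfolding H_def expU_def Upow_add scaleR_add_right sum.distrib ..
  also have "expU (Suc ?N) (Kc F) \<alpha>s (map h \<beta>s) Xs x = Kc (expU (Suc ?N) F) \<alpha>s (map h \<beta>s) Xs x"
  proof -
    have "(U ^^ n) (Kc F) \<alpha>s (map h \<beta>s) Xs x = Kc ((U ^^ n) F) \<alpha>s (map h \<beta>s) Xs x" for n
      using Upow_commutator[of Kc "\<lambda>F \<alpha>s \<beta>s Xs x. 0", OF _ _ F dom'] by (simp add: U_Kc U_def[of "\<lambda>\<alpha>s \<beta>s Xs x. 0"])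
    then show ?thesis unfolding linop_expU[OF linop_Kc F dom'] by (simp add: expU_def)
  qed
  also have "expU (Suc ?N) (Kv F) \<alpha>s (map h \<beta>s) Xs x =
      Kv (expU (Suc ?N) F) \<alpha>s (map h \<beta>s) Xs x - Kc (expU (Suc ?N) F) \<alpha>s (map h \<beta>s) Xs x"
    by (rule expU_commutator[of Kv Kc, OF U_Kv U_Kc linop_Kv linop_Kc van F dom'])
  also have "Kv (expU (Suc ?N) F) \<alpha>s (map h \<beta>s) Xs x = 0"
  proof -
    have "xsum \<beta>s (\<lambda>b bs. br (v (h b)) (expU (Suc ?N) F \<alpha>s (map h bs) Xs) x) = xsum \<beta>s (\<lambda>b bs. 0)"
    proof (rule xsum_cong[OF dom(2)])
      fix b bs assume b: "b \<in> SA" "set bs \<subseteq> SA"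
      have "expU (Suc ?N) F \<alpha>s (map h bs) Xs \<in> SA"
        by (rule SK_SA[OF tameD(1)[OF tame_expU[OF F] dom(1) h_set[OF b(2)] dom(3)]])
      then show "br (v (h b)) (expU (Suc ?N) F \<alpha>s (map h bs) Xs) x = 0"
        unfolding v_h[OF b(1)] using linon_zero[OF linon_bracket1 subsp_SA] by simp
    qed
    then show ?thesis by (simp add: Kv_def xsum_map)
  qed
  finally show ?thesis by simp
qed

section \<open>The commutator of the two differentials\<close>

text \<open>
  The exterior covariant derivative of a form with values in the bundle of ideals.  \<open>Dn\<close> extends it
  to Weil cochains, \<open>Dn2\<close> being the part that turns a symmetric argument into an alternating one.
\<close>

definition ext :: "('m vfield list \<Rightarrow> 'm \<Rightarrow> 'a) \<Rightarrow> 'm vfield list \<Rightarrow> 'm \<Rightarrow> 'a" where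
  "ext \<omega> Xs x = asum Xs (\<lambda>X Ys. C (\<omega> Ys) X x) + bsum Xs (\<lambda>X Y Ys. \<omega> (vf_bracket X Y # Ys) x)"

definition Dn1 :: "('m, 'a) cfun \<Rightarrow> ('m, 'a) cfun" where
  "Dn1 F \<alpha>s \<beta>s Xs x = (-1) ^ length \<beta>s *\<^sub>R ext (F \<alpha>s \<beta>s) Xs x"

definition Dn2 :: "('m, 'a) cfun \<Rightarrow> ('m, 'a) cfun" where
  "Dn2 F \<alpha>s \<beta>s Xs x = - ((-1) ^ length \<beta>s *\<^sub>R xsum \<beta>s (\<lambda>b bs. F (b # \<alpha>s) bs Xs x))"

definition Dn :: "('m, 'a) cfun \<Rightarrow> ('m, 'a) cfun" where
  "Dn F \<alpha>s \<beta>s Xs x = Dn1 F \<alpha>s \<beta>s Xs x + Dn2 F \<alpha>s \<beta>s Xs x"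

lemma ext_cong:
  assumes "\<And>Ys. set Ys \<subseteq> SX \<Longrightarrow> \<omega> Ys = \<eta> Ys" "set Xs \<subseteq> SX"
  shows "ext \<omega> Xs x = ext \<eta> Xs x"
  unfolding ext_def
  by (intro arg_cong2[of _ _ _ _ plus] asum_cong[OF assms(2)] bsum_cong[OF assms(2)])
    (simp_all add: assms(1) SX_bracket)

lemma ext_add:
  assumes "\<And>Ys. set Ys \<subseteq> SX \<Longrightarrow> \<omega> Ys \<in> SK" "\<And>Ys. set Ys \<subseteq> SX \<Longrightarrow> \<eta> Ys \<in> SK" "set Xs \<subseteq> SX"
  shows "ext (\<lambda>Ys x. r *\<^sub>R \<omega> Ys x + q *\<^sub>R \<eta> Ys x) Xs x = r *\<^sub>R ext \<omega> Xs x + q *\<^sub>R ext \<eta> Xs x"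
proof -
  have "asum Xs (\<lambda>X Ys. C (\<lambda>x. r *\<^sub>R \<omega> Ys x + q *\<^sub>R \<eta> Ys x) X x) =
      asum Xs (\<lambda>X Ys. r *\<^sub>R C (\<omega> Ys) X x + q *\<^sub>R C (\<eta> Ys) X x)"
    by (rule asum_cong[OF assms(3)]) (simp only: C_lin[OF SK_SA[OF assms(1)] SK_SA[OF assms(2)]])
  then show ?thesis by (simp add: ext_def asum_add asum_scaleR bsum_add bsum_scaleR algebra_simps)
qed

lemma ext_asum:
  assumes "set as \<subseteq> S" "\<And>a bs Ys. a \<in> S \<Longrightarrow> set bs \<subseteq> S \<Longrightarrow> set Ys \<subseteq> SX \<Longrightarrow> g a bs Ys \<in> SK" "set Xs \<subseteq> SX"
  shows "ext (\<lambda>Ys x. asum as (\<lambda>a bs. g a bs Ys x)) Xs x = asum as (\<lambda>a bs. ext (g a bs) Xs x)"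
proof -
  have "asum Xs (\<lambda>X Ys. C (\<lambda>x. asum as (\<lambda>a bs. g a bs Ys x)) X x) =
      asum Xs (\<lambda>X Ys. asum as (\<lambda>a bs. C (g a bs Ys) X x))"
    by (rule asum_cong[OF assms(3)], rule linon_asum[OF linon_C_SK subsp_SK assms(1)], rule assms(2))
  then show ?thesis unfolding ext_def asum_add asum_asum_fubini[of as Xs] asum_bsum_fubini by simp
qed

lemma ext_xsum:
  assumes "set as \<subseteq> S" "\<And>a bs Ys. a \<in> S \<Longrightarrow> set bs \<subseteq> S \<Longrightarrow> set Ys \<subseteq> SX \<Longrightarrow> g a bs Ys \<in> SK" "set Xs \<subseteq> SX"
  shows "ext (\<lambda>Ys x. xsum as (\<lambda>a bs. g a bs Ys x)) Xs x = xsum as (\<lambda>a bs. ext (g a bs) Xs x)"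
proof -
  have "asum Xs (\<lambda>X Ys. C (\<lambda>x. xsum as (\<lambda>a bs. g a bs Ys x)) X x) =
      asum Xs (\<lambda>X Ys. xsum as (\<lambda>a bs. C (g a bs Ys) X x))"
    by (rule asum_cong[OF assms(3)], rule linon_xsum[OF linon_C_SK subsp_SK assms(1)], rule assms(2))
  then show ?thesis unfolding ext_def xsum_add asum_xsum_fubini[symmetric] xsum_bsum_fubini by simp
qed

lemma ext_bsum:
  assumes "set as \<subseteq> S" "\<And>a b bs Ys. a \<in> S \<Longrightarrow> b \<in> S \<Longrightarrow> set bs \<subseteq> S \<Longrightarrow> set Ys \<subseteq> SX \<Longrightarrow> g a b bs Ys \<in> SK" "set Xs \<subseteq> SX"
  shows "ext (\<lambda>Ys x. bsum as (\<lambda>a b bs. g a b bs Ys x)) Xs x = bsum as (\<lambda>a b bs. ext (g a b bs) Xs x)"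
proof -
  have "asum Xs (\<lambda>X Ys. C (\<lambda>x. bsum as (\<lambda>a b bs. g a b bs Ys x)) X x) =
      asum Xs (\<lambda>X Ys. bsum as (\<lambda>a b bs. C (g a b bs Ys) X x))"
    by (rule asum_cong[OF assms(3)], rule linon_bsum[OF linon_C_SK subsp_SK assms(1)], rule assms(2))
  then show ?thesis unfolding ext_def bsum_add asum_bsum_fubini[symmetric] bsum_bsum_fubini[of Xs as, symmetric]
    by (simp add: bsum_bsum_fubini[of as Xs])
qed

lemma ext_SK:
  assumes "\<And>Ys. set Ys \<subseteq> SX \<Longrightarrow> \<omega> Ys \<in> SK" "set Xs \<subseteq> SX"
  shows "ext \<omega> Xs \<in> SK"
proof -
  have "(\<lambda>x. asum Xs (\<lambda>X Ys. C (\<omega> Ys) X x) + bsum Xs (\<lambda>X Y Ys. \<omega> (vf_bracket X Y # Ys) x)) \<in> SK"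
    by (rule subsp_add[OF subsp_SK subsp_asum[OF subsp_SK assms(2)] subsp_bsum[OF subsp_SK assms(2)]])
      (simp_all add: C_SK[OF SK_SA[OF assms(1)]] assms(1) SX_bracket)
  then show ?thesis unfolding ext_def .
qed

definition valued :: "('m, 'a) cfun \<Rightarrow> bool" where
  "valued F \<longleftrightarrow> (\<forall>\<alpha>s \<beta>s Xs. set \<alpha>s \<subseteq> SA \<longrightarrow> set \<beta>s \<subseteq> SA \<longrightarrow> set Xs \<subseteq> SX \<longrightarrow> F \<alpha>s \<beta>s Xs \<in> SK)"

lemma valuedD: "valued F \<Longrightarrow> set \<alpha>s \<subseteq> SA \<Longrightarrow> set \<beta>s \<subseteq> SA \<Longrightarrow> set Xs \<subseteq> SX \<Longrightarrow> F \<alpha>s \<beta>s Xs \<in> SK"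
  by (simp add: valued_def)

lemma tame_valued: "tame F \<Longrightarrow> valued F"
  by (simp add: valued_def tameD(1))

lemma lie_SK:
  assumes F: "valued F" and dom: "a \<in> SA" "set as \<subseteq> SA" "set \<beta>s \<subseteq> SA" "set Xs \<subseteq> SX"
  shows "lie a F as \<beta>s Xs \<in> SK"
proof -
  have "(\<lambda>x. br a (F as \<beta>s Xs) x - dsum (br a) \<beta>s (\<lambda>bs. F as bs Xs x)
     - dsum (vf_bracket (ro a)) Xs (\<lambda>Ys. F as \<beta>s Ys x)) \<in> SK"
    by (rule subsp_diff[OF subsp_SK subsp_diff[OF subsp_SK SK_br[OF dom(1) valuedD[OF F dom(2-4)]]
        subsp_dsum[OF subsp_SK dom(3) bracket_section[OF dom(1)] valuedD[OF F dom(2) _ dom(4)]]]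
        subsp_dsum[OF subsp_SK dom(4) SX_bracket[OF ro_SX[OF dom(1)]] valuedD[OF F dom(2,3)]]])
  then show ?thesis unfolding lie_def .
qed

text \<open>
  The exterior covariant derivative commutes with the Lie derivative up to the adjoint action of
  \<open>C a\<close>: the bracket terms match by the Jacobi identity, and the connection fails to be invariant by
  \<open>C_bracket_SK\<close>.
\<close>

lemma lie_ext:
  assumes F: "tame F" and dom: "a \<in> SA" "set as \<subseteq> SA" "set \<beta>s \<subseteq> SA" "set Xs \<subseteq> SX"
  shows "br a (ext (F as \<beta>s) Xs) x - dsum (br a) \<beta>s (\<lambda>bs. ext (F as bs) Xs x)
      - dsum (vf_bracket (ro a)) Xs (\<lambda>Ys. ext (F as \<beta>s) Ys x) =
    ext (lie a F as \<beta>s) Xs x - asum Xs (\<lambda>X Ys. br (C a X) (F as \<beta>s Ys) x)"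
proof -
  let ?D = "vf_bracket (ro a)"
  have D: "?D X \<in> SX" if "X \<in> SX" for X by (rule SX_bracket[OF ro_SX[OF dom(1)] that])
  have v: "F as bs Ys \<in> SK" if "set bs \<subseteq> SA" "set Ys \<subseteq> SX" for bs Ys by (rule tameD(1)[OF F dom(2) that])
  note lb = linon_bracket_SK[OF dom(1)]
  have vC: "(\<lambda>x. asum Xs (\<lambda>X Ys. C (F as \<beta>s Ys) X x)) \<in> SK"
    by (rule subsp_asum[OF subsp_SK dom(4)]) (rule C_SK[OF SK_SA[OF v[OF dom(3)]]])
  have vB: "(\<lambda>x. bsum Xs (\<lambda>X Y Ys. F as \<beta>s (vf_bracket X Y # Ys) x)) \<in> SK"
    by (rule subsp_bsum[OF subsp_SK dom(4)], rule v[OF dom(3)]) (simp add: SX_bracket)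
  have 1: "br a (ext (F as \<beta>s) Xs) x = asum Xs (\<lambda>X Ys. br a (C (F as \<beta>s Ys) X) x)
      + bsum Xs (\<lambda>X Y Ys. br a (F as \<beta>s (vf_bracket X Y # Ys)) x)"
  proof -
    have "br a (ext (F as \<beta>s) Xs) x = br a (\<lambda>x. asum Xs (\<lambda>X Ys. C (F as \<beta>s Ys) X x)) x
        + br a (\<lambda>x. bsum Xs (\<lambda>X Y Ys. F as \<beta>s (vf_bracket X Y # Ys) x)) x"
      unfolding ext_def using fun_cong[OF linon_add[OF lb vC vB], of x] .
    also have "br a (\<lambda>x. asum Xs (\<lambda>X Ys. C (F as \<beta>s Ys) X x)) x = asum Xs (\<lambda>X Ys. br a (C (F as \<beta>s Ys) X) x)"
      by (rule linon_asum[OF lb subsp_SK dom(4)]) (rule C_SK[OF SK_SA[OF v[OF dom(3)]]])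
    also have "br a (\<lambda>x. bsum Xs (\<lambda>X Y Ys. F as \<beta>s (vf_bracket X Y # Ys) x)) x =
        bsum Xs (\<lambda>X Y Ys. br a (F as \<beta>s (vf_bracket X Y # Ys)) x)"
      by (rule linon_bsum[OF lb subsp_SK dom(4)], rule v[OF dom(3)]) (simp add: SX_bracket)
    finally show ?thesis .
  qed
  have 2: "dsum (br a) \<beta>s (\<lambda>bs. ext (F as bs) Xs x) =
      asum Xs (\<lambda>X Ys. dsum (br a) \<beta>s (\<lambda>bs. C (F as bs Ys) X x))
      + bsum Xs (\<lambda>X Y Ys. dsum (br a) \<beta>s (\<lambda>bs. F as bs (vf_bracket X Y # Ys) x))"
    unfolding ext_def dsum_add dsum_asum_fubini dsum_bsum_fubini ..
  have 3: "dsum ?D Xs (\<lambda>Ys. ext (F as \<beta>s) Ys x) =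
      asum Xs (\<lambda>X Ys. C (F as \<beta>s Ys) (?D X) x + dsum ?D Ys (\<lambda>Zs. C (F as \<beta>s Zs) X x))
      + bsum Xs (\<lambda>X Y Ys. F as \<beta>s (vf_bracket (?D X) Y # Ys) x + F as \<beta>s (vf_bracket X (?D Y) # Ys) x
          + dsum ?D Ys (\<lambda>Zs. F as \<beta>s (vf_bracket X Y # Zs) x))"
    unfolding ext_def dsum_add dsum_asum dsum_bsum ..
  have 4: "C (lie a F as \<beta>s Ys) X x = br a (C (F as \<beta>s Ys) X) x - dsum (br a) \<beta>s (\<lambda>bs. C (F as bs Ys) X x)
      - (C (F as \<beta>s Ys) (?D X) x + dsum ?D Ys (\<lambda>Zs. C (F as \<beta>s Zs) X x)) + br (C a X) (F as \<beta>s Ys) x"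
    if X: "X \<in> SX" and Y: "set Ys \<subseteq> SX" for X Ys
  proof -
    note lC = linon_C_SK[of X]
    note vb = SK_br[OF dom(1) v[OF dom(3) Y]]
    have vd: "(\<lambda>x. dsum (br a) \<beta>s (\<lambda>bs. F as bs Ys x)) \<in> SK"
      by (rule subsp_dsum[OF subsp_SK dom(3) bracket_section[OF dom(1)] v[OF _ Y]])
    have vD: "(\<lambda>x. dsum ?D Ys (\<lambda>Zs. F as \<beta>s Zs x)) \<in> SK"
      by (rule subsp_dsum[OF subsp_SK Y D v[OF dom(3)]])
    have "C (lie a F as \<beta>s Ys) X x = C (br a (F as \<beta>s Ys)) X x - C (\<lambda>x. dsum (br a) \<beta>s (\<lambda>bs. F as bs Ys x)) X x
        - C (\<lambda>x. dsum ?D Ys (\<lambda>Zs. F as \<beta>s Zs x)) X x"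
      unfolding lie_def linon_diff[OF lC subsp_diff[OF subsp_SK vb vd] vD] linon_diff[OF lC vb vd] ..
    also have "C (\<lambda>x. dsum (br a) \<beta>s (\<lambda>bs. F as bs Ys x)) X x = dsum (br a) \<beta>s (\<lambda>bs. C (F as bs Ys) X x)"
      by (rule linon_dsum[OF lC subsp_SK dom(3) bracket_section[OF dom(1)] v[OF _ Y]])
    also have "C (\<lambda>x. dsum ?D Ys (\<lambda>Zs. F as \<beta>s Zs x)) X x = dsum ?D Ys (\<lambda>Zs. C (F as \<beta>s Zs) X x)"
      by (rule linon_dsum[OF lC subsp_SK Y D v[OF dom(3)]])
    finally show ?thesis
      using C_bracket_SK[OF dom(1) v[OF dom(3) Y] X, of x] by (simp add: algebra_simps)
  qed
  have 5: "lie a F as \<beta>s (vf_bracket X Y # Ys) x = br a (F as \<beta>s (vf_bracket X Y # Ys)) x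
      - dsum (br a) \<beta>s (\<lambda>bs. F as bs (vf_bracket X Y # Ys) x)
      - (F as \<beta>s (vf_bracket (?D X) Y # Ys) x + F as \<beta>s (vf_bracket X (?D Y) # Ys) x
          + dsum ?D Ys (\<lambda>Zs. F as \<beta>s (vf_bracket X Y # Zs) x))"
    if X: "X \<in> SX" "Y \<in> SX" and Y: "set Ys \<subseteq> SX" for X Y Ys
  proof -
    have "F as \<beta>s (?D (vf_bracket X Y) # Ys) x =
        F as \<beta>s (vf_bracket (?D X) Y # Ys) x + F as \<beta>s (vf_bracket X (?D Y) # Ys) x"
      unfolding vf_jacobi[OF ro_SX[OF dom(1)] X]
      by (rule tame_addX[OF F dom(2,3) Y SX_bracket[OF D[OF X(1)] X(2)] SX_bracket[OF X(1) D[OF X(2)]]])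
    then show ?thesis unfolding lie_def by (simp add: algebra_simps)
  qed
  have "ext (lie a F as \<beta>s) Xs x = asum Xs (\<lambda>X Ys. br a (C (F as \<beta>s Ys) X) x - dsum (br a) \<beta>s (\<lambda>bs. C (F as bs Ys) X x)
      - (C (F as \<beta>s Ys) (?D X) x + dsum ?D Ys (\<lambda>Zs. C (F as \<beta>s Zs) X x)) + br (C a X) (F as \<beta>s Ys) x)
    + bsum Xs (\<lambda>X Y Ys. br a (F as \<beta>s (vf_bracket X Y # Ys)) x
      - dsum (br a) \<beta>s (\<lambda>bs. F as bs (vf_bracket X Y # Ys) x)
      - (F as \<beta>s (vf_bracket (?D X) Y # Ys) x + F as \<beta>s (vf_bracket X (?D Y) # Ys) x
          + dsum ?D Ys (\<lambda>Zs. F as \<beta>s (vf_bracket X Y # Zs) x)))"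
    unfolding ext_def by (intro arg_cong2[of _ _ _ _ plus] asum_cong[OF dom(4)] bsum_cong[OF dom(4)] 4 5)
  then show ?thesis unfolding 1 2 3 by (simp only: asum_add asum_diff bsum_diff bsum_add algebra_simps)
qed

context
  fixes F :: "('m, 'a) cfun"
  assumes F: "valued F"
begin

lemma Dn1_SK:
  assumes "set as \<subseteq> SA" "set bs \<subseteq> SA" "set Ys \<subseteq> SX"
  shows "Dn1 F as bs Ys \<in> SK"
proof -
  have "(\<lambda>x. (-1) ^ length bs *\<^sub>R ext (F as bs) Ys x) \<in> SK"
    by (rule subsp_scaleR[OF subsp_SK ext_SK[OF valuedD[OF F assms(1,2)] assms(3)]])
  then show ?thesis unfolding Dn1_def .
qed

lemma Dn2_SK:
  assumes "set as \<subseteq> SA" "set bs \<subseteq> SA" "set Ys \<subseteq> SX"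
  shows "Dn2 F as bs Ys \<in> SK"
proof -
  have "(\<lambda>x. - ((-1) ^ length bs *\<^sub>R xsum bs (\<lambda>b bs. F (b # as) bs Ys x))) \<in> SK"
    by (rule subsp_minus[OF subsp_SK subsp_scaleR[OF subsp_SK subsp_xsum[OF subsp_SK assms(2) valuedD[OF F _ _ assms(3)]]]])
      (use assms in auto)
  then show ?thesis unfolding Dn2_def .
qed

lemma Del0_SK:
  assumes "set as \<subseteq> SA" "set bs \<subseteq> SA" "set Ys \<subseteq> SX"
  shows "Del0 F as bs Ys \<in> SK"
proof -
  have "(\<lambda>x. (-1) ^ length bs *\<^sub>R (asum as (\<lambda>a as. lie a F as bs Ys x) + bsum as (\<lambda>a b cs. F (br a b # cs) bs Ys x))) \<in> SK"
    by (rule subsp_scaleR[OF subsp_SK subsp_add[OF subsp_SK subsp_asum[OF subsp_SK assms(1) lie_SK[OF F _ _ assms(2,3)]]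
        subsp_bsum[OF subsp_SK assms(1) valuedD[OF F _ assms(2,3)]]]]) (auto simp: bracket_section)
  then show ?thesis unfolding Del0_def .
qed

lemma DelR_SK:
  assumes "set as \<subseteq> SA" "set bs \<subseteq> SA" "set Ys \<subseteq> SX"
  shows "DelR F as bs Ys \<in> SK"
proof -
  have "(\<lambda>x. - ((-1) ^ length bs *\<^sub>R xsum bs (\<lambda>b bs. F as bs (ro b # Ys) x))) \<in> SK"
    by (rule subsp_minus[OF subsp_SK subsp_scaleR[OF subsp_SK subsp_xsum[OF subsp_SK assms(2) valuedD[OF F assms(1)]]]])
      (use assms in \<open>auto simp: ro_SX\<close>)
  then show ?thesis unfolding DelR_def .
qed

end

lemma Del0_Dn1:
  assumes F: "tame F" and dom: "set \<alpha>s \<subseteq> SA" "set \<beta>s \<subseteq> SA" "set Xs \<subseteq> SX"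
  shows "Del0 (Dn1 F) \<alpha>s \<beta>s Xs x = Dn1 (Del0 F) \<alpha>s \<beta>s Xs x - Kc F \<alpha>s \<beta>s Xs x"
proof -
  let ?s = "(-1 :: real) ^ length \<beta>s"
  have l: "lie a (Dn1 F) as \<beta>s Xs x = ?s *\<^sub>R (ext (lie a F as \<beta>s) Xs x - asum Xs (\<lambda>X Ys. br (C a X) (F as \<beta>s Ys) x))"
    if a: "a \<in> SA" "set as \<subseteq> SA" for a as
  proof -
    have "ext (F as \<beta>s) Xs \<in> SK" by (rule ext_SK[OF tameD(1)[OF F a(2) dom(2)] dom(3)])
    then have "br a (Dn1 F as \<beta>s Xs) x = ?s *\<^sub>R br a (ext (F as \<beta>s) Xs) x"
      using linon_scaleR[OF linon_bracket_SK[OF a(1)], of "ext (F as \<beta>s) Xs" ?s] unfolding Dn1_def by simp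
    moreover have "dsum (br a) \<beta>s (\<lambda>bs. Dn1 F as bs Xs x) = dsum (br a) \<beta>s (\<lambda>bs. ?s *\<^sub>R ext (F as bs) Xs x)"
      by (rule dsum_cong[OF dom(2) bracket_section[OF a(1)]]) (simp_all add: Dn1_def)
    ultimately have "lie a (Dn1 F) as \<beta>s Xs x = ?s *\<^sub>R (br a (ext (F as \<beta>s) Xs) x - dsum (br a) \<beta>s (\<lambda>bs. ext (F as bs) Xs x)
        - dsum (vf_bracket (ro a)) Xs (\<lambda>Ys. ext (F as \<beta>s) Ys x))"
      unfolding lie_def by (simp add: Dn1_def dsum_scaleR scaleR_diff_right)
    then show ?thesis unfolding lie_ext[OF F a dom(2,3)] .
  qed
  have "Del0 (Dn1 F) \<alpha>s \<beta>s Xs x = ?s *\<^sub>R (asum \<alpha>s (\<lambda>a as. ?s *\<^sub>R (ext (lie a F as \<beta>s) Xs x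
      - asum Xs (\<lambda>X Ys. br (C a X) (F as \<beta>s Ys) x))) + bsum \<alpha>s (\<lambda>a b cs. ?s *\<^sub>R ext (F (br a b # cs) \<beta>s) Xs x))"
    unfolding Del0_def by (intro arg_cong[of _ _ "scaleR _"] arg_cong2[of _ _ _ _ plus] asum_cong[OF dom(1)] l)
      (simp_all add: Dn1_def)
  also have "\<dots> = asum \<alpha>s (\<lambda>a as. ext (lie a F as \<beta>s) Xs x) + bsum \<alpha>s (\<lambda>a b cs. ext (F (br a b # cs) \<beta>s) Xs x)
      - Kc F \<alpha>s \<beta>s Xs x"
    unfolding Kc_def asum_scaleR bsum_scaleR asum_diff scaleR_add_right scaleR_diff_right scaleR_scaleR by simp
  also have "asum \<alpha>s (\<lambda>a as. ext (lie a F as \<beta>s) Xs x) + bsum \<alpha>s (\<lambda>a b cs. ext (F (br a b # cs) \<beta>s) Xs x) =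
      Dn1 (Del0 F) \<alpha>s \<beta>s Xs x"
  proof -
    have vl: "lie a F as \<beta>s Ys \<in> SK" if "a \<in> SA" "set as \<subseteq> SA" "set Ys \<subseteq> SX" for a as Ys
      by (rule lie_SK[OF tame_valued[OF F] that(1,2) dom(2) that(3)])
    have vb: "F (br a b # cs) \<beta>s Ys \<in> SK" if "a \<in> SA" "b \<in> SA" "set cs \<subseteq> SA" "set Ys \<subseteq> SX" for a b cs Ys
      by (rule tameD(1)[OF F _ dom(2) that(4)]) (simp add: that bracket_section)
    have "ext (Del0 F \<alpha>s \<beta>s) Xs x = ext (\<lambda>Ys x. ?s *\<^sub>R asum \<alpha>s (\<lambda>a as. lie a F as \<beta>s Ys x)
        + ?s *\<^sub>R bsum \<alpha>s (\<lambda>a b cs. F (br a b # cs) \<beta>s Ys x)) Xs x"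
      unfolding Del0_def scaleR_add_right ..
    also have "\<dots> = ?s *\<^sub>R ext (\<lambda>Ys x. asum \<alpha>s (\<lambda>a as. lie a F as \<beta>s Ys x)) Xs x
        + ?s *\<^sub>R ext (\<lambda>Ys x. bsum \<alpha>s (\<lambda>a b cs. F (br a b # cs) \<beta>s Ys x)) Xs x"
      by (rule ext_add[OF subsp_asum[OF subsp_SK dom(1) vl] subsp_bsum[OF subsp_SK dom(1) vb] dom(3)])
    also have "ext (\<lambda>Ys x. asum \<alpha>s (\<lambda>a as. lie a F as \<beta>s Ys x)) Xs x = asum \<alpha>s (\<lambda>a as. ext (lie a F as \<beta>s) Xs x)"
      by (rule ext_asum[OF dom(1) vl dom(3)])
    also have "ext (\<lambda>Ys x. bsum \<alpha>s (\<lambda>a b cs. F (br a b # cs) \<beta>s Ys x)) Xs x = bsum \<alpha>s (\<lambda>a b cs. ext (F (br a b # cs) \<beta>s) Xs x)"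
      by (rule ext_bsum[OF dom(1) vb dom(3)])
    finally show ?thesis by (simp add: Dn1_def flip: scaleR_add_right)
  qed
  finally show ?thesis .
qed

lemma Del0_Dn2:
  assumes F: "tame F" and dom: "set \<alpha>s \<subseteq> SA" "set \<beta>s \<subseteq> SA" "set Xs \<subseteq> SX"
  shows "Del0 (Dn2 F) \<alpha>s \<beta>s Xs x = Dn2 (Del0 F) \<alpha>s \<beta>s Xs x - xsum \<beta>s (\<lambda>b bs. lie b F \<alpha>s bs Xs x)"
proof -
  let ?s = "(-1 :: real) ^ length \<beta>s"
  have l: "lie a (Dn2 F) as \<beta>s Xs x = - (?s *\<^sub>R (xsum \<beta>s (\<lambda>b bs. lie a F (b # as) bs Xs x)
      - xsum \<beta>s (\<lambda>b bs. F (br a b # as) bs Xs x)))"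
    if a: "a \<in> SA" "set as \<subseteq> SA" for a as
  proof -
    have v: "F (b # as) bs Xs \<in> SK" if "b \<in> SA" "set bs \<subseteq> SA" for b bs
      by (rule tameD(1)[OF F _ that(2) dom(3)]) (simp add: that a)
    note lb = linon_bracket_SK[OF a(1)]
    have vx: "(\<lambda>x. xsum \<beta>s (\<lambda>b bs. F (b # as) bs Xs x)) \<in> SK" by (rule subsp_xsum[OF subsp_SK dom(2) v])
    have "br a (Dn2 F as \<beta>s Xs) x = br a (\<lambda>x. - (?s *\<^sub>R xsum \<beta>s (\<lambda>b bs. F (b # as) bs Xs x))) x"
      unfolding Dn2_def ..
    also have "\<dots> = - (?s *\<^sub>R br a (\<lambda>x. xsum \<beta>s (\<lambda>b bs. F (b # as) bs Xs x)) x)"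
      unfolding linon_minus[OF lb subsp_scaleR[OF subsp_SK vx]] linon_scaleR[OF lb vx] ..
    also have "br a (\<lambda>x. xsum \<beta>s (\<lambda>b bs. F (b # as) bs Xs x)) x = xsum \<beta>s (\<lambda>b bs. br a (F (b # as) bs Xs) x)"
      by (rule linon_xsum[OF lb subsp_SK dom(2) v])
    finally have 1: "br a (Dn2 F as \<beta>s Xs) x = - (?s *\<^sub>R xsum \<beta>s (\<lambda>b bs. br a (F (b # as) bs Xs) x))" .
    have "dsum (br a) \<beta>s (\<lambda>bs. Dn2 F as bs Xs x) = dsum (br a) \<beta>s (\<lambda>bs. - (?s *\<^sub>R xsum bs (\<lambda>b bs. F (b # as) bs Xs x)))"
      by (rule dsum_cong[OF dom(2) bracket_section[OF a(1)]]) (simp_all add: Dn2_def)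
    also have "\<dots> = - (?s *\<^sub>R xsum \<beta>s (\<lambda>b bs. F (br a b # as) bs Xs x + dsum (br a) bs (\<lambda>cs. F (b # as) cs Xs x)))"
      unfolding dsum_minus dsum_scaleR dsum_xsum ..
    finally have 2: "dsum (br a) \<beta>s (\<lambda>bs. Dn2 F as bs Xs x) =
      - (?s *\<^sub>R xsum \<beta>s (\<lambda>b bs. F (br a b # as) bs Xs x + dsum (br a) bs (\<lambda>cs. F (b # as) cs Xs x)))" .
    have 3: "dsum (vf_bracket (ro a)) Xs (\<lambda>Ys. Dn2 F as \<beta>s Ys x) =
        - (?s *\<^sub>R xsum \<beta>s (\<lambda>b bs. dsum (vf_bracket (ro a)) Xs (\<lambda>Ys. F (b # as) bs Ys x)))"
      unfolding Dn2_def dsum_minus dsum_scaleR dsum_xsum_fubini ..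
    show ?thesis unfolding lie_def[of a "Dn2 F"] 1 2 3 by (simp add: lie_def xsum_diff xsum_add algebra_simps)
  qed
  have e1: "asum \<alpha>s (\<lambda>a as. lie a (Dn2 F) as \<beta>s Xs x) = - (?s *\<^sub>R (xsum \<beta>s (\<lambda>b bs. asum \<alpha>s (\<lambda>a as. lie a F (b # as) bs Xs x))
      - xsum \<beta>s (\<lambda>b bs. asum \<alpha>s (\<lambda>a as. F (br a b # as) bs Xs x))))"
  proof -
    have "asum \<alpha>s (\<lambda>a as. lie a (Dn2 F) as \<beta>s Xs x) = asum \<alpha>s (\<lambda>a as. - (?s *\<^sub>R (xsum \<beta>s (\<lambda>b bs. lie a F (b # as) bs Xs x)
      - xsum \<beta>s (\<lambda>b bs. F (br a b # as) bs Xs x))))"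
      by (rule asum_cong[OF dom(1)]) (rule l)
    then show ?thesis unfolding asum_minus asum_scaleR asum_diff asum_xsum_fubini .
  qed
  have e2: "bsum \<alpha>s (\<lambda>a c cs. Dn2 F (br a c # cs) \<beta>s Xs x) =
      ?s *\<^sub>R xsum \<beta>s (\<lambda>b bs. bsum \<alpha>s (\<lambda>a c cs. F (br a c # b # cs) bs Xs x))"
  proof -
    have "bsum \<alpha>s (\<lambda>a c cs. Dn2 F (br a c # cs) \<beta>s Xs x) =
        bsum \<alpha>s (\<lambda>a c cs. ?s *\<^sub>R xsum \<beta>s (\<lambda>b bs. F (br a c # b # cs) bs Xs x))"
    proof (rule bsum_cong[OF dom(1)])
      fix a c cs assume a: "a \<in> SA" "c \<in> SA" "set cs \<subseteq> SA"
      have "xsum \<beta>s (\<lambda>b bs. F (b # br a c # cs) bs Xs x) = xsum \<beta>s (\<lambda>b bs. - F (br a c # b # cs) bs Xs x)"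
        by (rule xsum_cong[OF dom(2)], rule altern_swap_head[OF tame_altA[OF F _ dom(3)]]) (simp_all add: a bracket_section)
      then show "Dn2 F (br a c # cs) \<beta>s Xs x = ?s *\<^sub>R xsum \<beta>s (\<lambda>b bs. F (br a c # b # cs) bs Xs x)"
        unfolding Dn2_def by (simp add: xsum_minus)
    qed
    then show ?thesis unfolding bsum_scaleR xsum_bsum_fubini .
  qed
  have sk: "F (br b a # as) bs Xs x = - F (br a b # as) bs Xs x"
    if "a \<in> SA" "b \<in> SA" "set as \<subseteq> SA" "set bs \<subseteq> SA" for a b as bs
    unfolding bracket_skew[OF that(2,1)] by (rule tame_minusA[OF F that(3,4) dom(3) bracket_section[OF that(1,2)]])
  have "Dn2 (Del0 F) \<alpha>s \<beta>s Xs x = xsum \<beta>s (\<lambda>b bs. lie b F \<alpha>s bs Xs x - asum \<alpha>s (\<lambda>a as. lie a F (b # as) bs Xs x)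
      + (bsum \<alpha>s (\<lambda>a c cs. F (br a c # b # cs) bs Xs x) + asum \<alpha>s (\<lambda>a as. F (br a b # as) bs Xs x)))"
    unfolding Dn2_def xsum_scaleR[symmetric] xsum_minus[symmetric]
  proof (rule xsum_cong[OF dom(2)])
    fix b bs assume b: "b \<in> SA" "set bs \<subseteq> SA" "Suc (length bs) = length \<beta>s"
    have "asum \<alpha>s (\<lambda>a as. F (br b a # as) bs Xs x) = asum \<alpha>s (\<lambda>a as. - F (br a b # as) bs Xs x)"
      by (rule asum_cong[OF dom(1)]) (rule sk[OF _ b(1) _ b(2)])
    then show "- (?s *\<^sub>R Del0 F (b # \<alpha>s) bs Xs x) = lie b F \<alpha>s bs Xs x - asum \<alpha>s (\<lambda>a as. lie a F (b # as) bs Xs x)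
      + (bsum \<alpha>s (\<lambda>a c cs. F (br a c # b # cs) bs Xs x) + asum \<alpha>s (\<lambda>a as. F (br a b # as) bs Xs x))"
      unfolding b(3)[symmetric] Del0_def asum.simps bsum.simps by (simp add: asum_minus)
  qed
  then show ?thesis unfolding Del0_def[of "Dn2 F"] e1 e2
    by (simp add: xsum_add xsum_diff scaleR_diff_right scaleR_add_right)
qed

lemma DelR_Dn1:
  assumes F: "tame F" and dom: "set \<alpha>s \<subseteq> SA" "set \<beta>s \<subseteq> SA" "set Xs \<subseteq> SX"
  shows "DelR (Dn1 F) \<alpha>s \<beta>s Xs x = Dn1 (DelR F) \<alpha>s \<beta>s Xs x + xsum \<beta>s (\<lambda>b bs. C (F \<alpha>s bs Xs) (ro b) x
      - asum Xs (\<lambda>X Ys. F \<alpha>s bs (vf_bracket (ro b) X # Ys) x))"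
proof -
  let ?s = "(-1 :: real) ^ length \<beta>s"
  have 1: "DelR (Dn1 F) \<alpha>s \<beta>s Xs x = xsum \<beta>s (\<lambda>b bs. ext (F \<alpha>s bs) (ro b # Xs) x)"
    unfolding DelR_def xsum_scaleR[symmetric] xsum_minus[symmetric]
  proof (rule xsum_cong[OF dom(2)])
    fix b bs assume "b \<in> SA" "set bs \<subseteq> SA" and b: "Suc (length bs) = length \<beta>s"
    show "- (?s *\<^sub>R Dn1 F \<alpha>s bs (ro b # Xs) x) = ext (F \<alpha>s bs) (ro b # Xs) x"
      unfolding b[symmetric] Dn1_def by simp
  qed
  have v: "F \<alpha>s bs (ro b # Ys) \<in> SK" if "b \<in> SA" "set bs \<subseteq> SA" "set Ys \<subseteq> SX" for b bs Ys
    by (rule tameD(1)[OF F dom(1) that(2)]) (simp add: that ro_SX)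
  have "ext (DelR F \<alpha>s \<beta>s) Xs x = ext (\<lambda>Ys x. (- ?s) *\<^sub>R xsum \<beta>s (\<lambda>b bs. F \<alpha>s bs (ro b # Ys) x) + 0 *\<^sub>R (\<lambda>x. 0) x) Xs x"
    unfolding DelR_def by simp
  also have "\<dots> = (- ?s) *\<^sub>R ext (\<lambda>Ys x. xsum \<beta>s (\<lambda>b bs. F \<alpha>s bs (ro b # Ys) x)) Xs x + 0 *\<^sub>R ext (\<lambda>Ys x. 0) Xs x"
    by (rule ext_add[OF subsp_xsum[OF subsp_SK dom(2) v] SK_zero dom(3)])
  also have "ext (\<lambda>Ys x. xsum \<beta>s (\<lambda>b bs. F \<alpha>s bs (ro b # Ys) x)) Xs x = xsum \<beta>s (\<lambda>b bs. ext (\<lambda>Ys. F \<alpha>s bs (ro b # Ys)) Xs x)"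
    by (rule ext_xsum[OF dom(2) v dom(3)])
  finally have 2: "Dn1 (DelR F) \<alpha>s \<beta>s Xs x = - xsum \<beta>s (\<lambda>b bs. ext (\<lambda>Ys. F \<alpha>s bs (ro b # Ys)) Xs x)"
    unfolding Dn1_def by simp
  have "ext (F \<alpha>s bs) (ro b # Xs) x = C (F \<alpha>s bs Xs) (ro b) x - asum Xs (\<lambda>X Ys. F \<alpha>s bs (vf_bracket (ro b) X # Ys) x)
      - ext (\<lambda>Ys. F \<alpha>s bs (ro b # Ys)) Xs x" if b: "b \<in> SA" "set bs \<subseteq> SA" for b bs
  proof -
    have "bsum Xs (\<lambda>X Y Ys. F \<alpha>s bs (vf_bracket X Y # ro b # Ys) x) = bsum Xs (\<lambda>X Y Ys. - F \<alpha>s bs (ro b # vf_bracket X Y # Ys) x)"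
      by (rule bsum_cong[OF dom(3)], rule altern_swap_head[OF tame_altX[OF F dom(1) b(2)]]) (simp_all add: b ro_SX SX_bracket)
    then show ?thesis unfolding ext_def by (simp add: bsum_minus)
  qed
  then have "xsum \<beta>s (\<lambda>b bs. ext (F \<alpha>s bs) (ro b # Xs) x) = xsum \<beta>s (\<lambda>b bs. (C (F \<alpha>s bs Xs) (ro b) x
      - asum Xs (\<lambda>X Ys. F \<alpha>s bs (vf_bracket (ro b) X # Ys) x)) - ext (\<lambda>Ys. F \<alpha>s bs (ro b # Ys)) Xs x)"
    by (intro xsum_cong[OF dom(2)])
  then show ?thesis unfolding 1 2 xsum_diff[of _ _ "\<lambda>b bs. ext (\<lambda>Ys. F \<alpha>s bs (ro b # Ys)) Xs x"] by simp
qed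

lemma DelR_Dn2:
  assumes dom: "set \<beta>s \<subseteq> SA"
  shows "DelR (Dn2 F) \<alpha>s \<beta>s Xs x = Dn2 (DelR F) \<alpha>s \<beta>s Xs x"
proof -
  have sg: "- ((-1) ^ length \<beta>s *\<^sub>R - ((-1) ^ length bs *\<^sub>R (y :: 'a))) = - y"
    if "Suc (length bs) = length \<beta>s" for bs :: "('m \<Rightarrow> 'a) list" and y
    unfolding that[symmetric] by simp
  have "DelR (Dn2 F) \<alpha>s \<beta>s Xs x = xsum \<beta>s (\<lambda>b bs. - xsum bs (\<lambda>c cs. F (c # \<alpha>s) cs (ro b # Xs) x))"
    unfolding DelR_def Dn2_def xsum_scaleR[of \<beta>s, symmetric] xsum_minus[of \<beta>s, symmetric]
    by (rule xsum_cong[OF dom]) (rule sg)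
  also have "\<dots> = xsum \<beta>s (\<lambda>b bs. - xsum bs (\<lambda>c cs. F (b # \<alpha>s) cs (ro c # Xs) x))"
    unfolding xsum_minus by (subst xsum_xsum_swap) (rule refl)
  also have "\<dots> = Dn2 (DelR F) \<alpha>s \<beta>s Xs x"
    unfolding DelR_def Dn2_def xsum_scaleR[of \<beta>s, symmetric] xsum_minus[of \<beta>s, symmetric]
    by (rule xsum_cong[OF dom]) (rule sg[symmetric])
  finally show ?thesis .
qed

text \<open>
  The exterior covariant derivative and the contraction along \<open>ro b\<close> combine to a Lie derivative that uses the
  connection, \<open>Dn2\<close> contributes the Lie derivative that uses the action of \<open>A\<close>, and \<open>C_ro_SK\<close> compares the two.  The
  brackets of pairs of symmetric arguments cancel by antisymmetry.
\<close>

lemma sum_lie_C: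
  assumes F: "tame F" and dom: "set \<alpha>s \<subseteq> SA" "set \<beta>s \<subseteq> SA" "set Xs \<subseteq> SX"
  shows "xsum \<beta>s (\<lambda>b bs. C (F \<alpha>s bs Xs) (ro b) x - asum Xs (\<lambda>X Ys. F \<alpha>s bs (vf_bracket (ro b) X # Ys) x))
    - xsum \<beta>s (\<lambda>b bs. lie b F \<alpha>s bs Xs x) = - Kv F \<alpha>s \<beta>s Xs x"
proof -
  have e: "C (F \<alpha>s bs Xs) (ro b) x - asum Xs (\<lambda>X Ys. F \<alpha>s bs (vf_bracket (ro b) X # Ys) x) - lie b F \<alpha>s bs Xs x =
      - br (v b) (F \<alpha>s bs Xs) x + xsum bs (\<lambda>c cs. F \<alpha>s (br b c # cs) Xs x)"
    if b: "b \<in> SA" "set bs \<subseteq> SA" for b bs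
  proof -
    have "dsum (vf_bracket (ro b)) Xs (\<lambda>Ys. F \<alpha>s bs Ys x) = asum Xs (\<lambda>X Ys. F \<alpha>s bs (vf_bracket (ro b) X # Ys) x)"
      by (rule altern_dsum[OF tame_altX[OF F dom(1) b(2)] dom(3) SX_bracket[OF ro_SX[OF b(1)]]])
    moreover have "dsum (br b) bs (\<lambda>cs. F \<alpha>s cs Xs x) = xsum bs (\<lambda>c cs. F \<alpha>s (br b c # cs) Xs x)"
      by (rule symm_dsum[OF tame_symB[OF F dom(1,3)] b(2) bracket_section[OF b(1)]])
    ultimately show ?thesis
      using C_ro_SK[OF b(1) tameD(1)[OF F dom(1) b(2) dom(3)], of x] by (simp add: lie_def algebra_simps)
  qed
  define T where "T = xsum \<beta>s (\<lambda>b bs. xsum bs (\<lambda>c cs. F \<alpha>s (br b c # cs) Xs x))"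
  have "T = xsum \<beta>s (\<lambda>b bs. xsum bs (\<lambda>c cs. F \<alpha>s (br c b # cs) Xs x))"
    unfolding T_def by (rule xsum_xsum_swap)
  also have "\<dots> = xsum \<beta>s (\<lambda>b bs. xsum bs (\<lambda>c cs. - F \<alpha>s (br b c # cs) Xs x))"
  proof (intro xsum_cong[OF dom(2)], rule xsum_cong, assumption)
    fix b bs c cs assume *: "b \<in> SA" "set bs \<subseteq> SA" "c \<in> SA" "set cs \<subseteq> SA"
    show "F \<alpha>s (br c b # cs) Xs x = - F \<alpha>s (br b c # cs) Xs x"
      unfolding bracket_skew[OF *(3,1)]
      by (rule fun_cong[OF linon_minus[OF tame_linonB[OF F dom(1) *(4) dom(3)] bracket_section[OF *(1,3)]]])
  qed
  also have "\<dots> = - T" unfolding T_def xsum_minus ..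
  finally have "2 *\<^sub>R T = 0" by (simp add: scaleR_2 eq_neg_iff_add_eq_0)
  then have T: "T = 0" by simp
  have "xsum \<beta>s (\<lambda>b bs. C (F \<alpha>s bs Xs) (ro b) x - asum Xs (\<lambda>X Ys. F \<alpha>s bs (vf_bracket (ro b) X # Ys) x) - lie b F \<alpha>s bs Xs x) =
      xsum \<beta>s (\<lambda>b bs. - br (v b) (F \<alpha>s bs Xs) x + xsum bs (\<lambda>c cs. F \<alpha>s (br b c # cs) Xs x))"
    by (rule xsum_cong[OF dom(2)]) (rule e)
  also have "\<dots> = - Kv F \<alpha>s \<beta>s Xs x + T" unfolding xsum_add xsum_minus Kv_def T_def ..
  finally show ?thesis unfolding T by (simp add: xsum_diff)
qed

text \<open>
  The commutator of the two differentials is the product of \<open>\<theta>\<close> with the adjoint action: \<open>Kc\<close> comes from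
  differentiating along the alternating sections, \<open>Kv\<close> from contracting with the symmetric ones.
\<close>

lemma Del_Dn:
  assumes F: "tame F" and dom: "set \<alpha>s \<subseteq> SA" "set \<beta>s \<subseteq> SA" "set Xs \<subseteq> SX"
  shows "Del (Dn F) \<alpha>s \<beta>s Xs x = Dn (Del F) \<alpha>s \<beta>s Xs x - (Kv F \<alpha>s \<beta>s Xs x + Kc F \<alpha>s \<beta>s Xs x)"
proof -
  note vF = tame_valued[OF F]
  note v1 = Dn1_SK[OF vF] and v2 = Dn2_SK[OF vF] and w1 = Del0_SK[OF vF] and w2 = DelR_SK[OF vF]
  have D0: "Del0 (Dn F) \<alpha>s \<beta>s Xs x = Del0 (Dn1 F) \<alpha>s \<beta>s Xs x + Del0 (Dn2 F) \<alpha>s \<beta>s Xs x"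
  proof -
    have "asum \<alpha>s (\<lambda>a as. lie a (Dn F) as \<beta>s Xs x) = asum \<alpha>s (\<lambda>a as. lie a (Dn1 F) as \<beta>s Xs x + lie a (Dn2 F) as \<beta>s Xs x)"
    proof (rule asum_cong[OF dom(1)])
      fix a as assume a: "a \<in> SA" "set as \<subseteq> SA"
      have "br a (Dn F as \<beta>s Xs) x = br a (Dn1 F as \<beta>s Xs) x + br a (Dn2 F as \<beta>s Xs) x"
        unfolding Dn_def using fun_cong[OF linon_add[OF linon_bracket_SK[OF a(1)] v1[OF a(2) dom(2,3)] v2[OF a(2) dom(2,3)]], of x] .
      then show "lie a (Dn F) as \<beta>s Xs x = lie a (Dn1 F) as \<beta>s Xs x + lie a (Dn2 F) as \<beta>s Xs x"
        unfolding lie_def by (simp add: Dn_def dsum_add)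
    qed
    then show ?thesis unfolding Del0_def by (simp add: Dn_def asum_add bsum_add algebra_simps)
  qed
  have DR: "DelR (Dn F) \<alpha>s \<beta>s Xs x = DelR (Dn1 F) \<alpha>s \<beta>s Xs x + DelR (Dn2 F) \<alpha>s \<beta>s Xs x"
    unfolding DelR_def by (simp add: Dn_def xsum_add algebra_simps)
  have E1: "Dn1 (Del F) \<alpha>s \<beta>s Xs x = Dn1 (Del0 F) \<alpha>s \<beta>s Xs x + Dn1 (DelR F) \<alpha>s \<beta>s Xs x"
    using ext_add[of "Del0 F \<alpha>s \<beta>s" "DelR F \<alpha>s \<beta>s" Xs 1 1 x, OF w1[OF dom(1,2)] w2[OF dom(1,2)] dom(3)]
    unfolding Dn1_def Del_def by (simp add: scaleR_add_right)
  have E2: "Dn2 (Del F) \<alpha>s \<beta>s Xs x = Dn2 (Del0 F) \<alpha>s \<beta>s Xs x + Dn2 (DelR F) \<alpha>s \<beta>s Xs x"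
    unfolding Dn2_def by (simp add: Del_def xsum_add algebra_simps)
  show ?thesis
    unfolding Del_def[of "Dn F"] Dn_def[of "Del F"] D0 DR E1 E2 Del0_Dn1[OF F dom] Del0_Dn2[OF F dom]
      DelR_Dn1[OF F dom] DelR_Dn2[OF dom(2)]
    using sum_lie_C[OF F dom, of x] by (simp add: algebra_simps)
qed

section \<open>Symmetry, tensoriality and the Leibniz rule\<close>

text \<open>
  Properties shared by a tame function and its simplicial differential, sufficient for evaluating
  the permutation sums in the horizontal projection of \<open>Dn (Del F)\<close>.
\<close>

definition skew :: "('m, 'a) cfun \<Rightarrow> bool" where
  "skew F \<longleftrightarrow> valued F \<and>
     (\<forall>\<alpha>s Xs x. set \<alpha>s \<subseteq> SA \<longrightarrow> set Xs \<subseteq> SX \<longrightarrow> symm SA (\<lambda>\<beta>s. F \<alpha>s \<beta>s Xs x)) \<and>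
     (\<forall>\<alpha>s \<beta>s x. set \<alpha>s \<subseteq> SA \<longrightarrow> set \<beta>s \<subseteq> SA \<longrightarrow> altern SX (\<lambda>Xs. F \<alpha>s \<beta>s Xs x)) \<and>
     (\<forall>\<alpha>s \<beta>s Xs X x. set \<alpha>s \<subseteq> SA \<longrightarrow> set \<beta>s \<subseteq> SA \<longrightarrow> set Xs \<subseteq> SX \<longrightarrow> X \<in> SX \<longrightarrow>
        F \<alpha>s \<beta>s ((\<lambda>x \<phi>. - X x \<phi>) # Xs) x = - F \<alpha>s \<beta>s (X # Xs) x)"

lemma skew_valued: "skew F \<Longrightarrow> valued F"
  by (simp add: skew_def)

lemma skew_symB: "skew F \<Longrightarrow> set \<alpha>s \<subseteq> SA \<Longrightarrow> set Xs \<subseteq> SX \<Longrightarrow> symm SA (\<lambda>\<beta>s. F \<alpha>s \<beta>s Xs x)"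
  by (simp add: skew_def)

lemma skew_altX: "skew F \<Longrightarrow> set \<alpha>s \<subseteq> SA \<Longrightarrow> set \<beta>s \<subseteq> SA \<Longrightarrow> altern SX (\<lambda>Xs. F \<alpha>s \<beta>s Xs x)"
  by (simp add: skew_def)

lemma skew_minusX: "skew F \<Longrightarrow> set \<alpha>s \<subseteq> SA \<Longrightarrow> set \<beta>s \<subseteq> SA \<Longrightarrow> set Xs \<subseteq> SX \<Longrightarrow> X \<in> SX \<Longrightarrow>
        F \<alpha>s \<beta>s ((\<lambda>x \<phi>. - X x \<phi>) # Xs) x = - F \<alpha>s \<beta>s (X # Xs) x"
  unfolding skew_def by blast

lemma tame_skew: "tame F \<Longrightarrow> skew F"
  by (simp add: skew_def tame_valued tame_symB tame_altX tame_minusX)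

context
  fixes F :: "('m, 'a) cfun"
  assumes F: "skew F"
begin

lemma lie_symB:
  assumes dom: "a \<in> SA" "set \<alpha>s \<subseteq> SA" "set Xs \<subseteq> SX"
  shows "symm SA (\<lambda>\<beta>s. lie a F \<alpha>s \<beta>s Xs x)"
  unfolding lie_def
proof (rule symm_diff, rule symm_diff)
  show "symm SA (\<lambda>\<beta>s. br a (F \<alpha>s \<beta>s Xs) x)"
    by (rule symm_fun) (rule skew_symB[OF F dom(2,3)])
  show "symm SA (\<lambda>\<beta>s. dsum (br a) \<beta>s (\<lambda>bs. F \<alpha>s bs Xs x))"
    by (rule symm_dsum_self[OF skew_symB[OF F dom(2,3)] bracket_section[OF dom(1)]])
  show "symm SA (\<lambda>\<beta>s. dsum (vf_bracket (ro a)) Xs (\<lambda>Ys. F \<alpha>s \<beta>s Ys x))"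
    by (rule symm_dsum_param[OF dom(3) SX_bracket[OF ro_SX[OF dom(1)]]], assumption) (rule skew_symB[OF F dom(2)])
qed

lemma lie_altX:
  assumes dom: "a \<in> SA" "set \<alpha>s \<subseteq> SA" "set \<beta>s \<subseteq> SA"
  shows "altern SX (\<lambda>Xs. lie a F \<alpha>s \<beta>s Xs x)"
  unfolding lie_def
proof (rule altern_diff, rule altern_diff)
  show "altern SX (\<lambda>Xs. br a (F \<alpha>s \<beta>s Xs) x)"
    by (rule altern_lin[OF linon_bracket_SK[OF dom(1)] skew_altX[OF F dom(2,3)] valuedD[OF skew_valued[OF F] dom(2,3)]])
  show "altern SX (\<lambda>Xs. dsum (br a) \<beta>s (\<lambda>bs. F \<alpha>s bs Xs x))"
    by (rule altern_dsum_param[OF dom(3) bracket_section[OF dom(1)]], assumption) (rule skew_altX[OF F dom(2)])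
  show "altern SX (\<lambda>Xs. dsum (vf_bracket (ro a)) Xs (\<lambda>Ys. F \<alpha>s \<beta>s Ys x))"
    by (rule altern_dsum_self[OF skew_altX[OF F dom(2,3)] SX_bracket[OF ro_SX[OF dom(1)]]])
qed

lemma lie_minusX:
  assumes dom: "a \<in> SA" "set \<alpha>s \<subseteq> SA" "set \<beta>s \<subseteq> SA" "set Xs \<subseteq> SX" "X \<in> SX"
  shows "lie a F \<alpha>s \<beta>s ((\<lambda>x \<phi>. - X x \<phi>) # Xs) x = - lie a F \<alpha>s \<beta>s (X # Xs) x"
proof -
  let ?D = "vf_bracket (ro a)"
  have DX: "?D X \<in> SX" by (rule SX_bracket[OF ro_SX[OF dom(1)] dom(5)])
  have neg: "?D (\<lambda>x \<phi>. - X x \<phi>) = (\<lambda>x \<phi>. - ?D X x \<phi>)"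
  proof (intro HOL.ext)
    fix x \<phi>
    have "(\<lambda>x \<phi>. - X x \<phi>) \<in> SX" using SX_lin[OF dom(5) SX_zero Cf_const[of "-1"] Cf_const[of 0]] by simp
    note off = SX_off[OF SX_bracket[OF ro_SX[OF dom(1)] this], of \<phi> x] SX_off[OF DX, of \<phi> x]
    show "?D (\<lambda>x \<phi>. - X x \<phi>) x \<phi> = - ?D X x \<phi>"
    proof (cases "\<phi> \<in> Cinf L")
      case True
      have "ro a x (\<lambda>y. - X y \<phi>) = - ro a x (\<lambda>y. X y \<phi>)"
        using SX_lin_fun[OF ro_SX[OF dom(1)] SX_Cf[OF dom(5) True] Cf_const[of 0], of x "-1" 0] by simp
      then show ?thesis by (simp add: vf_bracket_def)
    qed (simp add: off)
  qed
  have val: "F \<alpha>s \<beta>s (X # Xs) \<in> SK" by (rule valuedD[OF skew_valued[OF F]]) (use dom in auto)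
  have 0: "F \<alpha>s \<beta>s ((\<lambda>x \<phi>. - X x \<phi>) # Xs) = (\<lambda>x. - F \<alpha>s \<beta>s (X # Xs) x)"
    by (rule HOL.ext) (rule skew_minusX[OF F dom(2-5)])
  have 1: "dsum (br a) \<beta>s (\<lambda>bs. F \<alpha>s bs ((\<lambda>x \<phi>. - X x \<phi>) # Xs) x) = - dsum (br a) \<beta>s (\<lambda>bs. F \<alpha>s bs (X # Xs) x)"
    unfolding dsum_minus[symmetric]
    by (rule dsum_cong[OF dom(3) bracket_section[OF dom(1)]], assumption) (rule skew_minusX[OF F dom(2) _ dom(4,5)])
  have 2: "dsum ?D Xs (\<lambda>Ys. F \<alpha>s \<beta>s ((\<lambda>x \<phi>. - X x \<phi>) # Ys) x) = - dsum ?D Xs (\<lambda>Ys. F \<alpha>s \<beta>s (X # Ys) x)"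
    unfolding dsum_minus[symmetric]
    by (rule dsum_cong[OF dom(4) SX_bracket[OF ro_SX[OF dom(1)]]], assumption) (rule skew_minusX[OF F dom(2,3) _ dom(5)])
  show ?thesis
    unfolding lie_def dsum.simps 0 1 2 neg skew_minusX[OF F dom(2-4) DX]
    using linon_minus[OF linon_bracket_SK[OF dom(1)] val] by simp
qed

lemma Del_symB:
  assumes dom: "set \<alpha>s \<subseteq> SA" "set Xs \<subseteq> SX"
  shows "symm SA (\<lambda>\<beta>s. Del F \<alpha>s \<beta>s Xs x)"
proof -
  have 1: "symm SA (\<lambda>\<beta>s. asum \<alpha>s (\<lambda>a as. lie a F as \<beta>s Xs x))"
    by (rule symm_asum_param[OF dom(1)]) (rule lie_symB[OF _ _ dom(2)])
  have 2: "symm SA (\<lambda>\<beta>s. bsum \<alpha>s (\<lambda>a b cs. F (br a b # cs) \<beta>s Xs x))"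
    by (rule symm_bsum_param[OF dom(1)]) (rule skew_symB[OF F _ dom(2)], simp add: bracket_section)
  have 3: "symm SA (\<lambda>\<beta>s. xsum \<beta>s (\<lambda>b bs. F \<alpha>s bs (ro b # Xs) x))"
    by (rule symm_xsum) (rule skew_symB[OF F dom(1)], simp add: ro_SX dom)
  show ?thesis unfolding Del_def Del0_def DelR_def
    by (rule symm_add[OF symm_sign[OF symm_add[OF 1 2]] symm_minus[OF symm_sign[OF 3]]])
qed

lemma Del_altX:
  assumes dom: "set \<alpha>s \<subseteq> SA" "set \<beta>s \<subseteq> SA"
  shows "altern SX (\<lambda>Xs. Del F \<alpha>s \<beta>s Xs x)"
proof -
  have 1: "altern SX (\<lambda>Xs. asum \<alpha>s (\<lambda>a as. lie a F as \<beta>s Xs x))"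
    by (rule altern_asum_param[OF dom(1)]) (rule lie_altX[OF _ _ dom(2)])
  have 2: "altern SX (\<lambda>Xs. bsum \<alpha>s (\<lambda>a b cs. F (br a b # cs) \<beta>s Xs x))"
    by (rule altern_bsum_param[OF dom(1)]) (rule skew_altX[OF F _ dom(2)], simp add: bracket_section)
  have 3: "altern SX (\<lambda>Xs. xsum \<beta>s (\<lambda>b bs. F \<alpha>s bs (ro b # Xs) x))"
    by (rule altern_xsum_param[OF dom(2)]) (rule altern_Cons[OF skew_altX[OF F dom(1)] ro_SX])
  show ?thesis unfolding Del_def Del0_def DelR_def
    by (rule altern_add[OF altern_scaleR[OF altern_add[OF 1 2]] altern_minus[OF altern_scaleR[OF 3]]])
qed

lemma Del_minusX:
  assumes dom: "set \<alpha>s \<subseteq> SA" "set \<beta>s \<subseteq> SA" "set Xs \<subseteq> SX" "X \<in> SX"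
  shows "Del F \<alpha>s \<beta>s ((\<lambda>x \<phi>. - X x \<phi>) # Xs) x = - Del F \<alpha>s \<beta>s (X # Xs) x"
proof -
  have nX: "(\<lambda>x \<phi>. - X x \<phi>) \<in> SX" using SX_lin[OF dom(4) SX_zero Cf_const[of "-1"] Cf_const[of 0]] by simp
  have 1: "asum \<alpha>s (\<lambda>a as. lie a F as \<beta>s ((\<lambda>x \<phi>. - X x \<phi>) # Xs) x) = - asum \<alpha>s (\<lambda>a as. lie a F as \<beta>s (X # Xs) x)"
    unfolding asum_minus[symmetric] by (rule asum_cong[OF dom(1)]) (rule lie_minusX[OF _ _ dom(2-4)])
  have 2: "bsum \<alpha>s (\<lambda>a b cs. F (br a b # cs) \<beta>s ((\<lambda>x \<phi>. - X x \<phi>) # Xs) x) = - bsum \<alpha>s (\<lambda>a b cs. F (br a b # cs) \<beta>s (X # Xs) x)"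
    unfolding bsum_minus[symmetric]
    by (rule bsum_cong[OF dom(1)], rule skew_minusX[OF F _ dom(2-4)]) (simp add: bracket_section)
  have 3: "xsum \<beta>s (\<lambda>b bs. F \<alpha>s bs (ro b # (\<lambda>x \<phi>. - X x \<phi>) # Xs) x) = - xsum \<beta>s (\<lambda>b bs. F \<alpha>s bs (ro b # X # Xs) x)"
    unfolding xsum_minus[symmetric]
  proof (rule xsum_cong[OF dom(2)])
    fix b bs assume b: "b \<in> SA" "set bs \<subseteq> SA"
    have r: "set (ro b # Xs) \<subseteq> SX" using dom b by (simp add: ro_SX)
    show "F \<alpha>s bs (ro b # (\<lambda>x \<phi>. - X x \<phi>) # Xs) x = - F \<alpha>s bs (ro b # X # Xs) x"
      using altern_swap_head[OF skew_altX[OF F dom(1) b(2), of x] ro_SX[OF b(1)] nX dom(3)]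
        altern_swap_head[OF skew_altX[OF F dom(1) b(2), of x] ro_SX[OF b(1)] dom(4) dom(3)]
        skew_minusX[OF F dom(1) b(2) r dom(4), of x] by simp
  qed
  show ?thesis unfolding Del_def Del0_def DelR_def 1 2 3 by (simp add: algebra_simps)
qed

lemma Dn_symB:
  assumes dom: "set \<alpha>s \<subseteq> SA" "set Xs \<subseteq> SX"
  shows "symm SA (\<lambda>\<beta>s. Dn F \<alpha>s \<beta>s Xs x)"
proof -
  have 1: "symm SA (\<lambda>\<beta>s. ext (F \<alpha>s \<beta>s) Xs x)"
    unfolding ext_def
  proof (rule symm_add)
    show "symm SA (\<lambda>\<beta>s. asum Xs (\<lambda>X Ys. C (F \<alpha>s \<beta>s Ys) X x))"
      by (rule symm_asum_param[OF dom(2)]) (rule symm_fun[where T = "\<lambda>\<xi>. C \<xi> X" for X], rule skew_symB[OF F dom(1)])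
    show "symm SA (\<lambda>\<beta>s. bsum Xs (\<lambda>X Y Ys. F \<alpha>s \<beta>s (vf_bracket X Y # Ys) x))"
      by (rule symm_bsum_param[OF dom(2)]) (rule skew_symB[OF F dom(1)], simp add: SX_bracket)
  qed
  have 2: "symm SA (\<lambda>\<beta>s. xsum \<beta>s (\<lambda>b bs. F (b # \<alpha>s) bs Xs x))"
    by (rule symm_xsum) (rule skew_symB[OF F _ dom(2)], simp add: dom)
  show ?thesis unfolding Dn_def Dn1_def Dn2_def
    by (rule symm_add[OF symm_sign[OF 1] symm_minus[OF symm_sign[OF 2]]])
qed

lemma Dn_altX:
  assumes dom: "set \<alpha>s \<subseteq> SA" "set \<beta>s \<subseteq> SA"
  shows "altern SX (\<lambda>Xs. Dn F \<alpha>s \<beta>s Xs x)"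
proof -
  have 1: "altern SX (\<lambda>Xs. ext (F \<alpha>s \<beta>s) Xs x)"
    unfolding ext_def
  proof (rule altern_add)
    show "altern SX (\<lambda>Xs. asum Xs (\<lambda>X Ys. C (F \<alpha>s \<beta>s Ys) X x))"
      by (rule altern_asum)
        (rule altern_lin[where T = "\<lambda>\<xi>. C \<xi> X" for X, OF linon_C_SK skew_altX[OF F dom] valuedD[OF skew_valued[OF F] dom]])
    show "altern SX (\<lambda>Xs. bsum Xs (\<lambda>X Y Ys. F \<alpha>s \<beta>s (vf_bracket X Y # Ys) x))"
    proof (rule altern_bsum)
      fix X Y Ys assume X: "X \<in> SX" "Y \<in> SX"
      show "altern SX (\<lambda>Ys. F \<alpha>s \<beta>s (vf_bracket X Y # Ys) x)"
        by (rule altern_Cons[OF skew_altX[OF F dom] SX_bracket[OF X]])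
      assume Y: "set Ys \<subseteq> SX"
      show "F \<alpha>s \<beta>s (vf_bracket X Y # Ys) x = - F \<alpha>s \<beta>s (vf_bracket Y X # Ys) x"
        unfolding vf_bracket_skew[of X Y] by (rule skew_minusX[OF F dom Y SX_bracket[OF X(2,1)]])
    qed
  qed
  have 2: "altern SX (\<lambda>Xs. xsum \<beta>s (\<lambda>b bs. F (b # \<alpha>s) bs Xs x))"
    by (rule altern_xsum_param[OF dom(2)]) (rule skew_altX[OF F], simp_all add: dom)
  show ?thesis unfolding Dn_def Dn1_def Dn2_def
    by (rule altern_add[OF altern_scaleR[OF 1] altern_minus[OF altern_scaleR[OF 2]]])
qed

lemma Dn_altA:
  assumes T: "tame F" and dom: "set \<beta>s \<subseteq> SA" "set Xs \<subseteq> SX"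
  shows "altern SA (\<lambda>\<alpha>s. Dn F \<alpha>s \<beta>s Xs x)"
proof -
  have 1: "altern SA (\<lambda>\<alpha>s. ext (F \<alpha>s \<beta>s) Xs x)"
    unfolding ext_def
  proof (rule altern_add)
    show "altern SA (\<lambda>\<alpha>s. asum Xs (\<lambda>X Ys. C (F \<alpha>s \<beta>s Ys) X x))"
      by (rule altern_asum_param[OF dom(2)])
        (rule altern_lin[where T = "\<lambda>\<xi>. C \<xi> X" for X, OF linon_C_SK tame_altA[OF T dom(1)] valuedD[OF skew_valued[OF F] _ dom(1)]])
    show "altern SA (\<lambda>\<alpha>s. bsum Xs (\<lambda>X Y Ys. F \<alpha>s \<beta>s (vf_bracket X Y # Ys) x))"
      by (rule altern_bsum_param[OF dom(2)]) (rule tame_altA[OF T dom(1)], simp add: SX_bracket)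
  qed
  have 2: "altern SA (\<lambda>\<alpha>s. xsum \<beta>s (\<lambda>b bs. F (b # \<alpha>s) bs Xs x))"
    by (rule altern_xsum_param[OF dom(1)]) (rule altern_Cons[OF tame_altA[OF T _ dom(2)]])
  show ?thesis unfolding Dn_def Dn1_def Dn2_def
    by (rule altern_add[OF altern_scaleR[OF 1] altern_minus[OF altern_scaleR[OF 2]]])
qed

end

lemma skew_Del:
  assumes F: "tame F"
  shows "skew (Del F)"
proof -
  note S = tame_skew[OF F]
  have v: "Del F \<alpha>s \<beta>s Xs \<in> SK" if "set \<alpha>s \<subseteq> SA" "set \<beta>s \<subseteq> SA" "set Xs \<subseteq> SX" for \<alpha>s \<beta>s Xs
    unfolding Del_def
    by (rule subsp_add[OF subsp_SK Del0_SK[OF tame_valued[OF F] that] DelR_SK[OF tame_valued[OF F] that]])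
  show ?thesis
    unfolding skew_def valued_def
    by (intro conjI allI impI v Del_symB[OF S] Del_altX[OF S] Del_minusX[OF S])
qed

text \<open>
  The Leibniz rule of Weil cochains; the last sum is the wedge product with \<open>df\<close>.
\<close>

definition leib :: "('m, 'a) cfun \<Rightarrow> bool" where
  "leib F \<longleftrightarrow> (\<forall>\<alpha> \<alpha>s \<beta>s Xs f x. \<alpha> \<in> SA \<longrightarrow> set \<alpha>s \<subseteq> SA \<longrightarrow> set \<beta>s \<subseteq> SA \<longrightarrow> set Xs \<subseteq> SX \<longrightarrow> f \<in> Cinf L \<longrightarrow>
     F ((\<lambda>x. f x *\<^sub>R \<alpha> x) # \<alpha>s) \<beta>s Xs x =
       f x *\<^sub>R F (\<alpha> # \<alpha>s) \<beta>s Xs x + asum Xs (\<lambda>X Ys. X x f *\<^sub>R F \<alpha>s (\<alpha> # \<beta>s) Ys x))"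

lemma leibD: "leib F \<Longrightarrow> \<alpha> \<in> SA \<Longrightarrow> set \<alpha>s \<subseteq> SA \<Longrightarrow> set \<beta>s \<subseteq> SA \<Longrightarrow> set Xs \<subseteq> SX \<Longrightarrow> f \<in> Cinf L \<Longrightarrow>
     F ((\<lambda>x. f x *\<^sub>R \<alpha> x) # \<alpha>s) \<beta>s Xs x =
       f x *\<^sub>R F (\<alpha> # \<alpha>s) \<beta>s Xs x + asum Xs (\<lambda>X Ys. X x f *\<^sub>R F \<alpha>s (\<alpha> # \<beta>s) Ys x)"
  unfolding leib_def by blast

lemma C_scale_SK:
  assumes "\<xi> \<in> SK" "X \<in> SX" "f \<in> Cinf L"
  shows "C (\<lambda>x. f x *\<^sub>R \<xi> x) X x = f x *\<^sub>R C \<xi> X x + X x f *\<^sub>R \<xi> x"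
  using C_leibniz[OF SK_SA[OF assms(1)] assms(2,3)] v_SK[OF assms(1)] by simp

lemma ext_scale:
  assumes v: "\<And>Ys. set Ys \<subseteq> SX \<Longrightarrow> \<omega> Ys \<in> SK" and dom: "set Xs \<subseteq> SX" "f \<in> Cinf L"
  shows "ext (\<lambda>Ys x. f x *\<^sub>R \<omega> Ys x) Xs x = f x *\<^sub>R ext \<omega> Xs x + asum Xs (\<lambda>X Ys. X x f *\<^sub>R \<omega> Ys x)"
proof -
  have "asum Xs (\<lambda>X Ys. C (\<lambda>x. f x *\<^sub>R \<omega> Ys x) X x) = asum Xs (\<lambda>X Ys. f x *\<^sub>R C (\<omega> Ys) X x + X x f *\<^sub>R \<omega> Ys x)"
    by (rule asum_cong[OF dom(1)]) (rule C_scale_SK[OF v _ dom(2)])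
  then show ?thesis unfolding ext_def by (simp add: asum_add asum_scaleR bsum_scaleR algebra_simps)
qed

text \<open>
  The exterior covariant derivative anticommutes with \<open>df \<and>\<close>, as second derivatives of \<open>f\<close> cancel against derivatives
  along brackets.
\<close>

lemma ext_dwedge:
  assumes v: "\<And>Ys. set Ys \<subseteq> SX \<Longrightarrow> \<omega> Ys \<in> SK" and dom: "set Xs \<subseteq> SX" "f \<in> Cinf L"
  shows "ext (\<lambda>Ys x. asum Ys (\<lambda>Y Zs. Y x f *\<^sub>R \<omega> Zs x)) Xs x = - asum Xs (\<lambda>Y Ys. Y x f *\<^sub>R ext \<omega> Ys x)"
proof -
  have sv: "(\<lambda>x. Y x f *\<^sub>R \<omega> Zs x) \<in> SK" if "Y \<in> SX" "set Zs \<subseteq> SX" for Y Zs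
    by (rule SK_scale[OF v[OF that(2)] SX_Cf[OF that(1) dom(2)]])
  define P where "P X Y Zs = X x (\<lambda>y. Y y f) *\<^sub>R \<omega> Zs x" for X Y :: "'m vfield" and Zs
  define Q where "Q X Y Zs = Y x f *\<^sub>R C (\<omega> Zs) X x" for X Y :: "'m vfield" and Zs
  have 1: "asum Xs (\<lambda>X Ys. C (\<lambda>x. asum Ys (\<lambda>Y Zs. Y x f *\<^sub>R \<omega> Zs x)) X x) =
      asum Xs (\<lambda>X Ys. asum Ys (\<lambda>Y Zs. Q X Y Zs + P X Y Zs))"
  proof (rule asum_cong[OF dom(1)])
    fix X Ys assume X: "X \<in> SX" "set Ys \<subseteq> SX"
    have "C (\<lambda>x. asum Ys (\<lambda>Y Zs. Y x f *\<^sub>R \<omega> Zs x)) X x = asum Ys (\<lambda>Y Zs. C (\<lambda>x. Y x f *\<^sub>R \<omega> Zs x) X x)"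
      by (rule linon_asum[OF linon_C_SK subsp_SK X(2)]) (rule sv)
    also have "\<dots> = asum Ys (\<lambda>Y Zs. Q X Y Zs + P X Y Zs)"
      unfolding P_def Q_def by (rule asum_cong[OF X(2)]) (rule C_scale_SK[OF v X(1) SX_Cf[OF _ dom(2)]])
    finally show "C (\<lambda>x. asum Ys (\<lambda>Y Zs. Y x f *\<^sub>R \<omega> Zs x)) X x = asum Ys (\<lambda>Y Zs. Q X Y Zs + P X Y Zs)" .
  qed
  have 2: "bsum Xs (\<lambda>X Y Ys. asum (vf_bracket X Y # Ys) (\<lambda>Y Zs. Y x f *\<^sub>R \<omega> Zs x)) =
      bsum Xs (\<lambda>X Y Ys. P X Y Ys - P Y X Ys) - asum Xs (\<lambda>Z Zs. Z x f *\<^sub>R bsum Zs (\<lambda>X Y Ys. \<omega> (vf_bracket X Y # Ys) x))"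
    unfolding P_def asum.simps bsum_diff bsum_scaleR[symmetric] bsum_asum_swap[symmetric]
    by (simp add: vf_bracket_def scaleR_diff_left bsum_diff)
  show ?thesis
    unfolding ext_def 1 2 bsum_antisym asum_add asum_asum_swap[of Xs Q] scaleR_add_right
    by (simp add: Q_def[abs_def] asum_scaleR)
qed

text \<open>
  Differentiating \<open>f F(\<alpha>, \<dots>)\<close> yields the additional term \<open>df \<and> F(\<alpha>, \<dots>)\<close>.  It is what the second
  part of \<open>Dn F\<close> contributes to the right hand side when it turns the symmetric argument \<open>\<alpha>\<close> back into an
  alternating one.
\<close>

lemma leib_Dn:
  assumes F: "tame F" and l: "leib F"
  shows "leib (Dn F)"
  unfolding leib_def
proof (intro allI impI)
  fix \<alpha> \<alpha>s \<beta>s Xs f x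
  assume dom: "\<alpha> \<in> SA" "set \<alpha>s \<subseteq> SA" "set \<beta>s \<subseteq> SA" "set Xs \<subseteq> SX" "f \<in> Cinf L"
  let ?s = "(-1 :: real) ^ length \<beta>s"
  let ?f\<alpha> = "\<lambda>x. f x *\<^sub>R \<alpha> x"
  define \<omega> where "\<omega> = F (\<alpha> # \<alpha>s) \<beta>s"
  define \<eta> where "\<eta> = F \<alpha>s (\<alpha> # \<beta>s)"
  have v\<omega>: "\<omega> Ys \<in> SK" if "set Ys \<subseteq> SX" for Ys
    unfolding \<omega>_def by (rule tameD(1)[OF F _ dom(3) that]) (simp add: dom)
  have v\<eta>: "\<eta> Ys \<in> SK" if "set Ys \<subseteq> SX" for Ys
    unfolding \<eta>_def by (rule tameD(1)[OF F dom(2) _ that]) (simp add: dom)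
  have vd: "(\<lambda>x. asum Ys (\<lambda>X Zs. X x f *\<^sub>R \<eta> Zs x)) \<in> SK" if "set Ys \<subseteq> SX" for Ys
    by (rule subsp_asum[OF subsp_SK that]) (rule SK_scale[OF v\<eta> SX_Cf[OF _ dom(5)]])
  have f\<alpha>: "?f\<alpha> \<in> SA" by (rule SA_scale[OF dom(1,5)])
  have 1: "ext (F (?f\<alpha> # \<alpha>s) \<beta>s) Xs x = f x *\<^sub>R ext \<omega> Xs x + asum Xs (\<lambda>X Ys. X x f *\<^sub>R \<omega> Ys x)
      - asum Xs (\<lambda>Y Ys. Y x f *\<^sub>R ext \<eta> Ys x)"
  proof -
    have e: "F (?f\<alpha> # \<alpha>s) \<beta>s Ys = (\<lambda>x. 1 *\<^sub>R (f x *\<^sub>R \<omega> Ys x) + 1 *\<^sub>R asum Ys (\<lambda>X Zs. X x f *\<^sub>R \<eta> Zs x))"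
      if "set Ys \<subseteq> SX" for Ys
      unfolding \<omega>_def \<eta>_def by (rule HOL.ext) (simp add: leibD[OF l dom(1-3) that dom(5)])
    have "ext (F (?f\<alpha> # \<alpha>s) \<beta>s) Xs x = ext (\<lambda>Ys x. 1 *\<^sub>R (f x *\<^sub>R \<omega> Ys x) + 1 *\<^sub>R asum Ys (\<lambda>X Zs. X x f *\<^sub>R \<eta> Zs x)) Xs x"
      by (rule ext_cong[OF _ dom(4)]) (rule e)
    also have "\<dots> = 1 *\<^sub>R ext (\<lambda>Ys x. f x *\<^sub>R \<omega> Ys x) Xs x + 1 *\<^sub>R ext (\<lambda>Ys x. asum Ys (\<lambda>X Zs. X x f *\<^sub>R \<eta> Zs x)) Xs x"
      by (rule ext_add[OF SK_scale[OF v\<omega> dom(5)] vd dom(4)])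
    finally show ?thesis by (simp add: ext_scale[OF v\<omega> dom(4,5)] ext_dwedge[OF v\<eta> dom(4,5)])
  qed
  have sw: "F (b # a # \<alpha>s) bs Ys x = - F (a # b # \<alpha>s) bs Ys x"
    if "a \<in> SA" "b \<in> SA" "set bs \<subseteq> SA" "set Ys \<subseteq> SX" for a b bs Ys
    by (rule altern_swap_head[OF tame_altA[OF F that(3,4)] that(2,1) dom(2)])
  have 2: "xsum \<beta>s (\<lambda>b bs. F (b # ?f\<alpha> # \<alpha>s) bs Xs x) = f x *\<^sub>R xsum \<beta>s (\<lambda>b bs. F (b # \<alpha> # \<alpha>s) bs Xs x)
      - asum Xs (\<lambda>X Ys. X x f *\<^sub>R xsum \<beta>s (\<lambda>b bs. F (b # \<alpha>s) (\<alpha> # bs) Ys x))"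
  proof -
    have "xsum \<beta>s (\<lambda>b bs. F (b # ?f\<alpha> # \<alpha>s) bs Xs x) =
        xsum \<beta>s (\<lambda>b bs. f x *\<^sub>R F (b # \<alpha> # \<alpha>s) bs Xs x - asum Xs (\<lambda>X Ys. X x f *\<^sub>R F (b # \<alpha>s) (\<alpha> # bs) Ys x))"
    proof (rule xsum_cong[OF dom(3)])
      fix b bs assume b: "b \<in> SA" "set bs \<subseteq> SA"
      have "set (b # \<alpha>s) \<subseteq> SA" using b dom by simp
      from leibD[OF l dom(1) this b(2) dom(4,5), of x]
      show "F (b # ?f\<alpha> # \<alpha>s) bs Xs x = f x *\<^sub>R F (b # \<alpha> # \<alpha>s) bs Xs x - asum Xs (\<lambda>X Ys. X x f *\<^sub>R F (b # \<alpha>s) (\<alpha> # bs) Ys x)"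
        using sw[OF f\<alpha> b dom(4)] sw[OF dom(1) b dom(4)] by simp
    qed
    then show ?thesis unfolding xsum_diff xsum_scaleR asum_xsum_fubini[symmetric] by simp
  qed
  have 3: "asum Xs (\<lambda>X Ys. X x f *\<^sub>R Dn F \<alpha>s (\<alpha> # \<beta>s) Ys x) =
      ?s *\<^sub>R (asum Xs (\<lambda>X Ys. X x f *\<^sub>R \<omega> Ys x) + asum Xs (\<lambda>X Ys. X x f *\<^sub>R xsum \<beta>s (\<lambda>b bs. F (b # \<alpha>s) (\<alpha> # bs) Ys x))
        - asum Xs (\<lambda>X Ys. X x f *\<^sub>R ext \<eta> Ys x))"
    unfolding asum_add[symmetric] asum_diff[symmetric] asum_scaleR[symmetric] \<omega>_def \<eta>_def
    by (rule asum_cong[OF dom(4)]) (simp add: Dn_def Dn1_def Dn2_def algebra_simps)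
  show "Dn F (?f\<alpha> # \<alpha>s) \<beta>s Xs x = f x *\<^sub>R Dn F (\<alpha> # \<alpha>s) \<beta>s Xs x + asum Xs (\<lambda>X Ys. X x f *\<^sub>R Dn F \<alpha>s (\<alpha> # \<beta>s) Ys x)"
    unfolding 3 unfolding Dn_def Dn1_def Dn2_def 1 2 \<omega>_def[symmetric] by (simp add: algebra_simps)
qed

text \<open>
  Linearity over smooth functions in the symmetric arguments depends on \<open>leib F\<close>: the derivatives of
  the coefficients in the exterior covariant derivative cancel against those in the second part of \<open>Dn F\<close>.
\<close>

lemma tame_Dn:
  assumes F: "tame F" and l: "leib F"
  shows "tame (Dn F)"
proof (rule tameI, goal_cases)
  case (1 \<alpha>s \<beta>s Xs)
  show ?case unfolding Dn_def
    by (rule subsp_add[OF subsp_SK Dn1_SK[OF tame_valued[OF F] 1] Dn2_SK[OF tame_valued[OF F] 1]])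
next
  case (2 \<alpha>s Xs x)
  show ?case by (rule Dn_symB[OF tame_skew[OF F] 2])
next
  case (3 \<alpha>s \<beta>s x)
  show ?case by (rule Dn_altX[OF tame_skew[OF F] 3])
next
  case (4 \<beta>s Xs x)
  show ?case by (rule Dn_altA[OF tame_skew[OF F] F 4])
next
  case (5 \<alpha>s \<beta>s Xs \<beta> \<beta>' f g x)
  let ?Z = "\<lambda>x. f x *\<^sub>R \<beta> x + g x *\<^sub>R \<beta>' x"
  have v: "F \<alpha>s (b # \<beta>s) Ys \<in> SK" if "b \<in> SA" "set Ys \<subseteq> SX" for b Ys
    by (rule tameD(1)[OF F 5(1) _ that(2)]) (simp add: 5 that)
  have e: "ext (F \<alpha>s (?Z # \<beta>s)) Xs x = f x *\<^sub>R ext (F \<alpha>s (\<beta> # \<beta>s)) Xs x + asum Xs (\<lambda>X Ys. X x f *\<^sub>R F \<alpha>s (\<beta> # \<beta>s) Ys x)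
      + (g x *\<^sub>R ext (F \<alpha>s (\<beta>' # \<beta>s)) Xs x + asum Xs (\<lambda>X Ys. X x g *\<^sub>R F \<alpha>s (\<beta>' # \<beta>s) Ys x))"
  proof -
    have "F \<alpha>s (?Z # \<beta>s) Ys = (\<lambda>x. 1 *\<^sub>R (f x *\<^sub>R F \<alpha>s (\<beta> # \<beta>s) Ys x) + 1 *\<^sub>R (g x *\<^sub>R F \<alpha>s (\<beta>' # \<beta>s) Ys x))"
      if "set Ys \<subseteq> SX" for Ys
      by (rule HOL.ext) (simp add: tameD(2)[OF F 5(1,2) that 5(4-7)])
    then have "ext (F \<alpha>s (?Z # \<beta>s)) Xs x =
        ext (\<lambda>Ys x. 1 *\<^sub>R (f x *\<^sub>R F \<alpha>s (\<beta> # \<beta>s) Ys x) + 1 *\<^sub>R (g x *\<^sub>R F \<alpha>s (\<beta>' # \<beta>s) Ys x)) Xs x"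
      by (rule ext_cong[OF _ 5(3)])
    also have "\<dots> = 1 *\<^sub>R ext (\<lambda>Ys x. f x *\<^sub>R F \<alpha>s (\<beta> # \<beta>s) Ys x) Xs x + 1 *\<^sub>R ext (\<lambda>Ys x. g x *\<^sub>R F \<alpha>s (\<beta>' # \<beta>s) Ys x) Xs x"
      by (rule ext_add[OF SK_scale[OF v[OF 5(4)] 5(6)] SK_scale[OF v[OF 5(5)] 5(7)] 5(3)])
    finally show ?thesis by (simp add: ext_scale[OF v[OF 5(4)] 5(3,6)] ext_scale[OF v[OF 5(5)] 5(3,7)])
  qed
  have z: "F (?Z # \<alpha>s) \<beta>s Xs x = f x *\<^sub>R F (\<beta> # \<alpha>s) \<beta>s Xs x + asum Xs (\<lambda>X Ys. X x f *\<^sub>R F \<alpha>s (\<beta> # \<beta>s) Ys x)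
      + (g x *\<^sub>R F (\<beta>' # \<alpha>s) \<beta>s Xs x + asum Xs (\<lambda>X Ys. X x g *\<^sub>R F \<alpha>s (\<beta>' # \<beta>s) Ys x))"
    using tameD(4)[OF F 5(1-3) SA_scale[OF 5(4,6)] SA_scale[OF 5(5,7)], of 1 1 x]
    unfolding leibD[OF l 5(4,1-3,6)] leibD[OF l 5(5,1-3,7)] by simp
  have r: "xsum \<beta>s (\<lambda>b bs. F (b # \<alpha>s) (?Z # bs) Xs x) =
      f x *\<^sub>R xsum \<beta>s (\<lambda>b bs. F (b # \<alpha>s) (\<beta> # bs) Xs x) + g x *\<^sub>R xsum \<beta>s (\<lambda>b bs. F (b # \<alpha>s) (\<beta>' # bs) Xs x)"
    unfolding xsum_scaleR[symmetric] xsum_add[symmetric]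
    by (rule xsum_cong[OF 5(2)], rule tameD(2)[OF F _ _ 5(3-7)]) (simp_all add: 5)
  show ?case unfolding Dn_def Dn1_def Dn2_def xsum.simps e z r by (simp add: algebra_simps)
next
  case (6 \<alpha>s \<beta>s Xs X Y f g x)
  let ?Z = "\<lambda>x \<phi>. f x * X x \<phi> + g x * Y x \<phi>"
  have Z: "?Z \<in> SX" by (rule SX_lin[OF 6(4-7)])
  have v: "F \<alpha>s \<beta>s Ys \<in> SK" if "set Ys \<subseteq> SX" for Ys
    by (rule tameD(1)[OF F 6(1,2) that])
  have v': "F \<alpha>s \<beta>s (W # Ys) \<in> SK" if "W \<in> SX" "set Ys \<subseteq> SX" for W Ys
    by (rule v) (simp add: that)
  have e1: "C (F \<alpha>s \<beta>s (?Z # Ws)) W x = f x *\<^sub>R C (F \<alpha>s \<beta>s (X # Ws)) W x + W x f *\<^sub>R F \<alpha>s \<beta>s (X # Ws) x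
      + (g x *\<^sub>R C (F \<alpha>s \<beta>s (Y # Ws)) W x + W x g *\<^sub>R F \<alpha>s \<beta>s (Y # Ws) x)"
    if W: "W \<in> SX" "set Ws \<subseteq> SX" for W Ws
  proof -
    have "F \<alpha>s \<beta>s (?Z # Ws) = (\<lambda>x. f x *\<^sub>R F \<alpha>s \<beta>s (X # Ws) x + g x *\<^sub>R F \<alpha>s \<beta>s (Y # Ws) x)"
      by (rule HOL.ext) (rule tameD(3)[OF F 6(1,2) W(2) 6(4-7)])
    then show ?thesis
      using fun_cong[OF linon_add[OF linon_C_SK SK_scale[OF v'[OF 6(4) W(2)] 6(6)] SK_scale[OF v'[OF 6(5) W(2)] 6(7)], of W], of x]
        C_scale_SK[OF v'[OF 6(4) W(2)] W(1) 6(6), of x] C_scale_SK[OF v'[OF 6(5) W(2)] W(1) 6(7), of x] by simp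
  qed
  have e2: "F \<alpha>s \<beta>s (vf_bracket ?Z W # Ws) x = f x *\<^sub>R F \<alpha>s \<beta>s (vf_bracket X W # Ws) x + g x *\<^sub>R F \<alpha>s \<beta>s (vf_bracket Y W # Ws) x
      - W x f *\<^sub>R F \<alpha>s \<beta>s (X # Ws) x - W x g *\<^sub>R F \<alpha>s \<beta>s (Y # Ws) x"
    if W: "W \<in> SX" "set Ws \<subseteq> SX" for W Ws
  proof -
    note X1 = SX_bracket[OF 6(4) W(1)] and Y1 = SX_bracket[OF 6(5) W(1)]
    have f': "(\<lambda>x. - W x f) \<in> Cinf L" "(\<lambda>x. - W x g) \<in> Cinf L"
      using Cf_lin[OF SX_Cf[OF W(1) 6(6)] Cf_const[of 0], of "-1" 0] Cf_lin[OF SX_Cf[OF W(1) 6(7)] Cf_const[of 0], of "-1" 0]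
      by simp_all
    let ?P = "\<lambda>x \<phi>. f x * vf_bracket X W x \<phi> + g x * vf_bracket Y W x \<phi>"
    let ?Q = "\<lambda>x \<phi>. (- W x f) * X x \<phi> + (- W x g) * Y x \<phi>"
    have "vf_bracket ?Z W = (\<lambda>x \<phi>. ?P x \<phi> + ?Q x \<phi>)"
      unfolding vf_bracket_scale[OF 6(4,5) W(1) 6(6,7)] by (simp add: fun_eq_iff)
    then have "F \<alpha>s \<beta>s (vf_bracket ?Z W # Ws) x = F \<alpha>s \<beta>s (?P # Ws) x + F \<alpha>s \<beta>s (?Q # Ws) x"
      using tame_addX[OF F 6(1,2) W(2) SX_lin[OF X1 Y1 6(6,7)] SX_lin[OF 6(4,5) f']] by simp
    then show ?thesis
      unfolding tameD(3)[OF F 6(1,2) W(2) X1 Y1 6(6,7)] tameD(3)[OF F 6(1,2) W(2) 6(4,5) f'] by simp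
  qed
  have e3: "F \<alpha>s \<beta>s (vf_bracket V W # ?Z # Ws) x = f x *\<^sub>R F \<alpha>s \<beta>s (vf_bracket V W # X # Ws) x + g x *\<^sub>R F \<alpha>s \<beta>s (vf_bracket V W # Y # Ws) x"
    if W: "V \<in> SX" "W \<in> SX" "set Ws \<subseteq> SX" for V W Ws
  proof -
    have sw: "F \<alpha>s \<beta>s (vf_bracket V W # A # Ws) x = - F \<alpha>s \<beta>s (A # vf_bracket V W # Ws) x" if "A \<in> SX" for A
      by (rule altern_swap_head[OF tame_altX[OF F 6(1,2)] SX_bracket[OF W(1,2)] that W(3)])
    have "set (vf_bracket V W # Ws) \<subseteq> SX" using W by (simp add: SX_bracket)
    from tameD(3)[OF F 6(1,2) this 6(4-7), of x] show ?thesis unfolding sw[OF Z] sw[OF 6(4)] sw[OF 6(5)] by simp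
  qed
  have E1: "asum Xs (\<lambda>W Ws. C (F \<alpha>s \<beta>s (?Z # Ws)) W x) = asum Xs (\<lambda>W Ws. f x *\<^sub>R C (F \<alpha>s \<beta>s (X # Ws)) W x + W x f *\<^sub>R F \<alpha>s \<beta>s (X # Ws) x
      + (g x *\<^sub>R C (F \<alpha>s \<beta>s (Y # Ws)) W x + W x g *\<^sub>R F \<alpha>s \<beta>s (Y # Ws) x))"
    by (rule asum_cong[OF 6(3)]) (rule e1)
  have E2: "asum Xs (\<lambda>W Ws. F \<alpha>s \<beta>s (vf_bracket ?Z W # Ws) x) = asum Xs (\<lambda>W Ws. f x *\<^sub>R F \<alpha>s \<beta>s (vf_bracket X W # Ws) x + g x *\<^sub>R F \<alpha>s \<beta>s (vf_bracket Y W # Ws) x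
      - W x f *\<^sub>R F \<alpha>s \<beta>s (X # Ws) x - W x g *\<^sub>R F \<alpha>s \<beta>s (Y # Ws) x)"
    by (rule asum_cong[OF 6(3)]) (rule e2)
  have E3: "bsum Xs (\<lambda>V W Ws. F \<alpha>s \<beta>s (vf_bracket V W # ?Z # Ws) x) =
      bsum Xs (\<lambda>V W Ws. f x *\<^sub>R F \<alpha>s \<beta>s (vf_bracket V W # X # Ws) x + g x *\<^sub>R F \<alpha>s \<beta>s (vf_bracket V W # Y # Ws) x)"
    by (rule bsum_cong[OF 6(3)]) (rule e3)
  have e: "ext (F \<alpha>s \<beta>s) (?Z # Xs) x = f x *\<^sub>R ext (F \<alpha>s \<beta>s) (X # Xs) x + g x *\<^sub>R ext (F \<alpha>s \<beta>s) (Y # Xs) x"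
    unfolding ext_def asum.simps bsum.simps E1 E2 E3 C_linX[OF SK_SA[OF v[OF 6(3)]] 6(4-7)]
    by (simp add: asum_add asum_diff asum_scaleR bsum_add bsum_scaleR algebra_simps)
  have r: "xsum \<beta>s (\<lambda>b bs. F (b # \<alpha>s) bs (?Z # Xs) x) =
      f x *\<^sub>R xsum \<beta>s (\<lambda>b bs. F (b # \<alpha>s) bs (X # Xs) x) + g x *\<^sub>R xsum \<beta>s (\<lambda>b bs. F (b # \<alpha>s) bs (Y # Xs) x)"
    unfolding xsum_scaleR[symmetric] xsum_add[symmetric]
    by (rule xsum_cong[OF 6(2)], rule tameD(3)[OF F _ _ 6(3-7)]) (simp_all add: 6)
  show ?case unfolding Dn_def Dn1_def Dn2_def e r by (simp add: algebra_simps)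
next
  case (7 \<alpha>s \<beta>s Xs \<alpha> \<alpha>' r q x)
  let ?Z = "\<lambda>x. r *\<^sub>R \<alpha> x + q *\<^sub>R \<alpha>' x"
  have Z: "?Z \<in> SA" by (rule SA_lin[OF 7(4,5) Cf_const Cf_const])
  have v: "F (a # \<alpha>s) \<beta>s Ys \<in> SK" if "a \<in> SA" "set Ys \<subseteq> SX" for a Ys
    by (rule tameD(1)[OF F _ 7(2) that(2)]) (simp add: 7 that)
  have e: "ext (F (?Z # \<alpha>s) \<beta>s) Xs x = r *\<^sub>R ext (F (\<alpha> # \<alpha>s) \<beta>s) Xs x + q *\<^sub>R ext (F (\<alpha>' # \<alpha>s) \<beta>s) Xs x"
  proof -
    have "F (?Z # \<alpha>s) \<beta>s Ys = (\<lambda>x. r *\<^sub>R F (\<alpha> # \<alpha>s) \<beta>s Ys x + q *\<^sub>R F (\<alpha>' # \<alpha>s) \<beta>s Ys x)" if "set Ys \<subseteq> SX" for Ys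
      by (rule HOL.ext) (rule tameD(4)[OF F 7(1,2) that 7(4,5)])
    then have "ext (F (?Z # \<alpha>s) \<beta>s) Xs x = ext (\<lambda>Ys x. r *\<^sub>R F (\<alpha> # \<alpha>s) \<beta>s Ys x + q *\<^sub>R F (\<alpha>' # \<alpha>s) \<beta>s Ys x) Xs x"
      by (rule ext_cong[OF _ 7(3)])
    also have "\<dots> = r *\<^sub>R ext (F (\<alpha> # \<alpha>s) \<beta>s) Xs x + q *\<^sub>R ext (F (\<alpha>' # \<alpha>s) \<beta>s) Xs x"
      by (rule ext_add[OF v[OF 7(4)] v[OF 7(5)] 7(3)])
    finally show ?thesis .
  qed
  have r: "xsum \<beta>s (\<lambda>b bs. F (b # ?Z # \<alpha>s) bs Xs x) =
      r *\<^sub>R xsum \<beta>s (\<lambda>b bs. F (b # \<alpha> # \<alpha>s) bs Xs x) + q *\<^sub>R xsum \<beta>s (\<lambda>b bs. F (b # \<alpha>' # \<alpha>s) bs Xs x)"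
    unfolding xsum_scaleR[symmetric] xsum_add[symmetric]
  proof (rule xsum_cong[OF 7(2)])
    fix b bs assume b: "b \<in> SA" "set bs \<subseteq> SA"
    have sw: "F (b # a # \<alpha>s) bs Xs x = - F (a # b # \<alpha>s) bs Xs x" if "a \<in> SA" for a
      by (rule altern_swap_head[OF tame_altA[OF F b(2) 7(3)] b(1) that 7(1)])
    have "set (b # \<alpha>s) \<subseteq> SA" using b 7 by simp
    from tameD(4)[OF F this b(2) 7(3-5), of r q x]
    show "F (b # ?Z # \<alpha>s) bs Xs x = r *\<^sub>R F (b # \<alpha> # \<alpha>s) bs Xs x + q *\<^sub>R F (b # \<alpha>' # \<alpha>s) bs Xs x"
      unfolding sw[OF Z] sw[OF 7(4)] sw[OF 7(5)] by simp
  qed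
  show ?case unfolding Dn_def Dn1_def Dn2_def e r by (simp add: algebra_simps)
qed

lemma tame_B:
  assumes F: "tame F"
  shows "tame (B F)"
proof (rule tameI, goal_cases)
  case (1 \<alpha>s \<beta>s Xs)
  show ?case unfolding B_def using tameD(1)[OF F 1(1) h_set[OF 1(2)] 1(3)] by simp
next
  case (2 \<alpha>s Xs x)
  show ?case unfolding B_def by (rule symm_map[OF tame_symB[OF F 2] h_SA])
next
  case (3 \<alpha>s \<beta>s x)
  show ?case unfolding B_def by (rule tame_altX[OF F 3(1) h_set[OF 3(2)]])
next
  case (4 \<beta>s Xs x)
  show ?case unfolding B_def by (rule tame_altA[OF F h_set[OF 4(1)] 4(2)])
next
  case (5 \<alpha>s \<beta>s Xs \<beta> \<beta>' f g x)
  show ?case unfolding B_def list.map h_lin[OF 5(4-7)]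
    by (rule tameD(2)[OF F 5(1) h_set[OF 5(2)] 5(3) h_SA[OF 5(4)] h_SA[OF 5(5)] 5(6,7)])
next
  case (6 \<alpha>s \<beta>s Xs X Y f g x)
  show ?case unfolding B_def by (rule tameD(3)[OF F 6(1) h_set[OF 6(2)] 6(3-7)])
next
  case (7 \<alpha>s \<beta>s Xs \<alpha> \<alpha>' r q x)
  show ?case unfolding B_def by (rule tameD(4)[OF F 7(1) h_set[OF 7(2)] 7(3-5)])
qed

lemma H_B: "H F \<alpha>s \<beta>s Xs = B (expU (Suc (length \<alpha>s)) F) \<alpha>s \<beta>s Xs"
  unfolding H_def B_def ..

lemma tame_H:
  assumes F: "tame F"
  shows "tame (H F)"
proof (rule tameI, goal_cases)
  note T = tame_B[OF tame_expU[OF F]]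
  case (1 \<alpha>s \<beta>s Xs)
  show ?case unfolding H_B by (rule tameD(1)[OF T 1])
next
  note T = tame_B[OF tame_expU[OF F]]
  case (2 \<alpha>s Xs x)
  show ?case unfolding H_B by (rule tame_symB[OF T 2])
next
  note T = tame_B[OF tame_expU[OF F]]
  case (3 \<alpha>s \<beta>s x)
  show ?case unfolding H_B by (rule tame_altX[OF T 3])
next
  note T = tame_B[OF tame_expU[OF F]]
  case (4 \<beta>s Xs x)
  show ?case
  proof (rule alternI)
    fix ps qs a b assume *: "a \<in> SA" "b \<in> SA" "set ps \<subseteq> SA" "set qs \<subseteq> SA"
    from altern_swap[OF tame_altA[OF T 4] this, of "Suc (length (ps @ a # b # qs))" x]
    show "H F (ps @ a # b # qs) \<beta>s Xs x = - H F (ps @ b # a # qs) \<beta>s Xs x" unfolding H_B by simp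
  qed
next
  note T = tame_B[OF tame_expU[OF F]]
  case (5 \<alpha>s \<beta>s Xs \<beta> \<beta>' f g x)
  show ?case unfolding H_B by (rule tameD(2)[OF T 5])
next
  note T = tame_B[OF tame_expU[OF F]]
  case (6 \<alpha>s \<beta>s Xs X Y f g x)
  show ?case unfolding H_B by (rule tameD(3)[OF T 6])
next
  note T = tame_B[OF tame_expU[OF F]]
  case (7 \<alpha>s \<beta>s Xs \<alpha> \<alpha>' r q x)
  show ?case unfolding H_B length_Cons by (rule tameD(4)[OF T 7])
qed

text \<open>
  In addition to the Leibniz rule of \<open>F\<close>, each of the \<open>n\<close> insertions may meet \<open>f \<alpha>\<close>, where
  \<open>C (f \<alpha>) = f C \<alpha> + df \<otimes> v \<alpha>\<close>.
\<close>

lemma Upow_leib: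
  assumes F: "tame F" and l: "leib F"
    and dom: "\<alpha> \<in> SA" "set \<alpha>s \<subseteq> SA" "set \<beta>s \<subseteq> SA" "set Xs \<subseteq> SX" "f \<in> Cinf L"
  shows "(U ^^ n) F ((\<lambda>x. f x *\<^sub>R \<alpha> x) # \<alpha>s) \<beta>s Xs x = f x *\<^sub>R (U ^^ n) F (\<alpha> # \<alpha>s) \<beta>s Xs x
    + asum Xs (\<lambda>X Ys. X x f *\<^sub>R ((U ^^ n) F \<alpha>s (\<alpha> # \<beta>s) Ys x + real n *\<^sub>R (U ^^ (n - 1)) F \<alpha>s (v \<alpha> # \<beta>s) Ys x))"
  using dom(2-4)
proof (induction n arbitrary: \<alpha>s \<beta>s Xs)
  case 0
  show ?case using leibD[OF l dom(1) 0 dom(5)] by simp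
next
  case (Suc n)
  define G where "G = (U ^^ n) F"
  define G' where "G' = (U ^^ (n - 1)) F"
  have G: "tame G" unfolding G_def by (rule tame_Upow[OF F])
  have G': "tame G'" unfolding G'_def by (rule tame_Upow[OF F])
  have UG': "real n *\<^sub>R U G' as bs Ys x = real n *\<^sub>R G as bs Ys x" for as bs Ys
    unfolding G_def G'_def by (cases n) simp_all
  have 1: "G \<alpha>s (C (\<lambda>x. f x *\<^sub>R \<alpha> x) X # \<beta>s) Ys x =
      f x *\<^sub>R G \<alpha>s (C \<alpha> X # \<beta>s) Ys x + X x f *\<^sub>R G \<alpha>s (v \<alpha> # \<beta>s) Ys x"
    if "X \<in> SX" "set Ys \<subseteq> SX" for X Ys
    unfolding C_leibniz[OF dom(1) that(1) dom(5)]
    by (rule tameD(2)[OF G Suc.prems(1,2) that(2) C_SA[OF dom(1) that(1)] v_SA[OF dom(1)] dom(5) SX_Cf[OF that(1) dom(5)]])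
  have 2: "G ((\<lambda>x. f x *\<^sub>R \<alpha> x) # as) (C a X # \<beta>s) Ys x = f x *\<^sub>R G (\<alpha> # as) (C a X # \<beta>s) Ys x
      + asum Ys (\<lambda>Y Zs. Y x f *\<^sub>R (G as (C a X # \<alpha> # \<beta>s) Zs x + real n *\<^sub>R G' as (C a X # v \<alpha> # \<beta>s) Zs x))"
    if a: "a \<in> SA" "set as \<subseteq> SA" "X \<in> SX" "set Ys \<subseteq> SX" for a as X Ys
  proof -
    have "set (C a X # \<beta>s) \<subseteq> SA" using Suc.prems a by (simp add: C_SA)
    from Suc.IH[OF a(2) this a(4)]
    have "G ((\<lambda>x. f x *\<^sub>R \<alpha> x) # as) (C a X # \<beta>s) Ys x = f x *\<^sub>R G (\<alpha> # as) (C a X # \<beta>s) Ys x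
      + asum Ys (\<lambda>Y Zs. Y x f *\<^sub>R (G as (\<alpha> # C a X # \<beta>s) Zs x + real n *\<^sub>R G' as (v \<alpha> # C a X # \<beta>s) Zs x))"
      unfolding G_def G'_def .
    also have "asum Ys (\<lambda>Y Zs. Y x f *\<^sub>R (G as (\<alpha> # C a X # \<beta>s) Zs x + real n *\<^sub>R G' as (v \<alpha> # C a X # \<beta>s) Zs x)) =
        asum Ys (\<lambda>Y Zs. Y x f *\<^sub>R (G as (C a X # \<alpha> # \<beta>s) Zs x + real n *\<^sub>R G' as (C a X # v \<alpha> # \<beta>s) Zs x))"
    proof (rule asum_cong[OF a(4)])
      fix Y Zs assume Z: "set Zs \<subseteq> SX"
      show "Y x f *\<^sub>R (G as (\<alpha> # C a X # \<beta>s) Zs x + real n *\<^sub>R G' as (v \<alpha> # C a X # \<beta>s) Zs x) =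
          Y x f *\<^sub>R (G as (C a X # \<alpha> # \<beta>s) Zs x + real n *\<^sub>R G' as (C a X # v \<alpha> # \<beta>s) Zs x)"
        using symm_swap_head[OF tame_symB[OF G a(2) Z] dom(1) C_SA[OF a(1,3)] Suc.prems(2), of x]
          symm_swap_head[OF tame_symB[OF G' a(2) Z] v_SA[OF dom(1)] C_SA[OF a(1,3)] Suc.prems(2), of x] by simp
    qed
    finally show ?thesis .
  qed
  define T where "T a as X Y Zs = Y x f *\<^sub>R (G as (C a X # \<alpha> # \<beta>s) Zs x + real n *\<^sub>R G' as (C a X # v \<alpha> # \<beta>s) Zs x)" for a as X Y Zs
  have "U G ((\<lambda>x. f x *\<^sub>R \<alpha> x) # \<alpha>s) \<beta>s Xs x =
      asum Xs (\<lambda>X Ys. f x *\<^sub>R G \<alpha>s (C \<alpha> X # \<beta>s) Ys x + X x f *\<^sub>R G \<alpha>s (v \<alpha> # \<beta>s) Ys x)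
      - asum \<alpha>s (\<lambda>a as. asum Xs (\<lambda>X Ys. f x *\<^sub>R G (\<alpha> # as) (C a X # \<beta>s) Ys x + asum Ys (\<lambda>Y Zs. T a as X Y Zs)))"
    unfolding U_def[of G] asum.simps T_def
    by (intro arg_cong2[of _ _ _ _ minus] asum_cong[OF Suc.prems(1)] asum_cong[OF Suc.prems(3)] 1 2)
  also have "\<dots> = f x *\<^sub>R U G (\<alpha> # \<alpha>s) \<beta>s Xs x + asum Xs (\<lambda>X Ys. X x f *\<^sub>R G \<alpha>s (v \<alpha> # \<beta>s) Ys x)
      - asum \<alpha>s (\<lambda>a as. asum Xs (\<lambda>X Ys. asum Ys (\<lambda>Y Zs. T a as X Y Zs)))"
    unfolding U_def[of G] by (simp add: asum_add asum_scaleR algebra_simps)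
  also have "asum \<alpha>s (\<lambda>a as. asum Xs (\<lambda>X Ys. asum Ys (\<lambda>Y Zs. T a as X Y Zs))) =
      - asum Xs (\<lambda>Y Ys. asum \<alpha>s (\<lambda>a as. asum Ys (\<lambda>X Zs. T a as X Y Zs)))"
    unfolding asum_asum_swap[of Xs "\<lambda>X Y Zs. T a as X Y Zs" for a as] asum_minus asum_asum_fubini[of \<alpha>s Xs] ..
  also have "asum Xs (\<lambda>Y Ys. asum \<alpha>s (\<lambda>a as. asum Ys (\<lambda>X Zs. T a as X Y Zs))) =
      asum Xs (\<lambda>Y Ys. Y x f *\<^sub>R (U G \<alpha>s (\<alpha> # \<beta>s) Ys x + real n *\<^sub>R U G' \<alpha>s (v \<alpha> # \<beta>s) Ys x))"
    unfolding T_def U_def[of G] U_def[of G'] by (simp only: asum_add asum_scaleR)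
  finally show ?case unfolding UG' by (simp add: G_def asum_add asum_scaleR algebra_simps)
qed

text \<open>
  Summed over the exponential series, the terms of \<open>Upow_leib\<close> with \<open>v \<alpha>\<close> turn the new symmetric
  argument \<open>\<alpha>\<close> into \<open>\<alpha> - v \<alpha> = h \<alpha>\<close>.
\<close>

lemma leib_H:
  assumes F: "tame F" and l: "leib F"
  shows "leib (H F)"
  unfolding leib_def
proof (intro allI impI)
  fix \<alpha> \<alpha>s \<beta>s Xs f x
  assume dom: "\<alpha> \<in> SA" "set \<alpha>s \<subseteq> SA" "set \<beta>s \<subseteq> SA" "set Xs \<subseteq> SX" "f \<in> Cinf L"
  let ?N = "Suc (length \<alpha>s)"
  let ?b = "map h \<beta>s"
  note hb = h_set[OF dom(3)]
  have key: "(\<Sum>n<Suc ?N. ((-1) ^ n / fact n) *\<^sub>R ((U ^^ n) F \<alpha>s (\<alpha> # ?b) Ys x + real n *\<^sub>R (U ^^ (n - 1)) F \<alpha>s (v \<alpha> # ?b) Ys x)) =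
      H F \<alpha>s (\<alpha> # \<beta>s) Ys x" if Y: "set Ys \<subseteq> SX" for Ys
  proof -
    have "(\<Sum>n<Suc ?N. ((-1) ^ n / fact n) *\<^sub>R ((U ^^ n) F \<alpha>s (\<alpha> # ?b) Ys x + real n *\<^sub>R (U ^^ (n - 1)) F \<alpha>s (v \<alpha> # ?b) Ys x)) =
        expU (Suc ?N) F \<alpha>s (\<alpha> # ?b) Ys x - expU ?N F \<alpha>s (v \<alpha> # ?b) Ys x"
      unfolding scaleR_add_right sum.distrib expU_def
        exp_series_shift[where N = ?N and g = "\<lambda>n. (U ^^ n) F \<alpha>s (v \<alpha> # ?b) Ys x"] by simp
    also have "expU (Suc ?N) F \<alpha>s (\<alpha> # ?b) Ys x = expU ?N F \<alpha>s (\<alpha> # ?b) Ys x"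
      by (rule expU_eq) simp_all
    also have "expU ?N F \<alpha>s (\<alpha> # ?b) Ys x - expU ?N F \<alpha>s (v \<alpha> # ?b) Ys x = expU ?N F \<alpha>s (h \<alpha> # ?b) Ys x"
      unfolding hor_def[of \<theta> \<alpha>]
      by (rule tame_diffB[OF tame_expU[OF F] dom(2) hb Y dom(1) v_SA[OF dom(1)], symmetric])
    finally show ?thesis by (simp add: H_def)
  qed
  define E where "E n Ys = (U ^^ n) F \<alpha>s (\<alpha> # ?b) Ys x + real n *\<^sub>R (U ^^ (n - 1)) F \<alpha>s (v \<alpha> # ?b) Ys x" for n Ys
  have "H F ((\<lambda>x. f x *\<^sub>R \<alpha> x) # \<alpha>s) \<beta>s Xs x = (\<Sum>n<Suc ?N. ((-1) ^ n / fact n) *\<^sub>R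
      (f x *\<^sub>R (U ^^ n) F (\<alpha> # \<alpha>s) ?b Xs x + asum Xs (\<lambda>X Ys. X x f *\<^sub>R E n Ys)))"
    unfolding H_def expU_def length_Cons Upow_leib[OF F l dom(1,2) hb dom(4,5)] E_def ..
  also have "\<dots> = f x *\<^sub>R H F (\<alpha> # \<alpha>s) \<beta>s Xs x + (\<Sum>n<Suc ?N. ((-1) ^ n / fact n) *\<^sub>R asum Xs (\<lambda>X Ys. X x f *\<^sub>R E n Ys))"
    unfolding H_def expU_def length_Cons scaleR_add_right sum.distrib scaleR_sum_right by (simp add: mult.commute)
  also have "(\<Sum>n<Suc ?N. ((-1) ^ n / fact n) *\<^sub>R asum Xs (\<lambda>X Ys. X x f *\<^sub>R E n Ys)) =
      asum Xs (\<lambda>X Ys. X x f *\<^sub>R (\<Sum>n<Suc ?N. ((-1) ^ n / fact n) *\<^sub>R E n Ys))"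
    unfolding asum_scaleR[symmetric] asum_sum[symmetric] scaleR_sum_right by (simp only: scaleR_left_commute)
  also have "\<dots> = asum Xs (\<lambda>X Ys. X x f *\<^sub>R H F \<alpha>s (\<alpha> # \<beta>s) Ys x)"
    unfolding E_def by (rule asum_cong[OF dom(4)]) (simp only: key)
  finally show "H F ((\<lambda>x. f x *\<^sub>R \<alpha> x) # \<alpha>s) \<beta>s Xs x =
      f x *\<^sub>R H F (\<alpha> # \<alpha>s) \<beta>s Xs x + asum Xs (\<lambda>X Ys. X x f *\<^sub>R H F \<alpha>s (\<alpha> # \<beta>s) Ys x)" .
qed

section \<open>Weil cochains\<close>

definition toF :: "('m, 'a) cochain \<Rightarrow> ('m, 'a) cfun" where
  "toF c \<alpha>s \<beta>s Xs = c (length \<beta>s) \<alpha>s \<beta>s Xs"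

definition fromF :: "nat \<Rightarrow> nat \<Rightarrow> ('m, 'a) cfun \<Rightarrow> ('m, 'a) cochain" where
  "fromF p q F k \<alpha>s \<beta>s Xs = (if weil_dom L p q k \<alpha>s \<beta>s Xs then F \<alpha>s \<beta>s Xs else (\<lambda>x. 0))"

lemma weil_dom_iff:
  "weil_dom L p q k \<alpha>s \<beta>s Xs \<longleftrightarrow> length \<beta>s = k \<and> length \<alpha>s + k = p \<and> k + length Xs = q \<and>
     set \<alpha>s \<subseteq> SA \<and> set \<beta>s \<subseteq> SA \<and> set Xs \<subseteq> SX"
  unfolding weil_dom_def tuples_def by auto

lemma fromF_cong:
  assumes "\<And>\<alpha>s \<beta>s Xs. set \<alpha>s \<subseteq> SA \<Longrightarrow> set \<beta>s \<subseteq> SA \<Longrightarrow> set Xs \<subseteq> SX \<Longrightarrow>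
    length \<alpha>s + length \<beta>s = p \<Longrightarrow> length \<beta>s + length Xs = q \<Longrightarrow> F \<alpha>s \<beta>s Xs = G \<alpha>s \<beta>s Xs"
  shows "fromF p q F = fromF p q G"
  unfolding fromF_def by (intro HOL.ext) (auto simp: weil_dom_iff intro!: fun_cong[OF assms])

context
  fixes c p q
  assumes c: "c \<in> weil_cochains L \<kk> p q"
begin

lemma toF_off: "\<not> weil_dom L p q (length \<beta>s) \<alpha>s \<beta>s Xs \<Longrightarrow> toF c \<alpha>s \<beta>s Xs = (\<lambda>x. 0)"
  unfolding toF_def by (rule weilD(1)[OF c])

lemma toF_on:
  assumes "weil_dom L p q (length \<beta>s) \<alpha>s \<beta>s Xs"
  shows "c (length \<beta>s) \<alpha>s \<in> forms L \<kk> (length \<beta>s) (q - length \<beta>s)"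
    "\<beta>s \<in> tuples (length \<beta>s) SA" "Xs \<in> tuples (q - length \<beta>s) SX" "length \<beta>s \<le> p" "length \<beta>s \<le> q"
    "\<alpha>s \<in> tuples (p - length \<beta>s) SA"
  using assms weilD(2)[OF c, of "length \<beta>s" \<alpha>s] unfolding weil_dom_def by auto

lemma toF_altX:
  assumes dom: "set \<alpha>s \<subseteq> SA" "set \<beta>s \<subseteq> SA"
  shows "altern SX (\<lambda>Xs. toF c \<alpha>s \<beta>s Xs x)"
proof (rule altern_of_not_distinct[where pl = "\<lambda>X Y x \<phi>. 1 * X x \<phi> + 1 * Y x \<phi>"])
  fix X Y assume X: "X \<in> SX" "Y \<in> SX"
  show "(\<lambda>x \<phi>. 1 * X x \<phi> + 1 * Y x \<phi>) \<in> SX" by (rule SX_lin[OF X Cf_const Cf_const])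
  fix ps qs assume l: "set ps \<subseteq> SX" "set qs \<subseteq> SX"
  show "toF c \<alpha>s \<beta>s (ps @ (\<lambda>x \<phi>. 1 * X x \<phi> + 1 * Y x \<phi>) # qs) x = toF c \<alpha>s \<beta>s (ps @ X # qs) x + toF c \<alpha>s \<beta>s (ps @ Y # qs) x"
  proof (cases "weil_dom L p q (length \<beta>s) \<alpha>s \<beta>s (ps @ X # qs)")
    case True
    note T = toF_on[OF True]
    have "length ps < q - length \<beta>s" using T(3) by (simp add: tuples_def)
    from formsD(3)[OF T(1-3) this X Cf_const[of 1] Cf_const[of 1]]
    show ?thesis unfolding toF_def by (simp add: list_update_length)
  next
    case False
    then have "\<not> weil_dom L p q (length \<beta>s) \<alpha>s \<beta>s (ps @ Z # qs)" if "Z \<in> SX" for Z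
      using that X l by (auto simp: weil_dom_iff)
    then show ?thesis using toF_off X SX_lin[OF X Cf_const[of 1] Cf_const[of 1]] by simp
  qed
next
  fix Xs assume "set Xs \<subseteq> SX" "\<not> distinct Xs"
  then show "toF c \<alpha>s \<beta>s Xs x = 0"
    using formsD(5)[OF toF_on(1-3), of \<beta>s \<alpha>s Xs] toF_off[of \<beta>s \<alpha>s Xs]
    by (cases "weil_dom L p q (length \<beta>s) \<alpha>s \<beta>s Xs") (simp_all add: toF_def)
qed

lemma toF_altA:
  assumes dom: "set \<beta>s \<subseteq> SA" "set Xs \<subseteq> SX"
  shows "altern SA (\<lambda>\<alpha>s. toF c \<alpha>s \<beta>s Xs x)"
proof (rule altern_of_not_distinct[where pl = "\<lambda>a b x. 1 *\<^sub>R a x + 1 *\<^sub>R b x"])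
  fix a b assume X: "a \<in> SA" "b \<in> SA"
  show S: "(\<lambda>x. 1 *\<^sub>R a x + 1 *\<^sub>R b x) \<in> SA" by (rule SA_lin[OF X Cf_const Cf_const])
  fix ps qs assume l: "set ps \<subseteq> SA" "set qs \<subseteq> SA"
  show "toF c (ps @ (\<lambda>x. 1 *\<^sub>R a x + 1 *\<^sub>R b x) # qs) \<beta>s Xs x = toF c (ps @ a # qs) \<beta>s Xs x + toF c (ps @ b # qs) \<beta>s Xs x"
  proof (cases "weil_dom L p q (length \<beta>s) (ps @ a # qs) \<beta>s Xs")
    case True
    note T = toF_on[OF True]
    have "length ps < p - length \<beta>s" using T(6) by (simp add: tuples_def)
    from weilD(3)[OF c T(4-6) this X, of 1 1 \<beta>s Xs]
    show ?thesis unfolding toF_def by (simp add: list_update_length)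
  next
    case False
    then have "\<not> weil_dom L p q (length \<beta>s) (ps @ z # qs) \<beta>s Xs" if "z \<in> SA" for z
      using that X l by (auto simp: weil_dom_iff)
    then show ?thesis using toF_off X S by simp
  qed
next
  fix \<alpha>s assume "set \<alpha>s \<subseteq> SA" "\<not> distinct \<alpha>s"
  then show "toF c \<alpha>s \<beta>s Xs x = 0"
    using weilD(4)[OF c toF_on(4-6), of \<beta>s \<alpha>s Xs] toF_off[of \<beta>s \<alpha>s Xs]
    by (cases "weil_dom L p q (length \<beta>s) \<alpha>s \<beta>s Xs") (simp_all add: toF_def)
qed

lemma tame_toF: "tame (toF c)"
proof (rule tameI, goal_cases)
  case (1 \<alpha>s \<beta>s Xs)
  show ?case
  proof (cases "weil_dom L p q (length \<beta>s) \<alpha>s \<beta>s Xs")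
    case True
    show ?thesis unfolding toF_def by (rule formsD(1)[OF toF_on(1-3)[OF True]])
  next
    case False
    then show ?thesis using toF_off SK_zero by simp
  qed
next
  case (2 \<alpha>s Xs x)
  show ?case
  proof (rule symmI)
    fix ps qs a b assume *: "a \<in> SA" "b \<in> SA" "set ps \<subseteq> SA" "set qs \<subseteq> SA"
    show "toF c \<alpha>s (ps @ a # b # qs) Xs x = toF c \<alpha>s (ps @ b # a # qs) Xs x"
    proof (cases "weil_dom L p q (length (ps @ b # a # qs)) \<alpha>s (ps @ b # a # qs) Xs")
      case True
      show ?thesis
        using formsD(4)[OF toF_on(1-3)[OF True], of "ps @ a # b # qs"] by (simp add: toF_def)
    next
      case False
      moreover from this have "\<not> weil_dom L p q (length (ps @ a # b # qs)) \<alpha>s (ps @ a # b # qs) Xs"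
        by (auto simp: weil_dom_iff)
      ultimately show ?thesis using toF_off by simp
    qed
  qed
next
  case (3 \<alpha>s \<beta>s x)
  show ?case by (rule toF_altX[OF 3])
next
  case (4 \<beta>s Xs x)
  show ?case by (rule toF_altA[OF 4])
next
  case (5 \<alpha>s \<beta>s Xs \<beta> \<beta>' f g x)
  show ?case
  proof (cases "weil_dom L p q (length (\<beta> # \<beta>s)) \<alpha>s (\<beta> # \<beta>s) Xs")
    case True
    have "0 < length (\<beta> # \<beta>s)" by simp
    from formsD(2)[OF toF_on(1-3)[OF True] this 5(4-7)] show ?thesis by (simp add: toF_def)
  next
    case False
    then have "\<not> weil_dom L p q (length (b # \<beta>s)) \<alpha>s (b # \<beta>s) Xs" for b
      using 5 by (auto simp: weil_dom_iff)
    then show ?thesis using toF_off by simp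
  qed
next
  case (6 \<alpha>s \<beta>s Xs X Y f g x)
  show ?case
  proof (cases "weil_dom L p q (length \<beta>s) \<alpha>s \<beta>s (X # Xs)")
    case True
    then have "0 < q - length \<beta>s" by (auto simp: weil_dom_iff)
    from formsD(3)[OF toF_on(1-3)[OF True] this 6(4-7)] show ?thesis by (simp add: toF_def)
  next
    case False
    then have "\<not> weil_dom L p q (length \<beta>s) \<alpha>s \<beta>s (Z # Xs)" for Z
      using 6 by (auto simp: weil_dom_iff)
    then show ?thesis using toF_off by simp
  qed
next
  case (7 \<alpha>s \<beta>s Xs \<alpha> \<alpha>' r s x)
  show ?case
  proof (cases "weil_dom L p q (length \<beta>s) (\<alpha> # \<alpha>s) \<beta>s Xs")
    case True
    then have "0 < p - length \<beta>s" by (auto simp: weil_dom_iff)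
    from weilD(3)[OF c toF_on(4-6)[OF True] this 7(4,5), of r s \<beta>s Xs] show ?thesis by (simp add: toF_def)
  next
    case False
    then have "\<not> weil_dom L p q (length \<beta>s) (z # \<alpha>s) \<beta>s Xs" for z
      using 7 by (auto simp: weil_dom_iff)
    then show ?thesis using toF_off by simp
  qed
qed

lemma leib_toF: "leib (toF c)"
  unfolding leib_def
proof (intro allI impI)
  fix \<alpha> \<alpha>s \<beta>s Xs f x
  assume dom: "\<alpha> \<in> SA" "set \<alpha>s \<subseteq> SA" "set \<beta>s \<subseteq> SA" "set Xs \<subseteq> SX" "f \<in> Cinf L"
  have f\<alpha>: "(\<lambda>x. f x *\<^sub>R \<alpha> x) \<in> SA" by (rule SA_scale[OF dom(1,5)])
  show "toF c ((\<lambda>x. f x *\<^sub>R \<alpha> x) # \<alpha>s) \<beta>s Xs x =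
      f x *\<^sub>R toF c (\<alpha> # \<alpha>s) \<beta>s Xs x + asum Xs (\<lambda>X Ys. X x f *\<^sub>R toF c \<alpha>s (\<alpha> # \<beta>s) Ys x)"
  proof (cases "weil_dom L p q (length \<beta>s) (\<alpha> # \<alpha>s) \<beta>s Xs")
    case True
    have "dwedge f (c (Suc (length \<beta>s)) \<alpha>s (\<alpha> # \<beta>s)) Xs x = asum Xs (\<lambda>X Ys. X x f *\<^sub>R toF c \<alpha>s (\<alpha> # \<beta>s) Ys x)"
      unfolding dwedge_def toF_def list.size(4) One_nat_def add_Suc_right add_0_right by (rule asum_eq_sum)
    with weilD(5)[OF c dom(5) True] show ?thesis by (simp add: toF_def)
  next
    case False
    then have o: "\<not> weil_dom L p q (length \<beta>s) (z # \<alpha>s) \<beta>s Xs" if "z \<in> SA" for z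
      using dom by (auto simp: weil_dom_iff)
    have "asum Xs (\<lambda>X Ys. X x f *\<^sub>R toF c \<alpha>s (\<alpha> # \<beta>s) Ys x) = asum Xs (\<lambda>X Ys. 0)"
    proof (rule asum_cong[OF dom(4)])
      fix X Ys assume "set Ys \<subseteq> SX" "Suc (length Ys) = length Xs"
      then have "\<not> weil_dom L p q (length (\<alpha> # \<beta>s)) \<alpha>s (\<alpha> # \<beta>s) Ys"
        using False dom by (auto simp: weil_dom_iff)
      then show "X x f *\<^sub>R toF c \<alpha>s (\<alpha> # \<beta>s) Ys x = 0" using toF_off by simp
    qed
    then show ?thesis using toF_off o[OF f\<alpha>] o[OF dom(1)] by simp
  qed
qed

end

text \<open>
  Weil cochains are linear in every entry of their lists, whereas tameness speaks of the heads;
  the symmetries move an entry to the front.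
\<close>

lemma fromF_weil:
  assumes F: "tame F" and l: "leib F"
  shows "fromF p q F \<in> weil_cochains L \<kk> p q"
  unfolding weil_cochains_def mem_Collect_eq
proof (intro conjI allI impI ballI)
  show "fromF p q F k \<alpha>s \<beta>s Xs = (\<lambda>x. 0)" if "\<not> weil_dom L p q k \<alpha>s \<beta>s Xs" for k \<alpha>s \<beta>s Xs
    using that by (simp add: fromF_def)
next
  fix k \<alpha>s assume k: "k \<le> p \<and> k \<le> q" and a: "\<alpha>s \<in> tuples (p - k) SA"
  then have a': "set \<alpha>s \<subseteq> SA" "length \<alpha>s = p - k" by (auto simp: tuples_def)
  have val: "fromF p q F k \<alpha>s \<beta>s Xs = F \<alpha>s \<beta>s Xs" if "\<beta>s \<in> tuples k SA" "Xs \<in> tuples (q - k) SX" for \<beta>s Xs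
    using that k a by (simp add: fromF_def weil_dom_def)
  show "fromF p q F k \<alpha>s \<in> forms L \<kk> k (q - k)"
    unfolding forms_def mem_Collect_eq
  proof (intro conjI allI impI ballI)
    show "fromF p q F k \<alpha>s \<beta>s Xs = (\<lambda>x. 0)" if "\<not> (\<beta>s \<in> tuples k SA \<and> Xs \<in> tuples (q - k) SX)" for \<beta>s Xs
      using that by (auto simp: fromF_def weil_dom_def)
  next
    fix \<beta>s Xs assume B: "\<beta>s \<in> tuples k SA" and X: "Xs \<in> tuples (q - k) SX"
    then have B': "set \<beta>s \<subseteq> SA" "length \<beta>s = k" and X': "set Xs \<subseteq> SX" "length Xs = q - k" by (auto simp: tuples_def)
    show "fromF p q F k \<alpha>s \<beta>s Xs \<in> SK" unfolding val[OF B X] by (rule tameD(1)[OF F a'(1) B'(1) X'(1)])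
    { fix i \<beta> \<beta>' f g assume i: "i < k" and b: "\<beta> \<in> SA" "\<beta>' \<in> SA" and f: "f \<in> Cinf L" "g \<in> Cinf L"
      have o: "set (take i \<beta>s) \<subseteq> SA" "set (drop (Suc i) \<beta>s) \<subseteq> SA" "set (take i \<beta>s @ drop (Suc i) \<beta>s) \<subseteq> SA"
        using B'(1) set_take_subset[of i \<beta>s] set_drop_subset[of "Suc i" \<beta>s] by auto
      have t: "\<beta>s[i := z] \<in> tuples k SA" if "z \<in> SA" for z
        using that B' set_update_subset_insert[of \<beta>s i z] by (auto simp: tuples_def)
      have m: "F \<alpha>s (\<beta>s[i := z]) Xs x = F \<alpha>s (z # take i \<beta>s @ drop (Suc i) \<beta>s) Xs x" if "z \<in> SA" for z x
        using symm_move[OF tame_symB[OF F a'(1) X'(1)] that o(1,2)] i B'(2) by (simp add: upd_conv_take_nth_drop)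
      note z = SA_lin[OF b f]
      show "fromF p q F k \<alpha>s (\<beta>s[i := \<lambda>x. f x *\<^sub>R \<beta> x + g x *\<^sub>R \<beta>' x]) Xs =
          (\<lambda>x. f x *\<^sub>R fromF p q F k \<alpha>s (\<beta>s[i := \<beta>]) Xs x + g x *\<^sub>R fromF p q F k \<alpha>s (\<beta>s[i := \<beta>']) Xs x)"
        unfolding val[OF t[OF z] X] val[OF t[OF b(1)] X] val[OF t[OF b(2)] X]
        by (rule HOL.ext) (simp only: m[OF z] m[OF b(1)] m[OF b(2)] tameD(2)[OF F a'(1) o(3) X'(1) b f]) }
    { fix j Y Z f g assume j: "j < q - k" and y: "Y \<in> SX" "Z \<in> SX" and f: "f \<in> Cinf L" "g \<in> Cinf L"
      have o: "set (take j Xs) \<subseteq> SX" "set (drop (Suc j) Xs) \<subseteq> SX" "set (take j Xs @ drop (Suc j) Xs) \<subseteq> SX"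
        using X'(1) set_take_subset[of j Xs] set_drop_subset[of "Suc j" Xs] by auto
      have t: "Xs[j := z] \<in> tuples (q - k) SX" if "z \<in> SX" for z
        using that X' set_update_subset_insert[of Xs j z] by (auto simp: tuples_def)
      have m: "F \<alpha>s \<beta>s (Xs[j := z]) x = (-1) ^ length (take j Xs) *\<^sub>R F \<alpha>s \<beta>s (z # take j Xs @ drop (Suc j) Xs) x" if "z \<in> SX" for z x
        using altern_move[OF tame_altX[OF F a'(1) B'(1)] that o(1,2)] j X'(2) by (simp add: upd_conv_take_nth_drop)
      note z = SX_lin[OF y f]
      show "fromF p q F k \<alpha>s \<beta>s (Xs[j := \<lambda>x \<phi>. f x * Y x \<phi> + g x * Z x \<phi>]) =
          (\<lambda>x. f x *\<^sub>R fromF p q F k \<alpha>s \<beta>s (Xs[j := Y]) x + g x *\<^sub>R fromF p q F k \<alpha>s \<beta>s (Xs[j := Z]) x)"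
        unfolding val[OF B t[OF z]] val[OF B t[OF y(1)]] val[OF B t[OF y(2)]]
        by (rule HOL.ext) (simp only: m[OF z] m[OF y(1)] m[OF y(2)] tameD(3)[OF F a'(1) B'(1) o(3) y f] scaleR_add_right scaleR_left_commute) }
    { fix \<beta>s' assume ms: "mset \<beta>s' = mset \<beta>s"
      have "\<beta>s' \<in> tuples k SA" using B' mset_eq_setD[OF ms] mset_eq_length[OF ms] by (simp add: tuples_def)
      then show "fromF p q F k \<alpha>s \<beta>s' Xs = fromF p q F k \<alpha>s \<beta>s Xs"
        using symm_mset[OF tame_symB[OF F a'(1) X'(1)] B'(1) ms] by (simp add: val B X fun_eq_iff) }
    { assume "\<not> distinct Xs"
      then show "fromF p q F k \<alpha>s \<beta>s Xs = (\<lambda>x. 0)"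
        using altern_not_distinct[OF tame_altX[OF F a'(1) B'(1)] X'(1)] by (simp add: val B X fun_eq_iff) }
  qed
  { fix i \<alpha> \<alpha>' r s \<beta>s Xs assume i: "i < p - k" and b: "\<alpha> \<in> SA" "\<alpha>' \<in> SA"
    have o: "set (take i \<alpha>s) \<subseteq> SA" "set (drop (Suc i) \<alpha>s) \<subseteq> SA" "set (take i \<alpha>s @ drop (Suc i) \<alpha>s) \<subseteq> SA"
      using a'(1) set_take_subset[of i \<alpha>s] set_drop_subset[of "Suc i" \<alpha>s] by auto
    have t: "\<alpha>s[i := z] \<in> tuples (p - k) SA" if "z \<in> SA" for z
      using that a' set_update_subset_insert[of \<alpha>s i z] by (auto simp: tuples_def)
    note z = SA_lin[OF b Cf_const[of r] Cf_const[of s]]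
    show "fromF p q F k (\<alpha>s[i := \<lambda>x. r *\<^sub>R \<alpha> x + s *\<^sub>R \<alpha>' x]) \<beta>s Xs =
        (\<lambda>x. r *\<^sub>R fromF p q F k (\<alpha>s[i := \<alpha>]) \<beta>s Xs x + s *\<^sub>R fromF p q F k (\<alpha>s[i := \<alpha>']) \<beta>s Xs x)"
    proof (cases "\<beta>s \<in> tuples k SA \<and> Xs \<in> tuples (q - k) SX")
      case True
      then have BX: "set \<beta>s \<subseteq> SA" "set Xs \<subseteq> SX" by (auto simp: tuples_def)
      have v: "fromF p q F k (\<alpha>s[i := z]) \<beta>s Xs = F (\<alpha>s[i := z]) \<beta>s Xs" if "z \<in> SA" for z
        using t[OF that] True k by (simp add: fromF_def weil_dom_def)
      have m: "F (\<alpha>s[i := z]) \<beta>s Xs x = (-1) ^ length (take i \<alpha>s) *\<^sub>R F (z # take i \<alpha>s @ drop (Suc i) \<alpha>s) \<beta>s Xs x" if "z \<in> SA" for z x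
        using altern_move[OF tame_altA[OF F BX] that o(1,2)] i a'(2) by (simp add: upd_conv_take_nth_drop)
      show ?thesis
        unfolding v[OF z] v[OF b(1)] v[OF b(2)]
        by (rule HOL.ext) (simp only: m[OF z] m[OF b(1)] m[OF b(2)] tameD(4)[OF F o(3) BX b] scaleR_add_right scaleR_left_commute)
    next
      case False
      then show ?thesis by (auto simp: fromF_def weil_dom_def)
    qed }
  { fix \<beta>s Xs assume d: "\<not> distinct \<alpha>s"
    show "fromF p q F k \<alpha>s \<beta>s Xs = (\<lambda>x. 0)"
    proof (cases "\<beta>s \<in> tuples k SA \<and> Xs \<in> tuples (q - k) SX")
      case True
      then have BX: "set \<beta>s \<subseteq> SA" "set Xs \<subseteq> SX" by (auto simp: tuples_def)
      show ?thesis using altern_not_distinct[OF tame_altA[OF F BX] a'(1) d] True by (simp add: val fun_eq_iff)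
    next
      case False
      then show ?thesis by (auto simp: fromF_def weil_dom_def)
    qed }
next
  fix k \<alpha> \<alpha>s \<beta>s Xs f assume f: "f \<in> Cinf L" and D: "weil_dom L p q k (\<alpha> # \<alpha>s) \<beta>s Xs"
  then have dom: "\<alpha> \<in> SA" "set \<alpha>s \<subseteq> SA" "set \<beta>s \<subseteq> SA" "set Xs \<subseteq> SX" "length \<beta>s = k"
    by (auto simp: weil_dom_iff)
  have 1: "weil_dom L p q k ((\<lambda>x. f x *\<^sub>R \<alpha> x) # \<alpha>s) \<beta>s Xs"
    using D SA_scale[OF dom(1) f] by (simp add: weil_dom_iff)
  have 2: "dwedge f (fromF p q F (Suc k) \<alpha>s (\<alpha> # \<beta>s)) Xs x = asum Xs (\<lambda>X Ys. X x f *\<^sub>R F \<alpha>s (\<alpha> # \<beta>s) Ys x)" for x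
  proof -
    have "dwedge f (fromF p q F (Suc k) \<alpha>s (\<alpha> # \<beta>s)) Xs x = asum Xs (\<lambda>X Ys. X x f *\<^sub>R fromF p q F (Suc k) \<alpha>s (\<alpha> # \<beta>s) Ys x)"
      unfolding dwedge_def by (rule asum_eq_sum)
    also have "\<dots> = asum Xs (\<lambda>X Ys. X x f *\<^sub>R F \<alpha>s (\<alpha> # \<beta>s) Ys x)"
    proof (rule asum_cong[OF dom(4)])
      fix X Ys assume "set Ys \<subseteq> SX" "Suc (length Ys) = length Xs"
      then have "weil_dom L p q (Suc k) \<alpha>s (\<alpha> # \<beta>s) Ys" using D by (auto simp: weil_dom_iff)
      then show "X x f *\<^sub>R fromF p q F (Suc k) \<alpha>s (\<alpha> # \<beta>s) Ys x = X x f *\<^sub>R F \<alpha>s (\<alpha> # \<beta>s) Ys x"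
        by (simp add: fromF_def)
    qed
    finally show ?thesis .
  qed
  show "fromF p q F k ((\<lambda>x. f x *\<^sub>R \<alpha> x) # \<alpha>s) \<beta>s Xs =
      (\<lambda>x. f x *\<^sub>R fromF p q F k (\<alpha> # \<alpha>s) \<beta>s Xs x + dwedge f (fromF p q F (Suc k) \<alpha>s (\<alpha> # \<beta>s)) Xs x)"
    unfolding 2 using 1 D by (simp add: fromF_def fun_eq_iff leibD[OF l dom(1-4) f])
qed

subsection \<open>The operators on cochains\<close>

lemma weil_delta_fromF: "weil_delta L p q c = fromF (Suc p) q (Del (toF c))"
proof (intro HOL.ext)
  fix k \<alpha>s \<beta>s Xs x
  show "weil_delta L p q c k \<alpha>s \<beta>s Xs x = fromF (Suc p) q (Del (toF c)) k \<alpha>s \<beta>s Xs x"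
  proof (cases "weil_dom L (Suc p) q k \<alpha>s \<beta>s Xs")
    case True
    then have k: "length \<beta>s = k" by (simp add: weil_dom_iff)
    have lie: "lie_derivative L a (c k as) \<beta>s Xs x = lie a (toF c) as \<beta>s Xs x" for a as
    proof -
      have toF_k: "toF c as \<beta>s = c k as \<beta>s" unfolding toF_def k ..
      have "(\<Sum>i<length \<beta>s. c k as (\<beta>s[i := br a (\<beta>s ! i)]) Xs x) = dsum (br a) \<beta>s (\<lambda>bs. toF c as bs Xs x)"
        unfolding dsum_eq_sum[symmetric] toF_def by (simp add: k)
      moreover have "(\<Sum>j<length Xs. c k as \<beta>s (Xs[j := vf_bracket (ro a) (Xs ! j)]) x) = dsum (vf_bracket (ro a)) Xs (\<lambda>Ys. toF c as \<beta>s Ys x)"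
        unfolding dsum_eq_sum[symmetric] toF_k ..
      ultimately show ?thesis unfolding lie_derivative_def lie_def toF_k by simp
    qed
    have 1: "(\<Sum>i<length \<alpha>s. (-1) ^ i *\<^sub>R lie_derivative L (\<alpha>s ! i) (c k (omit i \<alpha>s)) \<beta>s Xs x) =
        asum \<alpha>s (\<lambda>a as. lie a (toF c) as \<beta>s Xs x)"
      unfolding lie by (rule asum_eq_sum[of "\<lambda>a as. lie a (toF c) as \<beta>s Xs x" \<alpha>s])
    have 2: "(\<Sum>j<length \<alpha>s. \<Sum>i<j. (-1) ^ (i + j) *\<^sub>R
                c k (br (\<alpha>s ! i) (\<alpha>s ! j) # omit i (omit j \<alpha>s)) \<beta>s Xs x) =
        bsum \<alpha>s (\<lambda>a b cs. toF c (br a b # cs) \<beta>s Xs x)"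
      using bsum_eq_sum[of "\<lambda>a b cs. toF c (br a b # cs) \<beta>s Xs x" \<alpha>s] by (simp add: toF_def k)
    have 3: "(\<Sum>j<k. c (k - 1) \<alpha>s (omit j \<beta>s) (ro (\<beta>s ! j) # Xs) x) = xsum \<beta>s (\<lambda>b bs. toF c \<alpha>s bs (ro b # Xs) x)"
    proof -
      have "c (k - 1) \<alpha>s (omit j \<beta>s) (ro (\<beta>s ! j) # Xs) x = toF c \<alpha>s (omit j \<beta>s) (ro (\<beta>s ! j) # Xs) x" if "j < k" for j
        using length_omit[of j \<beta>s] that k by (auto simp: toF_def)
      then show ?thesis unfolding xsum_eq_sum[symmetric] k by (intro sum.cong) auto
    qed
    show ?thesis
      unfolding weil_delta_def if_P[OF True] 1 2 3 fromF_def Del_def Del0_def DelR_def k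
      by (simp only: if_P[OF True] diff_conv_add_uminus scaleR_add_right scaleR_minus_right)
  next
    case False
    then show ?thesis by (simp add: weil_delta_def fromF_def)
  qed
qed

lemma weil_dnabla_fromF: "weil_dnabla L \<theta> p q c = fromF p (Suc q) (Dn (toF c))"
proof (intro HOL.ext)
  fix k \<alpha>s \<beta>s Xs x
  show "weil_dnabla L \<theta> p q c k \<alpha>s \<beta>s Xs x = fromF p (Suc q) (Dn (toF c)) k \<alpha>s \<beta>s Xs x"
  proof (cases "weil_dom L p (Suc q) k \<alpha>s \<beta>s Xs")
    case True
    then have k: "length \<beta>s = k" by (simp add: weil_dom_iff)
    have toF_k: "toF c as \<beta>s = c k as \<beta>s" for as unfolding toF_def k ..
    have 1: "ext_cov \<theta> (c k \<alpha>s \<beta>s) Xs x = ext (toF c \<alpha>s \<beta>s) Xs x"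
      unfolding ext_cov_def ext_def conn_def toF_k
      using asum_eq_sum[of "\<lambda>X Ys. C (c k \<alpha>s \<beta>s Ys) X x" Xs]
        bsum_eq_sum[of "\<lambda>X Y Ys. c k \<alpha>s \<beta>s (vf_bracket X Y # Ys) x" Xs] by simp
    have 3: "(\<Sum>j<k. c (k - 1) (\<beta>s ! j # \<alpha>s) (omit j \<beta>s) Xs x) = xsum \<beta>s (\<lambda>b bs. toF c (b # \<alpha>s) bs Xs x)"
    proof -
      have "c (k - 1) (\<beta>s ! j # \<alpha>s) (omit j \<beta>s) Xs x = toF c (\<beta>s ! j # \<alpha>s) (omit j \<beta>s) Xs x" if "j < k" for j
        using length_omit[of j \<beta>s] that k by (auto simp: toF_def)
      then show ?thesis unfolding xsum_eq_sum[symmetric] k by (intro sum.cong) auto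
    qed
    show ?thesis
      unfolding weil_dnabla_def if_P[OF True] 1 3 fromF_def Dn_def Dn1_def Dn2_def k
      by (simp only: if_P[OF True] diff_conv_add_uminus scaleR_add_right scaleR_minus_right)
  next
    case False
    then show ?thesis by (simp add: weil_dnabla_def fromF_def)
  qed
qed

lemma Upow_asumn:
  "(U ^^ l) F \<alpha>s \<beta>s Xs x = asumn l \<alpha>s (\<lambda>as ar. ins C as (\<lambda>bs Ys. F ar bs Ys x) \<beta>s Xs)"
proof (induction l arbitrary: \<alpha>s \<beta>s Xs)
  case (Suc l)
  have "(U ^^ Suc l) F \<alpha>s \<beta>s Xs x = asum \<alpha>s (\<lambda>a as. asum Xs (\<lambda>X Ys. (U ^^ l) F as (C a X # \<beta>s) Ys x))"
    by (simp add: U_def[of "(U ^^ l) F"])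
  also have "\<dots> = asum \<alpha>s (\<lambda>a as. asumn l as (\<lambda>cs ar. asum Xs (\<lambda>X Ys. ins C cs (\<lambda>bs Ys. F ar bs Ys x) (C a X # \<beta>s) Ys)))"
    unfolding Suc asumn_asum_fubini ..
  also have "\<dots> = asumn (Suc l) \<alpha>s (\<lambda>as ar. ins C as (\<lambda>bs Ys. F ar bs Ys x) \<beta>s Xs)" by simp
  finally show ?case .
qed simp

text \<open>
  The last hypothesis covers the case of fewer vector fields than one-forms, in which \<open>dot_wedge\<close>
  is given by a truncated subtraction.
\<close>

lemma dot_wedge_eq_ins:
  assumes sym: "\<And>Xs. set Xs \<subseteq> SX \<Longrightarrow> symm SA (\<lambda>bs. F bs Xs)"
    and alt: "\<And>bs. set bs \<subseteq> SA \<Longrightarrow> altern SX (\<lambda>Xs. F bs Xs)"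
    and dom: "set as \<subseteq> SA" "set bs \<subseteq> SA" "set Xs \<subseteq> SX"
    and \<gamma>: "\<And>ds Ys. length ds = length as \<Longrightarrow> \<gamma> ds Ys x = F (bs @ ds) Ys"
    and off: "length Xs < length as \<Longrightarrow> (\<And>ds Ys. \<gamma> ds Ys x = 0)"
  shows "dot_wedge \<gamma> (map C as) Xs x = ins C as F bs Xs"
proof (cases "length as \<le> length Xs")
  case True
  have e: "\<gamma> (map (\<lambda>i. (map C as ! i) (Xs ! \<sigma> i)) [0..<length as]) (map (\<lambda>i. Xs ! \<sigma> i) [length as..<length Xs]) x =
      F (bs @ map2 C as (map (\<lambda>i. Xs ! \<sigma> i) [0..<length Xs])) (drop (length as) (map (\<lambda>i. Xs ! \<sigma> i) [0..<length Xs]))" for \<sigma>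
  proof -
    have "map (\<lambda>i. (map C as ! i) (Xs ! \<sigma> i)) [0..<length as] = map2 C as (map (\<lambda>i. Xs ! \<sigma> i) [0..<length Xs])"
      using True by (intro nth_equalityI) auto
    then show ?thesis using True by (subst \<gamma>) (simp_all add: drop_map)
  qed
  have "dot_wedge \<gamma> (map C as) Xs x = (1 / fact (length Xs - length as)) *\<^sub>R
      psum Xs (\<lambda>Zs. F (bs @ map2 C as Zs) (drop (length as) Zs))"
    unfolding dot_wedge_def Let_def length_map e psum_def ..
  also have "\<dots> = ins C as F bs Xs"
    by (subst psum_eq_ins[where SX = SX and SB = SA and SA = SA]) (use sym alt dom True in \<open>simp_all add: C_SA\<close>)
  finally show ?thesis .
next
  case False
  then show ?thesis using off ins_vanish[of Xs as C F bs] by (simp add: dot_wedge_def Let_def)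
qed

text \<open>
  The products with one-forms become insertions by \<open>dot_wedge_eq_ins\<close>.  These alternate in the
  one-forms, so that the sum over shuffles becomes an iterated extraction by \<open>ssum_eq_asumn\<close>, that
  is, a power of \<open>U\<close>.
\<close>

lemma hor_proj_fromF:
  assumes sym: "\<And>\<alpha>s Xs x. set \<alpha>s \<subseteq> SA \<Longrightarrow> set Xs \<subseteq> SX \<Longrightarrow> symm SA (\<lambda>\<beta>s. toF c \<alpha>s \<beta>s Xs x)"
    and altX: "\<And>\<alpha>s \<beta>s x. set \<alpha>s \<subseteq> SA \<Longrightarrow> set \<beta>s \<subseteq> SA \<Longrightarrow> altern SX (\<lambda>Xs. toF c \<alpha>s \<beta>s Xs x)"
    and off: "\<And>k \<alpha>s \<beta>s Xs. q < k \<Longrightarrow> c k \<alpha>s \<beta>s Xs = (\<lambda>x. 0)"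
  shows "hor_proj L \<theta> p q c = fromF p q (H (toF c))"
proof (intro HOL.ext)
  fix k \<alpha>s \<beta>s Xs x
  show "hor_proj L \<theta> p q c k \<alpha>s \<beta>s Xs x = fromF p q (H (toF c)) k \<alpha>s \<beta>s Xs x"
  proof (cases "weil_dom L p q k \<alpha>s \<beta>s Xs")
    case True
    then have len: "length \<beta>s = k" "length \<alpha>s + k = p" "k + length Xs = q"
      and dom: "set \<alpha>s \<subseteq> SA" "set \<beta>s \<subseteq> SA" "set Xs \<subseteq> SX" by (auto simp: weil_dom_iff)
    let ?n = "length \<alpha>s"
    define G where "G l as ar = dot_wedge (\<lambda>\<gamma>s. c (k + l) ar (map h \<beta>s @ \<gamma>s)) (map C as) Xs x" for l as ar
    define I where "I as ar = ins C as (\<lambda>bs Ys. toF c ar bs Ys x) (map h \<beta>s) Xs" for as ar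
    have GI: "G l as ar = I as ar" if "length as = l" "set as \<subseteq> SA" "set ar \<subseteq> SA" for l as ar
      unfolding G_def I_def
    proof (rule dot_wedge_eq_ins[OF sym[OF that(3)] altX[OF that(3)] that(2) h_set[OF dom(2)] dom(3)])
      show "c (k + l) ar (map h \<beta>s @ ds) Ys x = toF c ar (map h \<beta>s @ ds) Ys x" if "length ds = length as" for ds Ys
        using that \<open>length as = l\<close> len(1) by (simp add: toF_def)
      show "c (k + l) ar (map h \<beta>s @ ds) Ys x = 0" if "length Xs < length as" for ds Ys
        using off[of "k + l"] that len \<open>length as = l\<close> by simp
    qed
    \<comment> \<open>Reindexing by the number \<open>l = j - k\<close> of one-forms makes the range depend on \<open>\<alpha>s\<close> only.\<close>
    have "hor_proj L \<theta> p q c k \<alpha>s \<beta>s Xs x = (\<Sum>j=k..p. (-1) ^ (j - k) *\<^sub>R ssum (j - k) (p - j) \<alpha>s (G (j - k)))"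
      unfolding hor_proj_def ssum_def G_def using True by (auto simp: o_def intro!: sum.cong)
    also have "\<dots> = (\<Sum>l<Suc ?n. (-1) ^ l *\<^sub>R ssum l (?n - l) \<alpha>s (G l))"
      using len by (intro sum.reindex_bij_witness[where i = "\<lambda>l. k + l" and j = "\<lambda>j. j - k"]) auto
    also have "\<dots> = (\<Sum>l<Suc ?n. ((-1) ^ l / fact l) *\<^sub>R (U ^^ l) (toF c) \<alpha>s (map h \<beta>s) Xs x)"
    proof (rule sum.cong[OF refl])
      fix l assume "l \<in> {..<Suc ?n}"
      then have l: "?n = l + (?n - l)" by simp
      have "ssum l (?n - l) \<alpha>s (G l) = ssum l (?n - l) \<alpha>s I"
        unfolding ssum_def
      proof (rule sum.cong[OF refl])
        fix \<sigma> assume "\<sigma> \<in> shuffle_perms l (?n - l)"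
        then have \<sigma>: "\<sigma> permutes {..<?n}" using l by (auto simp: shuffle_perms_def)
        have "\<alpha>s ! \<sigma> i \<in> SA" if "i < ?n" for i
          using permutes_in_image[OF \<sigma>, of i] that dom(1) by (auto simp: subset_iff)
        then show "of_int (sign \<sigma>) *\<^sub>R G l (map (\<lambda>i. \<alpha>s ! \<sigma> i) [0..<l]) (map (\<lambda>i. \<alpha>s ! \<sigma> i) [l..<l + (?n - l)]) =
            of_int (sign \<sigma>) *\<^sub>R I (map (\<lambda>i. \<alpha>s ! \<sigma> i) [0..<l]) (map (\<lambda>i. \<alpha>s ! \<sigma> i) [l..<l + (?n - l)])"
          using l by (subst GI) auto
      qed
      also have "\<dots> = (1 / fact l) *\<^sub>R asumn l \<alpha>s I"
      proof (rule ssum_eq_asumn[OF _ dom(1) l])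
        show "altern SA (\<lambda>as. I as ar)" if "set ar \<subseteq> SA" for ar
          unfolding I_def
          by (rule altern_ins[where SX = SX and SB = SA]) (use sym[OF that] dom h_set[OF dom(2)] in \<open>simp_all add: C_SA\<close>)
      qed
      also have "asumn l \<alpha>s I = (U ^^ l) (toF c) \<alpha>s (map h \<beta>s) Xs x"
        unfolding Upow_asumn I_def ..
      finally show "(-1) ^ l *\<^sub>R ssum l (?n - l) \<alpha>s (G l) = ((-1) ^ l / fact l) *\<^sub>R (U ^^ l) (toF c) \<alpha>s (map h \<beta>s) Xs x"
        by simp
    qed
    also have "\<dots> = fromF p q (H (toF c)) k \<alpha>s \<beta>s Xs x"
      using True by (simp add: fromF_def H_def expU_def)
    finally show ?thesis .
  next
    case False
    then show ?thesis by (simp add: hor_proj_def fromF_def)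
  qed
qed

text \<open>
  Agreement in bidegree \<open>(p, q)\<close>, the relation up to which \<open>toF\<close> inverts \<open>fromF p q\<close>.
\<close>

definition eqG :: "nat \<Rightarrow> nat \<Rightarrow> ('m, 'a) cfun \<Rightarrow> ('m, 'a) cfun \<Rightarrow> bool" where
  "eqG p q F G \<longleftrightarrow> (\<forall>\<alpha>s \<beta>s Xs. set \<alpha>s \<subseteq> SA \<longrightarrow> set \<beta>s \<subseteq> SA \<longrightarrow> set Xs \<subseteq> SX \<longrightarrow>
     length \<alpha>s + length \<beta>s = p \<longrightarrow> length \<beta>s + length Xs = q \<longrightarrow> F \<alpha>s \<beta>s Xs = G \<alpha>s \<beta>s Xs)"

lemma eqGD: "eqG p q F G \<Longrightarrow> set \<alpha>s \<subseteq> SA \<Longrightarrow> set \<beta>s \<subseteq> SA \<Longrightarrow> set Xs \<subseteq> SX \<Longrightarrow>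
     length \<alpha>s + length \<beta>s = p \<Longrightarrow> length \<beta>s + length Xs = q \<Longrightarrow> F \<alpha>s \<beta>s Xs = G \<alpha>s \<beta>s Xs"
  by (simp add: eqG_def)

lemma eqG_toF_fromF: "eqG p q (toF (fromF p q F)) F"
  by (auto simp: eqG_def toF_def fromF_def weil_dom_iff)

lemma fromF_eqG: "eqG p q F G \<Longrightarrow> fromF p q F = fromF p q G"
  by (rule fromF_cong) (rule eqGD)

lemma eqG_U:
  assumes "eqG p q F G"
  shows "eqG p q (U F) (U G)"
  unfolding eqG_def
proof (intro allI impI HOL.ext)
  fix \<alpha>s \<beta>s Xs x
  assume dom: "set \<alpha>s \<subseteq> SA" "set \<beta>s \<subseteq> SA" "set Xs \<subseteq> SX" "length \<alpha>s + length \<beta>s = p" "length \<beta>s + length Xs = q"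
  show "U F \<alpha>s \<beta>s Xs x = U G \<alpha>s \<beta>s Xs x"
    unfolding U_def
    by (intro asum_cong[OF dom(1)] asum_cong[OF dom(3)] fun_cong[OF eqGD[OF assms]])
      (use dom in \<open>simp_all add: C_SA\<close>)
qed

lemma eqG_H:
  assumes "eqG p q F G"
  shows "eqG p q (H F) (H G)"
proof -
  have n: "eqG p q ((U ^^ n) F) ((U ^^ n) G)" for n
    using assms by (induction n) (simp_all add: eqG_U)
  show ?thesis unfolding eqG_def
  proof (intro allI impI HOL.ext)
    fix \<alpha>s \<beta>s Xs x
    assume dom: "set \<alpha>s \<subseteq> SA" "set \<beta>s \<subseteq> SA" "set Xs \<subseteq> SX" "length \<alpha>s + length \<beta>s = p" "length \<beta>s + length Xs = q"
    have "(U ^^ n) F \<alpha>s (map h \<beta>s) Xs x = (U ^^ n) G \<alpha>s (map h \<beta>s) Xs x" for n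
      by (rule fun_cong[OF eqGD[OF n dom(1) h_set[OF dom(2)] dom(3)]]) (simp_all add: dom)
    then show "H F \<alpha>s \<beta>s Xs x = H G \<alpha>s \<beta>s Xs x" unfolding H_def expU_def by simp
  qed
qed

lemma eqG_Del:
  assumes "eqG p q F G"
  shows "eqG (Suc p) q (Del F) (Del G)"
  unfolding eqG_def
proof (intro allI impI HOL.ext)
  fix \<alpha>s \<beta>s Xs x
  assume dom: "set \<alpha>s \<subseteq> SA" "set \<beta>s \<subseteq> SA" "set Xs \<subseteq> SX"
    and g: "length \<alpha>s + length \<beta>s = Suc p" "length \<beta>s + length Xs = q"
  show "Del F \<alpha>s \<beta>s Xs x = Del G \<alpha>s \<beta>s Xs x"
    by (rule Del_cong[OF dom], rule eqGD[OF assms]) (use g in simp_all)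
qed

lemma eqG_Dn:
  assumes "eqG p q F G"
  shows "eqG p (Suc q) (Dn F) (Dn G)"
  unfolding eqG_def
proof (intro allI impI HOL.ext)
  fix \<alpha>s \<beta>s Xs x
  assume dom: "set \<alpha>s \<subseteq> SA" "set \<beta>s \<subseteq> SA" "set Xs \<subseteq> SX"
    and g: "length \<alpha>s + length \<beta>s = p" "length \<beta>s + length Xs = Suc q"
  have "asum Xs (\<lambda>X Ys. C (F \<alpha>s \<beta>s Ys) X x) = asum Xs (\<lambda>X Ys. C (G \<alpha>s \<beta>s Ys) X x)"
  proof (rule asum_cong[OF dom(3)])
    fix X Ys assume "set Ys \<subseteq> SX" "Suc (length Ys) = length Xs"
    then have "F \<alpha>s \<beta>s Ys = G \<alpha>s \<beta>s Ys" using g by (intro eqGD[OF assms dom(1,2)]) auto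
    then show "C (F \<alpha>s \<beta>s Ys) X x = C (G \<alpha>s \<beta>s Ys) X x" by simp
  qed
  moreover have "bsum Xs (\<lambda>X Y Ys. F \<alpha>s \<beta>s (vf_bracket X Y # Ys) x) = bsum Xs (\<lambda>X Y Ys. G \<alpha>s \<beta>s (vf_bracket X Y # Ys) x)"
    by (rule bsum_cong[OF dom(3)], rule fun_cong[OF eqGD[OF assms dom(1,2)]])
      (use g in \<open>simp_all add: SX_bracket\<close>)
  moreover have "xsum \<beta>s (\<lambda>b bs. F (b # \<alpha>s) bs Xs x) = xsum \<beta>s (\<lambda>b bs. G (b # \<alpha>s) bs Xs x)"
    by (rule xsum_cong[OF dom(2)], rule fun_cong[OF eqGD[OF assms _ _ dom(3)]])
      (use g dom in simp_all)
  ultimately show "Dn F \<alpha>s \<beta>s Xs x = Dn G \<alpha>s \<beta>s Xs x"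
    unfolding Dn_def Dn1_def Dn2_def ext_def by simp
qed

subsection \<open>The horizontal exterior covariant derivative\<close>

lemma hor_proj_fromF_skew:
  assumes sym: "\<And>\<alpha>s Xs x. set \<alpha>s \<subseteq> SA \<Longrightarrow> set Xs \<subseteq> SX \<Longrightarrow> symm SA (\<lambda>\<beta>s. F \<alpha>s \<beta>s Xs x)"
    and altX: "\<And>\<alpha>s \<beta>s x. set \<alpha>s \<subseteq> SA \<Longrightarrow> set \<beta>s \<subseteq> SA \<Longrightarrow> altern SX (\<lambda>Xs. F \<alpha>s \<beta>s Xs x)"
  shows "hor_proj L \<theta> p q (fromF p q F) = fromF p q (H F)"
proof -
  have "hor_proj L \<theta> p q (fromF p q F) = fromF p q (H (toF (fromF p q F)))"
  proof (rule hor_proj_fromF)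
    fix \<alpha>s Xs x assume dom: "set \<alpha>s \<subseteq> SA" "set Xs \<subseteq> SX"
    show "symm SA (\<lambda>\<beta>s. toF (fromF p q F) \<alpha>s \<beta>s Xs x)"
    proof (rule symmI)
      fix ps qs a b assume *: "a \<in> SA" "b \<in> SA" "set ps \<subseteq> SA" "set qs \<subseteq> SA"
      show "toF (fromF p q F) \<alpha>s (ps @ a # b # qs) Xs x = toF (fromF p q F) \<alpha>s (ps @ b # a # qs) Xs x"
        using symm_swap[OF sym[OF dom] *, of x] * by (simp add: toF_def fromF_def weil_dom_iff)
    qed
  next
    fix \<alpha>s \<beta>s x assume dom: "set \<alpha>s \<subseteq> SA" "set \<beta>s \<subseteq> SA"
    show "altern SX (\<lambda>Xs. toF (fromF p q F) \<alpha>s \<beta>s Xs x)"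
    proof (rule alternI)
      fix ps qs a b assume *: "a \<in> SX" "b \<in> SX" "set ps \<subseteq> SX" "set qs \<subseteq> SX"
      show "toF (fromF p q F) \<alpha>s \<beta>s (ps @ a # b # qs) x = - toF (fromF p q F) \<alpha>s \<beta>s (ps @ b # a # qs) x"
        using altern_swap[OF altX[OF dom] *, of x] * by (simp add: toF_def fromF_def weil_dom_iff)
    qed
  next
    fix k \<alpha>s \<beta>s Xs assume "q < k"
    then show "fromF p q F k \<alpha>s \<beta>s Xs = (\<lambda>x. 0)" by (auto simp: fromF_def weil_dom_iff)
  qed
  then show ?thesis using fromF_eqG[OF eqG_H[OF eqG_toF_fromF]] by simp
qed

lemma hor_ext_cov_fromF:
  assumes "skew (toF c)"
  shows "hor_ext_cov L \<theta> p q c = fromF p (Suc q) (H (Dn (toF c)))"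
  unfolding hor_ext_cov_def weil_dnabla_fromF
  by (rule hor_proj_fromF_skew[OF Dn_symB[OF assms] Dn_altX[OF assms]])

lemma H_Del_Dn:
  assumes F: "tame F" and D: "tame (Dn F)" and dom: "set \<alpha>s \<subseteq> SA" "set \<beta>s \<subseteq> SA" "set Xs \<subseteq> SX"
  shows "Del (H (Dn F)) \<alpha>s \<beta>s Xs x = H (Dn (Del F)) \<alpha>s \<beta>s Xs x"
proof -
  define K where "K = (\<lambda>\<alpha>s \<beta>s Xs x. Kv F \<alpha>s \<beta>s Xs x + Kc F \<alpha>s \<beta>s Xs x)"
  have "eqG p q (Dn (Del F)) (\<lambda>\<alpha>s \<beta>s Xs x. Del (Dn F) \<alpha>s \<beta>s Xs x + K \<alpha>s \<beta>s Xs x)" for p q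
    unfolding eqG_def K_def by (auto intro!: HOL.ext simp: Del_Dn[OF F])
  then have "H (Dn (Del F)) \<alpha>s \<beta>s Xs = H (\<lambda>\<alpha>s \<beta>s Xs x. Del (Dn F) \<alpha>s \<beta>s Xs x + K \<alpha>s \<beta>s Xs x) \<alpha>s \<beta>s Xs"
    by (intro eqGD[OF eqG_H dom refl refl])
  from fun_cong[OF this] have "H (Dn (Del F)) \<alpha>s \<beta>s Xs x = H (Del (Dn F)) \<alpha>s \<beta>s Xs x + H K \<alpha>s \<beta>s Xs x"
    unfolding H_def expU_def Upow_add by (simp add: scaleR_add_right sum.distrib)
  also have "H K \<alpha>s \<beta>s Xs x = 0" unfolding K_def by (rule H_K[OF F dom])
  finally show ?thesis using H_Del[OF D dom, of x] by simp
qed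

text \<open>
  The identity for functions of lists is transported along \<open>toF\<close> and \<open>fromF\<close>; at each step the
  composite \<open>toF \<circ> fromF\<close> is removed by the congruence of the operators in the given bidegree.
\<close>

theorem hor_ext_cov_cochain_map:
  assumes c: "c \<in> weil_cochains L \<kk> p q"
  shows "hor_ext_cov L \<theta> p q c \<in> weil_cochains L \<kk> p (Suc q)"
    and "weil_delta L p (Suc q) (hor_ext_cov L \<theta> p q c) = hor_ext_cov L \<theta> (Suc p) q (weil_delta L p q c)"
proof -
  note F = tame_toF[OF c] and l = leib_toF[OF c]
  note D = tame_Dn[OF F l] and lD = leib_Dn[OF F l]
  have 1: "hor_ext_cov L \<theta> p q c = fromF p (Suc q) (H (Dn (toF c)))"
    by (rule hor_ext_cov_fromF[OF tame_skew[OF F]])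
  show "hor_ext_cov L \<theta> p q c \<in> weil_cochains L \<kk> p (Suc q)"
    unfolding 1 by (rule fromF_weil[OF tame_H[OF D] leib_H[OF D lD]])
  have 2: "weil_delta L p (Suc q) (hor_ext_cov L \<theta> p q c) = fromF (Suc p) (Suc q) (Del (H (Dn (toF c))))"
    unfolding 1 weil_delta_fromF by (rule fromF_eqG[OF eqG_Del[OF eqG_toF_fromF]])
  have "weil_dnabla L \<theta> (Suc p) q (weil_delta L p q c) = fromF (Suc p) (Suc q) (Dn (Del (toF c)))"
    unfolding weil_dnabla_fromF weil_delta_fromF by (rule fromF_eqG[OF eqG_Dn[OF eqG_toF_fromF]])
  then have "hor_ext_cov L \<theta> (Suc p) q (weil_delta L p q c) = fromF (Suc p) (Suc q) (H (Dn (Del (toF c))))"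
    unfolding hor_ext_cov_def
    by (simp only:) (rule hor_proj_fromF_skew[OF Dn_symB[OF skew_Del[OF F]] Dn_altX[OF skew_Del[OF F]]])
  then show "weil_delta L p (Suc q) (hor_ext_cov L \<theta> p q c) = hor_ext_cov L \<theta> (Suc p) q (weil_delta L p q c)"
    unfolding 2 by (simp only:) (rule fromF_cong, rule HOL.ext, rule H_Del_Dn[OF F D])
qed

lemma hor_ext_cov_zero: "hor_ext_cov L \<theta> p q (\<lambda>k \<alpha>s \<beta>s Xs x. 0) = (\<lambda>k \<alpha>s \<beta>s Xs x. 0)"
proof -
  have "C (\<lambda>x. 0) X x = 0" for X x using fun_cong[OF linon_zero[OF linon_C subsp_SA], of X x] .
  then have "weil_dnabla L \<theta> p q (\<lambda>k \<alpha>s \<beta>s Xs x. 0) = (\<lambda>k \<alpha>s \<beta>s Xs x. 0)"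
    by (intro HOL.ext) (simp add: weil_dnabla_def ext_cov_def conn_def)
  then show ?thesis
    unfolding hor_ext_cov_def by (intro HOL.ext) (simp add: hor_proj_def dot_wedge_def Let_def)
qed

lemma hor_ext_cov_im_forms:
  assumes "c \<in> im_forms L \<kk> q"
  shows "hor_ext_cov L \<theta> 1 q c \<in> im_forms L \<kk> (Suc q)"
proof -
  have c: "c \<in> weil_cochains L \<kk> 1 q" "weil_delta L 1 q c = (\<lambda>k \<alpha>s \<beta>s Xs x. 0)"
    using assms by (simp_all add: im_forms_def)
  show ?thesis
    using hor_ext_cov_cochain_map[OF c(1)] unfolding c(2) hor_ext_cov_zero by (simp add: im_forms_def)
qed

end

theorem theorem8:
  fixes L :: "('m::{t2_space,second_countable_topology}, 'e::real_normed_vector, 'a::real_vector) algebroid"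
    and \<kk> :: "'m \<Rightarrow> 'a set"
    and \<theta> :: "('m, 'a) cochain"
  assumes "bundle_of_ideals L \<kk>"
    and "\<theta> \<in> im_connections L \<kk>"
  shows "(\<forall>p q. \<forall>c \<in> weil_cochains L \<kk> p q.
            hor_ext_cov L \<theta> p q c \<in> weil_cochains L \<kk> p (q + 1) \<and>
            weil_delta L p (q + 1) (hor_ext_cov L \<theta> p q c) =
              hor_ext_cov L \<theta> (p + 1) q (weil_delta L p q c)) \<and>
         (\<forall>q. \<forall>c \<in> im_forms L \<kk> q. hor_ext_cov L \<theta> 1 q c \<in> im_forms L \<kk> (q + 1))"
proof -
  interpret im_connection L \<kk> \<theta>
    using assms by (simp add: im_connection_def im_connection_axioms_def)
  show ?thesis
    using hor_ext_cov_cochain_map hor_ext_cov_im_forms by simp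
qed

end
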